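(* Let $p\in(2,6)$, $q\in(2,4)$ and $q\neq\frac{p}{2}+1$. Then there exists a critical mass $\mu_{p,q}>0$ such that (i) if $q<\frac{p}{2}+1$, then ground states of $F_{p,q}$ at mass $\mu$ exist if and only if $\mu\le\mu_{p,q}$; (ii) if $q>\frac{p}{2}+1$, then ground states of $F_{p,q}$ at mass $\mu$ exist if and only if $\mu\ge\mu_{p,q}$. Furthermore, whenever they exist, ground states at prescribed mass are unique and they are radial and decreasing on $S_N$, in the sense that their restriction to each half-line of the graph corresponds to the same decreasing function on $\mathbb{R}^+$.
   Context: $S_N$ is the star graph made of $N$ half-lines $\mathcal{H}_1,\dots,\mathcal{H}_N$, each with a coordinate $x_i\in[0,+\infty)$, glued together at their common origin (the vertex), denoted by $0$. A function $u$ on $S_N$ is the collection $(u_i)_{i=1}^N$ of its restrictions to the half-lines $\mathcal{H}_i\cong[0,+\infty)$; integrals on $S_N$ are sums of the integrals over the half-lines, and $\|u\|_{L^p(S_N)}^p=\sum_{i=1}^N\|u_i\|_{L^p(\mathcal{H}_i)}^p$. $H^1(S_N)$ is the space of functions $u$ that are continuous on $S_N$ (in particular at the vertex, where the common value is denoted $u(0)$) and such that $u_i\in H^1(\mathcal{H}_i)$ for every $i$. For $\mu>0$, $H^1_\mu(S_N)=\{u\in H^1(S_N):\|u\|_{L^2(S_N)}^2=\mu\}$. The energy is $$F_{p,q}(u)=\frac12\int_{S_N}|u'|^2\,dx-\frac1p\int_{S_N}|u|^p\,dx-\frac1q|u(0)|^q .$$ A ground state of $F_{p,q}$ at mass $\mu$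 is a function $u\in H^1_\mu(S_N)$ with $F_{p,q}(u)=\inf_{v\in H^1_\mu(S_N)}F_{p,q}(v)$.
   Formalization: Proved for N ≥ 3 half-lines and real-valued functions: for N = 1, 2 ground states exist at every mass, so no critical mass exists. Since u and -u have equal mass and energy, uniqueness and "radial and decreasing" are stated up to a global sign. *)

theory Defs
  imports "HOL-Analysis.Analysis"
begin

text \<open>
  A function \<open>u\<close> on the star graph with \<open>N\<close> half-lines is represented by
  \<open>u :: nat \<Rightarrow> real \<Rightarrow> real\<close>, where \<open>u i x\<close> is the value at the point \<open>x \<ge> 0\<close> of the half-line
  number \<open>i < N\<close>. The values at \<open>i \<ge> N\<close> or \<open>x < 0\<close> are irrelevant and are ignored everywhere.
  Functions are real-valued.
\<close>

definition L2_halfline :: "(real \<Rightarrow> real) \<Rightarrow> bool" where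
  "L2_halfline f \<longleftrightarrow> set_borel_measurable lborel {0..} f \<and>
     set_integrable lborel {0..} (\<lambda>x. (f x)\<^sup>2)"

text \<open>
  \<open>C\<^sup>1\<close> functions with compact support in the open half-line, the usual test functions for
  Sobolev spaces on an interval.
\<close>

definition test_function :: "(real \<Rightarrow> real) \<Rightarrow> bool" where
  "test_function \<phi> \<longleftrightarrow> \<phi> C1_differentiable_on UNIV \<and>
     (\<exists>a b. 0 < a \<and> a \<le> b \<and> (\<forall>x. x \<notin> {a..b} \<longrightarrow> \<phi> x = 0))"

definition is_weak_deriv :: "(real \<Rightarrow> real) \<Rightarrow> (real \<Rightarrow> real) \<Rightarrow> bool" where
  "is_weak_deriv f g \<longleftrightarrow> (\<forall>\<phi>. test_function \<phi> \<longrightarrow>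
     (LINT x:{0..}|lborel. f x * deriv \<phi> x) = - (LINT x:{0..}|lborel. g x * \<phi> x))"

definition H1_halfline :: "(real \<Rightarrow> real) \<Rightarrow> bool" where
  "H1_halfline f \<longleftrightarrow> L2_halfline f \<and> (\<exists>g. L2_halfline g \<and> is_weak_deriv f g)"

text \<open>
  Some representative of the weak derivative, which is determined up to a null set; only used
  for \<open>f\<close> satisfying \<^const>\<open>H1_halfline\<close> and under integrals.
\<close>

definition weak_deriv :: "(real \<Rightarrow> real) \<Rightarrow> real \<Rightarrow> real" where
  "weak_deriv f = (SOME g. L2_halfline g \<and> is_weak_deriv f g)"

definition star_continuous :: "nat \<Rightarrow> (nat \<Rightarrow> real \<Rightarrow> real) \<Rightarrow> bool" where
  "star_continuous N u \<longleftrightarrow> (\<forall>i<N. continuous_on {0..} (u i)) \<and> (\<forall>i<N. \<forall>j<N. u i 0 = u j 0)"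

definition star_integral :: "nat \<Rightarrow> (nat \<Rightarrow> real \<Rightarrow> real) \<Rightarrow> real" where
  "star_integral N u = (\<Sum>i<N. LINT x:{0..}|lborel. u i x)"

definition H1_star :: "nat \<Rightarrow> (nat \<Rightarrow> real \<Rightarrow> real) set" where
  "H1_star N = {u. star_continuous N u \<and> (\<forall>i<N. H1_halfline (u i))}"

definition H1_star_mass :: "nat \<Rightarrow> real \<Rightarrow> (nat \<Rightarrow> real \<Rightarrow> real) set" where
  "H1_star_mass N \<mu> = {u \<in> H1_star N. star_integral N (\<lambda>i x. (u i x)\<^sup>2) = \<mu>}"

text \<open>For \<open>N \<ge> 1\<close> and \<open>u\<close> in \<^term>\<open>H1_star N\<close>, the value at the vertex is \<open>u 0 0\<close>.\<close>

definition energy :: "nat \<Rightarrow> real \<Rightarrow> real \<Rightarrow> (nat \<Rightarrow> real \<Rightarrow> real) \<Rightarrow> real" where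
  "energy N p q u =
     1 / 2 * star_integral N (\<lambda>i x. (weak_deriv (u i) x)\<^sup>2)
     - 1 / p * star_integral N (\<lambda>i x. \<bar>u i x\<bar> powr p)
     - 1 / q * \<bar>u 0 0\<bar> powr q"

text \<open>The infimum is taken in the extended reals, so it is the true one in all cases.\<close>

definition ground_state ::
  "nat \<Rightarrow> real \<Rightarrow> real \<Rightarrow> real \<Rightarrow> (nat \<Rightarrow> real \<Rightarrow> real) \<Rightarrow> bool" where
  "ground_state N p q \<mu> u \<longleftrightarrow> u \<in> H1_star_mass N \<mu> \<and>
     ereal (energy N p q u) = (INF v\<in>H1_star_mass N \<mu>. ereal (energy N p q v))"

definition radial_decreasing :: "nat \<Rightarrow> (nat \<Rightarrow> real \<Rightarrow> real) \<Rightarrow> bool" where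
  "radial_decreasing N u \<longleftrightarrow>
     (\<exists>\<phi>. (\<forall>x y. 0 \<le> x \<longrightarrow> x < y \<longrightarrow> \<phi> y < \<phi> x) \<and> (\<forall>i<N. \<forall>x\<ge>0. u i x = \<phi> x))"

text \<open>
  The energy and the mass are invariant under \<open>u \<mapsto> - u\<close>, so uniqueness and
  monotonicity of ground states can only hold up to a global sign.
\<close>

definition eq_up_to_sign :: "nat \<Rightarrow> (nat \<Rightarrow> real \<Rightarrow> real) \<Rightarrow> (nat \<Rightarrow> real \<Rightarrow> real) \<Rightarrow> bool" where
  "eq_up_to_sign N u v \<longleftrightarrow> (\<exists>s\<in>{1, -1}. \<forall>i<N. \<forall>x\<ge>0. v i x = s * u i x)"

end

theory Submission
  imports Defs
begin

text \<open>
  Fix a half-line, a mass \<open>m > 0\<close> and a value \<open>a > 0\<close> at the vertex. Among all \<open>u\<close> with these data the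
  energy \<open>\<integral> (1/2 |u'|\<^sup>2 - 1/p |u|\<^sup>p)\<close> is smallest for a piece of a soliton, and its minimum \<open>W(m, a)\<close>
  (called \<open>branch_energy\<close>) is explicit. A soliton \<open>(p/2)\<^bsup>1/(p-2)\<^esup> (\<sigma> sech (\<sigma> x / al))\<^bsup>al\<^esup>\<close> with
  \<open>al = 2/(p - 2)\<close> has one scale parameter, the wave number \<open>\<sigma>\<close>, and a point on it is described by its
  phase \<open>\<theta>\<close>, where \<open>cos \<theta> = sech\<close> and \<open>sin \<theta> = tanh\<close>. A piece that starts at a positive phase is a
  decreasing tail; one that starts at a negative phase first rises to the top of a bump. The pair
  \<open>(\<sigma>, \<theta>)\<close> and the data \<open>(m, a)\<close> determine each other because the function \<open>rho\<close> of the phase is a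
  bijection.

  The minimality is shown by a calibration. The function \<open>W\<close> has the partial derivatives
  \<open>W\<^sub>m = - \<sigma>\<^sup>2 / 2\<close> and \<open>W\<^sub>a = a \<sigma> sin \<theta>\<close> and solves the Hamilton-Jacobi equation
  \<open>a\<^sup>2 W\<^sub>m + W\<^sub>a\<^sup>2 / 2 + |a|\<^sup>p / p = 0\<close>. If \<open>m(x)\<close> is the mass of \<open>u\<close> on \<open>[x, \<infinity>)\<close>, then the derivative of
  \<open>W(m(x), u(x))\<close> is \<open>1/2 (u' + W\<^sub>a)\<^sup>2\<close> minus the energy density. Integration gives the
  lower bound (\<open>half_energy_ge_branch_energy\<close>). In the case of equality \<open>u' = - W\<^sub>a\<close> almost everywhere, along
  this flow \<open>\<sigma>\<close> is constant and the phase moves as on a soliton, so \<open>u\<close> is one up to sign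
  (\<open>equality_case\<close>); in particular it does not vanish at the vertex.

  The problem on the star graph is thus reduced to minimising
  \<open>\<Sum>\<^sub>i W(m\<^sub>i, a) - a\<^sup>q / q\<close> over \<open>a > 0\<close> and positive masses with sum \<open>\<mu>\<close>. At a minimum the wave numbers
  agree, so the phases agree up to sign. Two bumps cannot occur, since \<open>W\<close> is strictly concave in the mass
  where the phase is negative (\<open>minimiser_one_bump\<close>). One bump cannot occur either: together
  with one of the tails it forms a full soliton, and lowering the phase of the other \<open>N - 2 \<ge> 1\<close> tails at
  a fixed wave number lowers the energy (\<open>minimiser_no_single_bump\<close>). Hence all branches are
  the same decreasing tail (\<open>minimiser_symmetric\<close>), and the vertex condition leaves at most one
  value \<open>a\<close>, because \<open>W\<^sub>a(m, a) / a\<^bsup>q-1\<^esup>\<close> increases with \<open>a\<close> along tails when \<open>2 < q < 4\<close>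
  (\<open>minimiser_value_unique\<close>).

  A soliton that runs off to infinity shows that the infimum of the energy is at most the energy
  \<open>- c \<mu>\<^bsup>1+2/nu\<^esup>\<close>, \<open>nu = (6 - p)/(p - 2)\<close>, of the soliton of mass \<open>\<mu>\<close> on the line, which is also the bound for all functions
  that vanish at the vertex. If some competitor is strictly below this level, a minimum exists by compactness. So
  a ground state exists exactly if for some \<open>a > 0\<close> the symmetric configuration is not above this level (\<open>minimiser_iff\<close>).
  Scaling the mass to 1 turns this into \<open>\<mu>\<^bsup>eta\<^esup> \<ge> R\<close>, where \<open>R > 0\<close> does not depend on \<open>\<mu>\<close> and \<open>eta\<close> has the
  sign of \<open>q - (p/2 + 1)\<close> (\<open>threshold\<close>). The constant \<open>R\<close> is positive because \<open>N \<ge> 3\<close>: without the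
  term at the vertex the best symmetric configuration consists of \<open>N\<close> half-solitons, which is worse than
  two half-solitons forming a whole one.
\<close>

section \<open>Masses and phases of soliton pieces\<close>

locale subcritical =
  fixes p :: real
  assumes p_gt_2: "2 < p" and p_lt_6: "p < 6"
begin

text \<open>
  The exponents of the soliton: \<open>sech\<close> occurs to the power \<open>al\<close>, its mass is proportional to
  \<open>\<sigma>\<^bsup>nu\<^esup>\<close>, and \<open>sqrt amp\<close> is its amplitude at wave number 1.
\<close>
definition nu :: real where "nu = (6 - p) / (p - 2)"
definition al :: real where "al = 2 / (p - 2)"
definition amp :: real where "amp = (p / 2) powr al"

lemma nu_pos: "nu > 0" using p_gt_2 p_lt_6 by (simp add: nu_def)
lemma al_pos: "al > 0" using p_gt_2 by (simp add: al_def)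
lemma two_al: "2 * al = nu + 1" using p_gt_2 by (simp add: al_def nu_def field_simps)
lemma amp_pos: "amp > 0" using p_gt_2 by (simp add: amp_def)

text \<open>
  With \<open>cos \<theta> = sech s\<close> one has \<open>d\<theta> = cos \<theta> ds\<close> and \<open>2 al = nu + 1\<close>, so that this is the normalised mass of
  the part of a soliton beyond the phase \<open>\<theta>\<close>.
\<close>
definition tail_mass :: "real \<Rightarrow> real" where
  "tail_mass \<theta> = integral {\<theta>..pi/2} (\<lambda>t. cos t powr nu)"

lemma continuous_on_cos_powr: "continuous_on {-(pi/2)..pi/2} (\<lambda>t. cos t powr nu)"
  using nu_pos by (intro continuous_on_powr' continuous_intros) (auto intro!: cos_ge_zero)

lemma tail_mass_alt:
  assumes "-(pi/2) \<le> \<theta>" "\<theta> \<le> pi/2"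
  shows "tail_mass \<theta> = tail_mass (-(pi/2)) - integral {-(pi/2)..\<theta>} (\<lambda>t. cos t powr nu)"
proof -
  have "(\<lambda>t. cos t powr nu) integrable_on {-(pi/2)..pi/2}"
    by (rule integrable_continuous_interval[OF continuous_on_cos_powr])
  from Henstock_Kurzweil_Integration.integral_combine[OF assms this]
  show ?thesis unfolding tail_mass_def by simp
qed

lemma tail_mass_at_end [simp]: "tail_mass (pi/2) = 0"
  by (simp add: tail_mass_def)

lemma continuous_on_tail_mass: "continuous_on {-(pi/2)..pi/2} tail_mass"
proof -
  have "continuous_on {-(pi/2)..pi/2}
      (\<lambda>\<theta>. tail_mass (-(pi/2)) - integral {-(pi/2)..\<theta>} (\<lambda>t. cos t powr nu))"
    by (intro continuous_intros indefinite_integral_continuous_1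
        integrable_continuous_interval continuous_on_cos_powr)
  thus ?thesis by (rule continuous_on_eq) (rule tail_mass_alt[symmetric], auto)
qed

lemma tail_mass_deriv [derivative_intros]:
  assumes "-(pi/2) < \<theta>" "\<theta> < pi/2"
  shows "(tail_mass has_real_derivative - (cos \<theta> powr nu)) (at \<theta>)"
proof -
  have "((\<lambda>\<theta>. integral {-(pi/2)..\<theta>} (\<lambda>t. cos t powr nu)) has_real_derivative cos \<theta> powr nu)
      (at \<theta> within {-(pi/2)..pi/2})"
    using assms by (intro integral_has_real_derivative continuous_on_cos_powr) auto
  hence "((\<lambda>\<theta>. integral {-(pi/2)..\<theta>} (\<lambda>t. cos t powr nu)) has_real_derivative cos \<theta> powr nu)
      (at \<theta>)"
    using assms by (simp add: at_within_Icc_at)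
  hence "((\<lambda>\<theta>. tail_mass (-(pi/2)) - integral {-(pi/2)..\<theta>} (\<lambda>t. cos t powr nu))
      has_real_derivative - (cos \<theta> powr nu)) (at \<theta>)"
    by (auto intro!: derivative_eq_intros)
  moreover have "\<forall>\<^sub>F t in at \<theta>. tail_mass t =
      tail_mass (-(pi/2)) - integral {-(pi/2)..t} (\<lambda>t. cos t powr nu)"
  proof -
    have "\<forall>\<^sub>F t in at \<theta>. t \<in> {-(pi/2)<..<pi/2}"
      by (rule eventually_at_in_open') (use assms in auto)
    thus ?thesis by eventually_elim (rule tail_mass_alt, auto)
  qed
  moreover have "tail_mass \<theta> =
      tail_mass (-(pi/2)) - integral {-(pi/2)..\<theta>} (\<lambda>t. cos t powr nu)"
    by (rule tail_mass_alt) (use assms in auto)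
  ultimately show ?thesis
    by (subst has_field_derivative_cong_eventually)
qed

lemma cos_pos': "-(pi/2) < \<theta> \<Longrightarrow> \<theta> < pi/2 \<Longrightarrow> cos \<theta> > 0"
  by (rule cos_gt_zero_pi) auto

text \<open>
  The bounds for \<open>tail_mass\<close> compare functions of the phase that vanish at \<open>pi/2\<close>, the far end of the soliton, so
  that it suffices to know the sign of a derivative.
\<close>
lemma antimono_to_end_pos:
  fixes f :: "real \<Rightarrow> real"
  assumes c: "continuous_on {-(pi/2)..pi/2} f" and e: "f (pi/2) = 0"
    and d: "\<And>t. -(pi/2) < t \<Longrightarrow> t < pi/2 \<Longrightarrow> \<exists>D. DERIV f t :> D \<and> D < 0"
    and \<theta>: "-(pi/2) \<le> \<theta>" "\<theta> < pi/2"
  shows "f \<theta> > 0"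
proof -
  have "f (pi/2) < f \<theta>"
    by (rule DERIV_neg_imp_decreasing_open[OF \<theta>(2)])
       (use d \<theta> in \<open>auto intro!: continuous_on_subset[OF c]\<close>)
  thus ?thesis using e by simp
qed

lemma tail_mass_deriv_neg:
  assumes "-(pi/2) < \<theta>" "\<theta> < pi/2"
  shows "\<exists>D. DERIV tail_mass \<theta> :> D \<and> D < 0"
  using tail_mass_deriv[OF assms] cos_pos'[OF assms]
  by (intro exI[of _ "- (cos \<theta> powr nu)"]) simp

lemma tail_mass_pos: "-(pi/2) \<le> \<theta> \<Longrightarrow> \<theta> < pi/2 \<Longrightarrow> tail_mass \<theta> > 0"
  by (rule antimono_to_end_pos[OF continuous_on_tail_mass tail_mass_at_end tail_mass_deriv_neg])

lemma tail_mass_strict_antimono: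
  assumes "-(pi/2) \<le> s" "s < t" "t \<le> pi/2"
  shows "tail_mass t < tail_mass s"
proof (rule DERIV_neg_imp_decreasing_open[OF assms(2)])
  show "continuous_on {s..t} tail_mass"
    by (rule continuous_on_subset[OF continuous_on_tail_mass]) (use assms in auto)
qed (use assms tail_mass_deriv_neg in auto)

lemma cos_powr_Suc: "cos \<theta> \<ge> 0 \<Longrightarrow> cos \<theta> powr (nu + 1) = cos \<theta> powr nu * cos \<theta>"
  by (cases "cos \<theta> = 0") (auto simp: powr_add)

lemma continuous_on_cos_powr_Suc: "continuous_on {-(pi/2)..pi/2} (\<lambda>t. cos t powr (nu + 1))"
  using nu_pos by (intro continuous_on_powr' continuous_intros) (auto intro!: cos_ge_zero)

lemma cos_powr_Suc_deriv [derivative_intros]: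
  assumes "-(pi/2) < \<theta>" "\<theta> < pi/2"
  shows "((\<lambda>t. cos t powr (nu + 1)) has_real_derivative - ((nu + 1) * cos \<theta> powr nu * sin \<theta>)) (at \<theta>)"
proof -
  have "cos \<theta> > 0" using assms by (rule cos_pos')
  thus ?thesis by (auto intro!: derivative_eq_intros)
qed

lemma cos_powr_Suc_div_deriv:
  assumes "-(pi/2) < \<theta>" "\<theta> < pi/2"
  shows "((\<lambda>t. cos t powr (nu + 1) / (nu + 1)) has_real_derivative - (cos \<theta> powr nu * sin \<theta>)) (at \<theta>)"
  using DERIV_cdivide[OF cos_powr_Suc_deriv[OF assms], of "nu + 1"] nu_pos
  by (simp add: mult.assoc)

lemma tail_mass_lower:
  assumes "-(pi/2) \<le> \<theta>" "\<theta> < pi/2"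
  shows "cos \<theta> powr (nu + 1) / (nu + 1) < tail_mass \<theta>"
proof -
  have "tail_mass \<theta> - cos \<theta> powr (nu + 1) / (nu + 1) > 0"
  proof (rule antimono_to_end_pos[where f = "\<lambda>\<theta>. tail_mass \<theta> - cos \<theta> powr (nu + 1) / (nu + 1)"])
    show "continuous_on {- (pi / 2)..pi / 2} (\<lambda>\<theta>. tail_mass \<theta> - cos \<theta> powr (nu + 1) / (nu + 1))"
      using nu_pos by (intro continuous_intros continuous_on_tail_mass continuous_on_cos_powr_Suc) auto
    fix t assume t: "-(pi/2) < t" "t < pi/2"
    have "((\<lambda>\<theta>. tail_mass \<theta> - cos \<theta> powr (nu + 1) / (nu + 1)) has_real_derivative
        - (cos t powr nu * (1 - sin t))) (at t)"
      using DERIV_diff[OF tail_mass_deriv[OF t] cos_powr_Suc_div_deriv[OF t]]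
      by (simp add: algebra_simps)
    moreover have "sin t < 1"
    proof -
      have "sin t < sin (pi/2)" using t by (intro sin_monotone_2pi) auto
      thus ?thesis by simp
    qed
    ultimately show "\<exists>D. ((\<lambda>\<theta>. tail_mass \<theta> - cos \<theta> powr (nu + 1) / (nu + 1)) has_real_derivative D) (at t) \<and> D < 0"
      using cos_pos'[OF t] by (intro exI conjI) auto
  qed (use assms in auto)
  thus ?thesis by simp
qed

lemma tail_mass_upper:
  assumes "-(pi/2) \<le> \<theta>" "\<theta> < pi/2"
  shows "sin \<theta> * tail_mass \<theta> < cos \<theta> powr (nu + 1) / (nu + 1)"
proof -
  have "cos \<theta> powr (nu + 1) / (nu + 1) - sin \<theta> * tail_mass \<theta> > 0"
  proof (rule antimono_to_end_pos[where f = "\<lambda>\<theta>. cos \<theta> powr (nu + 1) / (nu + 1) - sin \<theta> * tail_mass \<theta>"])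
    show "continuous_on {- (pi / 2)..pi / 2} (\<lambda>\<theta>. cos \<theta> powr (nu + 1) / (nu + 1) - sin \<theta> * tail_mass \<theta>)"
      using nu_pos by (intro continuous_intros continuous_on_tail_mass continuous_on_cos_powr_Suc) auto
    fix t assume t: "-(pi/2) < t" "t < pi/2"
    have "((\<lambda>\<theta>. cos \<theta> powr (nu + 1) / (nu + 1) - sin \<theta> * tail_mass \<theta>) has_real_derivative
        - (cos t * tail_mass t)) (at t)"
      using DERIV_diff[OF cos_powr_Suc_div_deriv[OF t] DERIV_mult[OF DERIV_sin tail_mass_deriv[OF t]]]
      by (simp add: algebra_simps)
    thus "\<exists>D. ((\<lambda>\<theta>. cos \<theta> powr (nu + 1) / (nu + 1) - sin \<theta> * tail_mass \<theta>) has_real_derivative D) (at t) \<and> D < 0"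
      using cos_pos'[OF t] tail_mass_pos[of t] t by (intro exI conjI) auto
  qed (use assms in auto)
  thus ?thesis by simp
qed

text \<open>
  The quotient \<open>sin cos\<^bsup>nu+1\<^esup> / (1 + nu sin\<^sup>2)\<close> is chosen such that in the derivative of the difference to
  \<open>tail_mass\<close> everything cancels but a multiple of \<open>cos\<^bsup>nu+2\<^esup>\<close>. The estimate makes the vertex value
  of a minimiser unique.
\<close>
lemma tail_mass_sharp:
  assumes "-(pi/2) \<le> \<theta>" "\<theta> < pi/2"
  shows "sin \<theta> * cos \<theta> powr (nu + 1) < tail_mass \<theta> * (1 + nu * (sin \<theta>)\<^sup>2)"
proof -
  define D where "D = (\<lambda>\<theta>::real. 1 + nu * (sin \<theta>)\<^sup>2)"
  have D: "D t > 0" for t using nu_pos by (auto simp: D_def intro!: add_pos_nonneg)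
  define f where "f = (\<lambda>\<theta>. tail_mass \<theta> - sin \<theta> * cos \<theta> powr (nu + 1) / D \<theta>)"
  have "f \<theta> > 0"
  proof (rule antimono_to_end_pos[where f = f])
    have cD: "continuous_on {- (pi / 2)..pi / 2} D"
      unfolding D_def by (intro continuous_intros)
    have "D t \<noteq> 0" for t using D[of t] by simp
    thus "continuous_on {- (pi / 2)..pi / 2} f"
      unfolding f_def
      by (intro continuous_on_diff continuous_on_tail_mass continuous_on_divide continuous_on_mult
          continuous_on_cos_powr_Suc continuous_on_sin continuous_on_id cD) auto
    fix t assume t: "-(pi/2) < t" "t < pi/2"
    have c: "cos t > 0" using t by (rule cos_pos')
    have dD: "(D has_real_derivative 2 * nu * sin t * cos t) (at t)"
      unfolding D_def by (auto intro!: derivative_eq_intros simp: power2_eq_square)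
    have "D t \<noteq> 0" using D[of t] by auto
    have "(f has_real_derivative
       - (cos t powr nu) - ((cos t * cos t powr (nu + 1) - sin t * ((nu + 1) * cos t powr nu * sin t)) * D t
         - sin t * cos t powr (nu + 1) * (2 * nu * sin t * cos t)) / (D t * D t)) (at t)"
      unfolding f_def using t \<open>D t \<noteq> 0\<close> by (auto intro!: derivative_eq_intros dD)
    also have "- (cos t powr nu) - ((cos t * cos t powr (nu + 1) - sin t * ((nu + 1) * cos t powr nu * sin t)) * D t
         - sin t * cos t powr (nu + 1) * (2 * nu * sin t * cos t)) / (D t * D t)
       = - (cos t powr nu) * (D t * D t + ((cos t)\<^sup>2 - (nu + 1) * (sin t)\<^sup>2) * D t
           - 2 * nu * (sin t)\<^sup>2 * (cos t)\<^sup>2) / (D t * D t)"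
      unfolding cos_powr_Suc[OF less_imp_le[OF c]]
      using \<open>D t \<noteq> 0\<close> c by (simp add: field_simps power2_eq_square)
    also have "D t * D t + ((cos t)\<^sup>2 - (nu + 1) * (sin t)\<^sup>2) * D t - 2 * nu * (sin t)\<^sup>2 * (cos t)\<^sup>2
        = 2 * (cos t)\<^sup>2"
      unfolding D_def cos_squared_eq by (simp add: algebra_simps power2_eq_square)
    finally have "(f has_real_derivative - (cos t powr nu) * (2 * (cos t)\<^sup>2) / (D t * D t)) (at t)" .
    thus "\<exists>D. (f has_real_derivative D) (at t) \<and> D < 0"
      using c D[of t] by (intro exI conjI) (auto intro!: divide_neg_pos mult_pos_pos)
  qed (use assms in \<open>auto simp: f_def\<close>)
  thus ?thesis using D[of \<theta>] by (simp add: f_def D_def field_simps)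
qed

text \<open>
  On soliton pieces \<open>cos \<theta> / tail_mass \<theta>\<^bsup>1/nu\<^esup>\<close> is the combination of value and mass that does not depend on
  the wave number, so that inverting it recovers the phase from the data. The linear
  extension below \<open>-pi/2\<close> makes the inverse continuous on the whole line, in particular at the ratio 0, which belongs to
  the value 0 at the vertex.
\<close>
definition rho :: "real \<Rightarrow> real" where
  "rho \<theta> = (if \<theta> < -(pi/2) then \<theta> + pi/2 else cos \<theta> / tail_mass \<theta> powr (1 / nu))"

definition rho' :: "real \<Rightarrow> real" where
  "rho' \<theta> = rho \<theta> * (cos \<theta> powr nu / (nu * tail_mass \<theta>) - sin \<theta> / cos \<theta>)"

lemma rho_pos: "-(pi/2) < \<theta> \<Longrightarrow> \<theta> < pi/2 \<Longrightarrow> rho \<theta> > 0"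
  using cos_pos'[of \<theta>] tail_mass_pos[of \<theta>] by (simp add: rho_def)

lemma rho_deriv:
  assumes "-(pi/2) < \<theta>" "\<theta> < pi/2"
  shows "(rho has_real_derivative rho' \<theta>) (at \<theta>)"
proof -
  have B: "tail_mass \<theta> > 0" and c: "cos \<theta> > 0"
    using tail_mass_pos[of \<theta>] cos_pos'[of \<theta>] assms by auto
  have dB: "((\<lambda>\<theta>. tail_mass \<theta> powr (1 / nu)) has_real_derivative
     tail_mass \<theta> powr (1 / nu) * (- (cos \<theta> powr nu) * (1 / nu) / tail_mass \<theta>)) (at \<theta>)"
    using DERIV_powr[OF tail_mass_deriv[OF assms] B DERIV_const[of "1 / nu"]] by simp
  have "((\<lambda>\<theta>. cos \<theta> / tail_mass \<theta> powr (1 / nu)) has_real_derivative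
      (- sin \<theta> * tail_mass \<theta> powr (1 / nu) - cos \<theta> *
        (tail_mass \<theta> powr (1 / nu) * (- (cos \<theta> powr nu) * (1 / nu) / tail_mass \<theta>))) /
      (tail_mass \<theta> powr (1 / nu) * tail_mass \<theta> powr (1 / nu))) (at \<theta>)"
    by (rule DERIV_divide[OF DERIV_cos dB]) (use B in simp)
  also have "(- sin \<theta> * tail_mass \<theta> powr (1 / nu) - cos \<theta> *
        (tail_mass \<theta> powr (1 / nu) * (- (cos \<theta> powr nu) * (1 / nu) / tail_mass \<theta>))) /
      (tail_mass \<theta> powr (1 / nu) * tail_mass \<theta> powr (1 / nu)) = rho' \<theta>"
  proof -
    define X where "X = tail_mass \<theta> powr (1 / nu)"
    have X: "X > 0" using B by (simp add: X_def)
    have r: "rho \<theta> = cos \<theta> / X" using assms by (simp add: rho_def X_def)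
    show ?thesis unfolding rho'_def r X_def[symmetric]
      using X B c nu_pos by (simp add: field_simps)
  qed
  finally have *: "((\<lambda>\<theta>. cos \<theta> / tail_mass \<theta> powr (1 / nu)) has_real_derivative rho' \<theta>) (at \<theta>)" .
  have "\<forall>\<^sub>F t in at \<theta>. t \<in> {-(pi/2)<..<pi/2}"
    by (rule eventually_at_in_open') (use assms in auto)
  hence ev: "\<forall>\<^sub>F t in at \<theta>. rho t = cos t / tail_mass t powr (1 / nu)"
    by eventually_elim (simp add: rho_def)
  have "rho \<theta> = cos \<theta> / tail_mass \<theta> powr (1 / nu)" using assms by (simp add: rho_def)
  from has_field_derivative_cong_eventually[OF ev this] * show ?thesis by blast
qed

text \<open>
  For positive phases this is weaker than \<open>tail_mass_upper\<close>; for the others the second term has the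
  good sign.
\<close>
lemma rho'_factor_pos:
  assumes "-(pi/2) < \<theta>" "\<theta> < pi/2"
  shows "cos \<theta> powr nu / (nu * tail_mass \<theta>) - sin \<theta> / cos \<theta> > 0"
proof -
  have B: "tail_mass \<theta> > 0" and c: "cos \<theta> > 0"
    using tail_mass_pos[of \<theta>] cos_pos'[of \<theta>] assms by auto
  have "nu * (sin \<theta> * tail_mass \<theta>) < cos \<theta> powr (nu + 1)"
  proof (cases "sin \<theta> \<ge> 0")
    case True
    have "(nu + 1) * (sin \<theta> * tail_mass \<theta>) < cos \<theta> powr (nu + 1)"
      using tail_mass_upper[of \<theta>] assms nu_pos by (simp add: field_simps)
    moreover have "sin \<theta> * tail_mass \<theta> \<ge> 0" using True B by simp
    ultimately show ?thesis by (simp add: algebra_simps)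
  next
    case False
    hence "nu * (sin \<theta> * tail_mass \<theta>) < 0" using B nu_pos by (simp add: mult_pos_neg mult_neg_pos)
    also have "0 < cos \<theta> powr (nu + 1)" using c by simp
    finally show ?thesis .
  qed
  thus ?thesis unfolding cos_powr_Suc[OF less_imp_le[OF c]]
    using B c nu_pos by (simp add: field_simps)
qed

lemma rho'_pos:
  assumes "-(pi/2) < \<theta>" "\<theta> < pi/2"
  shows "rho' \<theta> > 0"
  unfolding rho'_def using rho_pos[OF assms] rho'_factor_pos[OF assms] by simp

lemma continuous_on_rho_upper: "continuous_on {-(pi/2)..<pi/2} (\<lambda>\<theta>. cos \<theta> / tail_mass \<theta> powr (1 / nu))"
proof -
  have "continuous_on {-(pi/2)..<pi/2} tail_mass"
    by (rule continuous_on_subset[OF continuous_on_tail_mass]) auto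
  moreover have "\<forall>x\<in>{-(pi/2)..<pi/2}. tail_mass x > 0" by (auto intro: tail_mass_pos)
  ultimately show ?thesis
    by (intro continuous_on_divide continuous_on_cos continuous_on_id continuous_on_powr
        continuous_on_const) force+
qed

lemma rho_left_end: "rho (-(pi/2)) = 0"
  by (simp add: rho_def)

lemma continuous_on_rho: "continuous_on {..<pi/2} rho"
proof -
  have "continuous_on {..<pi/2}
      (\<lambda>\<theta>. if \<theta> \<le> -(pi/2) then \<theta> + pi/2 else cos \<theta> / tail_mass \<theta> powr (1 / nu))"
  proof (rule continuous_on_cases_1)
    have "{t \<in> {..<pi/2}. -(pi/2) \<le> t} = {-(pi/2)..<pi/2}" by auto
    thus "continuous_on {t \<in> {..<pi/2}. -(pi/2) \<le> t} (\<lambda>\<theta>. cos \<theta> / tail_mass \<theta> powr (1 / nu))"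
      using continuous_on_rho_upper by simp
  qed (auto intro!: continuous_intros)
  thus ?thesis
    by (rule continuous_on_eq) (auto simp: rho_def)
qed

lemma rho_strict_mono:
  assumes "s < t" "t < pi/2"
  shows "rho s < rho t"
proof -
  have right: "rho s < rho t" if "-(pi/2) \<le> s" "s < t" "t < pi/2" for s t
  proof (rule DERIV_pos_imp_increasing_open[OF that(2)])
    show "continuous_on {s..t} rho"
      by (rule continuous_on_subset[OF continuous_on_rho]) (use that in auto)
    show "\<exists>y. DERIV rho x :> y \<and> y > 0" if "s < x" "x < t" for x
      using rho_deriv[of x] rho'_pos[of x] that \<open>-(pi/2) \<le> s\<close> \<open>t < pi/2\<close> by auto
  qed
  show ?thesis
  proof (cases "-(pi/2) \<le> s")
    case True thus ?thesis using right assms by blast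
  next
    case False
    hence s: "rho s < 0" by (simp add: rho_def)
    consider "t < -(pi/2)" | "t = -(pi/2)" | "-(pi/2) < t" by linarith
    thus ?thesis
    proof cases
      case 1 thus ?thesis using False assms by (simp add: rho_def)
    next
      case 2 thus ?thesis using s rho_left_end by simp
    next
      case 3 thus ?thesis using s rho_pos[of t] assms by simp
    qed
  qed
qed

text \<open>
  The upper bound for \<open>tail_mass\<close> is of order \<open>cos\<^bsup>nu+1\<^esup>\<close>, so \<open>rho\<close> is at least of order \<open>cos\<^bsup>-1/nu\<^esup>\<close>.
\<close>
lemma rho_unbounded: "\<exists>\<theta><pi/2. -(pi/2) \<le> \<theta> \<and> r \<le> rho \<theta>"
proof -
  define R where "R = max r 1"
  have R: "R \<ge> 1" "R \<ge> r" by (auto simp: R_def)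
  (* the phase with this cosine has tail_mass at most 2 c^(nu+1), whence rho is at least (2 c)^(-1/nu) = R *)
  define c where "c = 1 / (2 * R powr nu)"
  have Rn: "R powr nu \<ge> 1" using R nu_pos by (simp add: ge_one_powr_ge_zero)
  have "1 / R powr nu \<le> 1" using Rn by (subst divide_le_eq_1_pos) auto
  hence c: "0 < c" "c \<le> 1/2" using Rn by (auto simp: c_def)
  define \<theta> where "\<theta> = arccos c"
  have cos: "cos \<theta> = c" unfolding \<theta>_def using c by (intro cos_arccos) auto
  have \<theta>: "0 \<le> \<theta>" "\<theta> < pi/2"
    using c arccos_lbound[of c] arccos_less_arccos[of 0 c] by (auto simp: \<theta>_def)
  have "(sin \<theta>)\<^sup>2 = 1 - c\<^sup>2" using cos by (simp add: sin_squared_eq)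
  also have "\<dots> \<ge> (1/2)\<^sup>2"
    using c power_mono[of c "1/2" 2] by (simp add: power2_eq_square)
  finally have sin: "sin \<theta> \<ge> 1/2"
  proof (rule power2_le_imp_le)
    show "0 \<le> sin \<theta>" by (rule sin_ge_zero) (use \<theta> in linarith)+
  qed
  have B: "tail_mass \<theta> > 0" using \<theta> by (intro tail_mass_pos) auto
  have "1/2 * tail_mass \<theta> \<le> sin \<theta> * tail_mass \<theta>" using sin B by (intro mult_right_mono) auto
  also have "\<dots> \<le> cos \<theta> powr (nu + 1) / (nu + 1)" using tail_mass_upper[of \<theta>] \<theta> by auto
  also have "\<dots> \<le> cos \<theta> powr (nu + 1)" using nu_pos by (simp add: divide_le_eq algebra_simps)
  also have "\<dots> = c * c powr nu" using cos c by (simp add: powr_add)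
  finally have "tail_mass \<theta> \<le> (2 * c) * c powr nu" by simp
  also have "\<dots> = c powr nu / R powr nu" using R by (simp add: c_def)
  also have "\<dots> = (c / R) powr nu" using c R by (simp add: powr_divide)
  finally have "tail_mass \<theta> powr (1 / nu) \<le> ((c / R) powr nu) powr (1 / nu)"
    using B nu_pos by (intro powr_mono2) auto
  also have "\<dots> = c / R" using c R nu_pos by (simp add: powr_powr)
  finally have "R \<le> c / tail_mass \<theta> powr (1 / nu)" using B R by (simp add: field_simps)
  also have "\<dots> = rho \<theta>" using \<theta> cos pi_gt_zero by (simp add: rho_def)
  finally show ?thesis using R \<theta> pi_gt_zero by (intro exI[of _ \<theta>]) auto
qed

lemma rho_surj: "\<exists>\<theta><pi/2. rho \<theta> = r"
proof (cases "r < 0")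
  case True
  hence "r < pi" using pi_gt_zero by linarith
  thus ?thesis using True by (intro exI[of _ "r - pi/2"]) (auto simp: rho_def)
next
  case False
  obtain b where b: "b < pi/2" "-(pi/2) \<le> b" "r \<le> rho b" using rho_unbounded by blast
  have "\<exists>x\<ge>-(pi/2). x \<le> b \<and> rho x = r"
  proof (rule IVT')
    show "continuous_on {-(pi/2)..b} rho"
      by (rule continuous_on_subset[OF continuous_on_rho]) (use b in auto)
  qed (use b False rho_left_end in auto)
  then obtain x where "x \<le> b" "rho x = r" by blast
  thus ?thesis using b(1) by (intro exI[of _ x]) linarith
qed

definition rho_inv :: "real \<Rightarrow> real" where
  "rho_inv r = (THE \<theta>. \<theta> < pi/2 \<and> rho \<theta> = r)"

lemma rho_inv_unique: "\<theta> < pi/2 \<Longrightarrow> rho \<theta> = r \<Longrightarrow> rho_inv r = \<theta>"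
  unfolding rho_inv_def
proof (rule the_equality)
  fix \<theta>' assume "\<theta> < pi/2" "rho \<theta> = r" "\<theta>' < pi/2 \<and> rho \<theta>' = r"
  thus "\<theta>' = \<theta>"
    using rho_strict_mono[of \<theta> \<theta>'] rho_strict_mono[of \<theta>' \<theta>] by (cases \<theta> \<theta>' rule: linorder_cases) auto
qed auto

lemma rho_inv_less: "rho_inv r < pi/2" and rho_rho_inv [simp]: "rho (rho_inv r) = r"
  using rho_surj[of r] rho_inv_unique[of _ r] by metis+

lemma rho_inv_strict_mono: "r < s \<Longrightarrow> rho_inv r < rho_inv s"
  by (metis linorder_less_linear order_less_asym rho_inv_less rho_rho_inv rho_strict_mono)

lemma rho_inv_0: "rho_inv 0 = -(pi/2)"
  by (rule rho_inv_unique) (use rho_left_end in auto)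

lemma rho_inv_gt: "r > 0 \<Longrightarrow> -(pi/2) < rho_inv r"
  using rho_inv_strict_mono[of 0 r] rho_inv_0 by simp

lemma rho_inv_ge: "r \<ge> 0 \<Longrightarrow> -(pi/2) \<le> rho_inv r"
  using rho_inv_gt[of r] rho_inv_0 by (cases "r = 0") auto

lemma isCont_rho_inv: "isCont rho_inv r"
proof -
  have "range rho_inv = {..<pi/2}"
  proof safe
    fix x assume "x < pi/2"
    thus "x \<in> range rho_inv" using rho_inv_unique[of x "rho x"] by (metis rangeI)
  qed (use rho_inv_less in auto)
  hence "continuous_on UNIV rho_inv"
    by (intro continuous_onI_mono) (auto, metis order_less_imp_le order.order_iff_strict rho_inv_strict_mono)
  thus ?thesis by (simp add: continuous_on_eq_continuous_at)
qed

lemma rho_inv_deriv: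
  assumes "r > 0"
  shows "(rho_inv has_real_derivative inverse (rho' (rho_inv r))) (at r)"
proof (rule DERIV_inverse_function[where a = 0 and b = "r + 1"])
  show "DERIV rho (rho_inv r) :> rho' (rho_inv r)"
    using rho_inv_gt[OF assms] rho_inv_less by (intro rho_deriv) auto
  show "rho' (rho_inv r) \<noteq> 0"
    using rho'_pos[of "rho_inv r"] rho_inv_gt[OF assms] rho_inv_less[of r] by simp
qed (use assms isCont_rho_inv in auto)

text \<open>
  The phase-dependent factor of the value function, see \<open>branch_energy_shape\<close> below.
\<close>
definition shape :: "real \<Rightarrow> real" where
  "shape \<theta> = tail_mass \<theta> powr (-2 / nu) * (2 * sin \<theta> * cos \<theta> powr (nu + 1) / tail_mass \<theta> - nu)"

text \<open>
  The logarithmic derivative of \<open>rho\<close> splits off as a factor; it cancels when \<open>shape\<close> is differentiated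
  with respect to mass or value through the phase.
\<close>
lemma shape_deriv:
  assumes "-(pi/2) < \<theta>" "\<theta> < pi/2"
  shows "(shape has_real_derivative
     2 * (nu + 2) * tail_mass \<theta> powr (-2 / nu) * sin \<theta> * cos \<theta> powr (nu + 1) / tail_mass \<theta>
      * (cos \<theta> powr nu / (nu * tail_mass \<theta>) - sin \<theta> / cos \<theta>)) (at \<theta>)"
proof -
  have B: "tail_mass \<theta> > 0" and c: "cos \<theta> > 0"
    using tail_mass_pos[of \<theta>] cos_pos'[of \<theta>] assms by auto
  define X where "X = tail_mass \<theta> powr (-2 / nu)"
  define Y where "Y = cos \<theta> powr nu"
  have Y1: "cos \<theta> powr (nu + 1) = Y * cos \<theta>" using c by (simp add: cos_powr_Suc Y_def)
  have dB: "((\<lambda>\<theta>. tail_mass \<theta> powr (-2 / nu)) has_real_derivative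
     X * (- Y * (-2 / nu) / tail_mass \<theta>)) (at \<theta>)"
    using DERIV_powr[OF tail_mass_deriv[OF assms] B DERIV_const[of "-2 / nu"]]
    by (simp add: X_def Y_def)
  have d2: "((\<lambda>\<theta>. 2 * sin \<theta> * cos \<theta> powr (nu + 1)) has_real_derivative
      2 * cos \<theta> * (Y * cos \<theta>) - 2 * sin \<theta> * ((nu + 1) * Y * sin \<theta>)) (at \<theta>)"
    using DERIV_mult[OF DERIV_cmult[OF DERIV_sin, of 2] cos_powr_Suc_deriv[OF assms]]
    unfolding Y1 by (simp add: Y_def algebra_simps)
  have d3: "((\<lambda>\<theta>. 2 * sin \<theta> * cos \<theta> powr (nu + 1) / tail_mass \<theta> - nu) has_real_derivative
      ((2 * cos \<theta> * (Y * cos \<theta>) - 2 * sin \<theta> * ((nu + 1) * Y * sin \<theta>)) * tail_mass \<theta>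
        - 2 * sin \<theta> * (Y * cos \<theta>) * (- Y)) / (tail_mass \<theta> * tail_mass \<theta>)) (at \<theta>)"
    using DERIV_diff[OF DERIV_divide[OF d2 tail_mass_deriv[OF assms]] DERIV_const[of nu]] B
    unfolding Y1 by (simp add: Y_def)
  have "(shape has_real_derivative
      X * (- Y * (-2 / nu) / tail_mass \<theta>) * (2 * sin \<theta> * (Y * cos \<theta>) / tail_mass \<theta> - nu)
      + ((2 * cos \<theta> * (Y * cos \<theta>) - 2 * sin \<theta> * ((nu + 1) * Y * sin \<theta>)) * tail_mass \<theta>
        - 2 * sin \<theta> * (Y * cos \<theta>) * (- Y)) / (tail_mass \<theta> * tail_mass \<theta>) * X) (at \<theta>)"
    using DERIV_mult[OF dB d3] unfolding shape_def[abs_def] Y1 X_def by simp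
  also have "X * (- Y * (-2 / nu) / tail_mass \<theta>) * (2 * sin \<theta> * (Y * cos \<theta>) / tail_mass \<theta> - nu)
      + ((2 * cos \<theta> * (Y * cos \<theta>) - 2 * sin \<theta> * ((nu + 1) * Y * sin \<theta>)) * tail_mass \<theta>
        - 2 * sin \<theta> * (Y * cos \<theta>) * (- Y)) / (tail_mass \<theta> * tail_mass \<theta>) * X
     = 2 * (nu + 2) * X * sin \<theta> * (Y * cos \<theta>) / tail_mass \<theta>
      * (Y / (nu * tail_mass \<theta>) - sin \<theta> / cos \<theta>)"
  proof -
    have "X * (- Y * (-2 / nu) / B) * (2 * s * (Y * c) / B - nu)
      + ((2 * c * (Y * c) - 2 * s * ((nu + 1) * Y * s)) * B
        - 2 * s * (Y * c) * (- Y)) / (B * B) * X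
     = 2 * (nu + 2) * X * s * (Y * c) / B * (Y / (nu * B) - s / c)
      + 2 * X * Y / B * (c\<^sup>2 + s\<^sup>2 - 1)"
      if "B > 0" "c > 0" for B c s :: real
      using that nu_pos by (simp add: divide_simps power2_eq_square) (simp add: algebra_simps)
    from this[OF B c, of "sin \<theta>"] show ?thesis by simp
  qed
  finally show ?thesis by (simp add: X_def Y_def Y1)
qed

end

section \<open>The value function of a half-line\<close>

context subcritical
begin

text \<open>
  The value of \<open>rho\<close> at the phase of the soliton piece with mass \<open>m\<close> and initial value \<open>a\<close>, expressed
  by \<open>m\<close> and \<open>a\<close>.
\<close>
definition ratio :: "real \<Rightarrow> real \<Rightarrow> real" where
  "ratio m a = \<bar>a\<bar> powr (1 / al) / (sqrt (p / 2) * (m / (al * amp)) powr (1 / nu))"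

definition phase :: "real \<Rightarrow> real \<Rightarrow> real" where
  "phase m a = rho_inv (ratio m a)"

definition wavenum :: "real \<Rightarrow> real \<Rightarrow> real" where
  "wavenum m a = (m / (al * amp * tail_mass (phase m a))) powr (1 / nu)"

text \<open>
  The energy of the soliton piece with mass \<open>m\<close> and initial value \<open>a\<close>. At \<open>a = 0\<close> it is the energy of the whole
  soliton of mass \<open>m\<close> on the line.
\<close>
definition branch_energy :: "real \<Rightarrow> real \<Rightarrow> real" where
  "branch_energy m a = ((nu + 1) * wavenum m a * sin (phase m a) * a\<^sup>2
     - nu * (wavenum m a)\<^sup>2 * m) / (2 * (nu + 2))"

text \<open>
  The derivative of the value function in \<open>a\<close>; on the soliton piece it is minus the initial slope.
\<close>
definition branch_slope :: "real \<Rightarrow> real \<Rightarrow> real" where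
  "branch_slope m a = a * wavenum m a * sin (phase m a)"

lemma sqrt_half_p_powr: "sqrt (p / 2) powr al = sqrt amp"
  using p_gt_2 by (simp add: amp_def powr_half_sqrt[symmetric] powr_powr mult.commute)

lemma half_p_pos: "sqrt (p / 2) > 0" using p_gt_2 by simp

lemma ratio_nonneg: "m > 0 \<Longrightarrow> ratio m a \<ge> 0"
  using half_p_pos by (auto simp: ratio_def)

lemma ratio_pos: "m > 0 \<Longrightarrow> a \<noteq> 0 \<Longrightarrow> ratio m a > 0"
  using half_p_pos al_pos amp_pos by (auto simp: ratio_def)

lemma ratio_zero [simp]: "ratio m 0 = 0"
  by (simp add: ratio_def)

lemma ratio_abs [simp]: "ratio m \<bar>a\<bar> = ratio m a" by (simp add: ratio_def)
lemma phase_abs [simp]: "phase m \<bar>a\<bar> = phase m a" by (simp add: phase_def)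
lemma wavenum_abs [simp]: "wavenum m \<bar>a\<bar> = wavenum m a" by (simp add: wavenum_def)
lemma branch_energy_abs [simp]: "branch_energy m \<bar>a\<bar> = branch_energy m a"
  by (simp add: branch_energy_def)
lemma ratio_minus [simp]: "ratio m (- a) = ratio m a" by (simp add: ratio_def)
lemma phase_minus [simp]: "phase m (- a) = phase m a" by (simp add: phase_def)
lemma wavenum_minus [simp]: "wavenum m (- a) = wavenum m a" by (simp add: wavenum_def)
lemma branch_energy_minus [simp]: "branch_energy m (- a) = branch_energy m a"
  by (simp add: branch_energy_def)

lemma phase_zero [simp]: "phase m 0 = -(pi/2)"
  by (simp add: phase_def rho_inv_0)

lemma phase_less: "phase m a < pi/2"
  unfolding phase_def by (rule rho_inv_less)

lemma phase_le_twice: "phase m a * 2 \<le> pi"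
  using phase_less[of m a] by linarith

lemma phase_ge: "m > 0 \<Longrightarrow> -(pi/2) \<le> phase m a"
  by (simp add: phase_def rho_inv_ge ratio_nonneg)

lemma phase_gt: "m > 0 \<Longrightarrow> a \<noteq> 0 \<Longrightarrow> -(pi/2) < phase m a"
  by (simp add: phase_def rho_inv_gt ratio_pos)

lemma tail_mass_phase_pos: "m > 0 \<Longrightarrow> tail_mass (phase m a) > 0"
  by (intro tail_mass_pos phase_ge phase_less)

lemma tail_mass_phase_neq: "m > 0 \<Longrightarrow> tail_mass (phase m a) \<noteq> 0"
  using tail_mass_phase_pos[of m a] by simp

lemma cos_phase_nonneg: "m > 0 \<Longrightarrow> cos (phase m a) \<ge> 0"
  using phase_ge[of m a] phase_less[of m a] by (intro cos_ge_zero) auto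

lemma cos_phase_pos: "m > 0 \<Longrightarrow> a \<noteq> 0 \<Longrightarrow> cos (phase m a) > 0"
  using phase_gt[of m a] phase_less[of m a] by (intro cos_gt_zero_pi) auto

lemma wavenum_pos: "m > 0 \<Longrightarrow> wavenum m a > 0"
  using tail_mass_phase_pos[of m a] al_pos amp_pos by (simp add: wavenum_def)

lemma mass_eq:
  assumes "m > 0"
  shows "m = al * amp * wavenum m a powr nu * tail_mass (phase m a)"
proof -
  have "wavenum m a powr nu = m / (al * amp * tail_mass (phase m a))"
    unfolding wavenum_def using nu_pos assms tail_mass_phase_pos[of m a] al_pos amp_pos
    by (simp add: powr_powr)
  thus ?thesis using al_pos amp_pos tail_mass_phase_pos[OF assms, of a] by simp
qed

lemma wavenum_split:
  assumes "m > 0"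
  shows "wavenum m a = (m / (al * amp)) powr (1 / nu) / tail_mass (phase m a) powr (1 / nu)"
proof -
  have "m / (al * amp * tail_mass (phase m a)) = (m / (al * amp)) / tail_mass (phase m a)" by simp
  thus ?thesis unfolding wavenum_def
    using assms al_pos amp_pos tail_mass_phase_pos[of m a] by (simp only: powr_divide)
qed

lemma rho_phase:
  assumes "m > 0"
  shows "cos (phase m a) / tail_mass (phase m a) powr (1 / nu) = ratio m a"
  using rho_rho_inv[of "ratio m a"] phase_ge[OF assms, of a] unfolding phase_def[symmetric]
  by (simp add: rho_def)

lemma abs_powr_eq:
  assumes "m > 0"
  shows "\<bar>a\<bar> powr (1 / al) = sqrt (p / 2) * (wavenum m a * cos (phase m a))"
proof -
  have pos: "(m / (al * amp)) powr (1 / nu) > 0" using assms al_pos amp_pos by simp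
  have "wavenum m a * cos (phase m a) = (m / (al * amp)) powr (1 / nu) * ratio m a"
    unfolding wavenum_split[OF assms] rho_phase[OF assms, symmetric] by simp
  also have "\<dots> = \<bar>a\<bar> powr (1 / al) / sqrt (p / 2)"
    unfolding ratio_def using pos half_p_pos by simp
  finally show ?thesis using half_p_pos by simp
qed

lemma abs_eq:
  assumes "m > 0"
  shows "\<bar>a\<bar> = sqrt amp * (wavenum m a * cos (phase m a)) powr al"
proof -
  have "\<bar>a\<bar> = (\<bar>a\<bar> powr (1 / al)) powr al" using al_pos by (simp add: powr_powr)
  also have "\<dots> = (sqrt (p / 2) * (wavenum m a * cos (phase m a))) powr al"
    by (simp only: abs_powr_eq[OF assms, of a])
  also have "\<dots> = sqrt (p / 2) powr al * (wavenum m a * cos (phase m a)) powr al"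
    by (rule powr_mult)
  finally show ?thesis by (simp only: sqrt_half_p_powr)
qed

lemma square_eq:
  assumes "m > 0"
  shows "a\<^sup>2 = amp * wavenum m a powr (nu + 1) * cos (phase m a) powr (nu + 1)"
proof -
  define x where "x = wavenum m a * cos (phase m a)"
  have x: "x \<ge> 0" using wavenum_pos[OF assms, of a] cos_phase_nonneg[OF assms, of a] by (simp add: x_def)
  have "a\<^sup>2 = \<bar>a\<bar>\<^sup>2" by simp
  also have "\<dots> = amp * (x powr al)\<^sup>2"
    unfolding abs_eq[OF assms, of a] x_def[symmetric] using amp_pos by (simp add: power_mult_distrib)
  also have "(x powr al)\<^sup>2 = x powr (nu + 1)"
    using x two_al by (simp add: power2_eq_square powr_add[symmetric])
  also have "x powr (nu + 1) = wavenum m a powr (nu + 1) * cos (phase m a) powr (nu + 1)"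
    unfolding x_def by (rule powr_mult)
  finally show ?thesis by simp
qed

text \<open>
  Eliminates the amplitude; all derivatives of the value function are computed with this identity.
\<close>
lemma square_mass:
  assumes "m > 0"
  shows "a\<^sup>2 = wavenum m a * m * (cos (phase m a) powr (nu + 1) / (al * tail_mass (phase m a)))"
proof -
  have "wavenum m a * m = al * amp * tail_mass (phase m a) * wavenum m a powr (nu + 1)"
    using wavenum_pos[OF assms, of a] by (subst (2) mass_eq[OF assms, of a]) (simp add: powr_add)
  thus ?thesis using square_eq[OF assms, of a] tail_mass_phase_pos[OF assms, of a] al_pos by simp
qed

lemma abs_powr_p:
  assumes "m > 0"
  shows "\<bar>a\<bar> powr p = p / 2 * (wavenum m a * cos (phase m a))\<^sup>2 * a\<^sup>2"
proof -
  have "\<bar>a\<bar> powr p = \<bar>a\<bar> powr (p - 2) * \<bar>a\<bar> powr 2"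
    by (simp only: powr_add[symmetric]) simp
  also have "\<bar>a\<bar> powr (p - 2) = (\<bar>a\<bar> powr (1 / al)) powr 2"
  proof -
    have "1 / al * 2 = p - 2" using p_gt_2 by (simp add: al_def)
    thus ?thesis by (simp only: powr_powr)
  qed
  also have "\<dots> = (sqrt (p / 2) * (wavenum m a * cos (phase m a))) powr 2"
    by (simp only: abs_powr_eq[OF assms, of a])
  also have "\<dots> = p / 2 * (wavenum m a * cos (phase m a))\<^sup>2"
    using wavenum_pos[OF assms, of a] cos_phase_nonneg[OF assms, of a] p_gt_2
    by (simp add: powr_numeral power_mult_distrib)
  finally show ?thesis by (simp add: powr_numeral)
qed

text \<open>
  With \<open>|a|\<^bsup>p-2\<^esup> = (p/2) (\<sigma> cos \<theta>)\<^sup>2\<close> this is \<open>sin\<^sup>2 + cos\<^sup>2 = 1\<close>.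
\<close>
lemma hamilton_jacobi:
  assumes "m > 0"
  shows "(wavenum m a)\<^sup>2 * a\<^sup>2 / 2 = (branch_slope m a)\<^sup>2 / 2 + \<bar>a\<bar> powr p / p"
  unfolding abs_powr_p[OF assms] branch_slope_def power_mult_distrib cos_squared_eq
  using p_gt_2 by (simp add: field_simps)

lemma coords_inverse:
  assumes \<sigma>: "\<sigma> > 0" and \<theta>: "-(pi/2) \<le> \<theta>" "\<theta> < pi/2"
    and m: "m = al * amp * \<sigma> powr nu * tail_mass \<theta>"
    and a: "\<bar>a\<bar> = sqrt amp * (\<sigma> * cos \<theta>) powr al"
  shows "phase m a = \<theta>" and "wavenum m a = \<sigma>"
proof -
  have B: "tail_mass \<theta> > 0" using \<theta> by (rule tail_mass_pos)
  have c: "cos \<theta> \<ge> 0" using \<theta> by (intro cos_ge_zero) auto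
  have 1: "(m / (al * amp)) powr (1 / nu) = \<sigma> * tail_mass \<theta> powr (1 / nu)"
    using m \<sigma> B al_pos amp_pos nu_pos by (simp add: powr_mult powr_powr)
  have 2: "\<bar>a\<bar> powr (1 / al) = sqrt (p / 2) * (\<sigma> * cos \<theta>)"
    unfolding a sqrt_half_p_powr[symmetric] using \<sigma> c al_pos half_p_pos by (simp add: powr_mult powr_powr)
  have "ratio m a = rho \<theta>"
    unfolding ratio_def 1 2 using \<sigma> half_p_pos \<theta> by (simp add: rho_def)
  thus ph: "phase m a = \<theta>" unfolding phase_def using rho_inv_unique \<theta> by auto
  show "wavenum m a = \<sigma>"
    unfolding wavenum_def ph unfolding m using \<sigma> B al_pos amp_pos nu_pos by (simp add: powr_powr)
qed

lemma phase_strict_mono: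
  assumes "m > 0" "0 \<le> a" "a < b"
  shows "phase m a < phase m b"
proof -
  have "a powr (1 / al) < b powr (1 / al)" using assms al_pos by (intro powr_less_mono2) auto
  thus ?thesis unfolding phase_def ratio_def using assms half_p_pos al_pos amp_pos
    by (intro rho_inv_strict_mono divide_strict_right_mono) auto
qed

lemma phase_strict_antimono_mass:
  assumes "0 < m" "m < m'" "a \<noteq> 0"
  shows "phase m' a < phase m a"
proof -
  have "(m / (al * amp)) powr (1 / nu) < (m' / (al * amp)) powr (1 / nu)"
    using assms al_pos amp_pos nu_pos by (intro powr_less_mono2 divide_strict_right_mono) auto
  thus ?thesis unfolding phase_def ratio_def using assms half_p_pos al_pos amp_pos
    by (intro rho_inv_strict_mono divide_strict_left_mono mult_strict_left_mono) auto
qed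

lemma wavenum_zero: "wavenum m 0 = (m / (al * amp * tail_mass (-(pi/2)))) powr (1 / nu)"
  by (simp add: wavenum_def)

lemma branch_energy_shape:
  assumes "m > 0"
  shows "branch_energy m a
    = m * (m / (al * amp)) powr (2 / nu) / (2 * (nu + 2)) * shape (phase m a)"
proof -
  define B C where "B = tail_mass (phase m a)" and "C = cos (phase m a) powr (nu + 1)"
  have B: "B > 0" using tail_mass_phase_pos[OF assms] by (simp add: B_def)
  have X: "(wavenum m a)\<^sup>2 = (m / (al * amp)) powr (2 / nu) * B powr (-2 / nu)"
  proof -
    have "(wavenum m a)\<^sup>2 = (m / (al * amp * B)) powr (2 / nu)"
      unfolding wavenum_def B_def[symmetric] by (simp add: power2_eq_square powr_add[symmetric])
    also have "m / (al * amp * B) = m / (al * amp) / B" by simp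
    also have "\<dots> powr (2 / nu) = (m / (al * amp)) powr (2 / nu) * B powr (-2 / nu)"
      using assms al_pos amp_pos B by (subst powr_divide) (auto simp: powr_minus_divide)
    finally show ?thesis .
  qed
  have "(nu + 1) * wavenum m a * sin (phase m a) * a\<^sup>2 = (wavenum m a)\<^sup>2 * m * (2 * sin (phase m a) * C / B)"
    unfolding square_mass[OF assms, of a] B_def[symmetric] C_def[symmetric]
    unfolding two_al[symmetric] using al_pos by (simp add: power2_eq_square)
  hence "branch_energy m a = (wavenum m a)\<^sup>2 * m * (2 * sin (phase m a) * C / B - nu) / (2 * (nu + 2))"
    unfolding branch_energy_def by (simp add: algebra_simps)
  thus ?thesis unfolding X shape_def B_def[symmetric] C_def[symmetric] by simp
qed

lemma ratio_deriv_value: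
  assumes "m > 0" "a > 0"
  shows "(ratio m has_real_derivative ratio m a / (al * a)) (at a)"
proof -
  define D where "D = sqrt (p / 2) * (m / (al * amp)) powr (1 / nu)"
  have "((\<lambda>a. \<bar>a\<bar> powr (1 / al) / D) has_real_derivative (a powr (1 / al - 1) * (1 / al)) / D) (at a)"
  proof -
    have "((\<lambda>a. a powr (1 / al)) has_real_derivative (1 / al) * a powr (1 / al - 1)) (at a)"
      using assms by (intro has_real_derivative_powr)
    hence "((\<lambda>a. \<bar>a\<bar> powr (1 / al)) has_real_derivative (1 / al) * a powr (1 / al - 1)) (at a)"
      by (rule has_field_derivative_transform_within_open[where S = "{0<..}"]) (use assms in auto)
    thus ?thesis using DERIV_cdivide by (metis mult.commute)
  qed
  moreover have "a powr (1 / al - 1) = a powr (1 / al) / a" using assms by (simp add: powr_diff)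
  ultimately show ?thesis unfolding ratio_def[abs_def] D_def[symmetric] using assms by (simp add: mult_ac)
qed

lemma ratio_deriv_mass:
  assumes "m > 0" "a > 0"
  shows "((\<lambda>m. ratio m a) has_real_derivative - (ratio m a / (nu * m))) (at m)"
proof -
  define D where "D = a powr (1 / al) / (sqrt (p / 2) / (al * amp) powr (1 / nu))"
  have eq: "ratio t a = D * t powr (- (1 / nu))" if "t > 0" for t
    unfolding ratio_def D_def using that assms al_pos amp_pos
    by (simp add: powr_divide powr_minus_divide)
  have "((\<lambda>m. D * m powr (- (1 / nu))) has_real_derivative D * (- (1 / nu) * m powr (- (1 / nu) - 1))) (at m)"
    using assms by (intro DERIV_cmult has_real_derivative_powr)
  also have "D * (- (1 / nu) * m powr (- (1 / nu) - 1)) = - (ratio m a / (nu * m))"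
    using eq[OF assms(1)] assms by (simp add: powr_diff)
  finally show ?thesis
    by (rule has_field_derivative_transform_within_open[where S = "{0<..}"]) (use assms eq in auto)
qed

lemma rho_inv_ratio_deriv:
  assumes "m > 0" "a > 0"
  shows "(rho_inv has_real_derivative 1 / (ratio m a *
     (cos (phase m a) powr nu / (nu * tail_mass (phase m a)) - sin (phase m a) / cos (phase m a))))
     (at (ratio m a))"
  using rho_inv_deriv[OF ratio_pos[of m a]] assms
  unfolding rho'_def rho_rho_inv unfolding phase_def by (simp add: inverse_eq_divide)

lemma phase_factor_pos:
  assumes "m > 0" "a > 0"
  shows "cos (phase m a) powr nu / (nu * tail_mass (phase m a)) - sin (phase m a) / cos (phase m a) > 0"
  using rho'_factor_pos[OF phase_gt[of m a] phase_less] assms by simp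

text \<open>
  The derivative of \<open>shape\<close> contains the same factor \<open>F\<close> as the derivative of \<open>rho\<close>, so that it drops out in
  the chain rule.
\<close>
lemma branch_energy_deriv_value_pos:
  assumes m: "m > 0" and a: "a > 0"
  shows "(branch_energy m has_real_derivative branch_slope m a) (at a)"
proof -
  define F where "F = cos (phase m a) powr nu / (nu * tail_mass (phase m a)) - sin (phase m a) / cos (phase m a)"
  define B C S where "B = tail_mass (phase m a)" and "C = cos (phase m a) powr (nu + 1)"
    and "S = sin (phase m a)"
  have F: "F > 0" unfolding F_def using phase_factor_pos[OF m a] .
  have B: "B > 0" using tail_mass_phase_pos[OF m] by (simp add: B_def)
  have r: "ratio m a > 0" using ratio_pos m a by simp
  define c where "c = m * (m / (al * amp)) powr (2 / nu) / (2 * (nu + 2))"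
  have dph: "(phase m has_real_derivative 1 / (al * a * F)) (at a)"
  proof -
    have "((\<lambda>a. rho_inv (ratio m a)) has_real_derivative 1 / (ratio m a * F) * (ratio m a / (al * a))) (at a)"
      by (rule DERIV_chain2[OF rho_inv_ratio_deriv[OF m a, folded F_def] ratio_deriv_value[OF m a]])
    thus ?thesis unfolding phase_def[abs_def] using r by (simp add: mult.commute mult.left_commute)
  qed
  have dsh: "(shape has_real_derivative 2 * (nu + 2) * B powr (-2 / nu) * S * C / B * F) (at (phase m a))"
    unfolding B_def C_def S_def F_def by (rule shape_deriv) (use phase_gt phase_less m a in auto)
  have "((\<lambda>a. c * shape (phase m a)) has_real_derivative
     c * (2 * (nu + 2) * B powr (-2 / nu) * S * C / B * F * (1 / (al * a * F)))) (at a)"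
    by (intro DERIV_cmult DERIV_chain2[OF dsh dph])
  also have "(\<lambda>a. c * shape (phase m a)) = branch_energy m"
    unfolding c_def using branch_energy_shape[OF m] by auto
  also have "c * (2 * (nu + 2) * B powr (-2 / nu) * S * C / B * F * (1 / (al * a * F)))
     = m * ((m / (al * amp)) powr (2 / nu) * B powr (-2 / nu)) * S * (C / (al * B)) / a"
    using F nu_pos B al_pos a by (simp add: c_def divide_simps)
  also have "(m / (al * amp)) powr (2 / nu) * B powr (-2 / nu) = (wavenum m a)\<^sup>2"
    unfolding wavenum_split[OF m] B_def[symmetric]
    by (simp add: power2_eq_square powr_add[symmetric] powr_minus_divide)
  also have "m * (wavenum m a)\<^sup>2 * S * (C / (al * B)) / a = wavenum m a * S * a\<^sup>2 / a"
    unfolding square_mass[OF m, of a] B_def[symmetric] C_def[symmetric] by (simp add: power2_eq_square)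
  also have "\<dots> = branch_slope m a" using a by (simp add: branch_slope_def S_def power2_eq_square)
  finally show ?thesis .
qed

text \<open>
  The explicit power of the mass and the phase both contribute; the terms with \<open>sin\<close> cancel. In the terms of
  the soliton equation, minus the derivative of the energy in the mass is half the Lagrange multiplier \<open>\<sigma>\<^sup>2\<close>.
\<close>
lemma branch_energy_deriv_mass:
  assumes m: "m > 0"
  shows "((\<lambda>m. branch_energy m a) has_real_derivative - (wavenum m a)\<^sup>2 / 2) (at m)"
proof -
  define c where "c = (\<lambda>m. m * (m / (al * amp)) powr (2 / nu) / (2 * (nu + 2)))"
  have dc: "(c has_real_derivative (nu + 2) / nu * c m / m) (at m)"
  proof -
    have "((\<lambda>m. (m / (al * amp)) powr (2 / nu)) has_real_derivative
        (m / (al * amp)) powr (2 / nu) * (1 / (al * amp) * (2 / nu) / (m / (al * amp)))) (at m)"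
      using DERIV_powr[OF DERIV_cdivide[OF DERIV_ident, of "al * amp"], of m "\<lambda>_. 2 / nu" 0]
        m al_pos amp_pos by simp
    from DERIV_cdivide[OF DERIV_mult[OF DERIV_ident this], of "2 * (nu + 2)"]
    show ?thesis unfolding c_def
      by (rule DERIV_cong) (use m al_pos amp_pos nu_pos in \<open>simp add: divide_simps, simp add: algebra_simps\<close>)
  qed
  have energy: "(nu + 2) / nu * branch_energy m b / m =
      ((nu + 1) * wavenum m b * sin (phase m b) * b\<^sup>2 - nu * (wavenum m b)\<^sup>2 * m) / (2 * nu * m)" for b
  proof -
    have "(nu + 2) / nu * (Z / (2 * (nu + 2))) / m = Z / (2 * nu * m)" for Z
      using m nu_pos by (simp add: divide_simps)
    thus ?thesis unfolding branch_energy_def .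
  qed
  show ?thesis
  proof (cases "a = 0")
    case True
    have eq: "branch_energy t 0 = c t * shape (-(pi/2))" if "t > 0" for t
      using branch_energy_shape[OF that, of 0] by (simp add: c_def)
    have "((\<lambda>t. c t * shape (-(pi/2))) has_real_derivative (nu + 2) / nu * c m / m * shape (-(pi/2))) (at m)"
      by (rule DERIV_cmult_right[OF dc])
    also have "(nu + 2) / nu * c m / m * shape (-(pi/2)) = (nu + 2) / nu * branch_energy m 0 / m"
      using eq[OF m] by simp
    also have "\<dots> = - (wavenum m 0)\<^sup>2 / 2" unfolding energy using m nu_pos by (simp add: field_simps)
    finally show ?thesis unfolding True
      by (rule has_field_derivative_transform_within_open[where S = "{0<..}"]) (use m eq in auto)
  next
    case False
    define b where "b = \<bar>a\<bar>"
    have b: "b > 0" using False by (simp add: b_def)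
    define F where "F = cos (phase m b) powr nu / (nu * tail_mass (phase m b)) - sin (phase m b) / cos (phase m b)"
    define B C S where "B = tail_mass (phase m b)" and "C = cos (phase m b) powr (nu + 1)"
      and "S = sin (phase m b)"
    have F: "F > 0" unfolding F_def using phase_factor_pos[OF m b] .
    have B: "B > 0" using tail_mass_phase_pos[OF m] by (simp add: B_def)
    have r: "ratio m b > 0" using ratio_pos m b by simp
    have dph: "((\<lambda>m. phase m b) has_real_derivative - (1 / (nu * m * F))) (at m)"
    proof -
      have "((\<lambda>m. rho_inv (ratio m b)) has_real_derivative 1 / (ratio m b * F) * (- (ratio m b / (nu * m)))) (at m)"
        by (rule DERIV_chain2[OF rho_inv_ratio_deriv[OF m b, folded F_def] ratio_deriv_mass[OF m b]])
      thus ?thesis unfolding phase_def[abs_def] using r by (simp add: mult.commute mult.left_commute)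
    qed
    have dsh: "(shape has_real_derivative 2 * (nu + 2) * B powr (-2 / nu) * S * C / B * F) (at (phase m b))"
      unfolding B_def C_def S_def F_def by (rule shape_deriv) (use phase_gt phase_less m b in auto)
    have W: "(m / (al * amp)) powr (2 / nu) * B powr (-2 / nu) = (wavenum m b)\<^sup>2"
      unfolding wavenum_split[OF m] B_def[symmetric]
      by (simp add: power2_eq_square powr_add[symmetric] powr_minus_divide)
    have S: "b\<^sup>2 * (al * B) = wavenum m b * m * C"
      unfolding square_mass[OF m, of b] B_def[symmetric] C_def[symmetric] using B al_pos by simp
    have eq: "branch_energy t b = c t * shape (phase t b)" if "t > 0" for t
      using branch_energy_shape[OF that, of b] by (simp add: c_def)
    have "((\<lambda>t. c t * shape (phase t b)) has_real_derivative
       (nu + 2) / nu * c m / m * shape (phase m b) +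
       2 * (nu + 2) * B powr (-2 / nu) * S * C / B * F * (- (1 / (nu * m * F))) * c m) (at m)"
      by (rule DERIV_mult[OF dc DERIV_chain2[OF dsh dph]])
    also have "(nu + 2) / nu * c m / m * shape (phase m b) = (nu + 2) / nu * branch_energy m b / m"
      using eq[OF m] by simp
    also have "2 * (nu + 2) * B powr (-2 / nu) * S * C / B * F * (- (1 / (nu * m * F))) * c m
      = - (((m / (al * amp)) powr (2 / nu) * B powr (-2 / nu)) * S * C / (nu * B))"
      using F m nu_pos B by (simp add: c_def divide_simps) (simp add: algebra_simps)?
    also have "\<dots> = - (wavenum m b * (wavenum m b * m * C) * S / (nu * m * B))"
      unfolding W using m by (simp add: power2_eq_square)
    also have "\<dots> = - ((nu + 1) * wavenum m b * S * b\<^sup>2 / (2 * nu * m))"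
      unfolding S[symmetric] two_al[symmetric] using B by simp
    also have "(nu + 2) / nu * branch_energy m b / m + \<dots> = - (wavenum m b)\<^sup>2 / 2"
      unfolding energy S_def using m nu_pos by (simp add: field_simps)
    finally have "((\<lambda>m. branch_energy m b) has_real_derivative - (wavenum m b)\<^sup>2 / 2) (at m)"
      by (rule has_field_derivative_transform_within_open[where S = "{0<..}"]) (use m eq in auto)
    thus ?thesis by (simp add: b_def)
  qed
qed

lemma tail_mass_antimono:
  "-(pi/2) \<le> s \<Longrightarrow> s \<le> t \<Longrightarrow> t \<le> pi/2 \<Longrightarrow> tail_mass t \<le> tail_mass s"
  using tail_mass_strict_antimono[of s t] by (cases "s = t") auto

lemma phase_mono: "m > 0 \<Longrightarrow> 0 \<le> a \<Longrightarrow> a \<le> b \<Longrightarrow> phase m a \<le> phase m b"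
  using phase_strict_mono[of m a b] by (cases "a = b") auto

lemma wavenum_mono:
  assumes "m > 0" "0 \<le> a" "a \<le> b"
  shows "wavenum m a \<le> wavenum m b"
proof -
  have "tail_mass (phase m b) \<le> tail_mass (phase m a)"
    using phase_mono[OF assms] phase_ge[of m a] phase_less[of m b] assms
    by (intro tail_mass_antimono) auto
  thus ?thesis unfolding wavenum_def
    using assms tail_mass_phase_pos[of m a] tail_mass_phase_pos[of m b] al_pos amp_pos nu_pos
    by (intro powr_mono2 divide_left_mono mult_left_mono mult_pos_pos) auto
qed

lemma continuous_on_ratio: "continuous_on ({0<..} \<times> UNIV) (\<lambda>(m, a). ratio m a)"
proof -
  have "continuous_on ({0<..} \<times> UNIV) (\<lambda>x. \<bar>snd x\<bar> powr (1 / al) /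
      (sqrt (p / 2) * (fst x / (al * amp)) powr (1 / nu)) :: real)"
    using al_pos amp_pos half_p_pos
    by (intro continuous_on_divide continuous_on_mult continuous_on_powr' continuous_on_const
          continuous_on_rabs continuous_on_snd continuous_on_fst continuous_on_id) auto
  thus ?thesis by (simp add: ratio_def case_prod_unfold)
qed

lemma continuous_on_phase: "continuous_on ({0<..} \<times> UNIV) (\<lambda>(m, a). phase m a)"
proof -
  have "continuous_on UNIV rho_inv" using isCont_rho_inv by (simp add: continuous_on_eq_continuous_at)
  hence "continuous_on ({0<..} \<times> UNIV) (\<lambda>x. rho_inv ((\<lambda>(m, a). ratio m a) x))"
    by (rule continuous_on_compose2[OF _ continuous_on_ratio]) auto
  thus ?thesis by (simp add: phase_def case_prod_unfold)
qed

lemma continuous_on_wavenum: "continuous_on ({0<..} \<times> UNIV) (\<lambda>(m, a). wavenum m a)"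
proof -
  have "continuous_on ({0<..} \<times> UNIV) (\<lambda>x. tail_mass ((\<lambda>(m, a). phase m a) x))"
    by (rule continuous_on_compose2[OF continuous_on_tail_mass continuous_on_phase])
       (auto simp: phase_ge phase_le_twice)
  hence "continuous_on ({0<..} \<times> UNIV)
     (\<lambda>x. (fst x / (al * amp * tail_mass (phase (fst x) (snd x)))) powr (1 / nu))"
    using al_pos amp_pos nu_pos
    by (intro continuous_on_divide continuous_on_mult continuous_on_powr' continuous_on_const
          continuous_on_snd continuous_on_fst continuous_on_id)
       (auto simp: case_prod_unfold intro!: divide_nonneg_nonneg mult_nonneg_nonneg
          less_imp_le[OF tail_mass_phase_pos] simp: tail_mass_phase_neq)
  thus ?thesis by (simp add: wavenum_def case_prod_unfold)
qed

lemma continuous_on_branch_slope: "continuous_on ({0<..} \<times> UNIV) (\<lambda>(m, a). branch_slope m a)"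
  using continuous_on_phase continuous_on_wavenum unfolding branch_slope_def case_prod_unfold
  by (intro continuous_intros) auto

lemma continuous_on_branch_energy: "continuous_on ({0<..} \<times> UNIV) (\<lambda>(m, a). branch_energy m a)"
  using continuous_on_phase continuous_on_wavenum nu_pos unfolding branch_energy_def case_prod_unfold
  by (intro continuous_intros) auto

lemma continuous_on_branch_energy_value:
  assumes "m > 0"
  shows "continuous_on S (branch_energy m)"
proof -
  have "continuous_on S (\<lambda>a. (\<lambda>(m, a). branch_energy m a) (m, a))"
    by (rule continuous_on_compose2[OF continuous_on_branch_energy])
       (use assms in \<open>auto intro!: continuous_intros\<close>)
  thus ?thesis by simp
qed

text \<open>
  At \<open>a = 0\<close> the phase is not differentiable; there the derivative comes from the quadratic bound that the
  mean value theorem gives for the increment.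
\<close>
lemma branch_energy_deriv_value:
  assumes m: "m > 0"
  shows "(branch_energy m has_real_derivative branch_slope m a) (at a)"
proof -
  consider "a > 0" | "a < 0" | "a = 0" by linarith
  thus ?thesis
  proof cases
    case 1 thus ?thesis using branch_energy_deriv_value_pos[OF m] by blast
  next
    case 2
    hence "(branch_energy m has_real_derivative branch_slope m (- a)) (at (- a))"
      by (intro branch_energy_deriv_value_pos[OF m]) auto
    hence "((\<lambda>x. branch_energy m (- x)) has_real_derivative - branch_slope m (- a)) (at a)"
      by (simp only: DERIV_mirror)
    thus ?thesis by (simp add: branch_slope_def)
  next
    case 3
    have pos: "\<bar>branch_energy m h - branch_energy m 0\<bar> \<le> h * h * wavenum m 1"
      if "0 < h" "h \<le> 1" for h
    proof -
      have "\<exists>l z. 0 < z \<and> z < h \<and> DERIV (branch_energy m) z :> l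
          \<and> branch_energy m h - branch_energy m 0 = (h - 0) * l"
      proof (rule MVT[OF \<open>0 < h\<close> continuous_on_branch_energy_value[OF m]])
        show "\<And>x. 0 < x \<Longrightarrow> x < h \<Longrightarrow> branch_energy m differentiable (at x)"
          using branch_energy_deriv_value_pos[OF m] real_differentiable_def by blast
      qed
      then obtain x where x: "0 < x" "x < h"
        "branch_energy m h - branch_energy m 0 = (h - 0) * branch_slope m x"
        using DERIV_unique branch_energy_deriv_value_pos[OF m] by blast
      have "\<bar>branch_slope m x\<bar> \<le> h * wavenum m 1"
      proof -
        have "\<bar>branch_slope m x\<bar> \<le> x * wavenum m x * 1"
          unfolding branch_slope_def abs_mult using x wavenum_pos[OF m, of x]
          by (intro mult_mono) auto
        also have "\<dots> \<le> h * wavenum m 1"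
          using x that wavenum_pos[OF m, of x] wavenum_mono[OF m, of x 1] by (auto intro: mult_mono)
        finally show ?thesis .
      qed
      thus ?thesis unfolding x(3) using that by (simp add: abs_mult)
    qed
    have "(branch_energy m has_real_derivative 0) (at 0)"
      unfolding has_field_derivative_iff
    proof (rule Lim_null_comparison[where g = "\<lambda>h. \<bar>h\<bar> * wavenum m 1"])
      have "\<forall>\<^sub>F h in at (0::real). h \<in> {-1<..<1}"
        by (rule eventually_at_in_open') auto
      moreover have "\<forall>\<^sub>F h in at (0::real). h \<noteq> 0" by (simp add: eventually_at_filter)
      ultimately show "\<forall>\<^sub>F h in at 0.
         norm ((branch_energy m h - branch_energy m 0) / (h - 0)) \<le> \<bar>h\<bar> * wavenum m 1"
      proof eventually_elim
        case (elim h)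
        have "\<bar>branch_energy m \<bar>h\<bar> - branch_energy m 0\<bar> \<le> \<bar>h\<bar> * \<bar>h\<bar> * wavenum m 1"
          using elim by (intro pos) auto
        thus ?case using elim by (simp add: abs_divide divide_le_eq mult_ac)
      qed
      show "((\<lambda>h. \<bar>h\<bar> * wavenum m 1) \<longlongrightarrow> 0) (at 0)"
        by (rule tendsto_eq_intros refl | simp)+
    qed
    thus ?thesis by (simp add: 3 branch_slope_def)
  qed
qed

end

section \<open>Solitons, scaling and bounds for the value function\<close>

context subcritical
begin

text \<open>
  The value 0 at the vertex is approached by solitons that move away to infinity, so this is the energy of
  the soliton of mass \<open>m\<close> on the whole line.
\<close>
definition soliton_energy :: "real \<Rightarrow> real" where
  "soliton_energy m = branch_energy m 0"

definition soliton_const :: real where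
  "soliton_const = nu / (2 * (nu + 2)) * (al * amp * tail_mass (-(pi/2))) powr (-2 / nu)"

lemma total_tail_pos: "tail_mass (-(pi/2)) > 0"
  by (rule tail_mass_pos) auto

lemma soliton_const_pos: "soliton_const > 0"
  unfolding soliton_const_def using nu_pos al_pos amp_pos total_tail_pos by simp

lemma soliton_energy_wavenum:
  "soliton_energy m = - (nu / (2 * (nu + 2)) * (wavenum m 0)\<^sup>2 * m)"
  by (simp add: soliton_energy_def branch_energy_def)

lemma soliton_energy_eq:
  assumes "m \<ge> 0"
  shows "soliton_energy m = - (soliton_const * m powr (1 + 2 / nu))"
proof (cases "m = 0")
  case False
  hence m: "m > 0" using assms by simp
  have "(wavenum m 0)\<^sup>2 = (m / (al * amp * tail_mass (-(pi/2)))) powr (2 / nu)"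
    unfolding wavenum_zero by (simp add: power2_eq_square powr_add[symmetric])
  also have "\<dots> = m powr (2 / nu) * (al * amp * tail_mass (-(pi/2))) powr (-2 / nu)"
    by (simp add: powr_divide powr_minus_divide)
  finally show ?thesis unfolding soliton_energy_wavenum soliton_const_def
    using m by (simp add: powr_add)
qed (simp add: soliton_energy_wavenum)

lemma soliton_energy_0 [simp]: "soliton_energy 0 = 0" by (simp add: soliton_energy_wavenum)

lemma soliton_energy_nonpos: "m \<ge> 0 \<Longrightarrow> soliton_energy m \<le> 0"
  using soliton_const_pos by (simp add: soliton_energy_eq)

text \<open>
  One soliton beats several: the power \<open>1 + 2/nu\<close> of the mass is superadditive.
\<close>
lemma soliton_energy_superadditive:
  assumes "finite A" "\<And>i. i \<in> A \<Longrightarrow> m i \<ge> 0"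
  shows "soliton_energy (\<Sum>i\<in>A. m i) \<le> (\<Sum>i\<in>A. soliton_energy (m i))"
proof -
  define M where "M = (\<Sum>i\<in>A. m i)"
  have M: "M \<ge> 0" "\<And>i. i \<in> A \<Longrightarrow> m i \<le> M"
    unfolding M_def using assms by (auto intro!: sum_nonneg member_le_sum)
  have "(\<Sum>i\<in>A. m i powr (1 + 2 / nu)) \<le> (\<Sum>i\<in>A. m i * M powr (2 / nu))"
  proof (rule sum_mono)
    fix i assume i: "i \<in> A"
    have "m i powr (2 / nu) \<le> M powr (2 / nu)"
      using M i assms nu_pos by (intro powr_mono2) auto
    hence "m i * m i powr (2 / nu) \<le> m i * M powr (2 / nu)"
      using assms i by (intro mult_left_mono) auto
    thus "m i powr (1 + 2 / nu) \<le> m i * M powr (2 / nu)"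
      using assms(2)[OF i] by (cases "m i = 0") (auto simp: powr_add)
  qed
  also have "\<dots> = M * M powr (2 / nu)" by (simp add: M_def sum_distrib_right)
  also have "\<dots> = M powr (1 + 2 / nu)" using M by (cases "M = 0") (auto simp: powr_add)
  finally have "soliton_const * (\<Sum>i\<in>A. m i powr (1 + 2 / nu)) \<le> soliton_const * M powr (1 + 2 / nu)"
    using soliton_const_pos by (intro mult_left_mono) auto
  moreover have "(\<Sum>i\<in>A. soliton_energy (m i)) = - (soliton_const * (\<Sum>i\<in>A. m i powr (1 + 2 / nu)))"
    using assms by (simp add: soliton_energy_eq sum_distrib_left sum_negf)
  ultimately show ?thesis using M by (simp add: soliton_energy_eq M_def)
qed

lemma tail_mass_reflect:
  assumes "-(pi/2) \<le> \<theta>" "\<theta> \<le> pi/2"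
  shows "tail_mass (- \<theta>) = tail_mass (-(pi/2)) - tail_mass \<theta>"
proof -
  have "tail_mass (- \<theta>) = integral {-\<theta>.. - (-(pi/2))} (\<lambda>t. cos (- t) powr nu)"
    by (simp add: tail_mass_def)
  also have "\<dots> = integral {-(pi/2)..\<theta>} (\<lambda>t. cos t powr nu)"
    by (rule Henstock_Kurzweil_Integration.integral_reflect_real)
  finally show ?thesis using tail_mass_alt[OF assms] by simp
qed

text \<open>
  Mass and initial value of the soliton piece with wave number \<open>\<sigma>\<close> that starts at the phase \<open>\<theta>\<close>.
\<close>
definition coord_mass :: "real \<Rightarrow> real \<Rightarrow> real" where
  "coord_mass \<sigma> \<theta> = al * amp * \<sigma> powr nu * tail_mass \<theta>"

definition coord_value :: "real \<Rightarrow> real \<Rightarrow> real" where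
  "coord_value \<sigma> \<theta> = sqrt amp * (\<sigma> * cos \<theta>) powr al"

lemma coord_mass_pos: "\<sigma> > 0 \<Longrightarrow> -(pi/2) \<le> \<theta> \<Longrightarrow> \<theta> < pi/2 \<Longrightarrow> coord_mass \<sigma> \<theta> > 0"
  using al_pos amp_pos tail_mass_pos[of \<theta>] by (simp add: coord_mass_def)

lemma coord_value_pos: "\<sigma> > 0 \<Longrightarrow> -(pi/2) < \<theta> \<Longrightarrow> \<theta> < pi/2 \<Longrightarrow> coord_value \<sigma> \<theta> > 0"
  using amp_pos cos_pos'[of \<theta>] by (simp add: coord_value_def)

lemma coord_value_nonneg: "coord_value \<sigma> \<theta> \<ge> 0"
  using amp_pos by (simp add: coord_value_def)

lemma coord_value_minus: "coord_value \<sigma> (- \<theta>) = coord_value \<sigma> \<theta>"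
  by (simp add: coord_value_def)

lemma phase_coord:
  assumes "\<sigma> > 0" "-(pi/2) \<le> \<theta>" "\<theta> < pi/2"
  shows "phase (coord_mass \<sigma> \<theta>) (coord_value \<sigma> \<theta>) = \<theta>"
    and "wavenum (coord_mass \<sigma> \<theta>) (coord_value \<sigma> \<theta>) = \<sigma>"
  using coords_inverse[OF assms coord_mass_def, of "coord_value \<sigma> \<theta>"] coord_value_nonneg[of \<sigma> \<theta>]
  by (auto simp: coord_value_def)

lemma coord_mass_inverse: "m > 0 \<Longrightarrow> coord_mass (wavenum m a) (phase m a) = m"
  using mass_eq[of m a] by (simp add: coord_mass_def)

lemma coord_value_inverse: "m > 0 \<Longrightarrow> coord_value (wavenum m a) (phase m a) = \<bar>a\<bar>"
  using abs_eq[of m a] by (simp add: coord_value_def)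

lemma coord_value_square:
  assumes "\<sigma> > 0" "-(pi/2) \<le> \<theta>" "\<theta> < pi/2"
  shows "(coord_value \<sigma> \<theta>)\<^sup>2 = amp * \<sigma> powr (nu + 1) * cos \<theta> powr (nu + 1)"
  using square_eq[OF coord_mass_pos[OF assms], of "coord_value \<sigma> \<theta>"]
  by (simp only: phase_coord[OF assms])

lemma coord_energy:
  assumes "\<sigma> > 0" "-(pi/2) \<le> \<theta>" "\<theta> < pi/2"
  shows "branch_energy (coord_mass \<sigma> \<theta>) (coord_value \<sigma> \<theta>)
    = al * amp * \<sigma> powr (nu + 2) * (2 * sin \<theta> * cos \<theta> powr (nu + 1) - nu * tail_mass \<theta>) / (2 * (nu + 2))"
proof -
  have 1: "(nu + 1) * \<sigma> * sin \<theta> * (coord_value \<sigma> \<theta>)\<^sup>2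
     = al * amp * \<sigma> powr (nu + 2) * (2 * sin \<theta> * cos \<theta> powr (nu + 1))"
  proof -
    have "\<sigma> powr (nu + 2) = \<sigma> powr (nu + 1) * \<sigma>"
      using assms powr_add[of \<sigma> "nu + 1" 1] by (simp add: add.commute)
    thus ?thesis unfolding coord_value_square[OF assms] by (simp add: two_al[symmetric])
  qed
  have 2: "\<sigma>\<^sup>2 * coord_mass \<sigma> \<theta> = al * amp * \<sigma> powr (nu + 2) * tail_mass \<theta>"
  proof -
    have "\<sigma> powr (nu + 2) = \<sigma> powr nu * \<sigma>\<^sup>2"
      using assms powr_add[of \<sigma> nu 2] by (simp add: powr_numeral)
    thus ?thesis by (simp add: coord_mass_def)
  qed
  show ?thesis unfolding branch_energy_def phase_coord[OF assms] using 1 2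
    by (simp add: algebra_simps)
qed

lemma wavenum_zero_coord:
  assumes "\<sigma> > 0"
  shows "wavenum (coord_mass \<sigma> (-(pi/2))) 0 = \<sigma>"
  using phase_coord(2)[OF assms, of "-(pi/2)"] by (simp add: coord_value_def)

text \<open>
  Pieces starting at opposite phases have the same initial value and fit together to a whole soliton.
\<close>
lemma bump_tail_pair:
  assumes "\<sigma> > 0" "-(pi/2) < \<theta>" "\<theta> < pi/2"
  shows "coord_mass \<sigma> (- \<theta>) + coord_mass \<sigma> \<theta> = coord_mass \<sigma> (-(pi/2))"
    and "branch_energy (coord_mass \<sigma> (- \<theta>)) (coord_value \<sigma> \<theta>)
       + branch_energy (coord_mass \<sigma> \<theta>) (coord_value \<sigma> \<theta>) = soliton_energy (coord_mass \<sigma> (-(pi/2)))"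
proof -
  show m: "coord_mass \<sigma> (- \<theta>) + coord_mass \<sigma> \<theta> = coord_mass \<sigma> (-(pi/2))"
    unfolding coord_mass_def ring_distribs(1)[symmetric] using tail_mass_reflect[of \<theta>] assms by simp
  have "branch_energy (coord_mass \<sigma> (- \<theta>)) (coord_value \<sigma> (- \<theta>))
       + branch_energy (coord_mass \<sigma> \<theta>) (coord_value \<sigma> \<theta>)
      = - (nu / (2 * (nu + 2)) * \<sigma>\<^sup>2 * (coord_mass \<sigma> (- \<theta>) + coord_mass \<sigma> \<theta>))"
    unfolding branch_energy_def coord_value_minus
    using phase_coord[of \<sigma> \<theta>] phase_coord[of \<sigma> "- \<theta>"] assms nu_pos
    by (simp add: coord_value_minus add_divide_distrib diff_divide_distrib ring_distribs)
  also have "\<dots> = soliton_energy (coord_mass \<sigma> (-(pi/2)))"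
    unfolding m soliton_energy_wavenum wavenum_zero_coord[OF assms(1)] ..
  finally show "branch_energy (coord_mass \<sigma> (- \<theta>)) (coord_value \<sigma> \<theta>)
       + branch_energy (coord_mass \<sigma> \<theta>) (coord_value \<sigma> \<theta>) = soliton_energy (coord_mass \<sigma> (-(pi/2)))"
    by (simp add: coord_value_minus)
qed

text \<open>
  Only the wave number changes when mass and value are scaled like this; the phase is kept.
\<close>
lemma branch_energy_scaling:
  assumes "t > 0" "m > 0" "a \<ge> 0"
  shows "branch_energy (t * m) (t powr (al / nu) * a) = t powr (1 + 2 / nu) * branch_energy m a"
proof -
  define \<sigma> \<theta> where "\<sigma> = wavenum m a" and "\<theta> = phase m a"
  have \<sigma>: "\<sigma> > 0" and \<theta>: "-(pi/2) \<le> \<theta>" "\<theta> < pi/2"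
    unfolding \<sigma>_def \<theta>_def using assms wavenum_pos phase_ge phase_less by blast+
  define s where "s = t powr (1 / nu) * \<sigma>"
  have s: "s > 0" using \<sigma> assms by (simp add: s_def)
  have m: "coord_mass s \<theta> = t * m"
    using coord_mass_inverse[OF assms(2), of a] assms nu_pos \<sigma>
    by (simp add: coord_mass_def s_def \<sigma>_def \<theta>_def powr_mult powr_powr)
  have a: "coord_value s \<theta> = t powr (al / nu) * a"
  proof -
    have "(s * cos \<theta>) powr al = (t powr (1 / nu)) powr al * (\<sigma> * cos \<theta>) powr al"
      unfolding s_def by (simp add: powr_mult mult.assoc)
    thus ?thesis
      using coord_value_inverse[OF assms(2), of a] assms
      by (simp add: coord_value_def \<sigma>_def \<theta>_def powr_powr)
  qed
  have "branch_energy (t * m) (t powr (al / nu) * a) = (t powr (1 / nu)) powr (nu + 2) *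
     (al * amp * \<sigma> powr (nu + 2) * (2 * sin \<theta> * cos \<theta> powr (nu + 1) - nu * tail_mass \<theta>) / (2 * (nu + 2)))"
    using coord_energy[OF s \<theta>] unfolding m a by (simp add: s_def powr_mult)
  also have "al * amp * \<sigma> powr (nu + 2) * (2 * sin \<theta> * cos \<theta> powr (nu + 1) - nu * tail_mass \<theta>) / (2 * (nu + 2))
     = branch_energy m a"
    using coord_energy[OF \<sigma> \<theta>] coord_mass_inverse[OF assms(2), of a] coord_value_inverse[OF assms(2), of a] assms
    by (simp add: \<sigma>_def \<theta>_def)
  also have "(t powr (1 / nu)) powr (nu + 2) = t powr (1 + 2 / nu)"
    using nu_pos by (simp add: powr_powr add_divide_distrib)
  finally show ?thesis .
qed

text \<open>
  The wave number of the half-soliton of mass \<open>m\<close>, the largest one among the pieces of mass \<open>m\<close> with phase at most 0.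
\<close>
definition max_wavenum :: "real \<Rightarrow> real" where
  "max_wavenum m = (m / (al * amp * tail_mass 0)) powr (1 / nu)"

lemma tail_mass_0_pos: "tail_mass 0 > 0" by (rule tail_mass_pos) auto

lemma max_wavenum_mono: "0 \<le> m \<Longrightarrow> m \<le> m' \<Longrightarrow> max_wavenum m \<le> max_wavenum m'"
  unfolding max_wavenum_def using nu_pos al_pos amp_pos tail_mass_0_pos
  by (intro powr_mono2 divide_right_mono) auto

lemma max_wavenum_nonneg: "max_wavenum m \<ge> 0"
  by (simp add: max_wavenum_def)

lemma branch_slope_ge:
  assumes "m > 0" "a \<ge> 0"
  shows "branch_slope m a \<ge> - (max_wavenum m * a)"
proof (cases "phase m a \<ge> 0")
  case True
  have "sin (phase m a) \<ge> 0" by (rule sin_ge_zero) (use True phase_less[of m a] pi_gt_zero in linarith)+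
  hence "branch_slope m a \<ge> 0"
    using wavenum_pos[OF assms(1), of a] assms by (simp add: branch_slope_def)
  moreover have "max_wavenum m * a \<ge> 0" using max_wavenum_nonneg assms by simp
  ultimately show ?thesis by linarith
next
  case False
  have "tail_mass 0 \<le> tail_mass (phase m a)"
    using False phase_ge[OF assms(1), of a] by (intro tail_mass_antimono) auto
  hence w: "wavenum m a \<le> max_wavenum m"
    unfolding wavenum_def max_wavenum_def
    using assms tail_mass_0_pos tail_mass_phase_pos[OF assms(1), of a] al_pos amp_pos nu_pos
    by (intro powr_mono2 divide_left_mono mult_left_mono mult_pos_pos) auto
  have "- branch_slope m a \<le> a * wavenum m a * 1"
    unfolding branch_slope_def mult_minus_right[symmetric]
    using assms wavenum_pos[OF assms(1), of a] sin_ge_minus_one[of "phase m a"]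
    by (intro mult_left_mono) auto
  also have "\<dots> \<le> a * max_wavenum m" using w assms by (simp add: mult_left_mono)
  finally show ?thesis by (simp add: mult.commute)
qed

lemma branch_energy_ge_soliton:
  assumes "m > 0" "a \<ge> 0"
  shows "branch_energy m a \<ge> soliton_energy m - max_wavenum m * a\<^sup>2 / 2"
proof -
  have "branch_energy m 0 + max_wavenum m * 0\<^sup>2 / 2 \<le> branch_energy m a + max_wavenum m * a\<^sup>2 / 2"
  proof (rule DERIV_nonneg_imp_nondecreasing[OF assms(2)])
    fix x assume x: "0 \<le> x" "x \<le> a"
    have "((\<lambda>x. branch_energy m x + max_wavenum m * x\<^sup>2 / 2) has_real_derivative
       branch_slope m x + max_wavenum m * x) (at x)"
      by (auto intro!: derivative_eq_intros branch_energy_deriv_value[OF assms(1)])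
    thus "\<exists>y. ((\<lambda>x. branch_energy m x + max_wavenum m * x\<^sup>2 / 2) has_real_derivative y) (at x) \<and> 0 \<le> y"
      using branch_slope_ge[OF assms(1) x(1)] by (intro exI conjI) auto
  qed
  thus ?thesis by (simp add: soliton_energy_def)
qed

lemma wavenum_square_bound:
  assumes "m > 0" "phase m a \<le> pi/4"
  shows "(wavenum m a)\<^sup>2 * m \<le> (al * amp * tail_mass (pi/4)) powr (-2 / nu) * m powr (1 + 2 / nu)"
proof -
  have B: "tail_mass (pi/4) > 0" by (rule tail_mass_pos) auto
  have "tail_mass (pi/4) \<le> tail_mass (phase m a)"
    using assms phase_ge[OF assms(1), of a] by (intro tail_mass_antimono) auto
  hence "wavenum m a \<le> (m / (al * amp * tail_mass (pi/4))) powr (1 / nu)"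
    unfolding wavenum_def
    using assms B tail_mass_phase_pos[OF assms(1), of a] al_pos amp_pos nu_pos
    by (intro powr_mono2 divide_left_mono mult_left_mono mult_pos_pos) auto
  hence "(wavenum m a)\<^sup>2 \<le> ((m / (al * amp * tail_mass (pi/4))) powr (1 / nu))\<^sup>2"
    using wavenum_pos[OF assms(1), of a] by (intro power_mono) auto
  also have "\<dots> = m powr (2 / nu) * (al * amp * tail_mass (pi/4)) powr (-2 / nu)"
    by (simp add: power2_eq_square powr_add[symmetric] powr_divide powr_minus_divide)
  finally have "(wavenum m a)\<^sup>2 * m \<le> m powr (2 / nu) * (al * amp * tail_mass (pi/4)) powr (-2 / nu) * m"
    using assms by (intro mult_right_mono) auto
  thus ?thesis using assms by (simp add: powr_add mult_ac)
qed

text \<open>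
  The lower bound gives coercivity in the reduced problem: \<open>a\<^sup>4 / m\<close> grows faster than the vertex term
  \<open>a\<^sup>q\<close> as \<open>q < 4\<close>. The upper bound makes \<open>W(m(x), u(x))\<close> tend to 0 along a function in \<open>H\<^sup>1\<close>. Below the phase
  \<open>pi/4\<close> the term \<open>\<sigma>\<^sup>2 m\<close> is controlled by the power of the mass, above it by \<open>a\<^sup>4 / m\<close>.
\<close>
lemma branch_energy_bounds:
  obtains C where "C > 0"
    and "\<And>m a. m > 0 \<Longrightarrow> \<bar>branch_energy m a\<bar> \<le> C * (m powr (1 + 2 / nu) + a ^ 4 / m)"
    and "\<And>m a. m > 0 \<Longrightarrow> branch_energy m a \<ge> a ^ 4 / m / (8 * (nu + 2)) - C * m powr (1 + 2 / nu)"
proof -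
  define D where "D = (al * amp * tail_mass (pi/4)) powr (-2 / nu)"
  have D: "D \<ge> 0" by (simp add: D_def)
  have sqrt2: "(sin (pi/4))\<^sup>2 = (1/2::real)" by (simp add: sin_45 power_divide)
  have main: "\<bar>branch_energy m a\<bar> \<le> 2 * (D * m powr (1 + 2 / nu) + a ^ 4 / m) \<and>
     branch_energy m a \<ge> a ^ 4 / m / (8 * (nu + 2)) - 3 * D * m powr (1 + 2 / nu)" if m: "m > 0" for m a
  proof -
    define X where "X = (wavenum m a)\<^sup>2 * m"
    define S where "S = sin (phase m a)"
    define B where "B = tail_mass (phase m a)"
    (* in terms of X and c one has W = X ((nu + 1) S c - nu) / (2 (nu + 2)) and a^4/m = X c^2 *)
    define c where "c = cos (phase m a) powr (nu + 1) / (al * B)"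
    have X: "X > 0" using wavenum_pos[OF m, of a] m by (simp add: X_def)
    have B: "B > 0" using tail_mass_phase_pos[OF m] by (simp add: B_def)
    have a2: "a\<^sup>2 = wavenum m a * m * c" using square_mass[OF m, of a] by (simp add: c_def B_def)
    have a4: "a ^ 4 / m = X * c\<^sup>2"
    proof -
      have "a ^ 4 = (a\<^sup>2)\<^sup>2" by simp
      thus ?thesis unfolding a2 X_def using m by (simp add: power2_eq_square)
    qed
    have E: "branch_energy m a = X * ((nu + 1) * S * c - nu) / (2 * (nu + 2))"
      unfolding branch_energy_def X_def S_def a2 by (simp add: power2_eq_square algebra_simps)
    have c0: "c \<ge> 0" using B al_pos by (simp add: c_def)
    have c2: "c \<le> 2"
    proof -
      have "cos (phase m a) powr (nu + 1) < 2 * al * B"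
        using tail_mass_lower[OF phase_ge[OF m] phase_less, of a] nu_pos
        unfolding two_al B_def by (simp add: divide_less_eq mult.commute)
      thus ?thesis using B al_pos by (simp add: c_def divide_le_eq mult_ac)
    qed
    have S1: "\<bar>S\<bar> \<le> 1" by (simp add: S_def abs_sin_le_one)
    have "\<bar>S * c\<bar> \<le> 1 * 2" unfolding abs_mult using S1 c0 c2 by (intro mult_mono) auto
    hence Sc: "-2 \<le> S * c" "S * c \<le> 2" by auto
    have "(nu + 1) * (S * c) \<le> (nu + 1) * 2" "(nu + 1) * (- 2) \<le> (nu + 1) * (S * c)"
      using Sc nu_pos by (intro mult_left_mono; simp)+
    hence "\<bar>(nu + 1) * S * c - nu\<bar> \<le> 2 * (2 * (nu + 2))" using nu_pos by (simp add: mult.assoc abs_le_iff)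
    hence "X * \<bar>(nu + 1) * S * c - nu\<bar> / (2 * (nu + 2)) \<le> X * (2 * (2 * (nu + 2))) / (2 * (nu + 2))"
      using X nu_pos by (intro divide_right_mono mult_left_mono) auto
    moreover have "\<bar>branch_energy m a\<bar> = X * \<bar>(nu + 1) * S * c - nu\<bar> / (2 * (nu + 2))"
      unfolding E using X nu_pos by (simp add: abs_mult)
    ultimately have "\<bar>branch_energy m a\<bar> \<le> X * (2 * (2 * (nu + 2))) / (2 * (nu + 2))" by simp
    moreover have "X * (2 * (2 * (nu + 2))) / (2 * (nu + 2)) = 2 * X"
      using nu_pos by (simp add: divide_simps)
    ultimately have EX: "\<bar>branch_energy m a\<bar> \<le> 2 * X" by simp
    have k: "a ^ 4 / m / (8 * (nu + 2)) \<le> X * 4 / (8 * (nu + 2))"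
    proof -
      have "c\<^sup>2 \<le> 2\<^sup>2" using c0 c2 by (intro power_mono)
      thus ?thesis unfolding a4 using X nu_pos by (intro divide_right_mono mult_left_mono) auto
    qed
    show ?thesis
    proof (cases "phase m a \<le> pi/4")
      case True
      have XD: "X \<le> D * m powr (1 + 2 / nu)"
        unfolding X_def D_def by (rule wavenum_square_bound[OF m True])
      moreover have "a ^ 4 / m \<ge> 0" unfolding a4 using X by simp
      moreover have "X * 4 / (8 * (nu + 2)) \<le> X" using X nu_pos by (simp add: divide_le_eq)
      ultimately show ?thesis using EX k by (auto simp: abs_le_iff)
    next
      case False
      have "sin (pi/4) < S" unfolding S_def using False phase_less[of m a]
        by (intro sin_monotone_2pi) auto
      moreover have "0 < sin (pi/4)" by (rule sin_gt_zero) auto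
      ultimately have S: "S > 0" "S\<^sup>2 \<ge> 1/2"
        using sqrt2 power_mono[of "sin (pi/4)" S 2] by linarith+
      have "2 * al * (S * B) < cos (phase m a) powr (nu + 1)"
        using tail_mass_upper[OF phase_ge[OF m] phase_less, of a] nu_pos
        unfolding B_def S_def two_al by (simp add: less_divide_eq mult.commute)
      hence cS: "c \<ge> 2 * S" using B al_pos by (simp add: c_def le_divide_eq mult_ac)
      have "S * c \<ge> S * (2 * S)" using cS S by (intro mult_left_mono) auto
      moreover have "S * (2 * S) = 2 * S\<^sup>2" by (simp add: power2_eq_square)
      ultimately have Sc1: "S * c \<ge> 1" using S by linarith
      have "c\<^sup>2 \<ge> (2 * S)\<^sup>2" using cS S by (intro power_mono) auto
      hence "c\<^sup>2 \<ge> 1" using S by (simp add: power_mult_distrib)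
      hence Xa: "X \<le> a ^ 4 / m" unfolding a4 using X by simp
      have "(nu + 1) * 1 \<le> (nu + 1) * (S * c)" using Sc1 nu_pos by (intro mult_left_mono) auto
      hence "X * 1 \<le> X * ((nu + 1) * S * c - nu)" using X by (intro mult_left_mono) (auto simp: mult.assoc)
      hence "branch_energy m a \<ge> X / (2 * (nu + 2))"
        unfolding E using nu_pos by (intro divide_right_mono) auto
      also have "X / (2 * (nu + 2)) = X * 4 / (8 * (nu + 2))" using nu_pos by (simp add: divide_simps)
      finally have "branch_energy m a \<ge> a ^ 4 / m / (8 * (nu + 2))" using k by linarith
      moreover have "D * m powr (1 + 2 / nu) \<ge> 0" using D by simp
      ultimately show ?thesis using EX Xa by (auto simp: abs_le_iff)
    qed
  qed
  show ?thesis
  proof (rule that[of "3 * D + 2"])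
    show "\<bar>branch_energy m a\<bar> \<le> (3 * D + 2) * (m powr (1 + 2 / nu) + a ^ 4 / m)" if "m > 0" for m a
    proof -
      have "2 * (D * m powr (1 + 2 / nu) + a ^ 4 / m) \<le> (3 * D + 2) * (m powr (1 + 2 / nu) + a ^ 4 / m)"
      proof -
        have "(3 * D + 2) * (x + y) - 2 * (D * x + y) = D * x + 2 * x + 3 * (D * y)" for x y
          by (simp add: algebra_simps)
        moreover have "0 \<le> D * x + 2 * x + 3 * (D * y)" if "0 \<le> x" "0 \<le> y" for x y
          using D that by simp
        moreover have "0 \<le> a ^ 4 / m" using that by simp
        ultimately show ?thesis by (smt (verit) powr_ge_zero)
      qed
      thus ?thesis using main[OF that, of a] by linarith
    qed
    show "branch_energy m a \<ge> a ^ 4 / m / (8 * (nu + 2)) - (3 * D + 2) * m powr (1 + 2 / nu)" if "m > 0" for m a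
      using main[OF that, of a] by (simp add: algebra_simps) (smt (verit) powr_ge_zero)
  qed (use D in simp)
qed

lemma wavenum_cos_eq:
  assumes "m > 0" "m' > 0"
  shows "wavenum m a * cos (phase m a) = wavenum m' a * cos (phase m' a)"
  using abs_powr_eq[OF assms(1), of a] abs_powr_eq[OF assms(2), of a] half_p_pos by simp

text \<open>
  The common value \<open>a\<close> fixes \<open>\<sigma> cos \<theta>\<close>.
\<close>
lemma abs_phase_eq:
  assumes "m > 0" "m' > 0" "wavenum m a = wavenum m' a"
  shows "\<bar>phase m a\<bar> = \<bar>phase m' a\<bar>"
proof -
  have eq: "cos \<bar>phase m a\<bar> = cos \<bar>phase m' a\<bar>"
    using wavenum_cos_eq[OF assms(1,2), of a] wavenum_pos[OF assms(1), of a] assms(3)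
    by (simp add: abs_if)
  have le: "\<bar>phase m a\<bar> \<le> pi" "\<bar>phase m' a\<bar> \<le> pi"
    using phase_ge[OF assms(1), of a] phase_ge[OF assms(2), of a] phase_less[of m a] phase_less[of m' a]
      pi_gt_zero unfolding abs_le_iff by linarith+
  show ?thesis by (rule cos_inj_pi[OF abs_ge_zero le(1) abs_ge_zero le(2) eq])
qed

text \<open>
  For bumps more mass at the same value means a larger wave number. As \<open>- \<sigma>\<^sup>2 / 2\<close> is the derivative of the
  value function in the mass, the function is strictly concave there.
\<close>
lemma wavenum_strict_mono_mass:
  assumes "0 < m" "m < m'" "a \<noteq> 0" "phase m a \<le> 0"
  shows "wavenum m a < wavenum m' a"
proof -
  have "phase m' a < phase m a" by (rule phase_strict_antimono_mass) (use assms in auto)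
  hence "cos (phase m' a) < cos (phase m a)"
    using phase_gt[of m' a] assms pi_gt_zero
    by (subst (1 2) cos_minus[symmetric], intro cos_monotone_0_pi) auto
  hence "wavenum m' a * cos (phase m' a) < wavenum m' a * cos (phase m a)"
    using wavenum_pos[of m' a] assms by simp
  hence "wavenum m a * cos (phase m a) < wavenum m' a * cos (phase m a)"
    using wavenum_cos_eq[of m m' a] assms by simp
  thus ?thesis using cos_phase_pos[of m a] assms by simp
qed

text \<open>
  Strict concavity in the mass on the bump region: shifting mass from one of two equal bumps to the other
  lowers the energy.
\<close>
lemma two_bumps_not_optimal:
  assumes M: "M > 0" and a: "a > 0" and bump: "phase M a < 0"
  shows "\<exists>t. 0 < t \<and> t < M \<and> branch_energy (M + t) a + branch_energy (M - t) a < 2 * branch_energy M a"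
proof -
  (* half the phase is still negative, so all masses between M0 and M are in the concave region *)
  define \<phi> where "\<phi> = phase M a / 2"
  have \<phi>: "-(pi/2) < \<phi>" "\<phi> < 0" "phase M a < \<phi>"
    using bump phase_gt[OF M, of a] a by (auto simp: \<phi>_def)
  have c: "cos \<phi> > 0" using \<phi> pi_gt_zero by (intro cos_pos') auto
  define \<sigma> where "\<sigma> = (a / sqrt amp) powr (1 / al) / cos \<phi>"
  have \<sigma>: "\<sigma> > 0" using a amp_pos c by (simp add: \<sigma>_def)
  have va: "coord_value \<sigma> \<phi> = a"
    unfolding coord_value_def \<sigma>_def using c a amp_pos al_pos by (simp add: powr_powr)
  define M0 where "M0 = coord_mass \<sigma> \<phi>"
  have \<phi>2: "\<phi> < pi/2" using \<phi> pi_gt_zero by linarith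
  have M0: "M0 > 0" unfolding M0_def using \<sigma> \<phi> \<phi>2 by (intro coord_mass_pos) auto
  have ph0: "phase M0 a = \<phi>" unfolding M0_def va[symmetric] using phase_coord[of \<sigma> \<phi>] \<sigma> \<phi> \<phi>2 by simp
  have lt: "M0 < M"
  proof (rule ccontr)
    assume "\<not> M0 < M"
    hence "phase M0 a \<le> phase M a"
      using phase_strict_antimono_mass[OF M, of M0 a] a by (cases "M = M0") auto
    thus False using ph0 \<phi> by simp
  qed
  define t where "t = M - M0"
  have t: "0 < t" "t < M" using lt M0 by (auto simp: t_def)
  have "\<exists>z. M < z \<and> z < M + t \<and> branch_energy (M + t) a - branch_energy M a = (M + t - M) * (- (wavenum z a)\<^sup>2 / 2)"
    by (rule MVT2, use t in simp, rule branch_energy_deriv_mass, use t M in simp)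
  then obtain z1 where z1: "M < z1" "branch_energy (M + t) a - branch_energy M a = t * (- (wavenum z1 a)\<^sup>2 / 2)"
    by auto
  have "\<exists>z. M0 < z \<and> z < M \<and> branch_energy M a - branch_energy M0 a = (M - M0) * (- (wavenum z a)\<^sup>2 / 2)"
    by (rule MVT2, use lt in simp, rule branch_energy_deriv_mass, use lt M0 in simp)
  then obtain z2 where z2: "M0 < z2" "z2 < M" "branch_energy M a - branch_energy M0 a = t * (- (wavenum z2 a)\<^sup>2 / 2)"
    by (auto simp: t_def)
  have "wavenum z2 a < wavenum M a"
  proof (rule wavenum_strict_mono_mass)
    have "phase z2 a < phase M0 a" by (rule phase_strict_antimono_mass) (use z2 M0 a in auto)
    thus "phase z2 a \<le> 0" using ph0 \<phi> by simp
  qed (use z2 M0 a in auto)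
  also have "\<dots> < wavenum z1 a"
    by (rule wavenum_strict_mono_mass) (use z1 M a bump in auto)
  finally have "(wavenum z2 a)\<^sup>2 < (wavenum z1 a)\<^sup>2"
    using wavenum_pos[of z2 a] z2 M0 by (intro power_strict_mono) auto
  hence "t * ((wavenum z2 a)\<^sup>2 / 2) < t * ((wavenum z1 a)\<^sup>2 / 2)" using t by simp
  moreover have "branch_energy (M + t) a - branch_energy M a = - (t * ((wavenum z1 a)\<^sup>2 / 2))"
    using z1(2) by simp
  moreover have "branch_energy M a - branch_energy (M - t) a = - (t * ((wavenum z2 a)\<^sup>2 / 2))"
    using z2(3) by (simp add: t_def)
  ultimately have "branch_energy (M + t) a + branch_energy (M - t) a < 2 * branch_energy M a"
    by linarith
  thus ?thesis using t by blast
qed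

lemma sin_phase_pos_iff:
  assumes "m > 0"
  shows "sin (phase m a) > 0 \<longleftrightarrow> phase m a > 0"
proof (cases "phase m a > 0")
  case True
  have "sin (phase m a) > 0" by (rule sin_gt_zero) (use True phase_less[of m a] pi_gt_zero in linarith)+
  thus ?thesis using True by simp
next
  case False
  have "sin (- phase m a) \<ge> 0"
    by (rule sin_ge_zero) (use False phase_ge[OF assms, of a] pi_gt_zero in linarith)+
  thus ?thesis using False by simp
qed

text \<open>
  Both \<open>W\<^sub>a / a\<close> and \<open>W\<^sub>a / a\<^sup>3\<close> increase on tails, the second one by \<open>tail_mass_sharp\<close>. The exponent \<open>q - 1\<close> lies
  between 1 and 3, so the quotient by \<open>a\<^bsup>q-1\<^esup>\<close> is a weighted geometric mean of them.
\<close>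
lemma tail_kirchhoff_mono:
  assumes M: "M > 0" and ab: "0 < a" "a < b" and tail: "phase M a > 0" and q: "2 < q" "q < 4"
  shows "branch_slope M a / a powr (q - 1) < branch_slope M b / b powr (q - 1)"
proof -
  (* X1 and X2 are W_a / x and W_a / x^3; their weights in the geometric mean are 1 - s and s *)
  define X1 where "X1 = (\<lambda>x. wavenum M x * sin (phase M x))"
  define X2 where "X2 = (\<lambda>x. X1 x / x\<^sup>2)"
  define s where "s = (q - 2) / 2"
  have s: "0 < s" "s < 1" using q by (auto simp: s_def)
  have ph: "phase M a < phase M b" by (rule phase_strict_mono) (use M ab in auto)
  have pb: "phase M b < pi/2" by (rule phase_less)
  have sin_ab: "sin (phase M a) < sin (phase M b)"
    using ph pb tail pi_gt_zero by (intro sin_monotone_2pi) auto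
  have sa: "sin (phase M a) > 0" using sin_phase_pos_iff[OF M] tail by simp
  have wa: "wavenum M a > 0" using wavenum_pos[OF M] .
  have "wavenum M a \<le> wavenum M b" by (rule wavenum_mono) (use M ab in auto)
  hence X1: "X1 a < X1 b" unfolding X1_def using sin_ab sa wa by (intro mult_le_less_imp_less) auto
  have X1a: "X1 a > 0" using sa wa by (simp add: X1_def)
  define h where "h = (\<lambda>\<theta>. sin \<theta> * tail_mass \<theta> / cos \<theta> powr (nu + 1))"
  have X2h: "X2 x = h (phase M x) * (al / M)" if "x > 0" for x
  proof -
    have "cos (phase M x) powr (nu + 1) > 0" using cos_phase_pos[OF M, of x] that by simp
    thus ?thesis
      unfolding X2_def X1_def h_def square_mass[OF M, of x]
      using wavenum_pos[OF M, of x] tail_mass_phase_pos[OF M, of x] M al_pos by (simp add: mult_ac)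
  qed
  have "h (phase M a) < h (phase M b)"
  proof (rule DERIV_pos_imp_increasing[OF ph])
    fix t assume t: "phase M a \<le> t" "t \<le> phase M b"
    have t': "-(pi/2) < t" "t < pi/2" "0 < t" using t tail pb pi_gt_zero by linarith+
    have c: "cos t > 0" using t' by (intro cos_pos')
    define C where "C = cos t powr (nu + 1)"
    have C: "C > 0" using c by (simp add: C_def)
    have "(h has_real_derivative
       ((cos t * tail_mass t + - (cos t powr nu) * sin t) * C
         - sin t * tail_mass t * (- ((nu + 1) * cos t powr nu * sin t))) / (C * C)) (at t)"
      unfolding h_def C_def
      by (intro DERIV_divide DERIV_mult DERIV_sin tail_mass_deriv cos_powr_Suc_deriv) (use c t' in auto)
    also have "((cos t * tail_mass t + - (cos t powr nu) * sin t) * C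
         - sin t * tail_mass t * (- ((nu + 1) * cos t powr nu * sin t)))
      = cos t powr nu * (tail_mass t * ((cos t)\<^sup>2 + (nu + 1) * (sin t)\<^sup>2) - sin t * C)"
      unfolding C_def cos_powr_Suc[OF less_imp_le[OF c]]
      by (simp add: power2_eq_square algebra_simps)
    also have "(cos t)\<^sup>2 + (nu + 1) * (sin t)\<^sup>2 = 1 + nu * (sin t)\<^sup>2"
      by (simp add: cos_squared_eq algebra_simps)
    finally have "(h has_real_derivative
       cos t powr nu * (tail_mass t * (1 + nu * (sin t)\<^sup>2) - sin t * C) / (C * C)) (at t)" .
    moreover have "cos t powr nu * (tail_mass t * (1 + nu * (sin t)\<^sup>2) - sin t * C) / (C * C) > 0"
      using tail_mass_sharp[of t] t' c C by (intro divide_pos_pos mult_pos_pos) (auto simp: C_def)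
    ultimately show "\<exists>y. (h has_real_derivative y) (at t) \<and> y > 0" by blast
  qed
  hence "h (phase M a) * (al / M) < h (phase M b) * (al / M)"
    using al_pos M by (intro mult_strict_right_mono) auto
  hence X2: "X2 a < X2 b" using X2h[of a] X2h[of b] ab by linarith
  have X2a: "X2 a > 0" using X1a ab by (simp add: X2_def)
  have eq: "branch_slope M x / x powr (q - 1) = X1 x powr (1 - s) * X2 x powr s"
    if "x > 0" "X1 x > 0" for x
  proof -
    have "X1 x powr (1 - s) * X2 x powr s = X1 x powr (1 - s) * X1 x powr s / (x\<^sup>2) powr s"
      unfolding X2_def using that by (simp add: powr_divide)
    also have "X1 x powr (1 - s) * X1 x powr s = X1 x"
      using that by (simp add: powr_add[symmetric])
    also have "(x\<^sup>2) powr s = x powr (q - 2)"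
    proof -
      have "(x\<^sup>2) powr s = (x powr 2) powr s" using that by (simp add: powr_numeral)
      also have "\<dots> = x powr (2 * s)" by (rule powr_powr)
      also have "2 * s = q - 2" by (simp add: s_def)
      finally show ?thesis .
    qed
    finally have "X1 x powr (1 - s) * X2 x powr s = X1 x / x powr (q - 2)" .
    moreover have "x powr (q - 1) = x * x powr (q - 2)"
    proof -
      have "x * x powr (q - 2) = x powr (1 + (q - 2))"
        by (rule powr_mult_base) (use that in simp)
      also have "1 + (q - 2) = q - 1" by simp
      finally show ?thesis by (rule sym)
    qed
    ultimately show ?thesis using that by (simp add: branch_slope_def X1_def)
  qed
  have "X1 a powr (1 - s) * X2 a powr s < X1 b powr (1 - s) * X2 b powr s"
  proof (rule mult_strict_mono)
    show "X1 a powr (1 - s) < X1 b powr (1 - s)" by (rule powr_less_mono2) (use s X1 X1a in auto)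
    show "X2 a powr s < X2 b powr s" by (rule powr_less_mono2) (use s X2 X2a in auto)
  qed (use X1 X1a in auto)
  thus ?thesis using eq[of a] eq[of b] ab X1 X1a by linarith
qed

end

section \<open>The reduced problem: minimisers are symmetric\<close>

locale star_graph = subcritical +
  fixes q :: real and N :: nat
  assumes q_gt_2: "2 < q" and q_lt_4: "q < 4" and N_ge_3: "N \<ge> 3"
begin

text \<open>
  Data of a competitor of mass \<open>\<mu>\<close> that is positive at the vertex and made of soliton pieces.
\<close>
definition admissible :: "real \<Rightarrow> (nat \<Rightarrow> real) \<Rightarrow> real \<Rightarrow> bool" where
  "admissible \<mu> m a \<longleftrightarrow> a > 0 \<and> (\<forall>i<N. m i > 0) \<and> (\<Sum>i<N. m i) = \<mu>"

definition reduced_energy :: "(nat \<Rightarrow> real) \<Rightarrow> real \<Rightarrow> real" where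
  "reduced_energy m a = (\<Sum>i<N. branch_energy (m i) a) - a powr q / q"

definition minimiser :: "real \<Rightarrow> (nat \<Rightarrow> real) \<Rightarrow> real \<Rightarrow> bool" where
  "minimiser \<mu> m a \<longleftrightarrow> admissible \<mu> m a \<and>
     (\<forall>m' a'. admissible \<mu> m' a' \<longrightarrow> reduced_energy m a \<le> reduced_energy m' a')"

lemma mass_determined:
  assumes "m > 0" "m' > 0" "wavenum m a = wavenum m' a" "phase m a = phase m' a"
  shows "m = m'"
proof -
  have "m = coord_mass (wavenum m a) (phase m a)" by (rule coord_mass_inverse[OF assms(1), symmetric])
  also have "\<dots> = coord_mass (wavenum m' a) (phase m' a)" by (simp only: assms(3,4))
  also have "\<dots> = m'" by (rule coord_mass_inverse[OF assms(2)])
  finally show ?thesis .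
qed

lemma sum_split_two:
  fixes h :: "nat \<Rightarrow> real"
  assumes "i < N" "j < N" "i \<noteq> j"
  shows "(\<Sum>k<N. h k) = h i + h j + (\<Sum>k\<in>{..<N} - {i, j}. h k)"
proof -
  have "(\<Sum>k<N. h k) = (\<Sum>k\<in>{..<N} - {i, j}. h k) + (\<Sum>k\<in>{i, j}. h k)"
    by (rule sum.subset_diff) (use assms in auto)
  thus ?thesis using assms by simp
qed

text \<open>
  Redistribution of mass between two branches at a fixed vertex value.
\<close>
lemma minimiser_exchange:
  assumes min: "minimiser \<mu> m a" and ij: "i < N" "j < N" "i \<noteq> j"
    and xy: "x > 0" "y > 0" "x + y = m i + m j"
  shows "branch_energy (m i) a + branch_energy (m j) a \<le> branch_energy x a + branch_energy y a"
proof -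
  define m' where "m' = m(i := x, j := y)"
  have rest: "(\<Sum>k\<in>{..<N} - {i, j}. f (m' k)) = (\<Sum>k\<in>{..<N} - {i, j}. f (m k))" for f :: "real \<Rightarrow> real"
    by (rule sum.cong) (auto simp: m'_def)
  have vals: "m' i = x" "m' j = y" using ij by (auto simp: m'_def)
  have adm: "admissible \<mu> m a" using min by (simp add: minimiser_def)
  have "(\<Sum>k<N. m' k) = (\<Sum>k<N. m k)"
    using sum_split_two[OF ij, of m'] sum_split_two[OF ij, of m] rest[of "\<lambda>z. z"] vals xy by simp
  hence "admissible \<mu> m' a" using adm xy by (auto simp: admissible_def m'_def)
  hence "reduced_energy m a \<le> reduced_energy m' a" using min by (simp add: minimiser_def)
  thus ?thesis unfolding reduced_energy_def
    using sum_split_two[OF ij, of "\<lambda>k. branch_energy (m' k) a"]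
      sum_split_two[OF ij, of "\<lambda>k. branch_energy (m k) a"] rest[of "\<lambda>z. branch_energy z a"] vals by simp
qed

lemma minimiser_pos: "minimiser \<mu> m a \<Longrightarrow> i < N \<Longrightarrow> m i > 0"
  and minimiser_value_pos: "minimiser \<mu> m a \<Longrightarrow> a > 0"
  by (auto simp: minimiser_def admissible_def)

text \<open>
  Stationarity under an exchange of mass between two branches, as \<open>W\<^sub>m = - \<sigma>\<^sup>2 / 2\<close>.
\<close>
lemma minimiser_equal_wavenum:
  assumes min: "minimiser \<mu> m a" and ij: "i < N" "j < N"
  shows "wavenum (m i) a = wavenum (m j) a"
proof (cases "i = j")
  case False
  have pos: "m i > 0" "m j > 0" using minimiser_pos[OF min] ij by auto
  define f where "f = (\<lambda>t. branch_energy (m i + t) a + branch_energy (m j - t) a)"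
  have "((\<lambda>t. branch_energy (m i + t) a) has_real_derivative - (wavenum (m i) a)\<^sup>2 / 2 * (0 + 1)) (at 0)"
    by (rule DERIV_chain2[where f = "\<lambda>m. branch_energy m a"])
       (use pos in \<open>auto intro!: derivative_eq_intros branch_energy_deriv_mass[THEN DERIV_cong]\<close>)
  moreover have "((\<lambda>t. branch_energy (m j - t) a) has_real_derivative - (wavenum (m j) a)\<^sup>2 / 2 * (0 - 1)) (at 0)"
    by (rule DERIV_chain2[where f = "\<lambda>m. branch_energy m a"])
       (use pos in \<open>auto intro!: derivative_eq_intros branch_energy_deriv_mass[THEN DERIV_cong]\<close>)
  ultimately have "(f has_real_derivative - (wavenum (m i) a)\<^sup>2 / 2 * (0 + 1) + - (wavenum (m j) a)\<^sup>2 / 2 * (0 - 1)) (at 0)"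
    unfolding f_def by (rule DERIV_add)
  moreover have "\<forall>t. \<bar>0 - t\<bar> < min (m i) (m j) \<longrightarrow> f 0 \<le> f t"
    using minimiser_exchange[OF min ij False] pos by (auto simp: f_def)
  ultimately have "- (wavenum (m i) a)\<^sup>2 / 2 * (0 + 1) + - (wavenum (m j) a)\<^sup>2 / 2 * (0 - 1) = 0"
    using pos by (intro DERIV_local_min[of f _ 0 "min (m i) (m j)"]) auto
  hence "(wavenum (m i) a)\<^sup>2 = (wavenum (m j) a)\<^sup>2" by simp
  thus ?thesis using wavenum_pos[OF pos(1), of a] wavenum_pos[OF pos(2), of a] by (simp add: power2_eq_iff)
qed simp

text \<open>
  Stationarity in the value at the vertex.
\<close>
lemma minimiser_kirchhoff:
  assumes min: "minimiser \<mu> m a"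
  shows "(\<Sum>i<N. branch_slope (m i) a) = a powr (q - 1)"
proof -
  have a: "a > 0" using minimiser_value_pos[OF min] .
  have "((\<lambda>a. a powr q / q) has_real_derivative a powr (q - 1)) (at a)"
  proof -
    have "((\<lambda>a. a powr q / q) has_real_derivative q * a powr (q - 1) / q) (at a)"
      by (rule DERIV_cdivide[OF has_real_derivative_powr[OF a]])
    thus ?thesis using q_gt_2 by simp
  qed
  moreover have "((\<lambda>a. \<Sum>i<N. branch_energy (m i) a) has_real_derivative (\<Sum>i<N. branch_slope (m i) a)) (at a)"
    by (rule DERIV_sum) (use branch_energy_deriv_value minimiser_pos[OF min] in auto)
  ultimately have "(reduced_energy m has_real_derivative (\<Sum>i<N. branch_slope (m i) a) - a powr (q - 1)) (at a)"
    unfolding reduced_energy_def[abs_def] by (intro DERIV_diff)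
  moreover have "\<forall>b. \<bar>a - b\<bar> < a \<longrightarrow> reduced_energy m a \<le> reduced_energy m b"
    using min by (auto simp: minimiser_def admissible_def abs_if split: if_splits)
  ultimately have "(\<Sum>i<N. branch_slope (m i) a) - a powr (q - 1) = 0"
    using a by (intro DERIV_local_min[of "reduced_energy m" _ a a])
  thus ?thesis by simp
qed

lemma minimiser_phases:
  assumes min: "minimiser \<mu> m a" and ij: "i < N" "j < N"
  shows "\<bar>phase (m i) a\<bar> = \<bar>phase (m j) a\<bar>"
  by (rule abs_phase_eq[OF minimiser_pos[OF min ij(1)] minimiser_pos[OF min ij(2)]
        minimiser_equal_wavenum[OF min ij]])

text \<open>
  Two branches with negative phases would have equal phase and wave number, hence equal masses, and
  moving mass between them would lower the energy.
\<close>
lemma minimiser_one_bump: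
  assumes min: "minimiser \<mu> m a" and ij: "i < N" "j < N" "i \<noteq> j"
    and bump: "phase (m i) a < 0"
  shows "phase (m j) a > 0"
proof (rule ccontr)
  assume "\<not> phase (m j) a > 0"
  hence ph: "phase (m j) a = phase (m i) a"
    using minimiser_phases[OF min ij(1,2)] bump by (simp add: abs_if split: if_splits)
  have pos: "m i > 0" "m j > 0" "a > 0"
    using minimiser_pos[OF min] minimiser_value_pos[OF min] ij by auto
  have eq: "m j = m i"
    by (rule mass_determined[OF pos(2,1) minimiser_equal_wavenum[OF min ij(2,1)] ph])
  from two_bumps_not_optimal[OF pos(1,3) bump] obtain t where t: "0 < t" "t < m i"
    "branch_energy (m i + t) a + branch_energy (m i - t) a < 2 * branch_energy (m i) a"
    by (elim exE conjE)
  have "branch_energy (m i) a + branch_energy (m j) a \<le> branch_energy (m i + t) a + branch_energy (m i - t) a"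
    by (rule minimiser_exchange[OF min ij]) (use t eq in auto)
  thus False using t eq by simp
qed

text \<open>
  A single bump is excluded along a path of competitors: \<open>N - 2\<close> branches carry tails with parameters
  \<open>(\<sigma>, \<theta>)\<close>, and the other two form one whole soliton with the rest of the mass, cut at a
  point where its value matches.
\<close>
definition core_mass :: "real \<Rightarrow> real \<Rightarrow> real \<Rightarrow> real" where
  "core_mass \<mu> \<sigma> \<theta> = \<mu> - (real N - 2) * coord_mass \<sigma> \<theta>"

definition core_energy :: "real \<Rightarrow> real \<Rightarrow> real \<Rightarrow> real" where
  "core_energy \<mu> \<sigma> \<theta> = soliton_energy (core_mass \<mu> \<sigma> \<theta>)
     + (real N - 2) * branch_energy (coord_mass \<sigma> \<theta>) (coord_value \<sigma> \<theta>)
     - coord_value \<sigma> \<theta> powr q / q"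

lemma sum_core:
  fixes f :: "nat \<Rightarrow> real"
  assumes "\<And>i. 2 \<le> i \<Longrightarrow> i < N \<Longrightarrow> f i = z"
  shows "(\<Sum>i<N. f i) = f 0 + f 1 + (real N - 2) * z"
proof -
  have "(\<Sum>i<N. f i) = f 0 + f 1 + (\<Sum>i\<in>{..<N} - {0, 1}. f i)"
    using sum_split_two[of 0 1 f] N_ge_3 by simp
  also have "(\<Sum>i\<in>{..<N} - {0, 1}. f i) = (\<Sum>i\<in>{..<N} - {0, 1}. z)"
    by (rule sum.cong) (use assms in auto)
  also have "\<dots> = (real N - 2) * z"
    using N_ge_3 by (simp add: card_Diff_subset of_nat_diff)
  finally show ?thesis .
qed

text \<open>
  The cut is possible if the maximum of the soliton exceeds the value at the vertex, which is the last assumption.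
\<close>
lemma core_admissible:
  assumes \<sigma>: "\<sigma> > 0" and \<theta>: "-(pi/2) < \<theta>" "\<theta> < pi/2"
    and x: "core_mass \<mu> \<sigma> \<theta> > 0" and peak: "\<sigma> * cos \<theta> < wavenum (core_mass \<mu> \<sigma> \<theta>) 0"
  shows "\<exists>m. admissible \<mu> m (coord_value \<sigma> \<theta>) \<and> reduced_energy m (coord_value \<sigma> \<theta>) = core_energy \<mu> \<sigma> \<theta>"
proof -
  define s where "s = wavenum (core_mass \<mu> \<sigma> \<theta>) 0"
  define c where "c = \<sigma> * cos \<theta> / s"
  have s: "s > 0" unfolding s_def using x by (rule wavenum_pos)
  have c: "0 < c" "c < 1" using peak \<sigma> cos_pos'[OF \<theta>] s by (auto simp: c_def s_def[symmetric])
  define \<phi> where "\<phi> = arccos c"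
  have cos\<phi>: "cos \<phi> = c" unfolding \<phi>_def using c by (intro cos_arccos) auto
  have "arccos c < arccos 0" by (rule arccos_less_arccos) (use c in auto)
  hence \<phi>: "0 \<le> \<phi>" "\<phi> < pi/2" using c arccos_lbound[of c] by (auto simp: \<phi>_def)
  have \<phi>': "-(pi/2) < \<phi>" "-(pi/2) \<le> - \<phi>" "- \<phi> < pi/2" using \<phi> pi_gt_zero by linarith+
  have val: "coord_value s \<phi> = coord_value \<sigma> \<theta>"
    unfolding coord_value_def cos\<phi> c_def using s by simp
  have mass: "coord_mass s (-(pi/2)) = core_mass \<mu> \<sigma> \<theta>"
    using coord_mass_inverse[OF x, of 0] by (simp add: s_def)
  note pair = bump_tail_pair[OF s \<phi>'(1) \<phi>(2), unfolded mass val]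
  define m where "m = (\<lambda>i::nat. if i = 0 then coord_mass s (- \<phi>) else if i = 1 then coord_mass s \<phi>
     else coord_mass \<sigma> \<theta>)"
  have "(\<Sum>i<N. m i) = m 0 + m 1 + (real N - 2) * coord_mass \<sigma> \<theta>"
    by (rule sum_core) (auto simp: m_def)
  also have "\<dots> = \<mu>" using pair(1) by (simp add: m_def core_mass_def)
  finally have sum: "(\<Sum>i<N. m i) = \<mu>" .
  have "(\<Sum>i<N. branch_energy (m i) (coord_value \<sigma> \<theta>))
    = branch_energy (m 0) (coord_value \<sigma> \<theta>) + branch_energy (m 1) (coord_value \<sigma> \<theta>)
      + (real N - 2) * branch_energy (coord_mass \<sigma> \<theta>) (coord_value \<sigma> \<theta>)"
    by (rule sum_core) (auto simp: m_def)
  hence "reduced_energy m (coord_value \<sigma> \<theta>) = core_energy \<mu> \<sigma> \<theta>"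
    using pair(2) by (simp add: reduced_energy_def core_energy_def m_def)
  moreover have "m i > 0" for i
    unfolding m_def using coord_mass_pos[OF s \<phi>'(2,3)] coord_mass_pos[OF s _ \<phi>(2)]
      coord_mass_pos[OF \<sigma> _ \<theta>(2)] \<theta> \<phi>' by simp
  ultimately show ?thesis
    using sum coord_value_pos[OF \<sigma> \<theta>] unfolding admissible_def by (intro exI[of _ m]) simp
qed

lemma coord_value_deriv:
  assumes \<sigma>: "\<sigma> > 0" and \<theta>: "-(pi/2) < \<theta>" "\<theta> < pi/2"
  shows "(coord_value \<sigma> has_real_derivative - (al * coord_value \<sigma> \<theta> * sin \<theta> / cos \<theta>)) (at \<theta>)"
proof -
  have c: "cos \<theta> > 0" using \<theta> by (rule cos_pos')
  have pos: "\<sigma> * cos \<theta> > 0" using \<sigma> c by simp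
  have "((\<lambda>t. (\<sigma> * cos t) powr al) has_real_derivative
     al * (\<sigma> * cos \<theta>) powr (al - 1) * (\<sigma> * - sin \<theta>)) (at \<theta>)"
    by (rule DERIV_chain2[OF has_real_derivative_powr[OF pos] DERIV_cmult[OF DERIV_cos]])
  from DERIV_cmult[OF this, of "sqrt amp"]
  have "(coord_value \<sigma> has_real_derivative
     sqrt amp * (al * (\<sigma> * cos \<theta>) powr (al - 1) * (\<sigma> * - sin \<theta>))) (at \<theta>)"
    unfolding coord_value_def[abs_def] .
  moreover have "(\<sigma> * cos \<theta>) powr (al - 1) = (\<sigma> * cos \<theta>) powr al / (\<sigma> * cos \<theta>)"
    using pos by (simp add: powr_diff)
  ultimately show ?thesis
    unfolding coord_value_def using \<sigma> c by (simp add: mult_ac)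
qed

lemma coord_mass_deriv:
  assumes \<theta>: "-(pi/2) < \<theta>" "\<theta> < pi/2"
  shows "(coord_mass \<sigma> has_real_derivative - (al * amp * \<sigma> powr nu * cos \<theta> powr nu)) (at \<theta>)"
  using DERIV_cmult[OF tail_mass_deriv[OF \<theta>], of "al * amp * \<sigma> powr nu"]
  unfolding coord_mass_def[abs_def] by simp

lemma coord_energy_deriv:
  assumes \<sigma>: "\<sigma> > 0" and \<theta>: "-(pi/2) < \<theta>" "\<theta> < pi/2"
  shows "((\<lambda>\<theta>. branch_energy (coord_mass \<sigma> \<theta>) (coord_value \<sigma> \<theta>)) has_real_derivative
     al * amp * \<sigma> powr (nu + 2) * cos \<theta> powr nu * (1 - 2 * (sin \<theta>)\<^sup>2) / 2) (at \<theta>)"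
proof -
  have c: "cos \<theta> > 0" using \<theta> by (rule cos_pos')
  define K where "K = al * amp * \<sigma> powr (nu + 2)"
  have "((\<lambda>t. 2 * sin t * cos t powr (nu + 1) - nu * tail_mass t) has_real_derivative
     (2 * cos \<theta> * cos \<theta> powr (nu + 1) + - ((nu + 1) * cos \<theta> powr nu * sin \<theta>) * (2 * sin \<theta>))
       - nu * - (cos \<theta> powr nu)) (at \<theta>)"
    by (intro DERIV_diff DERIV_mult DERIV_cmult DERIV_sin cos_powr_Suc_deriv tail_mass_deriv \<theta>)
  also have "(2 * cos \<theta> * cos \<theta> powr (nu + 1) + - ((nu + 1) * cos \<theta> powr nu * sin \<theta>) * (2 * sin \<theta>))
       - nu * - (cos \<theta> powr nu) = cos \<theta> powr nu * (2 * (cos \<theta>)\<^sup>2 - 2 * (nu + 1) * (sin \<theta>)\<^sup>2 + nu)"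
    unfolding cos_powr_Suc[OF less_imp_le[OF c]] by (simp add: power2_eq_square algebra_simps)
  also have "2 * (cos \<theta>)\<^sup>2 - 2 * (nu + 1) * (sin \<theta>)\<^sup>2 + nu = (nu + 2) * (1 - 2 * (sin \<theta>)\<^sup>2)"
    by (simp add: cos_squared_eq algebra_simps)
  finally have "((\<lambda>t. K * (2 * sin t * cos t powr (nu + 1) - nu * tail_mass t) / (2 * (nu + 2))) has_real_derivative
     K * (cos \<theta> powr nu * ((nu + 2) * (1 - 2 * (sin \<theta>)\<^sup>2))) / (2 * (nu + 2))) (at \<theta>)"
    by (intro DERIV_cdivide DERIV_cmult)
  also have "K * (cos \<theta> powr nu * ((nu + 2) * (1 - 2 * (sin \<theta>)\<^sup>2))) / (2 * (nu + 2))
     = K * cos \<theta> powr nu * (1 - 2 * (sin \<theta>)\<^sup>2) / 2"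
  proof -
    have "K * (Y * ((nu + 2) * Z)) / (2 * (nu + 2)) = K * Y * Z / 2" for Y Z
      using nu_pos by (simp add: divide_simps)
    thus ?thesis .
  qed
  finally show ?thesis
    unfolding K_def
    by (rule has_field_derivative_transform_within_open[where S = "{-(pi/2)<..<pi/2}"])
       (use \<theta> coord_energy[OF \<sigma>] in auto)
qed

text \<open>
  The derivative of \<open>core_energy\<close> has one term for the exchange of mass between soliton and tails and one
  for the defect in the Kirchhoff condition of the tails.
\<close>
lemma core_energy_deriv:
  assumes \<sigma>: "\<sigma> > 0" and \<theta>: "-(pi/2) < \<theta>" "\<theta> < pi/2" and x: "core_mass \<mu> \<sigma> \<theta> > 0"
  shows "(core_energy \<mu> \<sigma> has_real_derivative
    (real N - 2) * (al * amp * \<sigma> powr nu * cos \<theta> powr nu) * (\<sigma>\<^sup>2 - (wavenum (core_mass \<mu> \<sigma> \<theta>) 0)\<^sup>2) / 2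
    + al * coord_value \<sigma> \<theta> * sin \<theta> / cos \<theta> *
      (coord_value \<sigma> \<theta> powr (q - 1) - (real N - 2) * coord_value \<sigma> \<theta> * \<sigma> * sin \<theta>)) (at \<theta>)"
proof -
  define n where "n = real N - 2"
  define a where "a = coord_value \<sigma> \<theta>"
  define Z where "Z = al * amp * \<sigma> powr nu * cos \<theta> powr nu"
  define w where "w = wavenum (core_mass \<mu> \<sigma> \<theta>) 0"
  have c: "cos \<theta> > 0" using \<theta> by (rule cos_pos')
  have a: "a > 0" unfolding a_def by (rule coord_value_pos[OF \<sigma> \<theta>])
  have dx: "(core_mass \<mu> \<sigma> has_real_derivative 0 - n * (- Z)) (at \<theta>)"
    unfolding core_mass_def[abs_def] n_def Z_def
    by (intro DERIV_diff DERIV_const DERIV_cmult coord_mass_deriv \<theta>)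
  have d1: "((\<lambda>t. soliton_energy (core_mass \<mu> \<sigma> t)) has_real_derivative - w\<^sup>2 / 2 * (0 - n * (- Z))) (at \<theta>)"
    unfolding soliton_energy_def w_def
    by (rule DERIV_chain2[OF branch_energy_deriv_mass[OF x] dx])
  have d3: "((\<lambda>t. coord_value \<sigma> t powr q / q) has_real_derivative
      q * a powr (q - 1) * - (al * a * sin \<theta> / cos \<theta>) / q) (at \<theta>)"
    unfolding a_def
    by (intro DERIV_cdivide DERIV_chain2[OF has_real_derivative_powr coord_value_deriv[OF \<sigma> \<theta>]])
       (use a a_def in simp)
  have "(core_energy \<mu> \<sigma> has_real_derivative
     - w\<^sup>2 / 2 * (0 - n * (- Z)) + n * (al * amp * \<sigma> powr (nu + 2) * cos \<theta> powr nu * (1 - 2 * (sin \<theta>)\<^sup>2) / 2)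
     - q * a powr (q - 1) * - (al * a * sin \<theta> / cos \<theta>) / q) (at \<theta>)"
    unfolding core_energy_def[abs_def] n_def[symmetric]
    by (intro DERIV_diff[OF DERIV_add[OF d1] d3] DERIV_cmult coord_energy_deriv \<sigma> \<theta>)
  also have "al * amp * \<sigma> powr (nu + 2) * cos \<theta> powr nu = Z * \<sigma>\<^sup>2"
    using \<sigma> powr_add[of \<sigma> nu 2] by (simp add: Z_def powr_numeral)
  also have "- w\<^sup>2 / 2 * (0 - n * (- Z)) + n * (Z * \<sigma>\<^sup>2 * (1 - 2 * (sin \<theta>)\<^sup>2) / 2)
     - q * a powr (q - 1) * - (al * a * sin \<theta> / cos \<theta>) / q
     = n * Z * (\<sigma>\<^sup>2 - w\<^sup>2) / 2 + al * a * sin \<theta> / cos \<theta> * (a powr (q - 1) - n * a * \<sigma> * sin \<theta>)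
       + n * (sin \<theta>)\<^sup>2 * (al * \<sigma> * a\<^sup>2 / cos \<theta> - Z * \<sigma>\<^sup>2)"
    using q_gt_2 c by (simp add: field_simps power2_eq_square)
  also have "al * \<sigma> * a\<^sup>2 / cos \<theta> - Z * \<sigma>\<^sup>2 = 0"
  proof -
    have "a\<^sup>2 = amp * (\<sigma> powr nu * \<sigma>) * (cos \<theta> powr nu * cos \<theta>)"
      unfolding a_def using coord_value_square[OF \<sigma> _ \<theta>(2)] \<theta> \<sigma> c by (simp add: powr_add)
    thus ?thesis using c by (simp add: Z_def power2_eq_square)
  qed
  finally show ?thesis by (simp add: n_def a_def Z_def w_def)
qed

lemma wavenum_zero_strict_mono:
  assumes "0 < x" "x < y"
  shows "wavenum x 0 < wavenum y 0"
  unfolding wavenum_zero using assms nu_pos al_pos amp_pos total_tail_pos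
  by (intro powr_less_mono2 divide_strict_right_mono) auto

lemma coord_mass_strict_antimono:
  assumes "\<sigma> > 0" "-(pi/2) \<le> s" "s < t" "t \<le> pi/2"
  shows "coord_mass \<sigma> t < coord_mass \<sigma> s"
  unfolding coord_mass_def using tail_mass_strict_antimono[OF assms(2-4)] assms(1) al_pos amp_pos
  by (intro mult_strict_left_mono) auto

lemma coord_value_strict_antimono:
  assumes "\<sigma> > 0" "0 \<le> s" "s < t" "t < pi/2"
  shows "coord_value \<sigma> t < coord_value \<sigma> s"
proof -
  have "cos t < cos s" by (rule cos_monotone_0_pi) (use assms in auto)
  moreover have "cos t > 0" by (rule cos_pos') (use assms pi_gt_zero in linarith)+
  ultimately show ?thesis unfolding coord_value_def
    using assms(1) amp_pos al_pos by (intro mult_strict_left_mono powr_less_mono2) auto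
qed

text \<open>
  Move along the path of \<open>core_energy\<close> to smaller \<open>\<theta>\<close>. The tails gain mass, so the wave number of the soliton drops
  below \<open>\<sigma>\<close>. The value at the vertex grows while \<open>sin \<theta>\<close> decreases, so for \<open>q > 2\<close> the
  Kirchhoff defect becomes positive as well. Both terms of the derivative are then positive, and the energy decreases along
  the path.
\<close>
lemma minimiser_no_single_bump:
  assumes min: "minimiser \<mu> m a" and i: "i < N" and bump: "phase (m i) a < 0"
  shows False
proof -
  have a: "a > 0" using minimiser_value_pos[OF min] .
  have mi: "m i > 0" using minimiser_pos[OF min i] .
  define \<sigma> where "\<sigma> = wavenum (m i) a"
  define \<theta> where "\<theta> = - phase (m i) a"
  define n where "n = real N - 2"
  have n: "n \<ge> 1" using N_ge_3 by (simp add: n_def)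
  have \<sigma>: "\<sigma> > 0" unfolding \<sigma>_def using mi by (rule wavenum_pos)
  have \<theta>: "0 < \<theta>" "\<theta> < pi/2" using bump phase_gt[OF mi, of a] a by (auto simp: \<theta>_def)
  have \<theta>': "-(pi/2) < \<theta>" "-(pi/2) \<le> \<theta>" using \<theta> pi_gt_zero by linarith+
  have phj: "phase (m j) a = \<theta>" if "j < N" "j \<noteq> i" for j
    using minimiser_one_bump[OF min i that(1) that(2)[symmetric] bump] minimiser_phases[OF min i that(1)] bump
    by (simp add: \<theta>_def)
  have wj: "wavenum (m j) a = \<sigma>" if "j < N" for j
    unfolding \<sigma>_def using minimiser_equal_wavenum[OF min that i] .
  have val: "coord_value \<sigma> \<theta> = a"
    using coord_value_inverse[OF mi, of a] a by (simp add: \<sigma>_def \<theta>_def coord_value_minus)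
  have mass_i: "m i = coord_mass \<sigma> (- \<theta>)"
    using coord_mass_inverse[OF mi, of a] by (simp add: \<sigma>_def \<theta>_def)
  have mass_j: "m j = coord_mass \<sigma> \<theta>" if "j < N" "j \<noteq> i" for j
    using coord_mass_inverse[OF minimiser_pos[OF min that(1)], of a] wj[OF that(1)] phj[OF that] by simp
  have sums: "(\<Sum>j<N. f j) = f i + (n + 1) * z" if "\<And>j. j < N \<Longrightarrow> j \<noteq> i \<Longrightarrow> f j = z" for f :: "nat \<Rightarrow> real" and z
  proof -
    have "(\<Sum>j<N. f j) = f i + (\<Sum>j\<in>{..<N} - {i}. f j)" using i by (simp add: sum.remove)
    also have "(\<Sum>j\<in>{..<N} - {i}. f j) = (\<Sum>j\<in>{..<N} - {i}. z)" by (rule sum.cong) (use that in auto)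
    also have "\<dots> = (n + 1) * z" using i N_ge_3 by (simp add: n_def of_nat_diff)
    finally show ?thesis .
  qed
  note pair = bump_tail_pair[OF \<sigma> \<theta>'(1) \<theta>(2)]
  have "(\<Sum>j<N. m j) = m i + (n + 1) * coord_mass \<sigma> \<theta>" by (rule sums) (rule mass_j)
  moreover have "(\<Sum>j<N. m j) = \<mu>" using min by (simp add: minimiser_def admissible_def)
  ultimately have x: "core_mass \<mu> \<sigma> \<theta> = coord_mass \<sigma> (-(pi/2))"
    using pair(1) mass_i by (simp add: core_mass_def n_def algebra_simps)
  have xpos: "core_mass \<mu> \<sigma> \<theta> > 0" unfolding x by (rule coord_mass_pos[OF \<sigma>]) auto
  have wx: "wavenum (core_mass \<mu> \<sigma> \<theta>) 0 = \<sigma>" unfolding x by (rule wavenum_zero_coord[OF \<sigma>])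
  have "(\<Sum>j<N. branch_energy (m j) a) = branch_energy (m i) a + (n + 1) * branch_energy (coord_mass \<sigma> \<theta>) a"
    by (rule sums) (simp add: mass_j)
  hence E: "reduced_energy m a = core_energy \<mu> \<sigma> \<theta>"
    using pair(2) unfolding reduced_energy_def core_energy_def x val mass_i n_def[symmetric]
    by (simp add: algebra_simps)
  have "(\<Sum>j<N. branch_slope (m j) a) = branch_slope (m i) a + (n + 1) * (a * \<sigma> * sin \<theta>)"
    by (rule sums) (simp add: branch_slope_def wj phj)
  moreover have "branch_slope (m i) a = - (a * \<sigma> * sin \<theta>)"
    by (simp add: branch_slope_def \<sigma>_def \<theta>_def)
  ultimately have kirchhoff: "n * (\<sigma> * sin \<theta>) * a = a powr (q - 1)"
    using minimiser_kirchhoff[OF min] by (simp add: algebra_simps)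
  have split: "b powr (q - 1) = b powr (q - 2) * b" if "b > 0" for b
    using powr_mult_base[of b "q - 2"] that by (simp add: mult.commute)
  (* the slopes of the bump and of one tail cancel, which leaves n = N - 2 tails in the balance *)
  have kirchhoff': "n * (\<sigma> * sin \<theta>) = a powr (q - 2)"
    using kirchhoff a unfolding split[OF a] by simp
  (* near \<theta> the path stays within the range where the configuration is defined *)
  have ev: "\<forall>\<^sub>F t in at_left \<theta>. 0 < t \<and> core_mass \<mu> \<sigma> t > 0 \<and> \<sigma> * cos t < wavenum (core_mass \<mu> \<sigma> t) 0"
  proof -
    have c1: "isCont (core_mass \<mu> \<sigma>) \<theta>"
      unfolding core_mass_def[abs_def] using DERIV_isCont[OF coord_mass_deriv[OF \<theta>'(1) \<theta>(2)]]
      by (intro continuous_intros)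
    have c2: "isCont (\<lambda>x. wavenum x 0) (core_mass \<mu> \<sigma> \<theta>)"
      unfolding wavenum_zero using xpos al_pos amp_pos total_tail_pos by (intro continuous_intros) auto
    have c3: "isCont (\<lambda>t. wavenum (core_mass \<mu> \<sigma> t) 0 - \<sigma> * cos t) \<theta>"
      by (intro continuous_intros isCont_o2[OF c1 c2])
    have "cos \<theta> < cos 0" by (rule cos_monotone_0_pi) (use \<theta> pi_gt_zero in auto)
    hence "wavenum (core_mass \<mu> \<sigma> \<theta>) 0 - \<sigma> * cos \<theta> > 0" unfolding wx using \<sigma> by simp
    hence e3: "\<forall>\<^sub>F t in at \<theta>. wavenum (core_mass \<mu> \<sigma> t) 0 - \<sigma> * cos t > 0"
      using c3 unfolding isCont_def by (rule order_tendstoD(1)[rotated])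
    have e1: "\<forall>\<^sub>F t in at \<theta>. core_mass \<mu> \<sigma> t > 0"
      using c1 xpos unfolding isCont_def by (rule order_tendstoD(1))
    have e0: "\<forall>\<^sub>F t in at \<theta>. t > 0" using \<theta>(1) by (intro order_tendstoD(1)[OF tendsto_ident_at])
    from e0 e1 e3 have "\<forall>\<^sub>F t in at \<theta>. 0 < t \<and> core_mass \<mu> \<sigma> t > 0 \<and> \<sigma> * cos t < wavenum (core_mass \<mu> \<sigma> t) 0"
      by eventually_elim simp
    thus ?thesis unfolding eventually_at_split by blast
  qed
  then obtain b where b: "b < \<theta>" "\<And>t. b < t \<Longrightarrow> t < \<theta> \<Longrightarrow>
      0 < t \<and> core_mass \<mu> \<sigma> t > 0 \<and> \<sigma> * cos t < wavenum (core_mass \<mu> \<sigma> t) 0"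
    unfolding eventually_at_left_field by blast
  define s where "s = (b + \<theta>) / 2"
  have s: "b < s" "s < \<theta>" using b by (auto simp: s_def)
  have dE: "\<exists>y. DERIV (core_energy \<mu> \<sigma>) t :> y \<and> y > 0" if "s < t" "t < \<theta>" for t
  proof -
    have t: "0 < t" "core_mass \<mu> \<sigma> t > 0" using b(2)[of t] s that by auto
    have t': "-(pi/2) < t" "t < pi/2" using t \<theta> that pi_gt_zero by linarith+
    have c: "cos t > 0" by (rule cos_pos'[OF t'])
    have st: "sin t > 0" by (rule sin_gt_zero) (use t t' pi_gt_zero in linarith)+
    have at: "coord_value \<sigma> t > 0" by (rule coord_value_pos[OF \<sigma> t'])
    have "coord_mass \<sigma> \<theta> < coord_mass \<sigma> t"
      by (rule coord_mass_strict_antimono[OF \<sigma>]) (use t' that \<theta> in auto)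
    hence "core_mass \<mu> \<sigma> t < core_mass \<mu> \<sigma> \<theta>" unfolding core_mass_def n_def[symmetric] using n by simp
    hence w: "wavenum (core_mass \<mu> \<sigma> t) 0 < \<sigma>"
      using wavenum_zero_strict_mono[OF t(2), of "core_mass \<mu> \<sigma> \<theta>"] wx by linarith
    hence "(wavenum (core_mass \<mu> \<sigma> t) 0)\<^sup>2 < \<sigma>\<^sup>2"
      using wavenum_pos[OF t(2), of 0] by (intro power_strict_mono) auto
    hence p1: "n * (al * amp * \<sigma> powr nu * cos t powr nu) * (\<sigma>\<^sup>2 - (wavenum (core_mass \<mu> \<sigma> t) 0)\<^sup>2) / 2 > 0"
      using n al_pos amp_pos \<sigma> c by simp
    have "sin t < sin \<theta>" by (rule sin_monotone_2pi) (use t' that \<theta> in auto)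
    hence "n * (\<sigma> * sin t) < n * (\<sigma> * sin \<theta>)" using n \<sigma> by simp
    also have "\<dots> = a powr (q - 2)" by (rule kirchhoff')
    also have "\<dots> < coord_value \<sigma> t powr (q - 2)"
      using coord_value_strict_antimono[OF \<sigma> less_imp_le[OF t(1)] that(2) \<theta>(2)] val a q_gt_2
      by (intro powr_less_mono2) auto
    finally have "n * (\<sigma> * sin t) * coord_value \<sigma> t < coord_value \<sigma> t powr (q - 1)"
      unfolding split[OF at] using at by simp
    hence "coord_value \<sigma> t powr (q - 1) - n * coord_value \<sigma> t * \<sigma> * sin t > 0" by (simp add: mult_ac)
    hence "al * coord_value \<sigma> t * sin t / cos t *
       (coord_value \<sigma> t powr (q - 1) - n * coord_value \<sigma> t * \<sigma> * sin t) > 0"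
      using al_pos at st c by simp
    with p1 core_energy_deriv[OF \<sigma> t' t(2)] show ?thesis
      unfolding n_def[symmetric] by (intro exI conjI) (assumption, linarith)
  qed
  have s0: "0 < s" "core_mass \<mu> \<sigma> s > 0" "\<sigma> * cos s < wavenum (core_mass \<mu> \<sigma> s) 0" using b(2)[OF s] by auto
  have s': "-(pi/2) < s" "s < pi/2" using s0 s \<theta> pi_gt_zero by linarith+
  have "core_energy \<mu> \<sigma> s < core_energy \<mu> \<sigma> \<theta>"
  proof (rule DERIV_pos_imp_increasing_open[OF s(2) dE])
    show "continuous_on {s..\<theta>} (core_energy \<mu> \<sigma>)"
    proof (rule continuous_at_imp_continuous_on, rule ballI)
      fix t assume t: "t \<in> {s..\<theta>}"
      have "core_mass \<mu> \<sigma> t > 0"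
        using t s0(2) xpos b(2)[of t] s by (cases "t = \<theta>") auto
      moreover have "-(pi/2) < t" "t < pi/2" using t s' \<theta> by auto
      ultimately show "isCont (core_energy \<mu> \<sigma>) t"
        using DERIV_isCont[OF core_energy_deriv[OF \<sigma>]] by blast
    qed
  qed
  moreover obtain m' where "admissible \<mu> m' (coord_value \<sigma> s)"
      "reduced_energy m' (coord_value \<sigma> s) = core_energy \<mu> \<sigma> s"
    using core_admissible[OF \<sigma> s' s0(2,3)] by blast
  ultimately show False using min E unfolding minimiser_def by (metis not_le)
qed

lemma minimiser_symmetric:
  assumes min: "minimiser \<mu> m a"
  shows "\<And>i. i < N \<Longrightarrow> m i = \<mu> / real N" and "phase (\<mu> / real N) a > 0"
    and "real N * branch_slope (\<mu> / real N) a = a powr (q - 1)"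
proof -
  have N0: "0 < N" using N_ge_3 by simp
  have a: "a > 0" using minimiser_value_pos[OF min] .
  have ge: "phase (m i) a \<ge> 0" if "i < N" for i
    using minimiser_no_single_bump[OF min that] by (meson not_le)
  have eq: "m i = m 0" if "i < N" for i
  proof -
    have "phase (m i) a = phase (m 0) a"
      using minimiser_phases[OF min that N0] ge[OF that] ge[OF N0] by simp
    thus ?thesis
      by (rule mass_determined[OF minimiser_pos[OF min that] minimiser_pos[OF min N0]
            minimiser_equal_wavenum[OF min that N0]])
  qed
  have "\<mu> = (\<Sum>i<N. m i)" using min by (simp add: minimiser_def admissible_def)
  also have "\<dots> = (\<Sum>i<N. m 0)" by (rule sum.cong[OF refl], rule eq, simp)
  finally have "\<mu> = real N * m 0" by simp
  hence m0: "m 0 = \<mu> / real N" using N0 by (metis nonzero_mult_div_cancel_left of_nat_0_less_iff less_numeral_extra(3))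
  show m: "m i = \<mu> / real N" if "i < N" for i using eq[OF that] m0 by (rule trans)
  have "(\<Sum>i<N. branch_slope (m i) a) = (\<Sum>i<N. branch_slope (\<mu> / real N) a)"
  proof (rule sum.cong)
    show "branch_slope (m i) a = branch_slope (\<mu> / real N) a" if "i \<in> {..<N}" for i
      using m[of i] that by simp
  qed simp
  thus k: "real N * branch_slope (\<mu> / real N) a = a powr (q - 1)"
    using minimiser_kirchhoff[OF min] by simp
  have pos: "\<mu> / real N > 0" unfolding m0[symmetric] by (rule minimiser_pos[OF min N0])
  have "real N * branch_slope (\<mu> / real N) a > 0" unfolding k using a by simp
  hence "branch_slope (\<mu> / real N) a > 0" using N0 by (simp add: zero_less_mult_iff)
  moreover have "a * wavenum (\<mu> / real N) a > 0" using a wavenum_pos[OF pos, of a] by simp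
  ultimately have "sin (phase (\<mu> / real N) a) > 0"
    unfolding branch_slope_def by (rule zero_less_mult_pos)
  thus "phase (\<mu> / real N) a > 0" using sin_phase_pos_iff[OF pos] by simp
qed

text \<open>
  By symmetry the Kirchhoff condition is a scalar equation for the vertex value with a strictly monotone left-hand
  side.
\<close>
lemma minimiser_value_unique:
  assumes "minimiser \<mu> m a" "minimiser \<mu> m' b"
  shows "a = b"
proof -
  have *: False if min: "minimiser \<mu> m a" "minimiser \<mu> m' b" and "a < b" for m m' a b
  proof -
    have N0: "0 < N" using N_ge_3 by simp
    have M: "\<mu> / real N > 0" using minimiser_pos[OF min(1) N0] minimiser_symmetric(1)[OF min(1) N0] by simp
    have a: "a > 0" using minimiser_value_pos[OF min(1)] .
    have "branch_slope (\<mu> / real N) a / a powr (q - 1) < branch_slope (\<mu> / real N) b / b powr (q - 1)"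
      by (rule tail_kirchhoff_mono[OF M a \<open>a < b\<close> minimiser_symmetric(2)[OF min(1)] q_gt_2 q_lt_4])
    moreover have "branch_slope (\<mu> / real N) x / x powr (q - 1) = 1 / real N"
      if "real N * branch_slope (\<mu> / real N) x = x powr (q - 1)" "x > 0" for x
      using that N0 by (simp add: divide_simps mult.commute)
    ultimately show False
      using minimiser_symmetric(3)[OF min(1)] minimiser_symmetric(3)[OF min(2)] a \<open>a < b\<close> by simp
  qed
  show ?thesis using *[OF assms] *[OF assms(2,1)] by (meson linorder_neqE_linordered_idom)
qed

end

section \<open>The reduced problem: existence and the critical mass\<close>

context star_graph
begin

lemma isCont_wavenum_zero:
  assumes "\<mu> > 0"
  shows "isCont (\<lambda>x. wavenum x 0) \<mu>"
  unfolding wavenum_zero using assms al_pos amp_pos total_tail_pos by (intro continuous_intros) auto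

text \<open>
  As \<open>\<theta>\<close> tends to \<open>pi/2\<close>, the tails on \<open>N - 2\<close> branches disappear and the other two carry a whole soliton of mass tending to
  \<open>\<mu>\<close> that is cut further and further away from its centre.
\<close>
lemma runaway:
  assumes \<mu>: "\<mu> > 0" and \<epsilon>: "\<epsilon> > 0"
  shows "\<exists>m a. admissible \<mu> m a \<and> reduced_energy m a < soliton_energy \<mu> + \<epsilon>"
proof -
  define \<sigma> where "\<sigma> = wavenum \<mu> 0"
  have \<sigma>: "\<sigma> > 0" unfolding \<sigma>_def using \<mu> by (rule wavenum_pos)
  define F where "F = at_left (pi/2)"
  have F: "F = at (pi/2) within {-(pi/2)..pi/2}"
    unfolding F_def by (rule at_within_Icc_at_left[symmetric]) simp
  have lim: "(f \<longlongrightarrow> f (pi/2)) F" if "continuous_on {-(pi/2)..pi/2} f" for f :: "real \<Rightarrow> real"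
    using that unfolding F by (auto simp: continuous_on_def)
  have cm: "(core_mass \<mu> \<sigma> \<longlongrightarrow> \<mu>) F"
  proof -
    have "continuous_on {-(pi/2)..pi/2} (core_mass \<mu> \<sigma>)"
      unfolding core_mass_def[abs_def] coord_mass_def[abs_def]
      by (intro continuous_on_diff continuous_on_mult continuous_on_const continuous_on_tail_mass)
    from lim[OF this] show ?thesis by (simp add: core_mass_def coord_mass_def)
  qed
  have cv: "(coord_value \<sigma> \<longlongrightarrow> 0) F"
  proof -
    have "continuous_on {-(pi/2)..pi/2} (coord_value \<sigma>)"
      unfolding coord_value_def[abs_def] using \<sigma> al_pos
      by (intro continuous_on_mult continuous_on_const continuous_on_powr' continuous_on_cos continuous_on_id)
         (auto intro!: mult_nonneg_nonneg cos_ge_zero)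
    from lim[OF this] show ?thesis by (simp add: coord_value_def)
  qed
  have cq: "((\<lambda>t. coord_value \<sigma> t powr q / q) \<longlongrightarrow> 0 powr q / q) F"
    using q_gt_2 coord_value_nonneg
    by (intro tendsto_divide tendsto_const tendsto_powr'[OF cv]) auto
  define K where "K = (\<lambda>t. al * amp * \<sigma> powr (nu + 2) * (2 * sin t * cos t powr (nu + 1) - nu * tail_mass t) / (2 * (nu + 2)))"
  have ck: "(K \<longlongrightarrow> 0) F"
  proof -
    have "continuous_on {-(pi/2)..pi/2} K"
      unfolding K_def using nu_pos
      by (intro continuous_on_divide continuous_on_diff continuous_on_mult continuous_on_const continuous_on_tail_mass
            continuous_on_cos_powr_Suc continuous_on_sin continuous_on_id) auto
    from lim[OF this] show ?thesis by (simp add: K_def)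
  qed
  have cs: "((\<lambda>t. soliton_energy (core_mass \<mu> \<sigma> t)) \<longlongrightarrow> soliton_energy \<mu>) F"
    by (rule isCont_tendsto_compose[OF _ cm])
       (use DERIV_isCont[OF branch_energy_deriv_mass[OF \<mu>, of 0]] in \<open>simp add: soliton_energy_def[abs_def]\<close>)
  have "((\<lambda>t. soliton_energy (core_mass \<mu> \<sigma> t) + (real N - 2) * K t - coord_value \<sigma> t powr q / q)
     \<longlongrightarrow> soliton_energy \<mu> + (real N - 2) * 0 - 0 powr q / q) F"
    by (intro tendsto_diff tendsto_add tendsto_mult tendsto_const cs ck cq)
  hence e1: "\<forall>\<^sub>F t in F. soliton_energy (core_mass \<mu> \<sigma> t) + (real N - 2) * K t - coord_value \<sigma> t powr q / q
     < soliton_energy \<mu> + \<epsilon>"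
    by (rule order_tendstoD(2)) (use \<epsilon> q_gt_2 in simp)
  have e2: "\<forall>\<^sub>F t in F. core_mass \<mu> \<sigma> t > 0" by (rule order_tendstoD(1)[OF cm \<mu>])
  have "((\<lambda>t. wavenum (core_mass \<mu> \<sigma> t) 0 - \<sigma> * cos t) \<longlongrightarrow> wavenum \<mu> 0 - \<sigma> * cos (pi/2)) F"
    by (intro tendsto_diff tendsto_mult tendsto_const isCont_tendsto_compose[OF isCont_wavenum_zero[OF \<mu>] cm]
          lim continuous_on_cos continuous_on_id)
  hence e3: "\<forall>\<^sub>F t in F. wavenum (core_mass \<mu> \<sigma> t) 0 - \<sigma> * cos t > 0"
    by (rule order_tendstoD(1)) (use \<sigma> \<sigma>_def in simp)
  have e4: "\<forall>\<^sub>F t in F. -(pi/2) < t \<and> t < pi/2"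
    unfolding F_def eventually_at_left_field by (rule exI[of _ "-(pi/2)"]) simp
  have "\<forall>\<^sub>F t in F. -(pi/2) < t \<and> t < pi/2 \<and> core_mass \<mu> \<sigma> t > 0 \<and> \<sigma> * cos t < wavenum (core_mass \<mu> \<sigma> t) 0
      \<and> soliton_energy (core_mass \<mu> \<sigma> t) + (real N - 2) * K t - coord_value \<sigma> t powr q / q
     < soliton_energy \<mu> + \<epsilon>"
    using e1 e2 e3 e4 by eventually_elim simp
  moreover have "F \<noteq> bot" by (simp add: F_def)
  ultimately obtain t where t: "-(pi/2) < t" "t < pi/2" "core_mass \<mu> \<sigma> t > 0"
     "\<sigma> * cos t < wavenum (core_mass \<mu> \<sigma> t) 0"
     "soliton_energy (core_mass \<mu> \<sigma> t) + (real N - 2) * K t - coord_value \<sigma> t powr q / q < soliton_energy \<mu> + \<epsilon>"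
    using eventually_happens' by blast
  have "K t = branch_energy (coord_mass \<sigma> t) (coord_value \<sigma> t)"
    using coord_energy[OF \<sigma> less_imp_le[OF t(1)] t(2)] by (simp add: K_def)
  hence "core_energy \<mu> \<sigma> t < soliton_energy \<mu> + \<epsilon>" using t(5) by (simp add: core_energy_def)
  thus ?thesis using core_admissible[OF \<sigma> t(1-4)] by metis
qed

lemma quartic_bound:
  assumes "K1 > 0" "b > 0" "K1 * b ^ 4 \<le> K2 * b powr q"
  shows "b \<le> (K2 / K1) powr (1 / (4 - q))"
proof -
  have "b ^ 4 = b powr (4 - q) * b powr q"
    using assms by (simp add: powr_add[symmetric] powr_numeral)
  hence "(K1 * b powr (4 - q)) * b powr q \<le> K2 * b powr q" using assms by (simp add: mult_ac)
  hence "K1 * b powr (4 - q) \<le> K2" using assms by simp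
  hence "b powr (4 - q) \<le> K2 / K1" using assms by (simp add: le_divide_eq mult.commute)
  hence "(b powr (4 - q)) powr (1 / (4 - q)) \<le> (K2 / K1) powr (1 / (4 - q))"
    using q_lt_4 by (intro powr_mono2) auto
  thus ?thesis using assms q_lt_4 by (simp add: powr_powr)
qed

text \<open>
  On competitors of energy at most that of the given one, the value at the vertex is bounded above because
  \<open>q < 4\<close>, bounded away from 0 because the energy is strictly below that of a soliton, and the masses are
  bounded away from 0 by the term \<open>a\<^sup>4 / m\<close>. What remains is a compact set.
\<close>
lemma minimiser_exists:
  assumes adm0: "admissible \<mu> m0 a0" and less: "reduced_energy m0 a0 < soliton_energy \<mu>"
  shows "\<exists>m a. minimiser \<mu> m a"
proof -
  define L where "L = reduced_energy m0 a0"
  have N0: "0 < N" using N_ge_3 by simp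
  have \<mu>: "\<mu> > 0"
  proof -
    have "0 < (\<Sum>i<N. m0 i)" using adm0 N0 unfolding admissible_def by (intro sum_pos) auto
    thus ?thesis using adm0 by (simp add: admissible_def)
  qed
  have L0: "L < 0" using less soliton_energy_nonpos[of \<mu>] \<mu> by (simp add: L_def)
  obtain C where C: "C > 0" and "\<And>m a. m > 0 \<Longrightarrow> \<bar>branch_energy m a\<bar> \<le> C * (m powr (1 + 2 / nu) + a ^ 4 / m)"
    and lb: "\<And>m a. m > 0 \<Longrightarrow> branch_energy m a \<ge> a ^ 4 / m / (8 * (nu + 2)) - C * m powr (1 + 2 / nu)"
    using branch_energy_bounds by metis
  define k where "k = 1 / (8 * (nu + 2))"
  have k: "k > 0" using nu_pos by (simp add: k_def)
  define C\<mu> where "C\<mu> = C * \<mu> powr (1 + 2 / nu)"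
  have C\<mu>: "C\<mu> > 0" using C \<mu> by (simp add: C\<mu>_def)
  have le: "m i \<le> \<mu>" if "admissible \<mu> m a" "i < N" for m a i
  proof -
    have "m i \<le> (\<Sum>i<N. m i)"
      using that unfolding admissible_def by (intro member_le_sum) (auto simp: less_imp_le)
    thus ?thesis using that by (simp add: admissible_def)
  qed
  have lb': "branch_energy (m i) a \<ge> k * a ^ 4 / m i - C\<mu>" if "admissible \<mu> m a" "i < N" for m a i
  proof -
    have pos: "m i > 0" using that by (simp add: admissible_def)
    have "m i powr (1 + 2 / nu) \<le> \<mu> powr (1 + 2 / nu)"
      using pos le[OF that] nu_pos by (intro powr_mono2) auto
    hence "C * m i powr (1 + 2 / nu) \<le> C\<mu>" unfolding C\<mu>_def using C by simp
    moreover have "k * a ^ 4 / m i = a ^ 4 / m i / (8 * (nu + 2))" by (simp add: k_def mult_ac)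
    ultimately show ?thesis using lb[OF pos, of a] by linarith
  qed
  define D where "D = real N * C\<mu>"
  have D: "D > 0" using N0 C\<mu> by (simp add: D_def)
  have aq: "a powr q / q \<le> a powr q" for a using q_gt_2 by (simp add: divide_le_eq mult_left_le_one_le)
    (smt (verit) mult_le_cancel_left1 powr_ge_zero)
  (* upper bound for the vertex value, from a^4 against a^q *)
  define A where "A = max 1 (((D + 1) / (real N * k / \<mu>)) powr (1 / (4 - q)))"
  have upper: "a \<le> A" if adm: "admissible \<mu> m a" and low: "reduced_energy m a \<le> L" for m a
  proof (cases "a \<le> 1")
    case False
    have "(\<Sum>i<N. k * a ^ 4 / \<mu> - C\<mu>) \<le> (\<Sum>i<N. branch_energy (m i) a)"
    proof (rule sum_mono)
      fix i assume i: "i \<in> {..<N}"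
      have "k * a ^ 4 / \<mu> \<le> k * a ^ 4 / m i"
        using le[OF adm, of i] adm i k \<mu> by (intro divide_left_mono) (auto simp: admissible_def)
      thus "k * a ^ 4 / \<mu> - C\<mu> \<le> branch_energy (m i) a" using lb'[OF adm, of i] i by simp
    qed
    hence "real N * (k * a ^ 4 / \<mu>) - D \<le> L + a powr q / q"
      using low by (simp add: reduced_energy_def D_def algebra_simps)
    hence "real N * (k * a ^ 4 / \<mu>) \<le> D + a powr q" using L0 aq[of a] by linarith
    also have "\<dots> \<le> (D + 1) * a powr q"
    proof -
      have "a powr q \<ge> 1" using False q_gt_2 by (intro ge_one_powr_ge_zero) auto
      hence "D * 1 \<le> D * a powr q" using D by (intro mult_left_mono) auto
      thus ?thesis by (simp add: algebra_simps)
    qed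
    finally have "real N * k / \<mu> * a ^ 4 \<le> (D + 1) * a powr q" by (simp add: mult_ac)
    hence "a \<le> ((D + 1) / (real N * k / \<mu>)) powr (1 / (4 - q))"
      using False N0 k \<mu> by (intro quartic_bound) auto
    thus ?thesis by (simp add: A_def)
  qed (simp add: A_def)
  have A1: "A \<ge> 1" by (simp add: A_def)
  (* the reduced energy is at least that of the soliton minus h a, and h vanishes at 0 *)
  define h where "h = (\<lambda>a. real N * (max_wavenum \<mu> * a\<^sup>2 / 2) + a powr q / q)"
  have "(h \<longlongrightarrow> real N * (max_wavenum \<mu> * 0\<^sup>2 / 2) + 0 powr q / q) (at_right 0)"
    unfolding h_def using q_gt_2
    by (intro tendsto_add tendsto_mult tendsto_divide tendsto_power tendsto_const tendsto_ident_at tendsto_powr')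
       (auto simp: eventually_at_filter)
  moreover have "real N * (max_wavenum \<mu> * 0\<^sup>2 / 2) + 0 powr q / q < soliton_energy \<mu> - L"
    using less q_gt_2 by (simp add: L_def)
  ultimately have "\<forall>\<^sub>F a in at_right 0. h a < soliton_energy \<mu> - L" by (rule order_tendstoD(2))
  then obtain \<epsilon> where \<epsilon>: "\<epsilon> > 0" "\<And>a. 0 < a \<Longrightarrow> a < \<epsilon> \<Longrightarrow> h a < soliton_energy \<mu> - L"
    unfolding eventually_at_right_field by blast
  have lower: "a \<ge> \<epsilon>" if adm: "admissible \<mu> m a" and low: "reduced_energy m a \<le> L" for m a
  proof (rule ccontr)
    assume "\<not> a \<ge> \<epsilon>"
    hence a: "0 < a" "h a < soliton_energy \<mu> - L" using \<epsilon>(2)[of a] adm by (auto simp: admissible_def)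
    have "soliton_energy \<mu> \<le> (\<Sum>i<N. soliton_energy (m i))"
      using soliton_energy_superadditive[of "{..<N}" m] adm by (simp add: admissible_def less_imp_le)
    moreover have "(\<Sum>i<N. soliton_energy (m i) - max_wavenum \<mu> * a\<^sup>2 / 2) \<le> (\<Sum>i<N. branch_energy (m i) a)"
    proof (rule sum_mono)
      fix i assume i: "i \<in> {..<N}"
      have pos: "m i > 0" using adm i by (simp add: admissible_def)
      have "max_wavenum (m i) \<le> max_wavenum \<mu>" using pos le[OF adm, of i] i by (intro max_wavenum_mono) auto
      hence "max_wavenum (m i) * a\<^sup>2 \<le> max_wavenum \<mu> * a\<^sup>2" by (intro mult_right_mono) auto
      thus "soliton_energy (m i) - max_wavenum \<mu> * a\<^sup>2 / 2 \<le> branch_energy (m i) a"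
        using branch_energy_ge_soliton[OF pos less_imp_le[OF a(1)]] by linarith
    qed
    ultimately have "reduced_energy m a \<ge> soliton_energy \<mu> - h a"
      by (simp add: reduced_energy_def h_def sum_subtractf)
    thus False using a low by simp
  qed
  (* lower bound for the mass of each branch *)
  define \<delta> where "\<delta> = k * \<epsilon> ^ 4 / (D + A powr q)"
  have den: "D + A powr q > 0" using D by (simp add: add_pos_nonneg)
  have \<delta>: "\<delta> > 0" using k \<epsilon> den by (simp add: \<delta>_def)
  have mass_lower: "m i \<ge> \<delta>" if adm: "admissible \<mu> m a" and low: "reduced_energy m a \<le> L" and i: "i < N" for m a i
  proof -
    have a: "\<epsilon> \<le> a" "a \<le> A" using lower[OF adm low] upper[OF adm low] .
    have pos: "m j > 0" if "j < N" for j using adm that by (simp add: admissible_def)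
    have "(\<Sum>j\<in>{..<N} - {i}. - C\<mu>) \<le> (\<Sum>j\<in>{..<N} - {i}. branch_energy (m j) a)"
    proof (rule sum_mono)
      fix j assume j: "j \<in> {..<N} - {i}"
      have "0 \<le> k * a ^ 4 / m j" using k pos[of j] j by simp
      thus "- C\<mu> \<le> branch_energy (m j) a" using lb'[OF adm, of j] j by simp
    qed
    moreover have "(\<Sum>j\<in>{..<N} - {i}. - C\<mu>) = - (real N - 1) * C\<mu>"
      using i N0 by (simp add: of_nat_diff algebra_simps)
    moreover have "(\<Sum>j<N. branch_energy (m j) a) = branch_energy (m i) a + (\<Sum>j\<in>{..<N} - {i}. branch_energy (m j) a)"
      using i by (simp add: sum.remove)
    ultimately have "k * a ^ 4 / m i - D \<le> L + a powr q / q"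
      using low lb'[OF adm i] by (simp add: reduced_energy_def D_def algebra_simps)
    hence "k * a ^ 4 / m i \<le> D + a powr q" using L0 aq[of a] by linarith
    also have "a powr q \<le> A powr q" using a \<epsilon> q_gt_2 by (intro powr_mono2) auto
    finally have "k * a ^ 4 / m i \<le> D + A powr q" by simp
    hence "k * a ^ 4 \<le> (D + A powr q) * m i" using pos[OF i] by (simp add: divide_le_eq)
    moreover have "k * \<epsilon> ^ 4 \<le> k * a ^ 4" using k a \<epsilon> by (intro mult_left_mono power_mono) auto
    ultimately have "k * \<epsilon> ^ 4 \<le> m i * (D + A powr q)" by (simp add: mult.commute)
    thus ?thesis unfolding \<delta>_def using den by (simp add: divide_le_eq)
  qed
  (* the coordinates beyond N are set to 0 because the masses are functions on all of nat *)
  define S where "S = (\<lambda>i. if i < N then {\<delta>..\<mu>} else {0::real})"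
  define K where "K = (PiE UNIV S \<times> {\<epsilon>..A}) \<inter> {x. (\<Sum>i<N. fst x i) = \<mu>}"
  have cproj: "continuous_on UNIV (\<lambda>x :: (nat \<Rightarrow> real) \<times> real. fst x i)" for i
    by (rule continuous_on_compose2[OF continuous_on_product_coordinates[of i] continuous_on_fst[OF continuous_on_id]]) auto
  have "compact (PiE UNIV S)"
  proof -
    have "compactin (product_topology (\<lambda>i. euclidean) UNIV) (PiE UNIV S)"
      unfolding compactin_PiE by (auto simp: S_def)
    thus ?thesis unfolding euclidean_product_topology compactin_euclidean_iff .
  qed
  moreover have "closed {x :: (nat \<Rightarrow> real) \<times> real. (\<Sum>i<N. fst x i) = \<mu>}"
    by (intro closed_Collect_eq continuous_on_sum continuous_on_const cproj)
  ultimately have "compact K"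
    unfolding K_def by (intro compact_Int_closed compact_Times) auto
  moreover have "continuous_on K (\<lambda>x. reduced_energy (fst x) (snd x))"
  proof -
    have "continuous_on K (\<lambda>x. branch_energy (fst x i) (snd x))" if i: "i < N" for i
    proof -
      have "continuous_on K (\<lambda>x. (fst x i, snd x))"
        by (intro continuous_on_Pair continuous_on_subset[OF cproj] continuous_on_snd continuous_on_id) auto
      moreover have "(fst x i, snd x) \<in> {0<..} \<times> UNIV" if "x \<in> K" for x
      proof -
        have "fst x i \<in> S i" using that by (auto simp: K_def PiE_iff)
        thus ?thesis using i \<delta> by (auto simp: S_def)
      qed
      ultimately have "continuous_on K (\<lambda>x. (\<lambda>(m, a). branch_energy m a) (fst x i, snd x))"
        by (intro continuous_on_compose2[OF continuous_on_branch_energy]) auto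
      thus ?thesis by simp
    qed
    moreover have "continuous_on K (\<lambda>x. snd x powr q / q)"
      using \<epsilon> q_gt_2
      by (intro continuous_on_divide continuous_on_powr' continuous_on_snd continuous_on_id continuous_on_const)
         (auto simp: K_def)
    ultimately show ?thesis unfolding reduced_energy_def
      by (intro continuous_on_diff continuous_on_sum) auto
  qed
  moreover have inK: "\<exists>x\<in>K. reduced_energy (fst x) (snd x) = reduced_energy m a"
    if adm: "admissible \<mu> m a" and low: "reduced_energy m a \<le> L" for m a
  proof -
    define m' where "m' = (\<lambda>i. if i < N then m i else 0)"
    have "m' i \<in> S i" for i
      using mass_lower[OF adm low] le[OF adm] by (auto simp: m'_def S_def)
    moreover have "(\<Sum>i<N. m' i) = \<mu>" using adm by (simp add: m'_def admissible_def)
    ultimately have "(m', a) \<in> K"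
      using lower[OF adm low] upper[OF adm low] by (auto simp: K_def)
    moreover have "reduced_energy m' a = reduced_energy m a"
      by (simp add: reduced_energy_def m'_def)
    ultimately show ?thesis by force
  qed
  moreover have "K \<noteq> {}" using inK[OF adm0] by (auto simp: L_def)
  ultimately obtain x where x: "x \<in> K" "\<And>y. y \<in> K \<Longrightarrow> reduced_energy (fst x) (snd x) \<le> reduced_energy (fst y) (snd y)"
    using continuous_attains_inf[of K "\<lambda>x. reduced_energy (fst x) (snd x)"] by blast
  have "admissible \<mu> (fst x) (snd x)"
  proof -
    have "fst x i \<in> S i" for i using x(1) by (auto simp: K_def PiE_iff)
    hence "fst x i \<in> {\<delta>..\<mu>}" if "i < N" for i using that unfolding S_def by metis
    hence "fst x i > 0" if "i < N" for i using \<delta> that by fastforce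
    thus ?thesis using x(1) \<epsilon> by (auto simp: K_def admissible_def)
  qed
  moreover have xL: "reduced_energy (fst x) (snd x) \<le> L"
    using inK[OF adm0] x(2) unfolding L_def by (metis order_refl)
  have "reduced_energy (fst x) (snd x) \<le> reduced_energy m a" if "admissible \<mu> m a" for m a
    using inK[OF that] x(2) xL by (metis linear order_trans)
  ultimately show ?thesis unfolding minimiser_def by blast
qed

definition symmetric_energy :: "real \<Rightarrow> real \<Rightarrow> real" where
  "symmetric_energy \<mu> a = real N * branch_energy (\<mu> / real N) a - a powr q / q"

lemma minimiser_le_soliton:
  assumes min: "minimiser \<mu> m a" and \<mu>: "\<mu> > 0"
  shows "reduced_energy m a \<le> soliton_energy \<mu>"
proof (rule field_le_epsilon)
  fix e :: real assume "e > 0"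
  then obtain m' a' where "admissible \<mu> m' a'" "reduced_energy m' a' < soliton_energy \<mu> + e"
    using runaway[OF \<mu>] by blast
  thus "reduced_energy m a \<le> soliton_energy \<mu> + e" using min unfolding minimiser_def by fastforce
qed

text \<open>
  If no competitor is strictly below the level of the soliton, a symmetric one on this level is a minimiser.
\<close>
lemma minimiser_iff:
  assumes \<mu>: "\<mu> > 0"
  shows "(\<exists>m a. minimiser \<mu> m a) \<longleftrightarrow> (\<exists>a>0. symmetric_energy \<mu> a \<le> soliton_energy \<mu>)"
proof
  assume "\<exists>m a. minimiser \<mu> m a"
  then obtain m a where min: "minimiser \<mu> m a" by blast
  have "(\<Sum>i<N. branch_energy (m i) a) = (\<Sum>i<N. branch_energy (\<mu> / real N) a)"
    by (rule sum.cong[OF refl]) (simp add: minimiser_symmetric(1)[OF min])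
  hence "reduced_energy m a = symmetric_energy \<mu> a"
    by (simp add: reduced_energy_def symmetric_energy_def)
  thus "\<exists>a>0. symmetric_energy \<mu> a \<le> soliton_energy \<mu>"
    using minimiser_le_soliton[OF min \<mu>] minimiser_value_pos[OF min] by auto
next
  assume "\<exists>a>0. symmetric_energy \<mu> a \<le> soliton_energy \<mu>"
  then obtain a where a: "a > 0" "symmetric_energy \<mu> a \<le> soliton_energy \<mu>" by blast
  have N0: "0 < N" using N_ge_3 by simp
  show "\<exists>m a. minimiser \<mu> m a"
  proof (cases "\<exists>m a. admissible \<mu> m a \<and> reduced_energy m a < soliton_energy \<mu>")
    case True
    thus ?thesis using minimiser_exists by blast
  next
    case False
    have "reduced_energy (\<lambda>_. \<mu> / real N) a \<le> soliton_energy \<mu>"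
      using a by (simp add: reduced_energy_def symmetric_energy_def)
    moreover have "admissible \<mu> (\<lambda>_. \<mu> / real N) a"
      using a \<mu> N0 by (simp add: admissible_def)
    ultimately have "minimiser \<mu> (\<lambda>_. \<mu> / real N) a"
      using False unfolding minimiser_def by force
    thus ?thesis by blast
  qed
qed

text \<open>
  As a function of the value the energy is decreasing on bumps and increasing on tails, so that it is smallest for
  the half-soliton, the piece with phase 0.
\<close>
lemma branch_energy_ge_half_soliton:
  assumes M: "M > 0" and a: "a > 0"
  shows "branch_energy M a \<ge> - (nu / (2 * (nu + 2)) * (max_wavenum M)\<^sup>2 * M)"
proof -
  define \<sigma> where "\<sigma> = max_wavenum M"
  have \<sigma>: "\<sigma> > 0" unfolding \<sigma>_def max_wavenum_def using M al_pos amp_pos tail_mass_0_pos by simp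
  have 0: "-(pi/2) < 0" "0 < pi/2" "-(pi/2) \<le> 0" by auto
  have mass: "coord_mass \<sigma> 0 = M"
    unfolding coord_mass_def \<sigma>_def max_wavenum_def
    using M al_pos amp_pos tail_mass_0_pos nu_pos by (simp add: powr_powr)
  define b where "b = coord_value \<sigma> 0"
  have b: "b > 0" unfolding b_def by (rule coord_value_pos[OF \<sigma> 0(1,2)])
  have ph: "phase M b = 0" and w: "wavenum M b = \<sigma>"
    using phase_coord[OF \<sigma> 0(3,2)] by (auto simp: mass b_def)
  have E: "branch_energy M b = - (nu / (2 * (nu + 2)) * \<sigma>\<^sup>2 * M)"
    by (simp add: branch_energy_def ph w)
  have "branch_energy M b \<le> branch_energy M a"
  proof (cases "a \<le> b")
    case True
    thus ?thesis
    proof (rule DERIV_nonpos_imp_nonincreasing)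
      fix x assume x: "a \<le> x" "x \<le> b"
      have "phase M x \<le> phase M b" by (rule phase_mono) (use M a x in auto)
      hence "\<not> sin (phase M x) > 0" using ph sin_phase_pos_iff[OF M] by simp
      hence "branch_slope M x \<le> 0"
        unfolding branch_slope_def using x a wavenum_pos[OF M, of x] by (intro mult_nonneg_nonpos) auto
      thus "\<exists>y. DERIV (branch_energy M) x :> y \<and> y \<le> 0"
        using branch_energy_deriv_value[OF M] by blast
    qed
  next
    case False
    hence "b \<le> a" by simp
    thus ?thesis
    proof (rule DERIV_nonneg_imp_nondecreasing)
      fix x assume x: "b \<le> x" "x \<le> a"
      have "phase M b \<le> phase M x" by (rule phase_mono) (use M b x in auto)
      hence "sin (phase M x) \<ge> 0"
        using ph sin_phase_pos_iff[OF M, of x] by (cases "phase M x = 0") auto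
      hence "branch_slope M x \<ge> 0"
        unfolding branch_slope_def using x b wavenum_pos[OF M, of x] by (intro mult_nonneg_nonneg) auto
      thus "\<exists>y. DERIV (branch_energy M) x :> y \<and> y \<ge> 0"
        using branch_energy_deriv_value[OF M] by blast
    qed
  qed
  thus ?thesis using E by (simp add: \<sigma>_def)
qed

text \<open>
  The excess, at mass 1, of the symmetric configuration over the soliton when the vertex term is left out.
\<close>
definition unit_gap :: "real \<Rightarrow> real" where
  "unit_gap b = real N * branch_energy (1 / real N) b + soliton_const"

lemma total_tail_half: "tail_mass (-(pi/2)) = 2 * tail_mass 0"
  using tail_mass_reflect[of 0] by simp

text \<open>
  The gap is positive because of \<open>N \<ge> 3\<close>: \<open>N\<close> half-solitons of mass \<open>1/N\<close> have energy \<open>- c (2/N)\<^bsup>2/nu\<^esup>\<close>, which is above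
  \<open>- c\<close>.
\<close>
lemma unit_gap_lower:
  obtains d where "d > 0" "\<And>b. b > 0 \<Longrightarrow> unit_gap b \<ge> d"
proof -
  define d where "d = soliton_const * (1 - (2 / real N) powr (2 / nu))"
  have N0: "real N > 0" "2 / real N < 1" using N_ge_3 by auto
  have "(2 / real N) powr (2 / nu) < 1 powr (2 / nu)"
    using N0 nu_pos by (intro powr_less_mono2) auto
  hence d: "d > 0" using soliton_const_pos by (simp add: d_def)
  have w: "(max_wavenum (1 / real N))\<^sup>2 = (2 / real N) powr (2 / nu) * (al * amp * tail_mass (-(pi/2))) powr (-2 / nu)"
  proof -
    have "(max_wavenum (1 / real N))\<^sup>2 = (1 / real N / (al * amp * tail_mass 0)) powr (2 / nu)"
      unfolding max_wavenum_def by (simp add: power2_eq_square powr_add[symmetric])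
    also have "1 / real N / (al * amp * tail_mass 0) = (2 / real N) / (al * amp * tail_mass (-(pi/2)))"
      unfolding total_tail_half by simp
    also have "\<dots> powr (2 / nu) = (2 / real N) powr (2 / nu) * (al * amp * tail_mass (-(pi/2))) powr (-2 / nu)"
      by (simp only: powr_divide[of "2 / real N"]) (simp add: powr_minus_divide)
    finally show ?thesis .
  qed
  have "unit_gap b \<ge> d" if b: "b > 0" for b
  proof -
    have "real N * branch_energy (1 / real N) b \<ge>
        real N * - (nu / (2 * (nu + 2)) * (max_wavenum (1 / real N))\<^sup>2 * (1 / real N))"
      by (intro mult_left_mono branch_energy_ge_half_soliton b) (use N0 in auto)
    also have "real N * - (nu / (2 * (nu + 2)) * (max_wavenum (1 / real N))\<^sup>2 * (1 / real N))
        = - (soliton_const * (2 / real N) powr (2 / nu))"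
      unfolding w soliton_const_def using N0 by simp
    finally show ?thesis by (simp add: unit_gap_def d_def algebra_simps)
  qed
  thus ?thesis using that d by blast
qed

definition eta :: real where "eta = (2 * (q - 2) - (p - 2)) / (6 - p)"

text \<open>
  The kinetic and the \<open>p\<close>-terms scale with the power \<open>1 + 2/nu\<close> of the mass, the vertex term with an exponent that is larger by
  \<open>eta\<close>.
\<close>
lemma symmetric_energy_scaling:
  assumes \<mu>: "\<mu> > 0" and b: "b > 0"
  shows "symmetric_energy \<mu> (\<mu> powr (al / nu) * b) \<le> soliton_energy \<mu>
    \<longleftrightarrow> q * unit_gap b / b powr q \<le> \<mu> powr eta"
proof -
  define X where "X = \<mu> powr (1 + 2 / nu)"
  have X: "X > 0" using \<mu> by (simp add: X_def)
  have N0: "real N > 0" using N_ge_3 by simp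
  have "branch_energy (\<mu> / real N) (\<mu> powr (al / nu) * b) = X * branch_energy (1 / real N) b"
    using branch_energy_scaling[OF \<mu>, of "1 / real N" b] b N0 by (simp add: X_def)
  moreover have "(\<mu> powr (al / nu) * b) powr q = X * \<mu> powr eta * b powr q"
  proof -
    have "al / nu * q = 1 + 2 / nu + eta"
      using p_gt_2 p_lt_6 by (simp add: al_def nu_def eta_def divide_simps)
    hence "(\<mu> powr (al / nu)) powr q = \<mu> powr (1 + 2 / nu + eta)" by (simp add: powr_powr)
    thus ?thesis by (simp add: powr_mult powr_add X_def)
  qed
  moreover have "soliton_energy \<mu> = - (soliton_const * X)"
    using \<mu> by (simp add: soliton_energy_eq X_def)
  ultimately have "symmetric_energy \<mu> (\<mu> powr (al / nu) * b) \<le> soliton_energy \<mu>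
     \<longleftrightarrow> X * (unit_gap b) \<le> X * (\<mu> powr eta * b powr q / q)"
    by (simp add: symmetric_energy_def unit_gap_def algebra_simps)
  also have "\<dots> \<longleftrightarrow> unit_gap b \<le> \<mu> powr eta * b powr q / q"
    by (rule mult_le_cancel_left_pos[OF X])
  also have "\<dots> \<longleftrightarrow> q * unit_gap b / b powr q \<le> \<mu> powr eta"
    using q_gt_2 b by (simp add: divide_simps mult_ac)
  finally show ?thesis .
qed

text \<open>
  The quotient blows up at 0, where the excess is bounded below, and at infinity, where it grows like
  \<open>b\<^sup>4\<close>.
\<close>
lemma unit_gap_min:
  obtains b0 where "b0 > 0" "\<And>b. b > 0 \<Longrightarrow> q * unit_gap b0 / b0 powr q \<le> q * unit_gap b / b powr q"
proof -
  define g where "g = (\<lambda>b. q * unit_gap b / b powr q)"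
  obtain d where d: "d > 0" "\<And>b. b > 0 \<Longrightarrow> unit_gap b \<ge> d" by (rule unit_gap_lower) blast
  define M where "M = 1 / real N"
  have N0: "real N > 0" using N_ge_3 by simp
  have M: "M > 0" using N0 by (simp add: M_def)
  obtain C where C: "C > 0" and "\<And>m a. m > 0 \<Longrightarrow> \<bar>branch_energy m a\<bar> \<le> C * (m powr (1 + 2 / nu) + a ^ 4 / m)"
    and lb: "\<And>m a. m > 0 \<Longrightarrow> branch_energy m a \<ge> a ^ 4 / m / (8 * (nu + 2)) - C * m powr (1 + 2 / nu)"
    using branch_energy_bounds by metis
  define D where "D = real N * (C * M powr (1 + 2 / nu))"
  define K where "K = real N / (M * (8 * (nu + 2)))"
  have K: "K > 0" using N0 M nu_pos by (simp add: K_def)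
  have D: "D > 0" using N0 M C by (simp add: D_def)
  have gap: "unit_gap b \<ge> K * b ^ 4 - D" for b
  proof -
    have "real N * (b ^ 4 / M / (8 * (nu + 2)) - C * M powr (1 + 2 / nu)) \<le> real N * branch_energy M b"
      using lb[OF M, of b] N0 by (intro mult_left_mono) auto
    moreover have "real N * (b ^ 4 / M / (8 * (nu + 2)) - C * M powr (1 + 2 / nu)) = K * b ^ 4 - D"
      by (simp add: K_def D_def right_diff_distrib mult_ac)
    ultimately show ?thesis using soliton_const_pos by (simp add: unit_gap_def M_def)
  qed
  have g1: "g 1 > 0" using d(1) d(2)[of 1] q_gt_2 by (simp add: g_def)
  (* outside [b1, b2] the quotient is not smaller than at 1 *)
  define b1 where "b1 = min 1 ((q * d / g 1) powr (1 / q))"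
  define b2 where "b2 = max 1 (((g 1 / q + D) / K) powr (1 / (4 - q)))"
  have b1: "0 < b1" "b1 \<le> 1" using d g1 q_gt_2 by (auto simp: b1_def)
  have b2: "1 \<le> b2" by (simp add: b2_def)
  have small: "g 1 \<le> g b" if "0 < b" "b < b1" for b
  proof -
    have "b \<le> (q * d / g 1) powr (1 / q)" using that by (simp add: b1_def)
    hence "b powr q \<le> ((q * d / g 1) powr (1 / q)) powr q" using that q_gt_2 by (intro powr_mono2) auto
    also have "\<dots> = q * d / g 1" using q_gt_2 d g1 by (simp add: powr_powr)
    finally have "g 1 * b powr q \<le> q * d" using g1 by (simp add: field_simps)
    also have "\<dots> \<le> q * unit_gap b" using d(2)[OF that(1)] q_gt_2 by simp
    finally show ?thesis unfolding g_def[of] using that by (simp add: le_divide_eq g_def)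
  qed
  have large: "g 1 < g b" if "b2 < b" for b
  proof (rule ccontr)
    assume "\<not> g 1 < g b"
    have b: "b > 1" using that b2 by simp
    have "q * unit_gap b \<le> g 1 * b powr q"
      using \<open>\<not> g 1 < g b\<close> b by (simp add: g_def divide_le_eq not_less)
    hence "unit_gap b \<le> g 1 / q * b powr q" using q_gt_2 by (simp add: field_simps)
    hence "K * b ^ 4 \<le> g 1 / q * b powr q + D" using gap[of b] by linarith
    also have "\<dots> \<le> (g 1 / q + D) * b powr q"
    proof -
      have "b powr q \<ge> 1" using b q_gt_2 by (intro ge_one_powr_ge_zero) auto
      hence "D * 1 \<le> D * b powr q" using D by (intro mult_left_mono) auto
      thus ?thesis by (simp add: distrib_right)
    qed
    finally have "b \<le> ((g 1 / q + D) / K) powr (1 / (4 - q))" using K b by (intro quartic_bound) auto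
    thus False using that by (simp add: b2_def)
  qed
  have "continuous_on {b1..b2} g"
  proof -
    have "continuous_on {b1..b2} unit_gap"
      unfolding unit_gap_def[abs_def] using N0
      by (intro continuous_on_add continuous_on_mult continuous_on_const continuous_on_branch_energy_value) auto
    thus ?thesis unfolding g_def using b1
      by (intro continuous_on_divide continuous_on_mult continuous_on_const continuous_on_powr continuous_on_id) auto
  qed
  then obtain b0 where b0: "b0 \<in> {b1..b2}" "\<And>b. b \<in> {b1..b2} \<Longrightarrow> g b0 \<le> g b"
    using continuous_attains_inf[of "{b1..b2}" g] b1 b2 by auto
  have "g b0 \<le> g 1" using b0(2)[of 1] b1 b2 by simp
  hence "g b0 \<le> g b" if "b > 0" for b
    using small[of b] large[of b] b0(2)[of b] that by (cases "b < b1"; cases "b2 < b") auto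
  thus ?thesis using that[of b0] b0 b1 by (simp add: g_def)
qed

lemma threshold:
  assumes "q \<noteq> p / 2 + 1"
  obtains \<mu>c where "\<mu>c > 0"
    and "\<And>\<mu>. q < p / 2 + 1 \<Longrightarrow> \<mu> > 0 \<Longrightarrow> (\<exists>a>0. symmetric_energy \<mu> a \<le> soliton_energy \<mu>) \<longleftrightarrow> \<mu> \<le> \<mu>c"
    and "\<And>\<mu>. q > p / 2 + 1 \<Longrightarrow> \<mu> > 0 \<Longrightarrow> (\<exists>a>0. symmetric_energy \<mu> a \<le> soliton_energy \<mu>) \<longleftrightarrow> \<mu> \<ge> \<mu>c"
proof -
  obtain b0 where b0: "b0 > 0" "\<And>b. b > 0 \<Longrightarrow> q * unit_gap b0 / b0 powr q \<le> q * unit_gap b / b powr q"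
    by (rule unit_gap_min) blast
  define g where "g = q * unit_gap b0 / b0 powr q"
  have g: "g > 0"
  proof -
    obtain d where "d > 0" "\<And>b. b > 0 \<Longrightarrow> unit_gap b \<ge> d" by (rule unit_gap_lower) blast
    hence "unit_gap b0 > 0" using b0(1) by fastforce
    thus ?thesis using q_gt_2 b0 by (simp add: g_def)
  qed
  have iff: "(\<exists>a>0. symmetric_energy \<mu> a \<le> soliton_energy \<mu>) \<longleftrightarrow> g \<le> \<mu> powr eta" if \<mu>: "\<mu> > 0" for \<mu>
  proof
    assume "\<exists>a>0. symmetric_energy \<mu> a \<le> soliton_energy \<mu>"
    then obtain a where a: "a > 0" "symmetric_energy \<mu> a \<le> soliton_energy \<mu>" by blast
    define b where "b = a / \<mu> powr (al / nu)"
    have b: "b > 0" "a = \<mu> powr (al / nu) * b" using a \<mu> by (auto simp: b_def)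
    have "q * unit_gap b / b powr q \<le> \<mu> powr eta"
      using a(2) unfolding b(2) symmetric_energy_scaling[OF \<mu> b(1)] .
    thus "g \<le> \<mu> powr eta" using b0(2)[OF b(1)] by (simp add: g_def)
  next
    assume "g \<le> \<mu> powr eta"
    hence "symmetric_energy \<mu> (\<mu> powr (al / nu) * b0) \<le> soliton_energy \<mu>"
      unfolding symmetric_energy_scaling[OF \<mu> b0(1)] g_def .
    moreover have "\<mu> powr (al / nu) * b0 > 0" using \<mu> b0 by simp
    ultimately show "\<exists>a>0. symmetric_energy \<mu> a \<le> soliton_energy \<mu>" by blast
  qed
  define \<mu>c where "\<mu>c = g powr (1 / eta)"
  have \<mu>c: "\<mu>c > 0" using g by (simp add: \<mu>c_def)
  have neg: "eta < 0" if "q < p / 2 + 1" using that p_lt_6 by (simp add: eta_def divide_less_0_iff)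
  have pos: "eta > 0" if "q > p / 2 + 1" using that p_lt_6 by (simp add: eta_def)
  have "eta \<noteq> 0" using neg pos assms by fastforce
  hence g_eq: "g = \<mu>c powr eta" using g by (simp add: \<mu>c_def powr_powr)
  show ?thesis
  proof (rule that[OF \<mu>c])
    fix \<mu> :: real assume q: "q < p / 2 + 1" and \<mu>: "\<mu> > 0"
    have "g \<le> \<mu> powr eta \<longleftrightarrow> \<mu> \<le> \<mu>c"
      unfolding g_eq using neg[OF q] \<mu> \<mu>c
        powr_less_mono2_neg[of eta \<mu>c \<mu>] powr_mono2'[of eta \<mu> \<mu>c] by (auto simp: not_less[symmetric])
    thus "(\<exists>a>0. symmetric_energy \<mu> a \<le> soliton_energy \<mu>) \<longleftrightarrow> \<mu> \<le> \<mu>c" using iff[OF \<mu>] by simp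
  next
    fix \<mu> :: real assume q: "q > p / 2 + 1" and \<mu>: "\<mu> > 0"
    have "g \<le> \<mu> powr eta \<longleftrightarrow> \<mu> \<ge> \<mu>c"
      unfolding g_eq using pos[OF q] \<mu> \<mu>c
        powr_less_mono2[of eta \<mu> \<mu>c] powr_mono2[of eta \<mu>c \<mu>] by (auto simp: not_less[symmetric])
    thus "(\<exists>a>0. symmetric_energy \<mu> a \<le> soliton_energy \<mu>) \<longleftrightarrow> \<mu> \<ge> \<mu>c" using iff[OF \<mu>] by simp
  qed
qed

end

section \<open>Integrals over intervals and the chain rule for absolutely continuous functions\<close>

lemma Icc_subset_integrable:
  "set_integrable lborel {0..} f \<Longrightarrow> 0 \<le> a \<Longrightarrow> set_integrable lborel {a..b} (f :: real \<Rightarrow> real)"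
  by (rule set_integrable_subset) auto

lemma Ici_subset_integrable:
  "set_integrable lborel {0..} f \<Longrightarrow> 0 \<le> a \<Longrightarrow> set_integrable lborel {a..} (f :: real \<Rightarrow> real)"
  by (rule set_integrable_subset) auto

lemma set_borel_measurable_continuous:
  fixes f :: "real \<Rightarrow> real"
  assumes "continuous_on A f" "A \<in> sets borel"
  shows "set_borel_measurable lborel A f"
  unfolding set_borel_measurable_def using borel_measurable_continuous_on_indicator[OF assms(2,1)] by simp

lemma set_borel_measurable_mult:
  fixes f g :: "real \<Rightarrow> real"
  assumes "set_borel_measurable lborel A f" "set_borel_measurable lborel A g"
  shows "set_borel_measurable lborel A (\<lambda>x. f x * g x)"
proof -
  have "(\<lambda>x. (indicator A x *\<^sub>R f x) * (indicator A x *\<^sub>R g x)) \<in> borel_measurable lborel"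
    using assms unfolding set_borel_measurable_def by (rule borel_measurable_times)
  moreover have "(\<lambda>x. (indicator A x *\<^sub>R f x) * (indicator A x *\<^sub>R g x)) = (\<lambda>x. indicator A x *\<^sub>R (f x * g x))"
    by (auto simp: indicator_def)
  ultimately show ?thesis unfolding set_borel_measurable_def by simp
qed

lemma set_integrable_measurable:
  "set_integrable lborel A f \<Longrightarrow> set_borel_measurable lborel A f"
  unfolding set_integrable_def set_borel_measurable_def by (rule borel_measurable_integrable)

lemma set_integrable_continuous_mult:
  fixes f g :: "real \<Rightarrow> real"
  assumes f: "continuous_on {a..b} f" and g: "set_integrable lborel {a..b} g"
  shows "set_integrable lborel {a..b} (\<lambda>t. f t * g t)"
proof -
  have "bounded (f ` {a..b})" by (rule compact_imp_bounded[OF compact_continuous_image[OF f]]) simp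
  then obtain C where "\<forall>x\<in>f ` {a..b}. norm x \<le> C" unfolding bounded_iff by blast
  hence C: "\<bar>f t\<bar> \<le> C" if "t \<in> {a..b}" for t using that by simp
  show ?thesis
  proof (rule set_integrable_bound[where f = "\<lambda>t. \<bar>C\<bar> * g t"])
    show "set_integrable lborel {a..b} (\<lambda>t. \<bar>C\<bar> * g t)" using g by simp
    show "set_borel_measurable lborel {a..b} (\<lambda>t. f t * g t)"
      by (intro set_borel_measurable_mult set_borel_measurable_continuous f set_integrable_measurable g) auto
    show "AE x in lborel. x \<in> {a..b} \<longrightarrow> norm (f x * g x) \<le> norm (\<bar>C\<bar> * g x)"
      using C by (intro AE_I2) (force simp: abs_mult intro: mult_right_mono)
  qed
qed

lemma LINT_combine:
  fixes f :: "real \<Rightarrow> real"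
  assumes "a \<le> b" "b \<le> c" "set_integrable lborel {a..c} f"
  shows "(LINT t:{a..c}|lborel. f t) = (LINT t:{a..b}|lborel. f t) + (LINT t:{b..c}|lborel. f t)"
proof -
  have "set_integrable lborel {a..b} f" "set_integrable lborel {b..c} f"
    by (rule set_integrable_subset[OF assms(3)]; use assms in auto)+
  thus ?thesis
    using Henstock_Kurzweil_Integration.integral_combine[OF assms(1,2) set_borel_integral_eq_integral(1)[OF assms(3)]]
    by (simp add: set_borel_integral_eq_integral(2) assms(3))
qed

lemma LINT_tail_split:
  fixes f :: "real \<Rightarrow> real"
  assumes "set_integrable lborel {0..} f" "0 \<le> a" "a \<le> b"
  shows "(LINT t:{a..}|lborel. f t) = (LINT t:{a..b}|lborel. f t) + (LINT t:{b..}|lborel. f t)"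
proof -
  have i: "set_integrable lborel {a..} f" "set_integrable lborel {a..b} f" "set_integrable lborel {b..} f"
    by (rule set_integrable_subset[OF assms(1)]; use assms in auto)+
  have "{a..b} \<inter> {b..} = {b}" using assms by auto
  hence neg: "negligible ({a..b} \<inter> {b..})" by simp
  have un: "{a..} = {a..b} \<union> {b..}" using assms by auto
  have "integral {a..} f = integral {a..b} f + integral {b..} f"
    unfolding un
    by (rule integral_Un[OF set_borel_integral_eq_integral(1)[OF i(2)] set_borel_integral_eq_integral(1)[OF i(3)] neg])
  thus ?thesis
    by (simp only: set_borel_integral_eq_integral(2)[OF i(1)] set_borel_integral_eq_integral(2)[OF i(2)]
        set_borel_integral_eq_integral(2)[OF i(3)])
qed

lemma continuous_on_LINT_tail:
  fixes f :: "real \<Rightarrow> real"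
  assumes "set_integrable lborel {0..} f"
  shows "continuous_on {0..b} (\<lambda>x. LINT t:{x..}|lborel. f t)"
proof -
  have i: "set_integrable lborel {0..x} f" for x by (rule set_integrable_subset[OF assms]) auto
  have "continuous_on {0..b} (\<lambda>x. (LINT t:{0..}|lborel. f t) - integral {0..x} f)"
    by (intro continuous_intros indefinite_integral_continuous_1 set_borel_integral_eq_integral(1) i)
  thus ?thesis
  proof (rule continuous_on_eq)
    fix x assume "x \<in> {0..b}"
    thus "(LINT t:{0..}|lborel. f t) - integral {0..x} f = (LINT t:{x..}|lborel. f t)"
      using LINT_tail_split[OF assms, of 0 x] by (simp add: set_borel_integral_eq_integral(2)[OF i])
  qed
qed

lemma LINT_tail_tendsto:
  fixes f :: "real \<Rightarrow> real"
  assumes "set_integrable lborel {0..} f"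
  shows "((\<lambda>x. LINT t:{x..}|lborel. f t) \<longlongrightarrow> 0) at_top"
proof -
  have "((\<lambda>x. (LINT t:{0..}|lborel. f t) - (LINT t:{0..x}|lborel. f t)) \<longlongrightarrow>
      (LINT t:{0..}|lborel. f t) - (LINT t:{0..}|lborel. f t)) at_top"
    by (intro tendsto_diff tendsto_const tendsto_set_lebesgue_integral_at_top assms) auto
  moreover have "\<forall>\<^sub>F x in at_top. (LINT t:{0..}|lborel. f t) - (LINT t:{0..x}|lborel. f t) = (LINT t:{x..}|lborel. f t)"
    using eventually_ge_at_top[of 0] by eventually_elim (use LINT_tail_split[OF assms, of 0] in simp)
  ultimately show ?thesis by (simp add: tendsto_cong)
qed

lemma set_integral_ge_zero:
  fixes f :: "real \<Rightarrow> real"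
  assumes "\<And>x. x \<in> A \<Longrightarrow> 0 \<le> f x"
  shows "0 \<le> (LINT x:A|lborel. f x)"
  unfolding set_lebesgue_integral_def using assms
  by (intro Bochner_Integration.integral_nonneg) (auto simp: indicator_def)

lemma set_integral_abs_bound:
  fixes f :: "real \<Rightarrow> real"
  assumes "set_integrable lborel A f"
  shows "\<bar>LINT x:A|lborel. f x\<bar> \<le> (LINT x:A|lborel. \<bar>f x\<bar>)"
proof -
  have "(LINT x:A|lborel. f x) \<le> (LINT x:A|lborel. \<bar>f x\<bar>)"
    by (rule set_integral_mono) (use assms set_integrable_abs in auto)
  moreover have "(LINT x:A|lborel. - f x) \<le> (LINT x:A|lborel. \<bar>f x\<bar>)"
    by (rule set_integral_mono) (use assms set_integrable_abs in \<open>auto simp: set_integrable_def\<close>)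
  ultimately show ?thesis using set_integral_uminus[OF assms] by linarith
qed

text \<open>
  Intervals \<open>{..c}\<close> generate the Borel sets and are stable under intersection, so the integral vanishes over every
  Borel set.
\<close>
lemma interval_integrals_zero_imp_AE_zero:
  fixes f :: "real \<Rightarrow> real"
  assumes int: "set_integrable lborel {a..b} f"
    and zero: "\<And>x. a \<le> x \<Longrightarrow> x \<le> b \<Longrightarrow> (LINT t:{a..x}|lborel. f t) = 0"
  shows "AE t in lborel. t \<in> {a..b} \<longrightarrow> f t = 0"
proof (cases "a \<le> b")
  case True
  define h where "h = (\<lambda>t. indicator {a..b} t *\<^sub>R f t)"
  have h: "integrable lborel h" using int by (simp add: set_integrable_def h_def)
  have hA: "set_integrable lborel A h" if "A \<in> sets lborel" for A
    unfolding set_integrable_def using integrable_mult_indicator[OF that h] .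
  have total: "(LINT t|lborel. h t) = 0"
    using zero[of b] True by (simp add: set_lebesgue_integral_def h_def)
  have "set_lebesgue_integral lborel A h = 0" if A: "A \<in> sets lborel" for A
  proof -
    have "Int_stable (range (\<lambda>c. {..c::real}))"
      by (auto simp: Int_stable_def Int_atMost)
    moreover have "range (\<lambda>c. {..c::real}) \<subseteq> Pow UNIV" by simp
    moreover have "A \<in> sigma_sets UNIV (range (\<lambda>c. {..c::real}))"
      using A by (simp add: borel_eq_atMost)
    ultimately show ?thesis
    proof (induction rule: sigma_sets_induct_disjoint)
      case (basic A)
      then obtain c where c: "A = {..c}" by auto
      show ?case
      proof (cases "c < a")
        case True
        have "(\<lambda>t. indicator {..c} t *\<^sub>R h t) = (\<lambda>t. 0)" using True by (auto simp: h_def indicator_def)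
        thus ?thesis by (simp add: c set_lebesgue_integral_def)
      next
        case False
        have "(\<lambda>t. indicator {..c} t *\<^sub>R h t) = (\<lambda>t. indicator {a..min b c} t *\<^sub>R f t)"
          by (auto simp: h_def indicator_def)
        hence "set_lebesgue_integral lborel A h = (LINT t:{a..min b c}|lborel. f t)"
          by (simp add: c set_lebesgue_integral_def)
        also have "\<dots> = 0" by (rule zero) (use False True in auto)
        finally show ?thesis .
      qed
    next
      case empty
      show ?case by (simp add: set_lebesgue_integral_def)
    next
      case (compl A)
      hence A: "A \<in> sets lborel" by (simp add: borel_eq_atMost)
      have "(LINT t:UNIV - A|lborel. h t) = (LINT t|lborel. h t - indicator A t *\<^sub>R h t)"
        unfolding set_lebesgue_integral_def
        by (rule Bochner_Integration.integral_cong) (auto simp: indicator_def)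
      also have "\<dots> = (LINT t|lborel. h t) - (LINT t:A|lborel. h t)"
        unfolding set_lebesgue_integral_def
        by (rule Bochner_Integration.integral_diff[OF h]) (use hA[OF A] in \<open>simp add: set_integrable_def\<close>)
      finally show ?case using compl total by simp
    next
      case (union A)
      have A: "A i \<in> sets lborel" for i using union(2) by (auto simp: borel_eq_atMost)
      have "(LINT t:(\<Union>i. A i)|lborel. h t) = (\<Sum>i. (LINT t:A i|lborel. h t))"
        by (rule lebesgue_integral_countable_add)
           (use A union(1) hA in \<open>auto simp: disjoint_family_on_def\<close>)
      thus ?case using union(3) by simp
    qed
  qed
  hence "AE t in lborel. h t = (\<lambda>_. 0) t"
    by (intro density_unique_real[OF h]) auto
  thus ?thesis by eventually_elim (auto simp: h_def)
qed (auto intro!: AE_I2)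

text \<open>
  Absolute continuity on the half-line in the form of the fundamental theorem, with \<open>g\<close> as an almost everywhere
  derivative.
\<close>
definition ac_deriv :: "(real \<Rightarrow> real) \<Rightarrow> (real \<Rightarrow> real) \<Rightarrow> bool" where
  "ac_deriv u g \<longleftrightarrow> (\<forall>b. set_integrable lborel {0..b} g) \<and>
     (\<forall>x y. 0 \<le> x \<longrightarrow> x \<le> y \<longrightarrow> u y - u x = (LINT t:{x..y}|lborel. g t))"

lemma ac_derivD:
  assumes "ac_deriv u g" "0 \<le> x"
  shows "set_integrable lborel {x..y} g" "x \<le> y \<Longrightarrow> u y - u x = (LINT t:{x..y}|lborel. g t)"
proof -
  have "set_integrable lborel {0..y} g" using assms by (simp add: ac_deriv_def)
  thus "set_integrable lborel {x..y} g" by (rule set_integrable_subset) (use assms in auto)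
qed (use assms in \<open>simp add: ac_deriv_def\<close>)

text \<open>
  Sum the estimate over a fine subdivision and let \<open>\<epsilon>\<close> tend to 0.
\<close>
lemma increment_small_imp_const:
  fixes F H :: "real \<Rightarrow> real"
  assumes ab: "a \<le> b"
    and small: "\<And>\<epsilon>. \<epsilon> > 0 \<Longrightarrow> \<exists>\<delta>>0. \<forall>x y. a \<le> x \<longrightarrow> x \<le> y \<longrightarrow> y \<le> b \<longrightarrow> y - x < \<delta> \<longrightarrow>
        \<bar>F y - F x\<bar> \<le> \<epsilon> * (H y - H x)"
  shows "F b = F a"
proof -
  have bound: "\<bar>F b - F a\<bar> \<le> \<epsilon> * (H b - H a)" if \<epsilon>: "\<epsilon> > 0" for \<epsilon>
  proof -
    obtain \<delta> where \<delta>: "\<delta> > 0" "\<And>x y. a \<le> x \<Longrightarrow> x \<le> y \<Longrightarrow> y \<le> b \<Longrightarrow> y - x < \<delta> \<Longrightarrow>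
        \<bar>F y - F x\<bar> \<le> \<epsilon> * (H y - H x)" using small[OF \<epsilon>] by blast
    obtain n :: nat where n: "(b - a) / \<delta> < real n" using reals_Archimedean2 by blast
    have n0: "n > 0" using n ab \<delta>(1) by (metis divide_nonneg_pos diff_ge_0_iff_ge of_nat_0 not_gr0 not_less)
    define x where "x = (\<lambda>k::nat. a + real k * ((b - a) / real n))"
    have step: "x (Suc k) - x k = (b - a) / real n" for k by (simp add: x_def algebra_simps add_divide_distrib[symmetric])
    have st: "(b - a) / real n < \<delta>" using n n0 \<delta>(1) by (simp add: divide_less_eq mult.commute)
    have "\<bar>F (x k) - F a\<bar> \<le> \<epsilon> * (H (x k) - H a)" if "k \<le> n" for k
      using that
    proof (induction k)
      case 0
      thus ?case by (simp add: x_def)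
    next
      case (Suc k)
      have "real (Suc k) * ((b - a) / real n) \<le> real n * ((b - a) / real n)"
        using Suc.prems ab by (intro mult_right_mono) auto
      hence "x (Suc k) \<le> b" using n0 by (simp add: x_def)
      moreover have "a \<le> x k" using ab by (simp add: x_def)
      moreover have "x k \<le> x (Suc k)" using step[of k] ab divide_nonneg_nonneg[of "b - a" "real n"] by linarith
      ultimately have "\<bar>F (x (Suc k)) - F (x k)\<bar> \<le> \<epsilon> * (H (x (Suc k)) - H (x k))"
        using step[of k] st by (intro \<delta>(2)) auto
      moreover have "\<bar>F (x k) - F a\<bar> \<le> \<epsilon> * (H (x k) - H a)" using Suc by simp
      ultimately show ?case unfolding right_diff_distrib by linarith
    qed
    from this[of n] show ?thesis using n0 by (simp add: x_def)
  qed
  have "\<bar>F b - F a\<bar> \<le> 0 + e" if "e > 0" for e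
  proof -
    define \<epsilon> where "\<epsilon> = e / (\<bar>H b - H a\<bar> + 1)"
    have "\<epsilon> > 0" using that by (simp add: \<epsilon>_def add_nonneg_pos)
    have "\<epsilon> * (H b - H a) \<le> \<epsilon> * (\<bar>H b - H a\<bar> + 1)" using \<open>\<epsilon> > 0\<close> by (intro mult_left_mono) auto
    also have "\<dots> = e" by (simp add: \<epsilon>_def add_nonneg_pos)
    finally show ?thesis using bound[OF \<open>\<epsilon> > 0\<close>] by simp
  qed
  hence "\<bar>F b - F a\<bar> \<le> 0" by (rule field_le_epsilon)
  thus ?thesis by simp
qed

lemma mvt_between:
  fixes f f' :: "real \<Rightarrow> real"
  assumes "\<And>z. min x y \<le> z \<Longrightarrow> z \<le> max x y \<Longrightarrow> (f has_real_derivative f' z) (at z)"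
  obtains z where "min x y \<le> z" "z \<le> max x y" "f y - f x = (y - x) * f' z"
proof -
  consider "x < y" | "y < x" | "x = y" by linarith
  thus ?thesis
  proof cases
    case 1
    then obtain z where "x < z" "z < y" "f y - f x = (y - x) * f' z"
      using MVT2[of x y f f'] assms by auto
    thus ?thesis using that[of z] 1 by auto
  next
    case 2
    then obtain z where "y < z" "z < x" "f x - f y = (x - y) * f' z"
      using MVT2[of y x f f'] assms by auto
    thus ?thesis using that[of z] 2 by (auto simp: algebra_simps)
  next
    case 3 thus ?thesis using that[of x] by auto
  qed
qed

text \<open>
  The derivatives \<open>M'\<close> and \<open>U'\<close> are merely integrable, so pointwise differentiation is not used. Instead the
  difference of the two sides has increments that are small compared with those of \<open>\<integral> (|M'| + |U'|)\<close>, by the mean value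
  theorem and the uniform continuity of the partial derivatives.
\<close>
lemma ac_chain_rule:
  fixes \<Phi> \<Phi>m \<Phi>u :: "real \<Rightarrow> real \<Rightarrow> real" and M U M' U' :: "real \<Rightarrow> real"
  assumes ab: "a \<le> b"
    and M: "\<And>x y. a \<le> x \<Longrightarrow> x \<le> y \<Longrightarrow> y \<le> b \<Longrightarrow> M y - M x = (LINT t:{x..y}|lborel. M' t)"
    and U: "\<And>x y. a \<le> x \<Longrightarrow> x \<le> y \<Longrightarrow> y \<le> b \<Longrightarrow> U y - U x = (LINT t:{x..y}|lborel. U' t)"
    and iM: "set_integrable lborel {a..b} M'" and iU: "set_integrable lborel {a..b} U'"
    and cM: "continuous_on {a..b} M" and cU: "continuous_on {a..b} U"
    and pos: "\<And>t. t \<in> {a..b} \<Longrightarrow> M t > 0"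
    and d1: "\<And>m u. m > 0 \<Longrightarrow> ((\<lambda>m. \<Phi> m u) has_real_derivative \<Phi>m m u) (at m)"
    and d2: "\<And>m u. m > 0 \<Longrightarrow> ((\<lambda>u. \<Phi> m u) has_real_derivative \<Phi>u m u) (at u)"
    and c1: "continuous_on ({0<..} \<times> UNIV) (\<lambda>(m, u). \<Phi>m m u)"
    and c2: "continuous_on ({0<..} \<times> UNIV) (\<lambda>(m, u). \<Phi>u m u)"
  shows "set_integrable lborel {a..b} (\<lambda>t. \<Phi>m (M t) (U t) * M' t + \<Phi>u (M t) (U t) * U' t)"
    and "\<Phi> (M b) (U b) - \<Phi> (M a) (U a) = (LINT t:{a..b}|lborel. \<Phi>m (M t) (U t) * M' t + \<Phi>u (M t) (U t) * U' t)"
proof -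
  define h where "h = (\<lambda>t. \<Phi>m (M t) (U t) * M' t + \<Phi>u (M t) (U t) * U' t)"
  have cMU: "continuous_on {a..b} (\<lambda>t. (M t, U t))" using cM cU by (intro continuous_on_Pair)
  have sub0: "(\<lambda>t. (M t, U t)) ` {a..b} \<subseteq> {0<..} \<times> UNIV" using pos by auto
  have c1': "continuous_on {a..b} (\<lambda>t. \<Phi>m (M t) (U t))"
    using continuous_on_compose2[OF c1 cMU sub0] by simp
  have c2': "continuous_on {a..b} (\<lambda>t. \<Phi>u (M t) (U t))"
    using continuous_on_compose2[OF c2 cMU sub0] by simp
  show ih: "set_integrable lborel {a..b} (\<lambda>t. \<Phi>m (M t) (U t) * M' t + \<Phi>u (M t) (U t) * U' t)"
    by (intro set_integral_add set_integrable_continuous_mult c1' c2' iM iU)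
  have ih': "set_integrable lborel {a..b} h" unfolding h_def by (rule ih)
  have sub: "set_integrable lborel {x..y} f" if "set_integrable lborel {a..b} f" "a \<le> x" "y \<le> b"
    for f :: "real \<Rightarrow> real" and x y
    by (rule set_integrable_subset[OF that(1)]) (use that in auto)
  have ne: "{a..b} \<noteq> {}" using ab by simp
  obtain t1 where t1: "t1 \<in> {a..b}" "\<And>t. t \<in> {a..b} \<Longrightarrow> M t1 \<le> M t"
    using continuous_attains_inf[OF compact_Icc ne cM] by blast
  obtain t2 where t2: "t2 \<in> {a..b}" "\<And>t. t \<in> {a..b} \<Longrightarrow> M t \<le> M t2"
    using continuous_attains_sup[OF compact_Icc ne cM] by blast
  obtain t3 where t3: "t3 \<in> {a..b}" "\<And>t. t \<in> {a..b} \<Longrightarrow> U t3 \<le> U t"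
    using continuous_attains_inf[OF compact_Icc ne cU] by blast
  obtain t4 where t4: "t4 \<in> {a..b}" "\<And>t. t \<in> {a..b} \<Longrightarrow> U t \<le> U t4"
    using continuous_attains_sup[OF compact_Icc ne cU] by blast
  (* a compact rectangle containing all (M s, U t), on which the partial derivatives are uniformly continuous *)
  define K where "K = {M t1..M t2} \<times> {U t3..U t4}"
  have K: "compact K" unfolding K_def by (intro compact_Times compact_Icc)
  have Ksub: "K \<subseteq> {0<..} \<times> UNIV" unfolding K_def using pos[OF t1(1)] by auto
  have inK: "(M s, U t) \<in> K" if "s \<in> {a..b}" "t \<in> {a..b}" for s t
    unfolding K_def using t1(2)[OF that(1)] t2(2)[OF that(1)] t3(2)[OF that(2)] t4(2)[OF that(2)] by simp
  have u1: "uniformly_continuous_on K (\<lambda>(m, u). \<Phi>m m u)"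
    by (rule compact_uniformly_continuous[OF continuous_on_subset[OF c1 Ksub] K])
  have u2: "uniformly_continuous_on K (\<lambda>(m, u). \<Phi>u m u)"
    by (rule compact_uniformly_continuous[OF continuous_on_subset[OF c2 Ksub] K])
  have uM: "uniformly_continuous_on {a..b} M" by (rule compact_uniformly_continuous[OF cM compact_Icc])
  have uU: "uniformly_continuous_on {a..b} U" by (rule compact_uniformly_continuous[OF cU compact_Icc])
  define F where "F = (\<lambda>x. \<Phi> (M x) (U x) - (LINT t:{a..x}|lborel. h t))"
  define H where "H = (\<lambda>x. LINT t:{a..x}|lborel. \<bar>M' t\<bar> + \<bar>U' t\<bar>)"
  have iH: "set_integrable lborel {a..b} (\<lambda>t. \<bar>M' t\<bar> + \<bar>U' t\<bar>)"
    by (intro set_integral_add set_integrable_abs iM iU)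
  have "F b = F a"
  proof (rule increment_small_imp_const[OF ab, where H = H])
    fix \<epsilon> :: real assume \<epsilon>: "\<epsilon> > 0"
    obtain d where d: "d > 0" "\<And>z w. z \<in> K \<Longrightarrow> w \<in> K \<Longrightarrow> dist z w < d \<Longrightarrow>
        dist ((\<lambda>(m, u). \<Phi>m m u) z) ((\<lambda>(m, u). \<Phi>m m u) w) < \<epsilon>"
      using u1 \<epsilon> unfolding uniformly_continuous_on_def by (metis dist_commute)
    obtain d' where d': "d' > 0" "\<And>z w. z \<in> K \<Longrightarrow> w \<in> K \<Longrightarrow> dist z w < d' \<Longrightarrow>
        dist ((\<lambda>(m, u). \<Phi>u m u) z) ((\<lambda>(m, u). \<Phi>u m u) w) < \<epsilon>"
      using u2 \<epsilon> unfolding uniformly_continuous_on_def by (metis dist_commute)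
    define e where "e = min d d' / 2"
    have e: "e > 0" using d(1) d'(1) by (simp add: e_def)
    obtain \<delta>1 where \<delta>1: "\<delta>1 > 0" "\<And>s t. s \<in> {a..b} \<Longrightarrow> t \<in> {a..b} \<Longrightarrow> dist s t < \<delta>1 \<Longrightarrow> dist (M s) (M t) < e"
      using uM e unfolding uniformly_continuous_on_def by (metis dist_commute)
    obtain \<delta>2 where \<delta>2: "\<delta>2 > 0" "\<And>s t. s \<in> {a..b} \<Longrightarrow> t \<in> {a..b} \<Longrightarrow> dist s t < \<delta>2 \<Longrightarrow> dist (U s) (U t) < e"
      using uU e unfolding uniformly_continuous_on_def by (metis dist_commute)
    show "\<exists>\<delta>>0. \<forall>x y. a \<le> x \<longrightarrow> x \<le> y \<longrightarrow> y \<le> b \<longrightarrow> y - x < \<delta> \<longrightarrow> \<bar>F y - F x\<bar> \<le> \<epsilon> * (H y - H x)"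
    proof (intro exI[of _ "min \<delta>1 \<delta>2"] conjI allI impI)
      fix x y assume xy: "a \<le> x" "x \<le> y" "y \<le> b" "y - x < min \<delta>1 \<delta>2"
      have x: "x \<in> {a..b}" and y: "y \<in> {a..b}" using xy by auto
      have near: "\<bar>M s - M t\<bar> < e" "\<bar>U s - U t\<bar> < e" if "s \<in> {x..y}" "t \<in> {x..y}" for s t
        using \<delta>1(2)[of s t] \<delta>2(2)[of s t] that xy by (auto simp: dist_real_def abs_if)
      have pM: "min (M x) (M y) > 0" using pos[OF x] pos[OF y] by simp
      obtain \<xi> where \<xi>: "min (M x) (M y) \<le> \<xi>" "\<xi> \<le> max (M x) (M y)"
        "\<Phi> (M y) (U y) - \<Phi> (M x) (U y) = (M y - M x) * \<Phi>m \<xi> (U y)"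
        by (rule mvt_between[where f = "\<lambda>m. \<Phi> m (U y)" and f' = "\<lambda>m. \<Phi>m m (U y)" and x = "M x" and y = "M y"])
           (use d1 pM in auto)
      obtain \<eta> where \<eta>: "min (U x) (U y) \<le> \<eta>" "\<eta> \<le> max (U x) (U y)"
        "\<Phi> (M x) (U y) - \<Phi> (M x) (U x) = (U y - U x) * \<Phi>u (M x) \<eta>"
        by (rule mvt_between[where f = "\<lambda>u. \<Phi> (M x) u" and f' = "\<lambda>u. \<Phi>u (M x) u" and x = "U x" and y = "U y"])
           (use d2 pos[OF x] in auto)
      have \<xi>K: "(\<xi>, U y) \<in> K" using \<xi>(1,2) inK[OF x y] inK[OF y y] by (auto simp: K_def min_le_iff_disj le_max_iff_disj)
      have \<eta>K: "(M x, \<eta>) \<in> K" using \<eta>(1,2) inK[OF x x] inK[OF x y] by (auto simp: K_def min_le_iff_disj le_max_iff_disj)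
      have \<xi>e: "\<bar>\<xi> - M t\<bar> < e" if "t \<in> {x..y}" for t
        using near(1)[of x t] near(1)[of y t] that \<xi>(1,2) xy by (auto simp: min_def max_def split: if_splits)
      have \<eta>e: "\<bar>\<eta> - U t\<bar> < e" if "t \<in> {x..y}" for t
        using near(2)[of x t] near(2)[of y t] that \<eta>(1,2) xy by (auto simp: min_def max_def split: if_splits)
      have close: "dist z w < d \<and> dist z w < d'" if "\<bar>fst z - fst w\<bar> < e" "\<bar>snd z - snd w\<bar> < e" for z w :: "real \<times> real"
      proof -
        have "dist z w \<le> \<bar>fst z - fst w\<bar> + \<bar>snd z - snd w\<bar>"
          unfolding dist_prod_def dist_real_def by (rule sqrt_sum_squares_le_sum_abs[THEN order_trans]) simp
        also have "\<dots> < 2 * e" using that by simp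
        also have "\<dots> = min d d'" by (simp add: e_def)
        finally show ?thesis by simp
      qed
      have E1: "\<bar>\<Phi>m \<xi> (U y) - \<Phi>m (M t) (U t)\<bar> \<le> \<epsilon>" if t: "t \<in> {x..y}" for t
      proof -
        have "t \<in> {a..b}" using t xy by auto
        thus ?thesis using d(2)[OF \<xi>K inK[of t t]] close[of "(\<xi>, U y)" "(M t, U t)"] \<xi>e[OF t] near(2)[of y t] t xy
          by (simp add: dist_real_def)
      qed
      have E2: "\<bar>\<Phi>u (M x) \<eta> - \<Phi>u (M t) (U t)\<bar> \<le> \<epsilon>" if t: "t \<in> {x..y}" for t
      proof -
        have "t \<in> {a..b}" using t xy by auto
        thus ?thesis using d'(2)[OF \<eta>K inK[of t t]] close[of "(M x, \<eta>)" "(M t, U t)"] \<eta>e[OF t] near(1)[of x t] t xy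
          by (simp add: dist_real_def)
      qed
      have ixM: "set_integrable lborel {x..y} M'" and ixU: "set_integrable lborel {x..y} U'"
        and ixh: "set_integrable lborel {x..y} h" and ixH: "set_integrable lborel {x..y} (\<lambda>t. \<bar>M' t\<bar> + \<bar>U' t\<bar>)"
        using sub[OF iM xy(1,3)] sub[OF iU xy(1,3)] sub[OF ih' xy(1,3)] sub[OF iH xy(1,3)] by auto
      (* the partial derivatives at intermediate points, constant on the subinterval *)
      define c1 c2 where "c1 = \<Phi>m \<xi> (U y)" and "c2 = \<Phi>u (M x) \<eta>"
      have ic: "set_integrable lborel {x..y} (\<lambda>t. c1 * M' t + c2 * U' t)"
        using ixM ixU by (intro set_integral_add) auto
      have "\<Phi> (M y) (U y) - \<Phi> (M x) (U x) = c1 * (LINT t:{x..y}|lborel. M' t) + c2 * (LINT t:{x..y}|lborel. U' t)"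
      proof -
        have "\<Phi> (M y) (U y) - \<Phi> (M x) (U y) = c1 * (LINT t:{x..y}|lborel. M' t)"
          unfolding \<xi>(3) M[OF xy(1-3)] c1_def by (rule mult.commute)
        moreover have "\<Phi> (M x) (U y) - \<Phi> (M x) (U x) = c2 * (LINT t:{x..y}|lborel. U' t)"
          unfolding \<eta>(3) U[OF xy(1-3)] c2_def by (rule mult.commute)
        ultimately show ?thesis by linarith
      qed
      also have "\<dots> = (LINT t:{x..y}|lborel. c1 * M' t + c2 * U' t)"
        using ixM ixU by (simp add: set_integral_add)
      finally have inc: "\<Phi> (M y) (U y) - \<Phi> (M x) (U x) = (LINT t:{x..y}|lborel. c1 * M' t + c2 * U' t)" .
      have "F y - F x = (LINT t:{x..y}|lborel. (c1 * M' t + c2 * U' t) - h t)"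
        unfolding F_def using LINT_combine[OF xy(1,2) sub[OF ih' order_refl xy(3)]] inc
        by (simp add: set_integral_diff[OF ic ixh])
      also have "\<bar>\<dots>\<bar> \<le> (LINT t:{x..y}|lborel. \<bar>(c1 * M' t + c2 * U' t) - h t\<bar>)"
        by (intro set_integral_abs_bound set_integral_diff ic ixh)
      also have "\<dots> \<le> (LINT t:{x..y}|lborel. \<epsilon> * (\<bar>M' t\<bar> + \<bar>U' t\<bar>))"
      proof (rule set_integral_mono)
        show "set_integrable lborel {x..y} (\<lambda>t. \<bar>(c1 * M' t + c2 * U' t) - h t\<bar>)"
          by (intro set_integrable_abs set_integral_diff ic ixh)
        show "set_integrable lborel {x..y} (\<lambda>t. \<epsilon> * (\<bar>M' t\<bar> + \<bar>U' t\<bar>))" using ixH by simp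
        fix t assume t: "t \<in> {x..y}"
        have "\<bar>(c1 * M' t + c2 * U' t) - h t\<bar> = \<bar>(c1 - \<Phi>m (M t) (U t)) * M' t + (c2 - \<Phi>u (M t) (U t)) * U' t\<bar>"
          by (simp add: h_def algebra_simps)
        also have "\<dots> \<le> \<bar>c1 - \<Phi>m (M t) (U t)\<bar> * \<bar>M' t\<bar> + \<bar>c2 - \<Phi>u (M t) (U t)\<bar> * \<bar>U' t\<bar>"
          by (simp add: abs_mult[symmetric] abs_triangle_ineq)
        also have "\<dots> \<le> \<epsilon> * \<bar>M' t\<bar> + \<epsilon> * \<bar>U' t\<bar>"
          using E1[OF t] E2[OF t] by (intro add_mono mult_right_mono) (auto simp: c1_def c2_def)
        finally show "\<bar>(c1 * M' t + c2 * U' t) - h t\<bar> \<le> \<epsilon> * (\<bar>M' t\<bar> + \<bar>U' t\<bar>)" by (simp add: distrib_left)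
      qed
      also have "\<dots> = \<epsilon> * (H y - H x)"
        unfolding H_def using LINT_combine[OF xy(1,2) sub[OF iH order_refl xy(3)]] by simp
      finally show "\<bar>F y - F x\<bar> \<le> \<epsilon> * (H y - H x)" .
    qed (use \<delta>1 \<delta>2 in auto)
  qed
  moreover have "(LINT t:{a..a}|lborel. h t) = 0"
    using set_borel_integral_eq_integral(2)[OF sub[OF ih' order_refl ab]] by simp
  ultimately show "\<Phi> (M b) (U b) - \<Phi> (M a) (U a) = (LINT t:{a..b}|lborel. \<Phi>m (M t) (U t) * M' t + \<Phi>u (M t) (U t) * U' t)"
    by (simp add: F_def h_def)
qed

section \<open>Weak derivatives of continuous functions\<close>

lemma L2_halfline_mult:
  assumes "L2_halfline f" "L2_halfline g"
  shows "set_integrable lborel {0..} (\<lambda>t. f t * g t)"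
proof (rule set_integrable_bound[where f = "\<lambda>t. (f t)\<^sup>2 + (g t)\<^sup>2"])
  show "set_integrable lborel {0..} (\<lambda>t. (f t)\<^sup>2 + (g t)\<^sup>2)"
    using assms by (intro set_integral_add) (auto simp: L2_halfline_def)
  show "set_borel_measurable lborel {0..} (\<lambda>t. f t * g t)"
    using assms by (intro set_borel_measurable_mult) (auto simp: L2_halfline_def)
  have "\<bar>a * b\<bar> \<le> a\<^sup>2 + b\<^sup>2" for a b :: real
  proof -
    have "2 * (\<bar>a\<bar> * \<bar>b\<bar>) \<le> \<bar>a\<bar>\<^sup>2 + \<bar>b\<bar>\<^sup>2" using zero_le_power2[of "\<bar>a\<bar> - \<bar>b\<bar>"] by (simp add: power2_diff)
    moreover have "0 \<le> \<bar>a\<bar> * \<bar>b\<bar>" by simp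
    ultimately show ?thesis unfolding abs_mult power2_abs by linarith
  qed
  thus "AE t in lborel. t \<in> {0..} \<longrightarrow> norm (f t * g t) \<le> norm ((f t)\<^sup>2 + (g t)\<^sup>2)"
    by (intro AE_I2) (simp add: abs_of_nonneg)
qed

lemma L2_halfline_integrable_Icc:
  assumes "L2_halfline g" "0 \<le> a"
  shows "set_integrable lborel {a..b} g"
proof (rule set_integrable_bound[where f = "\<lambda>t. 1 + (g t)\<^sup>2"])
  show "set_integrable lborel {a..b} (\<lambda>t. 1 + (g t)\<^sup>2)"
    using assms by (intro set_integral_add borel_integrable_atLeastAtMost' continuous_on_const Icc_subset_integrable)
      (auto simp: L2_halfline_def)
  show "set_borel_measurable lborel {a..b} g"
    by (rule set_borel_measurable_subset[of lborel "{0..}"]) (use assms in \<open>auto simp: L2_halfline_def\<close>)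
  have "\<bar>x\<bar> \<le> 1 + x\<^sup>2" for x :: real
    using zero_le_power2[of "\<bar>x\<bar> - 1"] by (simp add: power2_diff)
  thus "AE t in lborel. t \<in> {a..b} \<longrightarrow> norm (g t) \<le> norm (1 + (g t)\<^sup>2)"
    by (intro AE_I2) (simp add: abs_of_nonneg add_nonneg_nonneg)
qed

text \<open>
  A \<open>C\<^sup>1\<close> step from 0 to 1 on the unit interval, glued from parabolas.
\<close>
definition ramp :: "real \<Rightarrow> real" where
  "ramp s = 2 * ((max 0 s)\<^sup>2 - 2 * (max 0 (s - 1/2))\<^sup>2 + (max 0 (s - 1))\<^sup>2)"

definition ramp' :: "real \<Rightarrow> real" where
  "ramp' s = 4 * (max 0 s - 2 * max 0 (s - 1/2) + max 0 (s - 1))"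

lemma pos_part_square_deriv:
  "((\<lambda>s::real. (max 0 s)\<^sup>2) has_real_derivative 2 * max 0 s) (at s)"
proof -
  consider "s > 0" | "s < 0" | "s = 0" by linarith
  thus ?thesis
  proof cases
    case 1
    have "((\<lambda>s::real. s\<^sup>2) has_real_derivative 2 * s) (at s)" by (auto intro!: derivative_eq_intros)
    hence "((\<lambda>s::real. (max 0 s)\<^sup>2) has_real_derivative 2 * s) (at s)"
      by (rule has_field_derivative_transform_within_open[where S = "{0<..}"]) (use 1 in auto)
    thus ?thesis using 1 by simp
  next
    case 2
    have "((\<lambda>s::real. 0) has_real_derivative 0) (at s)" by simp
    hence "((\<lambda>s::real. (max 0 s)\<^sup>2) has_real_derivative 0) (at s)"
      by (rule has_field_derivative_transform_within_open[where S = "{..<0}"]) (use 2 in auto)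
    thus ?thesis using 2 by simp
  next
    case 3
    have "((\<lambda>s::real. (max 0 s)\<^sup>2) has_real_derivative 0) (at 0)"
      unfolding has_field_derivative_iff
    proof (rule Lim_null_comparison[where g = "\<lambda>h. \<bar>h\<bar>"])
      show "\<forall>\<^sub>F h in at 0. norm (((max 0 h)\<^sup>2 - (max 0 0)\<^sup>2) / (h - 0)) \<le> \<bar>h\<bar>" for h :: real
        by (intro always_eventually allI) (auto simp: max_def power2_eq_square)
      show "((\<lambda>h::real. \<bar>h\<bar>) \<longlongrightarrow> 0) (at 0)" by (rule tendsto_eq_intros refl | simp)+
    qed
    thus ?thesis using 3 by simp
  qed
qed

lemma ramp_deriv: "(ramp has_real_derivative ramp' s) (at s)"
proof -
  have d: "((\<lambda>s. (max 0 (s - c))\<^sup>2) has_real_derivative 2 * max 0 (s - c)) (at s)" for c :: real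
    using DERIV_chain2[OF pos_part_square_deriv[of "s - c"] DERIV_diff[OF DERIV_ident DERIV_const]] by simp
  have "((\<lambda>s. 2 * ((max 0 (s - 0))\<^sup>2 - 2 * (max 0 (s - 1/2))\<^sup>2 + (max 0 (s - 1))\<^sup>2)) has_real_derivative
     2 * (2 * max 0 (s - 0) - 2 * (2 * max 0 (s - 1/2)) + 2 * max 0 (s - 1))) (at s)"
    by (intro DERIV_cmult DERIV_add DERIV_diff d)
  thus ?thesis unfolding ramp_def[abs_def] ramp'_def by (simp add: algebra_simps)
qed

lemma ramp'_nonneg: "ramp' s \<ge> 0" by (auto simp: ramp'_def max_def)
lemma ramp'_outside: "s \<le> 0 \<or> 1 \<le> s \<Longrightarrow> ramp' s = 0" by (auto simp: ramp'_def max_def)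
lemma ramp_left: "s \<le> 0 \<Longrightarrow> ramp s = 0" by (auto simp: ramp_def max_def)
lemma ramp_right: "1 \<le> s \<Longrightarrow> ramp s = 1" by (auto simp: ramp_def max_def power2_eq_square algebra_simps)

lemma ramp_mono: "s \<le> t \<Longrightarrow> ramp s \<le> ramp t"
  by (rule DERIV_nonneg_imp_nondecreasing) (use ramp_deriv ramp'_nonneg in blast)+

lemma ramp_range: "0 \<le> ramp s" "ramp s \<le> 1"
  using ramp_mono[of "min s 0" s] ramp_mono[of s "max s 1"] ramp_left[of "min s 0"] ramp_right[of "max s 1"] by auto

text \<open>
  The derivative of a step of width \<open>\<epsilon>\<close>: an approximate identity at \<open>z\<close>.
\<close>
definition bump_kernel :: "real \<Rightarrow> real \<Rightarrow> real \<Rightarrow> real" where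
  "bump_kernel \<epsilon> z t = ramp' ((t - z) / \<epsilon>) / \<epsilon>"

lemma ramp_scaled_deriv: "((\<lambda>t. ramp ((t - z) / \<epsilon>)) has_real_derivative bump_kernel \<epsilon> z t) (at t)"
proof -
  have "((\<lambda>t. ramp ((t - z) / \<epsilon>)) has_real_derivative ramp' ((t - z) / \<epsilon>) * ((1 - 0) / \<epsilon>)) (at t)"
    by (intro DERIV_chain2[OF ramp_deriv] DERIV_cdivide DERIV_diff DERIV_ident DERIV_const)
  thus ?thesis by (simp add: bump_kernel_def)
qed

lemma continuous_on_kernel: "\<epsilon> > 0 \<Longrightarrow> continuous_on A (bump_kernel \<epsilon> z)"
  unfolding bump_kernel_def[abs_def] ramp'_def by (intro continuous_intros) auto

lemma kernel_nonneg: "\<epsilon> > 0 \<Longrightarrow> bump_kernel \<epsilon> z t \<ge> 0"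
  using ramp'_nonneg by (simp add: bump_kernel_def)

lemma kernel_outside: "\<epsilon> > 0 \<Longrightarrow> t \<notin> {z..z + \<epsilon>} \<Longrightarrow> bump_kernel \<epsilon> z t = 0"
  unfolding bump_kernel_def by (subst ramp'_outside) (auto simp: divide_le_0_iff le_divide_eq)

lemma kernel_integral:
  assumes "\<epsilon> > 0"
  shows "(LINT t:{z..z + \<epsilon>}|lborel. bump_kernel \<epsilon> z t) = 1"
proof -
  have "(LINT t:{z..z + \<epsilon>}|lborel. bump_kernel \<epsilon> z t) = ramp ((z + \<epsilon> - z) / \<epsilon>) - ramp ((z - z) / \<epsilon>)"
    unfolding set_lebesgue_integral_def
    by (rule integral_FTC_atLeastAtMost)
       (use assms continuous_on_kernel ramp_scaled_deriv in
         \<open>auto simp: has_real_derivative_iff_has_vector_derivative[symmetric] intro: has_field_derivative_at_within\<close>)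
  thus ?thesis using assms by (simp add: ramp_left ramp_right)
qed

lemma kernel_restrict:
  fixes u :: "real \<Rightarrow> real"
  assumes "\<epsilon> > 0" "0 \<le> z"
  shows "(\<lambda>t. indicator {0..} t *\<^sub>R (u t * bump_kernel \<epsilon> z t)) = (\<lambda>t. indicator {z..z + \<epsilon>} t *\<^sub>R (u t * bump_kernel \<epsilon> z t))"
proof
  fix t
  show "indicator {0..} t *\<^sub>R (u t * bump_kernel \<epsilon> z t) = indicator {z..z + \<epsilon>} t *\<^sub>R (u t * bump_kernel \<epsilon> z t)"
    using kernel_outside[OF assms(1), of t z] assms(2) by (cases "t \<in> {z..z + \<epsilon>}") auto
qed

lemma kernel_integrable:
  fixes u :: "real \<Rightarrow> real"
  assumes u: "continuous_on {0..} u" and \<epsilon>: "\<epsilon> > 0" "0 \<le> z"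
  shows "set_integrable lborel {z..z + \<epsilon>} (\<lambda>t. u t * bump_kernel \<epsilon> z t)"
    and "set_integrable lborel {0..} (\<lambda>t. u t * bump_kernel \<epsilon> z t)"
proof -
  show "set_integrable lborel {z..z + \<epsilon>} (\<lambda>t. u t * bump_kernel \<epsilon> z t)"
    by (intro borel_integrable_atLeastAtMost' continuous_on_mult continuous_on_kernel \<epsilon> continuous_on_subset[OF u])
       (use \<epsilon> in auto)
  thus "set_integrable lborel {0..} (\<lambda>t. u t * bump_kernel \<epsilon> z t)"
    unfolding set_integrable_def kernel_restrict[OF \<epsilon>] .
qed

lemma kernel_average:
  fixes u :: "real \<Rightarrow> real"
  assumes u: "continuous_on {0..} u" and \<epsilon>: "\<epsilon> > 0" "0 \<le> z"
    and close: "\<And>t. t \<in> {z..z + \<epsilon>} \<Longrightarrow> \<bar>u t - u z\<bar> \<le> \<eta>"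
  shows "\<bar>(LINT t:{0..}|lborel. u t * bump_kernel \<epsilon> z t) - u z\<bar> \<le> \<eta>"
proof -
  have ik: "set_integrable lborel {z..z + \<epsilon>} (bump_kernel \<epsilon> z)"
    by (intro borel_integrable_atLeastAtMost' continuous_on_kernel \<epsilon>)
  note iu = kernel_integrable(1)[OF u \<epsilon>]
  have "(LINT t:{0..}|lborel. u t * bump_kernel \<epsilon> z t) = (LINT t:{z..z + \<epsilon>}|lborel. u t * bump_kernel \<epsilon> z t)"
    unfolding set_lebesgue_integral_def kernel_restrict[OF \<epsilon>] ..
  moreover have "(LINT t:{z..z + \<epsilon>}|lborel. (u z - \<eta>) * bump_kernel \<epsilon> z t) \<le> (LINT t:{z..z + \<epsilon>}|lborel. u t * bump_kernel \<epsilon> z t)"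
  proof (rule set_integral_mono)
    fix t assume "t \<in> {z..z + \<epsilon>}"
    hence "u z - \<eta> \<le> u t" using close[of t] by linarith
    thus "(u z - \<eta>) * bump_kernel \<epsilon> z t \<le> u t * bump_kernel \<epsilon> z t" using kernel_nonneg[OF \<epsilon>(1)] by (intro mult_right_mono)
  qed (use ik iu in auto)
  moreover have "(LINT t:{z..z + \<epsilon>}|lborel. u t * bump_kernel \<epsilon> z t) \<le> (LINT t:{z..z + \<epsilon>}|lborel. (u z + \<eta>) * bump_kernel \<epsilon> z t)"
  proof (rule set_integral_mono)
    fix t assume "t \<in> {z..z + \<epsilon>}"
    hence "u t \<le> u z + \<eta>" using close[of t] by linarith
    thus "u t * bump_kernel \<epsilon> z t \<le> (u z + \<eta>) * bump_kernel \<epsilon> z t" using kernel_nonneg[OF \<epsilon>(1)] by (intro mult_right_mono)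
  qed (use ik iu in auto)
  ultimately show ?thesis by (simp add: abs_le_iff kernel_integral[OF \<epsilon>(1)])
qed

text \<open>
  Approximates the indicator function of \<open>{x..y}\<close> by test functions.
\<close>
definition plateau :: "real \<Rightarrow> real \<Rightarrow> real \<Rightarrow> real \<Rightarrow> real" where
  "plateau \<epsilon> x y t = ramp ((t - x) / \<epsilon>) - ramp ((t - y) / \<epsilon>)"

lemma plateau_deriv: "(plateau \<epsilon> x y has_real_derivative bump_kernel \<epsilon> x t - bump_kernel \<epsilon> y t) (at t)"
  unfolding plateau_def[abs_def] by (intro DERIV_diff ramp_scaled_deriv)

lemma plateau_test_function:
  assumes "\<epsilon> > 0" "0 < x" "x \<le> y"
  shows "test_function (plateau \<epsilon> x y)"
  unfolding test_function_def
proof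
  have "(plateau \<epsilon> x y has_vector_derivative bump_kernel \<epsilon> x t - bump_kernel \<epsilon> y t) (at t)" for t
    using plateau_deriv by (simp add: has_real_derivative_iff_has_vector_derivative)
  moreover have "continuous_on UNIV (\<lambda>t. bump_kernel \<epsilon> x t - bump_kernel \<epsilon> y t)"
    by (intro continuous_on_diff continuous_on_kernel assms)
  ultimately show "plateau \<epsilon> x y C1_differentiable_on UNIV"
    unfolding C1_differentiable_on_def
    by (intro exI[of _ "\<lambda>t. bump_kernel \<epsilon> x t - bump_kernel \<epsilon> y t"]) simp
  show "\<exists>a b. 0 < a \<and> a \<le> b \<and> (\<forall>t. t \<notin> {a..b} \<longrightarrow> plateau \<epsilon> x y t = 0)"
  proof (rule exI[of _ x], rule exI[of _ "y + \<epsilon>"], intro conjI allI impI)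
    fix t assume "t \<notin> {x..y + \<epsilon>}"
    hence "t < x \<or> t > y + \<epsilon>" by auto
    thus "plateau \<epsilon> x y t = 0"
    proof
      assume "t < x"
      hence "(t - x) / \<epsilon> \<le> 0" "(t - y) / \<epsilon> \<le> 0" using assms by (auto simp: divide_le_0_iff)
      thus ?thesis by (simp add: plateau_def ramp_left)
    next
      assume "t > y + \<epsilon>"
      hence "1 \<le> (t - x) / \<epsilon>" "1 \<le> (t - y) / \<epsilon>" using assms by (auto simp: le_divide_eq)
      thus ?thesis by (simp add: plateau_def ramp_right)
    qed
  qed (use assms in auto)
qed

text \<open>
  Test with plateaus whose flanks become steep: the left-hand side of the definition tends to the difference of the
  values at the end points, the right-hand side to the integral over the interval.
\<close>
lemma weak_deriv_increment_pos:
  assumes u: "continuous_on {0..} u" and g: "L2_halfline g" and w: "is_weak_deriv u g"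
    and xy: "0 < x" "x \<le> y"
  shows "u y - u x = (LINT t:{x..y}|lborel. g t)"
proof -
  define e where "e = (\<lambda>n. 1 / real (Suc n))"
  have e: "e n > 0" "e n \<le> 1" for n by (auto simp: e_def)
  have e0: "e \<longlonglongrightarrow> 0" unfolding e_def by (rule LIMSEQ_Suc[OF lim_1_over_n])
  have avg: "(\<lambda>n. LINT t:{0..}|lborel. u t * bump_kernel (e n) z t) \<longlonglongrightarrow> u z" if z: "0 \<le> z" for z
  proof (rule LIMSEQ_I)
    fix r :: real assume r: "r > 0"
    obtain d where d: "d > 0" "\<And>t. t \<in> {0..} \<Longrightarrow> dist t z < d \<Longrightarrow> dist (u t) (u z) < r / 2"
      using u z r unfolding continuous_on_iff by (metis atLeast_iff half_gt_zero)
    obtain n0 where n0: "\<And>n. n \<ge> n0 \<Longrightarrow> e n < d"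
      using order_tendstoD(2)[OF e0 d(1)] unfolding eventually_sequentially by blast
    show "\<exists>no. \<forall>n\<ge>no. norm ((LINT t:{0..}|lborel. u t * bump_kernel (e n) z t) - u z) < r"
    proof (intro exI[of _ n0] allI impI)
      fix n assume "n \<ge> n0"
      hence n: "e n < d" by (rule n0)
      have "\<bar>(LINT t:{0..}|lborel. u t * bump_kernel (e n) z t) - u z\<bar> \<le> r / 2"
      proof (rule kernel_average[OF u e(1) z])
        fix t assume "t \<in> {z..z + e n}"
        hence "dist (u t) (u z) < r / 2" using n z by (intro d(2)) (auto simp: dist_real_def)
        thus "\<bar>u t - u z\<bar> \<le> r / 2" by (simp add: dist_real_def)
      qed
      thus "norm ((LINT t:{0..}|lborel. u t * bump_kernel (e n) z t) - u z) < r" using r by simp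
    qed
  qed
  have lhs: "(LINT t:{0..}|lborel. u t * deriv (plateau (e n) x y) t)
      = (LINT t:{0..}|lborel. u t * bump_kernel (e n) x t) - (LINT t:{0..}|lborel. u t * bump_kernel (e n) y t)" for n
  proof -
    have "deriv (plateau (e n) x y) t = bump_kernel (e n) x t - bump_kernel (e n) y t" for t
      by (rule DERIV_imp_deriv[OF plateau_deriv])
    thus ?thesis
      using set_integral_diff(2)[OF kernel_integrable(2)[OF u e(1)] kernel_integrable(2)[OF u e(1)], of x y n n] xy
      by (simp add: right_diff_distrib)
  qed
  have rhs: "(\<lambda>n. LINT t:{0..}|lborel. g t * plateau (e n) x y t) \<longlonglongrightarrow> (LINT t:{x..y}|lborel. g t)"
    unfolding set_lebesgue_integral_def
  proof (rule integral_dominated_convergence)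
    have ig: "set_integrable lborel {0..y + 1} (\<lambda>t. \<bar>g t\<bar>)"
      by (intro set_integrable_abs L2_halfline_integrable_Icc[OF g]) simp
    show "integrable lborel (\<lambda>t. indicator {0..y + 1} t *\<^sub>R \<bar>g t\<bar>)"
      using ig by (simp add: set_integrable_def)
    show "(\<lambda>t. indicator {x..y} t *\<^sub>R g t) \<in> borel_measurable lborel"
      using set_integrable_measurable[OF L2_halfline_integrable_Icc[OF g less_imp_le[OF xy(1)]]]
      by (simp add: set_borel_measurable_def)
    show "(\<lambda>t. indicator {0..} t *\<^sub>R (g t * plateau (e n) x y t)) \<in> borel_measurable lborel" for n
    proof -
      have "continuous_on {0..} (plateau (e n) x y)"
        by (intro continuous_at_imp_continuous_on ballI DERIV_isCont[OF plateau_deriv])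
      hence "set_borel_measurable lborel {0..} (\<lambda>t. g t * plateau (e n) x y t)"
        using g by (intro set_borel_measurable_mult[OF _ set_borel_measurable_continuous]) (auto simp: L2_halfline_def)
      thus ?thesis by (simp add: set_borel_measurable_def)
    qed
    show "AE t in lborel. (\<lambda>n. indicator {0..} t *\<^sub>R (g t * plateau (e n) x y t)) \<longlonglongrightarrow> indicator {x..y} t *\<^sub>R g t"
      using AE_lborel_singleton[of x]
    proof eventually_elim
      case (elim t)
      have lim: "(\<lambda>n. ramp ((t - z) / e n)) \<longlonglongrightarrow> (if t \<le> z then 0 else 1)" for z
      proof (cases "t \<le> z")
        case True
        hence "ramp ((t - z) / e n) = 0" for n using e(1)[of n] by (intro ramp_left) (simp add: divide_le_0_iff)
        thus ?thesis using True by simp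
      next
        case False
        hence "\<forall>\<^sub>F n in sequentially. e n < t - z" by (intro order_tendstoD(2)[OF e0]) simp
        hence "\<forall>\<^sub>F n in sequentially. ramp ((t - z) / e n) = 1"
          by eventually_elim (use e in \<open>auto intro!: ramp_right simp: le_divide_eq\<close>)
        thus ?thesis using False by (simp add: tendsto_eventually)
      qed
      have "(\<lambda>n. indicator {0..} t *\<^sub>R (g t * plateau (e n) x y t)) \<longlonglongrightarrow>
          indicator {0..} t *\<^sub>R (g t * ((if t \<le> x then 0 else 1) - (if t \<le> y then 0 else 1)))"
        unfolding plateau_def by (intro tendsto_scaleR tendsto_mult tendsto_diff tendsto_const lim)
      also have "indicator {0..} t *\<^sub>R (g t * ((if t \<le> x then 0 else 1) - (if t \<le> y then 0 else 1))) = indicator {x..y} t *\<^sub>R g t"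
        using elim xy by (auto simp: indicator_def)
      finally show ?case .
    qed
    show "AE t in lborel. norm (indicator {0..} t *\<^sub>R (g t * plateau (e n) x y t)) \<le> indicator {0..y + 1} t *\<^sub>R \<bar>g t\<bar>" for n
    proof (rule AE_I2)
      fix t
      show "norm (indicator {0..} t *\<^sub>R (g t * plateau (e n) x y t)) \<le> indicator {0..y + 1} t *\<^sub>R \<bar>g t\<bar>"
      proof (cases "t \<in> {0..y + 1}")
        case True
        have "\<bar>plateau (e n) x y t\<bar> \<le> 1"
          using ramp_range[of "(t - x) / e n"] ramp_range[of "(t - y) / e n"] by (auto simp: plateau_def abs_le_iff)
        thus ?thesis using True by (simp add: abs_mult mult_left_le)
      next
        case False
        have "indicator {0..} t *\<^sub>R (g t * plateau (e n) x y t) = 0"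
        proof (cases "t \<ge> 0")
          case True
          hence "1 \<le> (t - x) / e n" "1 \<le> (t - y) / e n"
            using False e[of n] xy by (auto simp: le_divide_eq)
          thus ?thesis by (simp add: plateau_def ramp_right)
        qed simp
        hence "norm (indicator {0..} t *\<^sub>R (g t * plateau (e n) x y t)) = 0" by (simp only: norm_zero)
        moreover have "0 \<le> indicator {0..y + 1} t *\<^sub>R \<bar>g t\<bar>" by (simp add: indicator_def)
        ultimately show ?thesis by (simp only:)
      qed
    qed
  qed
  have "(\<lambda>n. (LINT t:{0..}|lborel. u t * bump_kernel (e n) x t) - (LINT t:{0..}|lborel. u t * bump_kernel (e n) y t)) \<longlonglongrightarrow> u x - u y"
    using xy by (intro tendsto_diff avg) auto
  moreover have "(LINT t:{0..}|lborel. u t * bump_kernel (e n) x t) - (LINT t:{0..}|lborel. u t * bump_kernel (e n) y t)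
     = - (LINT t:{0..}|lborel. g t * plateau (e n) x y t)" for n
    using w plateau_test_function[OF e(1) xy] lhs unfolding is_weak_deriv_def by metis
  ultimately have "(\<lambda>n. - (LINT t:{0..}|lborel. g t * plateau (e n) x y t)) \<longlonglongrightarrow> u x - u y" by simp
  from LIMSEQ_unique[OF this tendsto_minus[OF rhs]] show ?thesis by simp
qed

text \<open>
  Test functions live in the open half-line, so the end point 0 is reached by continuity.
\<close>
lemma weak_deriv_imp_ac_deriv:
  assumes u: "continuous_on {0..} u" and g: "L2_halfline g" and w: "is_weak_deriv u g"
  shows "ac_deriv u g"
  unfolding ac_deriv_def
proof (intro conjI allI impI)
  fix x y :: real assume xy: "0 \<le> x" "x \<le> y"
  show "u y - u x = (LINT t:{x..y}|lborel. g t)"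
  proof (cases "x = 0 \<and> 0 < y")
    case True
    have ig: "set_integrable lborel {0..y} g" by (rule L2_halfline_integrable_Icc[OF g]) simp
    have ig': "set_integrable lborel {t..y} g" if "0 \<le> t" for t by (rule L2_halfline_integrable_Icc[OF g that])
    define h where "h = (\<lambda>t. u y - u t - integral {t..y} g)"
    have "continuous_on {0..y} h"
      unfolding h_def
      by (intro continuous_on_diff continuous_on_const indefinite_integral_continuous_1' set_borel_integral_eq_integral(1)
            ig continuous_on_subset[OF u]) auto
    hence "(h \<longlongrightarrow> h 0) (at 0 within {0..y})" using True by (simp add: continuous_on_def)
    hence "(h \<longlongrightarrow> h 0) (at_right 0)" using True by (simp add: at_within_Icc_at_right)
    moreover have "\<forall>\<^sub>F t in at_right 0. h t = 0"
      unfolding eventually_at_right_field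
    proof (intro exI[of _ y] conjI allI impI)
      fix t assume t: "0 < t" "t < y"
      show "h t = 0"
        using weak_deriv_increment_pos[OF u g w t(1), of y] t
        by (simp add: h_def set_borel_integral_eq_integral(2)[OF ig'])
    qed (use True in simp)
    hence "(h \<longlongrightarrow> 0) (at_right 0)" by (rule tendsto_eventually)
    ultimately have "h 0 = 0" using tendsto_unique by (metis trivial_limit_at_right_real)
    thus ?thesis using True by (simp add: h_def set_borel_integral_eq_integral(2)[OF ig])
  next
    case False
    show ?thesis
    proof (cases "x > 0")
      case True thus ?thesis using weak_deriv_increment_pos[OF u g w True xy(2)] by blast
    next
      case False
      hence "x = 0" "y = 0" using \<open>\<not> (x = 0 \<and> 0 < y)\<close> xy by auto
      moreover have "set_integrable lborel {0..0} g" by (rule L2_halfline_integrable_Icc[OF g]) simp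
      ultimately show ?thesis by (simp add: set_borel_integral_eq_integral(2))
    qed
  qed
qed (rule L2_halfline_integrable_Icc[OF g], simp)

lemma ac_deriv_unique_AE:
  assumes "ac_deriv u g" "ac_deriv u h"
  shows "AE t in lborel. t \<in> {0..} \<longrightarrow> g t = h t"
proof -
  have "AE t in lborel. t \<in> {0..real n} \<longrightarrow> g t - h t = 0" for n
  proof (rule interval_integrals_zero_imp_AE_zero)
    note i = ac_derivD(1)[OF assms(1) order_refl] ac_derivD(1)[OF assms(2) order_refl]
    show "set_integrable lborel {0..real n} (\<lambda>t. g t - h t)"
      by (intro set_integral_diff i)
    fix x :: real assume "0 \<le> x" "x \<le> real n"
    thus "(LINT t:{0..x}|lborel. g t - h t) = 0"
      using ac_derivD(2)[OF assms(1) order_refl, of x] ac_derivD(2)[OF assms(2) order_refl, of x] i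
      by (simp add: set_integral_diff)
  qed
  hence "AE t in lborel. \<forall>n. t \<in> {0..real n} \<longrightarrow> g t - h t = 0" unfolding AE_all_countable by blast
  thus ?thesis
  proof eventually_elim
    case (elim t)
    obtain n :: nat where "t \<le> real n" using real_arch_simple by blast
    thus ?case using elim by (auto dest!: spec[of _ n])
  qed
qed

section \<open>The calibration inequality on a half-line\<close>

text \<open>
  A function in \<open>H\<^sup>1\<close> of the half-line together with a representative of its derivative.
\<close>
definition branch_function :: "(real \<Rightarrow> real) \<Rightarrow> (real \<Rightarrow> real) \<Rightarrow> bool" where
  "branch_function u g \<longleftrightarrow> continuous_on {0..} u \<and> L2_halfline u \<and> L2_halfline g \<and> ac_deriv u g"

definition tail :: "(real \<Rightarrow> real) \<Rightarrow> real \<Rightarrow> real" where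
  "tail u x = (LINT t:{x..}|lborel. (u t)\<^sup>2)"

lemma LINT_singleton [simp]: "(LINT t:{x..x}|lborel. f t) = (0::real)" for f :: "real \<Rightarrow> real"
proof -
  have "(LINT t:{x..x}|lborel. f t) = (LINT t:{x}|lborel. f t)" by simp
  also have "\<dots> = 0" by (simp add: set_integral_at_point)
  finally show ?thesis .
qed

context
  fixes u g :: "real \<Rightarrow> real"
  assumes uv: "branch_function u g"
begin

lemma u_continuous: "continuous_on {0..} u" using uv by (simp add: branch_function_def)
lemma u_L2: "L2_halfline u" using uv by (simp add: branch_function_def)
lemma g_L2: "L2_halfline g" using uv by (simp add: branch_function_def)
lemma u_ac: "ac_deriv u g" using uv by (simp add: branch_function_def)
lemma u_square: "set_integrable lborel {0..} (\<lambda>t. (u t)\<^sup>2)" using u_L2 by (simp add: L2_halfline_def)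
lemma g_square: "set_integrable lborel {0..} (\<lambda>t. (g t)\<^sup>2)" using g_L2 by (simp add: L2_halfline_def)

lemma u_continuous_Icc: "0 \<le> a \<Longrightarrow> continuous_on {a..b} u"
  by (rule continuous_on_subset[OF u_continuous]) auto

lemma tail_nonneg: "tail u x \<ge> 0"
  unfolding tail_def by (rule set_integral_ge_zero) simp

lemma tail_diff: "0 \<le> x \<Longrightarrow> x \<le> y \<Longrightarrow> tail u y - tail u x = (LINT t:{x..y}|lborel. - (u t)\<^sup>2)"
  unfolding tail_def using LINT_tail_split[OF u_square, of x y]
  by (simp add: set_integral_uminus Icc_subset_integrable[OF u_square])

lemma tail_antimono: "0 \<le> x \<Longrightarrow> x \<le> y \<Longrightarrow> tail u y \<le> tail u x"
proof -
  assume xy: "0 \<le> x" "x \<le> y"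
  have "0 \<le> (LINT t:{x..y}|lborel. (u t)\<^sup>2)" by (rule set_integral_ge_zero) simp
  thus ?thesis unfolding tail_def using LINT_tail_split[OF u_square xy] by simp
qed

lemma tail_continuous: "continuous_on {0..b} (tail u)"
  unfolding tail_def[abs_def] by (rule continuous_on_LINT_tail[OF u_square])

text \<open>
  A continuous function that is not 0 at a point carries mass there.
\<close>
lemma tail_zero_imp_zero:
  assumes "0 \<le> x" "tail u x = 0" "x \<le> y"
  shows "u y = 0"
proof (rule ccontr)
  assume "u y \<noteq> 0"
  define c where "c = (u y)\<^sup>2 / 2"
  have c: "c > 0" "c < (u y)\<^sup>2" using \<open>u y \<noteq> 0\<close> by (auto simp: c_def)
  have "continuous_on {0..} (\<lambda>t. (u t)\<^sup>2)" by (intro continuous_on_power u_continuous)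
  then obtain d where d: "d > 0" "\<And>t. t \<in> {0..} \<Longrightarrow> dist t y < d \<Longrightarrow> dist ((u t)\<^sup>2) ((u y)\<^sup>2) < (u y)\<^sup>2 - c"
    unfolding continuous_on_iff using assms c by (metis atLeast_iff diff_gt_0_iff_gt order_trans)
  have low: "c \<le> (u t)\<^sup>2" if "t \<in> {y..y + d / 2}" for t
    using d(2)[of t] that assms d(1) by (auto simp: dist_real_def abs_if split: if_splits)
  have y0: "0 \<le> y" using assms by simp
  have "c * (d / 2) = (LINT t:{y..y + d / 2}|lborel. c)"
    using d(1) by (simp add: set_integral_const)
  also have "\<dots> \<le> (LINT t:{y..y + d / 2}|lborel. (u t)\<^sup>2)"
    by (rule set_integral_mono)
       (use low Icc_subset_integrable[OF u_square y0] in \<open>auto intro!: borel_integrable_atLeastAtMost' continuous_on_const\<close>)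
  also have "\<dots> \<le> tail u y"
    unfolding tail_def using LINT_tail_split[OF u_square y0, of "y + d / 2"] d(1) tail_nonneg[of "y + d / 2"]
    by (simp add: tail_def)
  also have "\<dots> \<le> 0" using tail_antimono[OF assms(1,3)] assms(2) by simp
  finally show False using c d(1) by (simp add: mult_le_0_iff)
qed

lemma tail_pos_antimono: "0 \<le> x \<Longrightarrow> x \<le> y \<Longrightarrow> tail u y > 0 \<Longrightarrow> tail u x > 0"
  using tail_antimono[of x y] by simp

lemma ug_integrable: "set_integrable lborel {0..} (\<lambda>t. \<bar>u t * g t\<bar>)"
  by (intro set_integrable_abs L2_halfline_mult u_L2 g_L2)

lemma square_increment:
  assumes "0 \<le> x" "x \<le> y"
  shows "(u y)\<^sup>2 - (u x)\<^sup>2 = (LINT t:{x..y}|lborel. 2 * (u t * g t))"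
proof -
  have "(\<lambda>m a. a\<^sup>2) 1 (u y) - (\<lambda>m a. a\<^sup>2) 1 (u x) =
     (LINT t:{x..y}|lborel. (\<lambda>m a. 0) 1 (u t) * 0 + (\<lambda>m a. 2 * a) 1 (u t) * g t)"
  proof (rule ac_chain_rule(2)[where M = "\<lambda>_. 1" and M' = "\<lambda>_. 0" and U = u and U' = g])
    show "u y' - u x' = (LINT t:{x'..y'}|lborel. g t)" if "x \<le> x'" "x' \<le> y'" "y' \<le> y" for x' y'
      using ac_derivD(2)[OF u_ac _ that(2)] that assms by simp
    show "set_integrable lborel {x..y} g" by (rule L2_halfline_integrable_Icc[OF g_L2 assms(1)])
    show "set_integrable lborel {x..y} (\<lambda>t. 0::real)" by (simp add: set_integrable_def)
    show "((\<lambda>a. a\<^sup>2) has_real_derivative 2 * a) (at a)" for a :: real by (auto intro!: derivative_eq_intros)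
    show "continuous_on ({0<..} \<times> UNIV) (\<lambda>(m :: real, a :: real). 2 * a)"
      unfolding case_prod_unfold by (intro continuous_intros)
  qed (use assms u_continuous_Icc in auto)
  thus ?thesis by (simp add: mult.assoc)
qed

text \<open>
  Integrate the derivative of \<open>u\<^sup>2\<close> up to a point where \<open>u\<^sup>2\<close> is small; such points exist far out because \<open>u\<^sup>2\<close> is integrable.
\<close>
lemma square_le_tail_product:
  assumes x: "0 \<le> x"
  shows "(u x)\<^sup>2 \<le> 2 * (LINT t:{x..}|lborel. \<bar>u t * g t\<bar>)"
proof (rule field_le_epsilon)
  fix e :: real assume e: "e > 0"
  have "\<exists>y\<ge>x. (u y)\<^sup>2 < e"
  proof (rule ccontr)
    assume "\<not> ?thesis"
    hence big: "e \<le> (u y)\<^sup>2" if "x \<le> y" for y using that by force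
    obtain n :: nat where n: "tail u x / e < real n" using reals_Archimedean2 by blast
    have "real n * e = (LINT t:{x..x + real n}|lborel. e)"
      by (simp add: set_integral_const)
    also have "\<dots> \<le> (LINT t:{x..x + real n}|lborel. (u t)\<^sup>2)"
      by (rule set_integral_mono)
         (use big Icc_subset_integrable[OF u_square x] in \<open>auto intro!: borel_integrable_atLeastAtMost' continuous_on_const\<close>)
    also have "\<dots> \<le> tail u x"
      unfolding tail_def using LINT_tail_split[OF u_square x, of "x + real n"] tail_nonneg[of "x + real n"]
      by (simp add: tail_def)
    finally show False using n e by (simp add: divide_less_eq)
  qed
  then obtain y where y: "x \<le> y" "(u y)\<^sup>2 < e" by blast
  have i: "set_integrable lborel {x..y} (\<lambda>t. u t * g t)" "set_integrable lborel {x..y} (\<lambda>t. \<bar>u t * g t\<bar>)"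
    by (intro Icc_subset_integrable x L2_halfline_mult u_L2 g_L2 ug_integrable)+
  have "- (LINT t:{x..y}|lborel. u t * g t) \<le> (LINT t:{x..y}|lborel. \<bar>u t * g t\<bar>)"
    using set_integral_abs_bound[OF i(1)] by (simp add: abs_le_iff)
  also have "\<dots> \<le> (LINT t:{x..}|lborel. \<bar>u t * g t\<bar>)"
    using LINT_tail_split[OF ug_integrable x y(1)] set_integral_ge_zero[of "{y..}" "\<lambda>t. \<bar>u t * g t\<bar>"] by simp
  finally have "(u x)\<^sup>2 - (u y)\<^sup>2 \<le> 2 * (LINT t:{x..}|lborel. \<bar>u t * g t\<bar>)"
    using square_increment[OF x y(1)] by simp
  thus "(u x)\<^sup>2 \<le> 2 * (LINT t:{x..}|lborel. \<bar>u t * g t\<bar>) + e" using y(2) by simp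
qed

text \<open>
  The Cauchy-Schwarz inequality for \<open>2 |u g|\<close> on the tail. It controls the boundary term \<open>W(m(x), u(x))\<close>, which can contain
  \<open>u\<^sup>4 / m\<close>.
\<close>
lemma quartic_le_tail:
  assumes x: "0 \<le> x" and pos: "tail u x > 0"
  shows "u x ^ 4 / tail u x \<le> 4 * (LINT t:{x..}|lborel. (g t)\<^sup>2)"
proof -
  define J where "J = (LINT t:{x..}|lborel. (g t)\<^sup>2)"
  have J: "J \<ge> 0" unfolding J_def by (rule set_integral_ge_zero) simp
  have bound: "(u x)\<^sup>2 \<le> l * tail u x + J / l" if l: "l > 0" for l
  proof -
    note i = Ici_subset_integrable[OF u_square x] Ici_subset_integrable[OF g_square x] Ici_subset_integrable[OF ug_integrable x]
    have "2 * (LINT t:{x..}|lborel. \<bar>u t * g t\<bar>) = (LINT t:{x..}|lborel. 2 * \<bar>u t * g t\<bar>)" by simp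
    also have "\<dots> \<le> (LINT t:{x..}|lborel. l * (u t)\<^sup>2 + (g t)\<^sup>2 / l)"
    proof (rule set_integral_mono)
      show "set_integrable lborel {x..} (\<lambda>t. l * (u t)\<^sup>2 + (g t)\<^sup>2 / l)"
        using i by (intro set_integral_add) auto
      fix t
      have "0 \<le> (l * \<bar>u t\<bar> - \<bar>g t\<bar>)\<^sup>2 / l" using l by simp
      also have "\<dots> = l * (u t)\<^sup>2 + (g t)\<^sup>2 / l - 2 * \<bar>u t * g t\<bar>"
        using l by (simp add: power2_eq_square abs_mult field_simps)
      finally show "2 * \<bar>u t * g t\<bar> \<le> l * (u t)\<^sup>2 + (g t)\<^sup>2 / l" by simp
    qed (use i in auto)
    also have "\<dots> = l * tail u x + J / l"
      unfolding tail_def J_def using i by (simp add: set_integral_add)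
    finally show ?thesis using square_le_tail_product[OF x] by simp
  qed
  have "((u x)\<^sup>2)\<^sup>2 \<le> 4 * J * tail u x"
  proof (cases "J = 0")
    case False
    (* this choice balances both terms of the bound *)
    define l where "l = sqrt (J / tail u x)"
    have l: "l > 0" using False J pos by (simp add: l_def)
    have ll: "l * l = J / tail u x" using J pos by (simp add: l_def)
    have "(l * tail u x + J / l) * l = 2 * J"
    proof -
      have "l * tail u x * l = (l * l) * tail u x" by (simp add: mult_ac)
      also have "\<dots> = J" unfolding ll using pos by simp
      finally show ?thesis using l by (simp add: distrib_right)
    qed
    hence "(u x)\<^sup>2 * l \<le> 2 * J" using mult_right_mono[OF bound[OF l] less_imp_le[OF l]] by simp
    hence "((u x)\<^sup>2 * l)\<^sup>2 \<le> (2 * J)\<^sup>2" using l by (intro power_mono) auto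
    moreover have "((u x)\<^sup>2 * l)\<^sup>2 = ((u x)\<^sup>2)\<^sup>2 * (l * l)" by (simp add: power2_eq_square mult_ac)
    moreover have "(2 * J)\<^sup>2 = 4 * J * J" by (simp add: power2_eq_square)
    ultimately have "((u x)\<^sup>2)\<^sup>2 * (J / tail u x) \<le> 4 * J * J" by (simp only: ll)
    hence "((u x)\<^sup>2)\<^sup>2 * J \<le> (4 * J * tail u x) * J" using pos by (simp add: divide_le_eq mult_ac)
    thus ?thesis using False J by (simp add: mult_le_cancel_right)
  next
    case True
    have "(u x)\<^sup>2 \<le> 0"
    proof (rule field_le_epsilon)
      fix e :: real assume "e > 0"
      thus "(u x)\<^sup>2 \<le> 0 + e" using bound[of "e / tail u x"] True pos by simp
    qed
    thus ?thesis using True by simp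
  qed
  moreover have "((u x)\<^sup>2)\<^sup>2 = u x ^ 4" by simp
  ultimately show ?thesis using pos by (simp add: divide_le_eq J_def)
qed

lemma g_square_vanishes:
  assumes x: "0 \<le> x" and "tail u x = 0"
  shows "(LINT t:{x..}|lborel. (g t)\<^sup>2) = 0"
proof -
  have "AE t in lborel. t \<in> {x..x + real n} \<longrightarrow> g t = 0" for n
  proof (rule interval_integrals_zero_imp_AE_zero[OF L2_halfline_integrable_Icc[OF g_L2 x]])
    fix y assume "x \<le> y" "y \<le> x + real n"
    thus "(LINT t:{x..y}|lborel. g t) = 0"
      using ac_derivD(2)[OF u_ac x, of y] tail_zero_imp_zero[OF x assms(2), of x] tail_zero_imp_zero[OF x assms(2), of y] by simp
  qed
  hence "AE t in lborel. \<forall>n. t \<in> {x..x + real n} \<longrightarrow> g t = 0" unfolding AE_all_countable by blast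
  hence "AE t in lborel. indicator {x..} t *\<^sub>R (g t)\<^sup>2 = 0"
  proof eventually_elim
    case (elim t)
    obtain n :: nat where n: "t - x \<le> real n" using real_arch_simple by blast
    have "t \<in> {x..x + real n} \<longrightarrow> g t = 0" using elim by blast
    thus ?case using n by (auto simp: indicator_def)
  qed
  thus ?thesis unfolding set_lebesgue_integral_def by (rule integral_eq_zero_AE)
qed

end

text \<open>
  A function in \<open>H\<^sup>1\<close> is bounded, so \<open>|u|\<^sup>p\<close> is at most a multiple of \<open>u\<^sup>2\<close>.
\<close>
lemma (in subcritical) powr_p_integrable:
  assumes uv: "branch_function u g"
  shows "set_integrable lborel {0..} (\<lambda>t. \<bar>u t\<bar> powr p)"
proof -
  define C where "C = (2 * (LINT t:{0..}|lborel. \<bar>u t * g t\<bar>)) powr ((p - 2) / 2)"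
  show ?thesis
  proof (rule set_integrable_bound[where f = "\<lambda>t. C * (u t)\<^sup>2"])
    show "set_integrable lborel {0..} (\<lambda>t. C * (u t)\<^sup>2)" using u_square[OF uv] by simp
    show "set_borel_measurable lborel {0..} (\<lambda>t. \<bar>u t\<bar> powr p)"
      using p_gt_2 by (intro set_borel_measurable_continuous continuous_on_powr' continuous_on_rabs
          u_continuous[OF uv] continuous_on_const) auto
    have "\<bar>u t\<bar> powr p \<le> C * (u t)\<^sup>2" if "t \<ge> 0" for t
    proof (cases "u t = 0")
      case False
      have "(u t)\<^sup>2 \<le> 2 * (LINT t:{t..}|lborel. \<bar>u t * g t\<bar>)" by (rule square_le_tail_product[OF uv that])
      also have "(LINT t:{t..}|lborel. \<bar>u t * g t\<bar>) \<le> (LINT t:{0..}|lborel. \<bar>u t * g t\<bar>)"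
        using LINT_tail_split[OF ug_integrable[OF uv] order_refl that] set_integral_ge_zero[of "{0..t}" "\<lambda>t. \<bar>u t * g t\<bar>"] by simp
      finally have "((u t)\<^sup>2) powr ((p - 2) / 2) \<le> C"
        unfolding C_def using p_gt_2 by (intro powr_mono2) auto
      moreover have "((u t)\<^sup>2) powr ((p - 2) / 2) = \<bar>u t\<bar> powr (p - 2)"
      proof -
        have "(u t)\<^sup>2 = \<bar>u t\<bar> powr 2" using False by (simp add: powr_numeral)
        hence "((u t)\<^sup>2) powr ((p - 2) / 2) = \<bar>u t\<bar> powr (2 * ((p - 2) / 2))" by (simp only: powr_powr)
        also have "2 * ((p - 2) / 2) = p - 2" by simp
        finally show ?thesis .
      qed
      ultimately have "\<bar>u t\<bar> powr (p - 2) * (u t)\<^sup>2 \<le> C * (u t)\<^sup>2" by (intro mult_right_mono) auto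
      moreover have "\<bar>u t\<bar> powr p = \<bar>u t\<bar> powr (p - 2) * (u t)\<^sup>2"
      proof -
        have "\<bar>u t\<bar> powr p = \<bar>u t\<bar> powr (p - 2) * \<bar>u t\<bar> powr 2" by (simp only: powr_add[symmetric]) simp
        thus ?thesis using False by (simp add: powr_numeral)
      qed
      ultimately show ?thesis by simp
    qed (use p_gt_2 in simp)
    moreover have "C \<ge> 0" by (simp add: C_def)
    ultimately show "AE t in lborel. t \<in> {0..} \<longrightarrow> norm (\<bar>u t\<bar> powr p) \<le> norm (C * (u t)\<^sup>2)"
      by (intro AE_I2) (simp add: abs_mult)
  qed
qed

context subcritical
begin

definition half_energy :: "(real \<Rightarrow> real) \<Rightarrow> (real \<Rightarrow> real) \<Rightarrow> real" where
  "half_energy u g = (LINT t:{0..}|lborel. 1/2 * (g t)\<^sup>2 - 1/p * \<bar>u t\<bar> powr p)"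

text \<open>
  The loss in the calibration inequality up to the point \<open>b\<close>.
\<close>
definition defect :: "(real \<Rightarrow> real) \<Rightarrow> (real \<Rightarrow> real) \<Rightarrow> real \<Rightarrow> real" where
  "defect u g b = (LINT t:{0..b}|lborel. 1/2 * (g t + branch_slope (tail u t) (u t))\<^sup>2)"

context
  fixes u g :: "real \<Rightarrow> real"
  assumes uv: "branch_function u g"
begin

lemma continuous_on_slope:
  assumes "tail u b > 0"
  shows "continuous_on {0..b} (\<lambda>t. branch_slope (tail u t) (u t))"
proof -
  have "continuous_on {0..b} (\<lambda>t. (\<lambda>(m, a). branch_slope m a) (tail u t, u t))"
    by (rule continuous_on_compose2[OF continuous_on_branch_slope])
       (use assms tail_pos_antimono[OF uv] tail_continuous[OF uv] u_continuous_Icc[OF uv] in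
         \<open>auto intro!: continuous_on_Pair\<close>)
  thus ?thesis by simp
qed

lemma defect_integrable:
  assumes b: "0 \<le> b" and pos: "tail u b > 0"
  shows "set_integrable lborel {0..b} (\<lambda>t. 1/2 * (g t + branch_slope (tail u t) (u t))\<^sup>2)"
proof -
  note c = continuous_on_slope[OF pos]
  have ig: "set_integrable lborel {0..b} g" by (rule L2_halfline_integrable_Icc[OF g_L2[OF uv]]) simp
  have "set_integrable lborel {0..b} (\<lambda>t. (1/2 * (g t)\<^sup>2 + branch_slope (tail u t) (u t) * g t)
      + 1/2 * (branch_slope (tail u t) (u t))\<^sup>2)"
  proof (intro set_integral_add(1))
    show "set_integrable lborel {0..b} (\<lambda>t. 1/2 * (g t)\<^sup>2)"
      using Icc_subset_integrable[OF g_square[OF uv], of 0 b] by simp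
    show "set_integrable lborel {0..b} (\<lambda>t. branch_slope (tail u t) (u t) * g t)"
      by (rule set_integrable_continuous_mult[OF c ig])
    show "set_integrable lborel {0..b} (\<lambda>t. 1/2 * (branch_slope (tail u t) (u t))\<^sup>2)"
      by (intro borel_integrable_atLeastAtMost' continuous_on_mult continuous_on_const continuous_on_power c)
  qed
  moreover have "(1/2 * (g t)\<^sup>2 + branch_slope (tail u t) (u t) * g t) + 1/2 * (branch_slope (tail u t) (u t))\<^sup>2
     = 1/2 * (g t + branch_slope (tail u t) (u t))\<^sup>2" for t
    by (simp add: power2_eq_square algebra_simps)
  ultimately show ?thesis by (simp only:)
qed

lemma defect_mono:
  assumes "0 \<le> a" "a \<le> b" "tail u b > 0"
  shows "defect u g a \<le> defect u g b"
  unfolding defect_def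
  using LINT_combine[OF assms(1,2) defect_integrable[of b]] assms
    set_integral_ge_zero[of "{a..b}" "\<lambda>t. 1/2 * (g t + branch_slope (tail u t) (u t))\<^sup>2"] by simp

lemma energy_density_integrable:
  "set_integrable lborel {0..} (\<lambda>t. 1/2 * (g t)\<^sup>2 - 1/p * \<bar>u t\<bar> powr p)"
  using g_square[OF uv] powr_p_integrable[OF uv] by (intro set_integral_diff) auto

text \<open>
  The chain rule along \<open>(m(x), u(x))\<close>, where \<open>m' = - u\<^sup>2\<close>, and the Hamilton-Jacobi equation to complete the square.
\<close>
lemma calibration_identity:
  assumes b: "0 \<le> b" and pos: "tail u b > 0"
  shows "branch_energy (tail u b) (u b) - branch_energy (tail u 0) (u 0)
    = defect u g b - (LINT t:{0..b}|lborel. 1/2 * (g t)\<^sup>2 - 1/p * \<bar>u t\<bar> powr p)"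
proof -
  have tp: "tail u t > 0" if "t \<in> {0..b}" for t using tail_pos_antimono[OF uv _ _ pos] that by simp
  have "branch_energy (tail u b) (u b) - branch_energy (tail u 0) (u 0) =
     (LINT t:{0..b}|lborel. (- (wavenum (tail u t) (u t))\<^sup>2 / 2) * (- (u t)\<^sup>2) + branch_slope (tail u t) (u t) * g t)"
  proof (rule ac_chain_rule(2)[where \<Phi> = branch_energy and M = "tail u" and U = u
      and \<Phi>m = "\<lambda>m a. - (wavenum m a)\<^sup>2 / 2" and \<Phi>u = branch_slope and M' = "\<lambda>t. - (u t)\<^sup>2" and U' = g])
    show "tail u y - tail u x = (LINT t:{x..y}|lborel. - (u t)\<^sup>2)" if "0 \<le> x" "x \<le> y" "y \<le> b" for x y
      by (rule tail_diff[OF uv that(1,2)])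
    show "u y - u x = (LINT t:{x..y}|lborel. g t)" if "0 \<le> x" "x \<le> y" "y \<le> b" for x y
      by (rule ac_derivD(2)[OF u_ac[OF uv] that(1,2)])
    show "set_integrable lborel {0..b} (\<lambda>t. - (u t)\<^sup>2)"
      using Icc_subset_integrable[OF u_square[OF uv], of 0 b] by (simp add: set_integrable_def)
    show "set_integrable lborel {0..b} g" by (rule L2_halfline_integrable_Icc[OF g_L2[OF uv]]) simp
    show "continuous_on ({0<..} \<times> UNIV) (\<lambda>(m, a). - (wavenum m a)\<^sup>2 / 2)"
      using continuous_on_wavenum unfolding case_prod_unfold by (intro continuous_intros) auto
  qed (use b tp branch_energy_deriv_mass branch_energy_deriv_value continuous_on_branch_slope
        tail_continuous[OF uv] u_continuous_Icc[OF uv] in auto)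
  also have "\<dots> = (LINT t:{0..b}|lborel. 1/2 * (g t + branch_slope (tail u t) (u t))\<^sup>2
       - (1/2 * (g t)\<^sup>2 - 1/p * \<bar>u t\<bar> powr p))"
  proof (rule set_lebesgue_integral_cong)
    show "\<forall>t. t \<in> {0..b} \<longrightarrow> (- (wavenum (tail u t) (u t))\<^sup>2 / 2) * (- (u t)\<^sup>2) + branch_slope (tail u t) (u t) * g t
        = 1/2 * (g t + branch_slope (tail u t) (u t))\<^sup>2 - (1/2 * (g t)\<^sup>2 - 1/p * \<bar>u t\<bar> powr p)"
    proof (intro allI impI)
      fix t assume t: "t \<in> {0..b}"
      show "(- (wavenum (tail u t) (u t))\<^sup>2 / 2) * (- (u t)\<^sup>2) + branch_slope (tail u t) (u t) * g t
        = 1/2 * (g t + branch_slope (tail u t) (u t))\<^sup>2 - (1/2 * (g t)\<^sup>2 - 1/p * \<bar>u t\<bar> powr p)"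
      proof -
        define S where "S = branch_slope (tail u t) (u t)"
        have "1/2 * (g t + S)\<^sup>2 = 1/2 * (g t)\<^sup>2 + S * g t + S\<^sup>2 / 2"
          by (simp add: power2_sum algebra_simps)
        moreover have "(- (wavenum (tail u t) (u t))\<^sup>2 / 2) * (- (u t)\<^sup>2) = S\<^sup>2 / 2 + \<bar>u t\<bar> powr p / p"
          using hamilton_jacobi[OF tp[OF t], of "u t"] by (simp add: S_def)
        moreover have "1/p * \<bar>u t\<bar> powr p = \<bar>u t\<bar> powr p / p" by simp
        ultimately show ?thesis unfolding S_def[symmetric] by linarith
      qed
    qed
  qed simp
  also have "\<dots> = defect u g b - (LINT t:{0..b}|lborel. 1/2 * (g t)\<^sup>2 - 1/p * \<bar>u t\<bar> powr p)"
    unfolding defect_def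
    by (rule set_integral_diff(2)[OF defect_integrable[OF b pos] Icc_subset_integrable[OF energy_density_integrable order_refl]])
  finally show ?thesis .
qed

text \<open>
  The boundary term and the remaining part of the energy vanish in the limit. If the function has compact support, the mass
  of the tail is 0 from some point on, where the value function is of no use, and the limit is taken at the first such
  point instead of infinity.
\<close>
lemma calibration_limit:
  assumes a: "0 \<le> a" "tail u a > 0" and \<epsilon>: "\<epsilon> > 0"
  shows "\<exists>b\<ge>a. tail u b > 0 \<and> \<bar>half_energy u g - (branch_energy (tail u 0) (u 0) + defect u g b)\<bar> < \<epsilon>"
proof -
  obtain C where C: "C > 0" "\<And>m a. m > 0 \<Longrightarrow> \<bar>branch_energy m a\<bar> \<le> C * (m powr (1 + 2 / nu) + a ^ 4 / m)"
    using branch_energy_bounds by metis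
  define J where "J = (\<lambda>x. LINT t:{x..}|lborel. (g t)\<^sup>2)"
  define P where "P = (\<lambda>x. LINT t:{x..}|lborel. \<bar>u t\<bar> powr p)"
  (* a bound for boundary term and remaining energy at x *)
  define T where "T = (\<lambda>x. C * (tail u x powr (1 + 2 / nu) + 4 * J x) + (1/2 * J x + 1/p * P x))"
  have JP: "J x \<ge> 0" "P x \<ge> 0" for x unfolding J_def P_def by (rule set_integral_ge_zero, simp)+
  have T0: "(T \<longlongrightarrow> 0) F" if "(tail u \<longlongrightarrow> 0) F" "(J \<longlongrightarrow> 0) F" "(P \<longlongrightarrow> 0) F" for F
  proof -
    have "((\<lambda>x. tail u x powr (1 + 2 / nu)) \<longlongrightarrow> 0 powr (1 + 2 / nu)) F"
      using nu_pos tail_nonneg[OF uv] by (intro tendsto_powr' that tendsto_const) (auto intro!: add_pos_pos)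
    hence "(T \<longlongrightarrow> C * (0 powr (1 + 2 / nu) + 4 * 0) + (1/2 * 0 + 1/p * 0)) F"
      unfolding T_def by (intro tendsto_add tendsto_mult tendsto_const that)
    thus ?thesis by simp
  qed
  have "\<exists>b\<ge>a. tail u b > 0 \<and> T b < \<epsilon>"
  proof (cases "\<exists>x\<ge>0. tail u x = 0")
    case False
    hence pos: "tail u x > 0" if "x \<ge> 0" for x using tail_nonneg[OF uv, of x] that by (metis order_le_less)
    have "(T \<longlongrightarrow> 0) at_top"
      by (rule T0; unfold tail_def[abs_def] J_def P_def)
         (intro LINT_tail_tendsto u_square[OF uv] g_square[OF uv] powr_p_integrable[OF uv])+
    hence "\<forall>\<^sub>F x in at_top. T x < \<epsilon>" using \<epsilon> by (rule order_tendstoD(2))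
    then obtain X where "\<And>x. x \<ge> X \<Longrightarrow> T x < \<epsilon>" unfolding eventually_at_top_linorder by blast
    thus ?thesis using pos[of "max a X"] a by (intro exI[of _ "max a X"]) auto
  next
    case True
    then obtain x1 where x1: "0 \<le> x1" "tail u x1 = 0" by blast
    define S where "S = {x \<in> {0..x1}. tail u x = 0}"
    have "closed S"
      unfolding S_def using continuous_closed_preimage[OF tail_continuous[OF uv, of x1] closed_atLeastAtMost, of "{0}"]
      by (simp add: vimage_def Int_def)
    moreover have "bounded S" by (rule bounded_subset[OF bounded_closed_interval[of 0 x1]]) (auto simp: S_def)
    ultimately have "compact S" by (simp add: compact_eq_bounded_closed)
    moreover have "S \<noteq> {}" using x1 by (auto simp: S_def)
    ultimately have "\<exists>s\<in>S. \<forall>t\<in>S. s \<le> t" by (rule compact_attains_inf)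
    then obtain x0 where x0: "x0 \<in> S" "\<And>x. x \<in> S \<Longrightarrow> x0 \<le> x" by blast
    have x0': "0 \<le> x0" "tail u x0 = 0" "x0 \<le> x1" using x0(1) by (auto simp: S_def)
    have ax: "a < x0" using tail_antimono[OF uv x0'(1), of a] x0'(2) a by linarith
    have before: "tail u x > 0" if "0 \<le> x" "x < x0" for x
    proof -
      have "x \<notin> S" using x0(2)[of x] that by auto
      hence "tail u x \<noteq> 0" using that x0'(3) by (auto simp: S_def)
      thus ?thesis using tail_nonneg[OF uv, of x] by simp
    qed
    have Pz: "P x0 = 0"
    proof -
      have "P x0 = (LINT t:{x0..}|lborel. 0)"
        unfolding P_def by (rule set_lebesgue_integral_cong)
          (use tail_zero_imp_zero[OF uv x0'(1,2)] p_gt_2 in auto)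
      thus ?thesis by simp
    qed
    have Jz: "J x0 = 0" unfolding J_def by (rule g_square_vanishes[OF uv x0'(1,2)])
    have left: "(f \<longlongrightarrow> 0) (at_left x0)" if "continuous_on {0..x0} f" "f x0 = 0" for f :: "real \<Rightarrow> real"
    proof -
      have "(f \<longlongrightarrow> f x0) (at x0 within {0..x0})" using that(1) x0'(1) by (auto simp: continuous_on_def)
      thus ?thesis using that ax a by (simp add: at_within_Icc_at_left)
    qed
    have "(T \<longlongrightarrow> 0) (at_left x0)"
    proof (rule T0)
      show "(tail u \<longlongrightarrow> 0) (at_left x0)" by (rule left[of "tail u", OF tail_continuous[OF uv] x0'(2)])
      show "(J \<longlongrightarrow> 0) (at_left x0)" by (rule left[of J, OF _ Jz]) (unfold J_def, rule continuous_on_LINT_tail[OF g_square[OF uv]])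
      show "(P \<longlongrightarrow> 0) (at_left x0)" by (rule left[of P, OF _ Pz]) (unfold P_def, rule continuous_on_LINT_tail[OF powr_p_integrable[OF uv]])
    qed
    hence "\<forall>\<^sub>F x in at_left x0. T x < \<epsilon>" using \<epsilon> by (rule order_tendstoD(2))
    then obtain c where c: "c < x0" "\<And>x. c < x \<Longrightarrow> x < x0 \<Longrightarrow> T x < \<epsilon>" unfolding eventually_at_left_field by blast
    define M where "M = max a c"
    have M: "M < x0" "a \<le> M" "c \<le> M" using ax c(1) by (auto simp: M_def)
    obtain b where Mb: "M < b" and b3: "b < x0" using dense[OF M(1)] by blast
    have b1: "a \<le> b" and b2: "c < b" using M(2,3) Mb by (auto intro: less_imp_le less_le_trans le_less_trans)
    show ?thesis using before[of b] c(2)[OF b2 b3] a b1 b3 by (intro exI[of _ b]) simp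
  qed
  then obtain b where b: "a \<le> b" "tail u b > 0" "T b < \<epsilon>" by blast
  have b0: "0 \<le> b" using a b by simp
  have "half_energy u g = (LINT t:{0..b}|lborel. 1/2 * (g t)\<^sup>2 - 1/p * \<bar>u t\<bar> powr p)
     + (LINT t:{b..}|lborel. 1/2 * (g t)\<^sup>2 - 1/p * \<bar>u t\<bar> powr p)"
    unfolding half_energy_def by (rule LINT_tail_split[OF energy_density_integrable order_refl b0])
  also have "(LINT t:{b..}|lborel. 1/2 * (g t)\<^sup>2 - 1/p * \<bar>u t\<bar> powr p) = 1/2 * J b - 1/p * P b"
    unfolding J_def P_def
    using set_integral_diff(2)[of lborel "{b..}" "\<lambda>t. 1/2 * (g t)\<^sup>2" "\<lambda>t. 1/p * \<bar>u t\<bar> powr p"]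
      Ici_subset_integrable[OF g_square[OF uv] b0] Ici_subset_integrable[OF powr_p_integrable[OF uv] b0] by simp
  finally have "half_energy u g - (branch_energy (tail u 0) (u 0) + defect u g b) =
     - branch_energy (tail u b) (u b) + (1/2 * J b - 1/p * P b)"
    using calibration_identity[OF b0 b(2)] by simp
  moreover have "\<bar>branch_energy (tail u b) (u b)\<bar> \<le> C * (tail u b powr (1 + 2 / nu) + 4 * J b)"
  proof -
    have "C * (tail u b powr (1 + 2 / nu) + u b ^ 4 / tail u b) \<le> C * (tail u b powr (1 + 2 / nu) + 4 * J b)"
      using quartic_le_tail[OF uv b0 b(2)] C(1) by (simp add: J_def)
    thus ?thesis using C(2)[OF b(2), of "u b"] by linarith
  qed
  moreover have "0 \<le> 1/2 * J b" "0 \<le> 1/p * P b" using JP[of b] p_gt_2 by auto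
  ultimately have "\<bar>half_energy u g - (branch_energy (tail u 0) (u 0) + defect u g b)\<bar> \<le> T b"
    unfolding T_def by linarith
  thus ?thesis using b by (intro exI[of _ b]) auto
qed

lemma defect_nonneg: "defect u g b \<ge> 0"
  unfolding defect_def by (rule set_integral_ge_zero) simp

lemma half_energy_ge:
  assumes b: "0 \<le> b" "tail u b > 0"
  shows "half_energy u g \<ge> branch_energy (tail u 0) (u 0) + defect u g b"
proof (rule field_le_epsilon)
  fix e :: real assume "e > 0"
  then obtain c where c: "b \<le> c" "tail u c > 0"
    "\<bar>half_energy u g - (branch_energy (tail u 0) (u 0) + defect u g c)\<bar> < e"
    using calibration_limit[OF b] by blast
  thus "branch_energy (tail u 0) (u 0) + defect u g b \<le> half_energy u g + e"
    using defect_mono[OF b(1) c(1,2)] by linarith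
qed

lemma half_energy_ge_branch_energy:
  assumes "tail u 0 > 0"
  shows "half_energy u g \<ge> branch_energy (tail u 0) (u 0)"
  using half_energy_ge[OF order_refl assms] defect_nonneg[of 0] by linarith

lemma half_energy_eq:
  assumes "tail u 0 > 0" and zero: "\<And>b. 0 \<le> b \<Longrightarrow> tail u b > 0 \<Longrightarrow> defect u g b = 0"
  shows "half_energy u g = branch_energy (tail u 0) (u 0)"
proof -
  have "half_energy u g \<le> branch_energy (tail u 0) (u 0)"
  proof (rule field_le_epsilon)
    fix e :: real assume "e > 0"
    then obtain c where c: "0 \<le> c" "tail u c > 0"
      "\<bar>half_energy u g - (branch_energy (tail u 0) (u 0) + defect u g c)\<bar> < e"
      using calibration_limit[OF order_refl assms(1)] by blast
    thus "half_energy u g \<le> branch_energy (tail u 0) (u 0) + e" using zero[OF c(1,2)] by linarith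
  qed
  thus ?thesis using half_energy_ge_branch_energy[OF assms(1)] by linarith
qed

lemma half_energy_nonneg_if_zero:
  assumes "tail u 0 = 0"
  shows "half_energy u g \<ge> 0" and "u 0 = 0"
proof -
  have z: "u t = 0" if "t \<ge> 0" for t using tail_zero_imp_zero[OF uv order_refl assms that] .
  thus "u 0 = 0" by simp
  show "half_energy u g \<ge> 0"
    unfolding half_energy_def by (rule set_integral_ge_zero) (use z p_gt_2 in auto)
qed

end
end

section \<open>Equality in the calibration inequality: solitons\<close>

context subcritical
begin

text \<open>
  The soliton with wave number \<open>\<sigma>\<close>, shifted such that the vertex sits at the argument \<open>\<xi>\<close>.
\<close>
definition soliton_profile :: "real \<Rightarrow> real \<Rightarrow> real \<Rightarrow> real" where
  "soliton_profile \<sigma> \<xi> x = sqrt amp * (\<sigma> / cosh (\<xi> + \<sigma> * x / al)) powr al"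

text \<open>
  The Gudermannian function: it turns the argument of the hyperbolic functions into the phase.
\<close>
definition gd_phase :: "real \<Rightarrow> real \<Rightarrow> real \<Rightarrow> real" where
  "gd_phase \<sigma> \<xi> x = arcsin (tanh (\<xi> + \<sigma> * x / al))"

lemma cos_arcsin_tanh: "cos (arcsin (tanh s)) = 1 / cosh (s::real)"
proof -
  have t: "-1 < tanh s" "tanh s < 1" using tanh_real_bounds[of s] by auto
  have "cos (arcsin (tanh s)) = sqrt (1 - (tanh s)\<^sup>2)" using t by (intro cos_arcsin) auto
  also have "1 - (tanh s)\<^sup>2 = (1 / cosh s)\<^sup>2"
  proof -
    have gen: "1 - y / (y + 1) = 1 / (y + 1)" if "y \<ge> 0" for y :: real
      using that by (simp add: field_simps)
    show ?thesis unfolding tanh_def power_divide cosh_square_eq using gen[of "(sinh s)\<^sup>2"] by simp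
  qed
  also have "sqrt ((1 / cosh s)\<^sup>2) = 1 / cosh s" by (simp add: cosh_real_nonneg)
  finally show ?thesis .
qed

lemma arcsin_tanh_range: "-(pi/2) < arcsin (tanh (s::real))" "arcsin (tanh s) < pi/2"
  using arcsin_lt_bounded[of "tanh s"] tanh_real_bounds[of s] by auto

lemma tanh_artanh: "\<bar>x\<bar> < 1 \<Longrightarrow> tanh (artanh x) = (x::real)"
proof -
  assume x: "\<bar>x\<bar> < 1"
  have "exp (- 2 * artanh x) = inverse (exp (ln ((1 + x) / (1 - x))))"
    by (simp add: artanh_def exp_minus)
  also have "\<dots> = (1 - x) / (1 + x)" using x by (simp add: abs_less_iff)
  finally have e: "exp (- 2 * artanh x) = (1 - x) / (1 + x)" .
  have "1 + x \<noteq> 0" using x by auto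
  thus ?thesis unfolding tanh_real_altdef e by (simp add: divide_simps)
qed

lemma cosh_artanh_sin:
  assumes "-(pi/2) < \<theta>" "\<theta> < pi/2"
  shows "cos \<theta> = 1 / cosh (artanh (sin \<theta>))" and "\<theta> = arcsin (tanh (artanh (sin \<theta>)))"
proof -
  have c: "cos \<theta> > 0" using assms by (rule cos_pos')
  have "(sin \<theta>)\<^sup>2 < 1" using c by (simp add: sin_squared_eq)
  hence s: "\<bar>sin \<theta>\<bar> < 1" by (simp add: abs_square_less_1)
  show 1: "\<theta> = arcsin (tanh (artanh (sin \<theta>)))"
    using s assms by (simp add: tanh_artanh arcsin_sin)
  show "cos \<theta> = 1 / cosh (artanh (sin \<theta>))"
    by (subst 1) (rule cos_arcsin_tanh)
qed

lemma soliton_profile_coord: "soliton_profile \<sigma> \<xi> x = coord_value \<sigma> (gd_phase \<sigma> \<xi> x)"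
  by (simp add: soliton_profile_def coord_value_def gd_phase_def cos_arcsin_tanh)

lemma soliton_profile_pos: "\<sigma> > 0 \<Longrightarrow> soliton_profile \<sigma> \<xi> x > 0"
  using amp_pos by (simp add: soliton_profile_def)

lemma soliton_profile_deriv:
  assumes \<sigma>: "\<sigma> > 0"
  shows "(soliton_profile \<sigma> \<xi> has_real_derivative - (soliton_profile \<sigma> \<xi> x * \<sigma> * tanh (\<xi> + \<sigma> * x / al))) (at x)"
proof -
  define s where "s = \<xi> + \<sigma> * x / al"
  have c: "cosh s > 0" by (rule cosh_real_pos)
  have ds: "((\<lambda>x. \<xi> + \<sigma> * x / al) has_real_derivative \<sigma> / al) (at x)"
    using al_pos by (auto intro!: derivative_eq_intros)
  have dq: "((\<lambda>x. \<sigma> / cosh (\<xi> + \<sigma> * x / al)) has_real_derivative - (\<sigma> * (sinh s * (\<sigma> / al)) / (cosh s * cosh s))) (at x)"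
    unfolding s_def using al_pos
    by (auto intro!: derivative_eq_intros ds simp: power2_eq_square)
  have pos: "\<sigma> / cosh (\<xi> + \<sigma> * x / al) > 0" using \<sigma> by simp
  have "((\<lambda>x. (\<sigma> / cosh (\<xi> + \<sigma> * x / al)) powr al) has_real_derivative
     al * (\<sigma> / cosh s) powr (al - 1) * - (\<sigma> * (sinh s * (\<sigma> / al)) / (cosh s * cosh s))) (at x)"
    unfolding s_def by (rule DERIV_chain2[OF has_real_derivative_powr[OF pos] dq[unfolded s_def]])
  from DERIV_cmult[OF this, of "sqrt amp"]
  have "(soliton_profile \<sigma> \<xi> has_real_derivative
     sqrt amp * (al * (\<sigma> / cosh s) powr (al - 1) * - (\<sigma> * (sinh s * (\<sigma> / al)) / (cosh s * cosh s)))) (at x)"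
    unfolding soliton_profile_def[abs_def] .
  also have "(\<sigma> / cosh s) powr (al - 1) = (\<sigma> / cosh s) powr al / (\<sigma> / cosh s)"
    using \<sigma> c by (simp add: powr_diff)
  also have "sqrt amp * (al * ((\<sigma> / cosh s) powr al / (\<sigma> / cosh s)) * - (\<sigma> * (sinh s * (\<sigma> / al)) / (cosh s * cosh s)))
     = - (sqrt amp * (\<sigma> / cosh s) powr al * \<sigma> * (sinh s / cosh s))"
    using \<sigma> c al_pos by simp
  finally show ?thesis
    unfolding soliton_profile_def[abs_def] tanh_def s_def[symmetric] .
qed

lemma gd_phase_deriv:
  "(gd_phase \<sigma> \<xi> has_real_derivative \<sigma> / al * cos (gd_phase \<sigma> \<xi> x)) (at x)"
proof -
  define s where "s = \<xi> + \<sigma> * x / al"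
  have t: "-1 < tanh s" "tanh s < 1" using tanh_real_bounds[of s] by auto
  have ds: "((\<lambda>x. \<xi> + \<sigma> * x / al) has_real_derivative \<sigma> / al) (at x)"
    using al_pos by (auto intro!: derivative_eq_intros)
  have "((\<lambda>x. tanh (\<xi> + \<sigma> * x / al)) has_real_derivative (1 - (tanh s)\<^sup>2) * (\<sigma> / al)) (at x)"
    unfolding s_def using al_pos by (auto intro!: derivative_eq_intros ds)
  hence "(gd_phase \<sigma> \<xi> has_real_derivative inverse (sqrt (1 - (tanh s)\<^sup>2)) * ((1 - (tanh s)\<^sup>2) * (\<sigma> / al))) (at x)"
    unfolding gd_phase_def[abs_def] s_def
    by (rule DERIV_chain2[where f = arcsin and g = "\<lambda>x. tanh (\<xi> + \<sigma> * x / al)" and x = x,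
          OF DERIV_arcsin[OF t[unfolded s_def]]])
  moreover have "inverse (sqrt (1 - (tanh s)\<^sup>2)) * ((1 - (tanh s)\<^sup>2) * (\<sigma> / al)) = \<sigma> / al * sqrt (1 - (tanh s)\<^sup>2)"
  proof -
    have "(tanh s)\<^sup>2 < 1" using t by (simp add: abs_square_less_1)
    hence y: "1 - (tanh s)\<^sup>2 > 0" by simp
    have "inverse (sqrt y) * (y * c) = c * sqrt y" if "y > 0" for y c :: real
    proof -
      have "inverse (sqrt y) * y = sqrt y" using that by (simp add: real_div_sqrt inverse_eq_divide)
      thus ?thesis unfolding mult.assoc[symmetric] by (simp only: mult.commute)
    qed
    from this[OF y] show ?thesis .
  qed
  moreover have "sqrt (1 - (tanh s)\<^sup>2) = cos (gd_phase \<sigma> \<xi> x)"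
    unfolding gd_phase_def s_def[symmetric] using t by (intro cos_arcsin[symmetric]) auto
  ultimately show ?thesis by (simp only:)
qed

lemma gd_phase_range: "-(pi/2) < gd_phase \<sigma> \<xi> x" "gd_phase \<sigma> \<xi> x < pi/2"
  unfolding gd_phase_def by (rule arcsin_tanh_range)+

lemma sin_gd_phase: "sin (gd_phase \<sigma> \<xi> x) = tanh (\<xi> + \<sigma> * x / al)"
  using tanh_real_bounds[of "\<xi> + \<sigma> * x / al"] by (simp add: gd_phase_def sin_arcsin less_imp_le)

lemma profile_mass_deriv:
  assumes \<sigma>: "\<sigma> > 0"
  shows "((\<lambda>x. coord_mass \<sigma> (gd_phase \<sigma> \<xi> x)) has_real_derivative - (soliton_profile \<sigma> \<xi> x)\<^sup>2) (at x)"
proof -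
  define \<theta> where "\<theta> = gd_phase \<sigma> \<xi> x"
  have \<theta>: "-(pi/2) < \<theta>" "\<theta> < pi/2" unfolding \<theta>_def by (rule gd_phase_range)+
  have c: "cos \<theta> > 0" using \<theta> by (rule cos_pos')
  have dm: "(coord_mass \<sigma> has_real_derivative - (al * amp * \<sigma> powr nu * cos \<theta> powr nu)) (at \<theta>)"
    using DERIV_cmult[OF tail_mass_deriv[OF \<theta>], of "al * amp * \<sigma> powr nu"]
    unfolding coord_mass_def[abs_def] by simp
  have "((\<lambda>x. coord_mass \<sigma> (gd_phase \<sigma> \<xi> x)) has_real_derivative
      - (al * amp * \<sigma> powr nu * cos \<theta> powr nu) * (\<sigma> / al * cos \<theta>)) (at x)"
    using DERIV_chain2[OF dm[unfolded \<theta>_def] gd_phase_deriv] by (simp add: \<theta>_def)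
  also have "- (al * amp * \<sigma> powr nu * cos \<theta> powr nu) * (\<sigma> / al * cos \<theta>)
     = - (amp * (\<sigma> powr nu * \<sigma>) * (cos \<theta> powr nu * cos \<theta>))" using al_pos by simp
  also have "\<dots> = - (coord_value \<sigma> \<theta>)\<^sup>2"
    using coord_value_square[OF \<sigma> less_imp_le[OF \<theta>(1)] \<theta>(2)] \<sigma> c by (simp add: powr_add)
  finally show ?thesis by (simp add: soliton_profile_coord \<theta>_def)
qed

text \<open>
  The phase tends to \<open>pi/2\<close>, where \<open>tail_mass\<close> vanishes.
\<close>
lemma profile_mass_tendsto:
  assumes \<sigma>: "\<sigma> > 0"
  shows "((\<lambda>x. coord_mass \<sigma> (gd_phase \<sigma> \<xi> x)) \<longlongrightarrow> 0) at_top"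
proof -
  have "filterlim (\<lambda>x. \<xi> + \<sigma> / al * x) at_top at_top"
    using \<sigma> al_pos
    by (intro filterlim_tendsto_add_at_top[OF tendsto_const] filterlim_tendsto_pos_mult_at_top[OF tendsto_const]
          filterlim_ident) auto
  hence "((\<lambda>x. tanh (\<xi> + \<sigma> / al * x)) \<longlongrightarrow> 1) at_top"
    by (rule filterlim_compose[OF tanh_real_at_top])
  hence "((\<lambda>x. arcsin (tanh (\<xi> + \<sigma> / al * x))) \<longlongrightarrow> arcsin 1) at_top"
  proof -
    have "continuous_on {-1..1} arcsin" by (rule continuous_on_arcsin') 
    hence "(arcsin \<longlongrightarrow> arcsin 1) (at 1 within {-1..1})" unfolding continuous_on_def by (rule bspec) simp
    moreover have "filterlim (\<lambda>x. tanh (\<xi> + \<sigma> / al * x)) (at 1 within {-1..1}) at_top"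
    proof -
      have "tanh s \<in> {-1..1} \<and> tanh s \<noteq> 1" for s :: real using tanh_real_bounds[of s] by auto
      thus ?thesis using \<open>((\<lambda>x. tanh (\<xi> + \<sigma> / al * x)) \<longlongrightarrow> 1) at_top\<close>
        unfolding filterlim_at by simp
    qed
    ultimately show ?thesis by (rule filterlim_compose)
  qed
  hence g: "((\<lambda>x. gd_phase \<sigma> \<xi> x) \<longlongrightarrow> pi/2) at_top" by (simp add: gd_phase_def)
  have "(tail_mass \<longlongrightarrow> tail_mass (pi/2)) (at (pi/2) within {-(pi/2)..pi/2})"
    using continuous_on_tail_mass unfolding continuous_on_def by (rule bspec) simp
  moreover have "filterlim (gd_phase \<sigma> \<xi>) (at (pi/2) within {-(pi/2)..pi/2}) at_top"
  proof -
    have "gd_phase \<sigma> \<xi> x \<in> {-(pi/2)..pi/2} \<and> gd_phase \<sigma> \<xi> x \<noteq> pi/2" for x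
      using gd_phase_range[of \<sigma> \<xi> x] less_imp_le[OF gd_phase_range(1)] less_imp_le[OF gd_phase_range(2)]
      by (metis atLeastAtMost_iff less_irrefl)
    thus ?thesis using g unfolding filterlim_at by simp
  qed
  ultimately have "((\<lambda>x. tail_mass (gd_phase \<sigma> \<xi> x)) \<longlongrightarrow> tail_mass (pi/2)) at_top"
    by (rule filterlim_compose)
  hence "((\<lambda>x. coord_mass \<sigma> (gd_phase \<sigma> \<xi> x)) \<longlongrightarrow> al * amp * \<sigma> powr nu * 0) at_top"
    unfolding coord_mass_def by (intro tendsto_mult tendsto_const) simp
  thus ?thesis by simp
qed

lemma profile_square_integral:
  assumes \<sigma>: "\<sigma> > 0"
  shows "set_integrable lborel {a..} (\<lambda>x. (soliton_profile \<sigma> \<xi> x)\<^sup>2)"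
    and "tail (soliton_profile \<sigma> \<xi>) a = coord_mass \<sigma> (gd_phase \<sigma> \<xi> a)"
proof -
  define U where "U = soliton_profile \<sigma> \<xi>"
  have cU: "continuous_on UNIV U"
    unfolding U_def by (intro continuous_at_imp_continuous_on ballI DERIV_isCont[OF soliton_profile_deriv[OF \<sigma>]])
  have bU: "(\<lambda>x. (U x)\<^sup>2) \<in> borel_measurable borel"
    by (intro borel_measurable_continuous_onI continuous_on_power cU)
  have "(\<integral>\<^sup>+x. ennreal ((U x)\<^sup>2) * indicator {a..} x \<partial>lborel) = ennreal (0 - (- coord_mass \<sigma> (gd_phase \<sigma> \<xi> a)))"
  proof (rule nn_integral_FTC_atLeast[OF bU])
    show "((\<lambda>x. - coord_mass \<sigma> (gd_phase \<sigma> \<xi> x)) has_real_derivative (U x)\<^sup>2) (at x)" for x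
      using DERIV_minus[OF profile_mass_deriv[OF \<sigma>]] by (simp add: U_def)
    show "((\<lambda>x. - coord_mass \<sigma> (gd_phase \<sigma> \<xi> x)) \<longlongrightarrow> 0) at_top"
      using tendsto_minus[OF profile_mass_tendsto[OF \<sigma>]] by simp
  qed simp
  hence nn: "(\<integral>\<^sup>+x. ennreal (indicator {a..} x *\<^sub>R (U x)\<^sup>2) \<partial>lborel) = ennreal (coord_mass \<sigma> (gd_phase \<sigma> \<xi> a))"
    by (simp add: indicator_mult_ennreal mult.commute)
  have nonneg: "AE x in lborel. 0 \<le> indicator {a..} x *\<^sub>R (U x)\<^sup>2" by simp
  have m0: "coord_mass \<sigma> (gd_phase \<sigma> \<xi> a) \<ge> 0"
    using coord_mass_pos[OF \<sigma> less_imp_le[OF gd_phase_range(1)] gd_phase_range(2)] by (rule less_imp_le)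
  have meas: "(\<lambda>x. indicator {a..} x *\<^sub>R (U x)\<^sup>2) \<in> borel_measurable lborel"
    using bU by (auto intro!: borel_measurable_scaleR borel_measurable_indicator)
  show "set_integrable lborel {a..} (\<lambda>x. (soliton_profile \<sigma> \<xi> x)\<^sup>2)"
    unfolding set_integrable_def U_def[symmetric]
    by (rule integrableI_nn_integral_finite[OF meas _ nn]) (auto simp: indicator_def)
  show "tail (soliton_profile \<sigma> \<xi>) a = coord_mass \<sigma> (gd_phase \<sigma> \<xi> a)"
    unfolding tail_def set_lebesgue_integral_def U_def[symmetric]
    unfolding integral_eq_nn_integral[OF meas nonneg] nn by (rule enn2real_ennreal[OF m0])
qed

definition profile_slope :: "real \<Rightarrow> real \<Rightarrow> real \<Rightarrow> real" where
  "profile_slope \<sigma> \<xi> x = - (soliton_profile \<sigma> \<xi> x * \<sigma> * tanh (\<xi> + \<sigma> * x / al))"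

lemma continuous_on_soliton_profile: "\<sigma> > 0 \<Longrightarrow> continuous_on A (soliton_profile \<sigma> \<xi>)"
  by (intro continuous_at_imp_continuous_on ballI DERIV_isCont[OF soliton_profile_deriv])

lemma continuous_on_profile_slope: "\<sigma> > 0 \<Longrightarrow> continuous_on A (profile_slope \<sigma> \<xi>)"
  unfolding profile_slope_def[abs_def]
  using al_pos by (intro continuous_on_minus continuous_on_mult continuous_on_soliton_profile continuous_on_const
      continuous_on_tanh continuous_on_add continuous_on_divide continuous_on_id) auto

lemma profile_slope_L2:
  assumes \<sigma>: "\<sigma> > 0"
  shows "L2_halfline (profile_slope \<sigma> \<xi>)"
  unfolding L2_halfline_def
proof
  show "set_borel_measurable lborel {0..} (profile_slope \<sigma> \<xi>)"
    by (intro set_borel_measurable_continuous continuous_on_profile_slope \<sigma>) auto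
  show "set_integrable lborel {0..} (\<lambda>x. (profile_slope \<sigma> \<xi> x)\<^sup>2)"
  proof (rule set_integrable_bound[where f = "\<lambda>x. \<sigma>\<^sup>2 * (soliton_profile \<sigma> \<xi> x)\<^sup>2"])
    show "set_integrable lborel {0..} (\<lambda>x. \<sigma>\<^sup>2 * (soliton_profile \<sigma> \<xi> x)\<^sup>2)"
      using profile_square_integral(1)[OF \<sigma>] by simp
    show "set_borel_measurable lborel {0..} (\<lambda>x. (profile_slope \<sigma> \<xi> x)\<^sup>2)"
      by (intro set_borel_measurable_continuous continuous_on_power continuous_on_profile_slope \<sigma>) auto
    show "AE x in lborel. x \<in> {0..} \<longrightarrow> norm ((profile_slope \<sigma> \<xi> x)\<^sup>2) \<le> norm (\<sigma>\<^sup>2 * (soliton_profile \<sigma> \<xi> x)\<^sup>2)"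
    proof (intro AE_I2 impI)
      fix x
      have "(tanh (\<xi> + \<sigma> * x / al))\<^sup>2 \<le> 1"
        using tanh_real_bounds[of "\<xi> + \<sigma> * x / al"] by (auto simp: abs_square_le_1)
      hence "(soliton_profile \<sigma> \<xi> x * \<sigma>)\<^sup>2 * (tanh (\<xi> + \<sigma> * x / al))\<^sup>2 \<le> (soliton_profile \<sigma> \<xi> x * \<sigma>)\<^sup>2 * 1"
        by (intro mult_left_mono) auto
      thus "norm ((profile_slope \<sigma> \<xi> x)\<^sup>2) \<le> norm (\<sigma>\<^sup>2 * (soliton_profile \<sigma> \<xi> x)\<^sup>2)"
        by (simp add: profile_slope_def power_mult_distrib mult_ac)
    qed
  qed
qed

lemma profile_branch_function:
  assumes \<sigma>: "\<sigma> > 0"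
  shows "branch_function (soliton_profile \<sigma> \<xi>) (profile_slope \<sigma> \<xi>)"
  unfolding branch_function_def
proof (intro conjI)
  show "continuous_on {0..} (soliton_profile \<sigma> \<xi>)" by (rule continuous_on_soliton_profile[OF \<sigma>])
  show "L2_halfline (soliton_profile \<sigma> \<xi>)"
    unfolding L2_halfline_def using profile_square_integral(1)[OF \<sigma>]
    by (intro conjI set_borel_measurable_continuous continuous_on_soliton_profile \<sigma>) auto
  show "L2_halfline (profile_slope \<sigma> \<xi>)" by (rule profile_slope_L2[OF \<sigma>])
  show "ac_deriv (soliton_profile \<sigma> \<xi>) (profile_slope \<sigma> \<xi>)"
    unfolding ac_deriv_def
  proof (intro conjI allI impI)
    show "set_integrable lborel {0..b} (profile_slope \<sigma> \<xi>)" for b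
      by (intro borel_integrable_atLeastAtMost' continuous_on_profile_slope \<sigma>)
    fix x y :: real assume xy: "0 \<le> x" "x \<le> y"
    have "(\<integral>t. indicator {x..y} t *\<^sub>R profile_slope \<sigma> \<xi> t \<partial>lborel) = soliton_profile \<sigma> \<xi> y - soliton_profile \<sigma> \<xi> x"
    proof (rule integral_FTC_atLeastAtMost[OF xy(2)])
      show "(soliton_profile \<sigma> \<xi> has_vector_derivative profile_slope \<sigma> \<xi> t) (at t within {x..y})" for t
        using soliton_profile_deriv[OF \<sigma>] unfolding profile_slope_def
        by (simp add: has_real_derivative_iff_has_vector_derivative[symmetric] has_field_derivative_at_within)
    qed (rule continuous_on_profile_slope[OF \<sigma>])
    thus "soliton_profile \<sigma> \<xi> y - soliton_profile \<sigma> \<xi> x = (LINT t:{x..y}|lborel. profile_slope \<sigma> \<xi> t)"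
      by (simp add: set_lebesgue_integral_def)
  qed
qed

text \<open>
  On a soliton the slope is \<open>- W\<^sub>a\<close> everywhere, so that nothing is lost in the calibration inequality.
\<close>
lemma branch_energy_attained:
  assumes m: "m > 0" and a: "a > 0"
  obtains \<sigma> \<xi> where "\<sigma> > 0" "soliton_profile \<sigma> \<xi> 0 = a" "tail (soliton_profile \<sigma> \<xi>) 0 = m"
    "half_energy (soliton_profile \<sigma> \<xi>) (profile_slope \<sigma> \<xi>) = branch_energy m a"
proof -
  define \<sigma> where "\<sigma> = wavenum m a"
  define \<xi> where "\<xi> = artanh (sin (phase m a))"
  define U where "U = soliton_profile \<sigma> \<xi>"
  have \<sigma>: "\<sigma> > 0" unfolding \<sigma>_def using m by (rule wavenum_pos)
  have ph: "-(pi/2) < phase m a" "phase m a < pi/2" using phase_gt[OF m, of a] a phase_less by auto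
  have g0: "gd_phase \<sigma> \<xi> 0 = phase m a"
    using cosh_artanh_sin(2)[OF ph] by (simp add: gd_phase_def \<xi>_def)
  have U0: "U 0 = a"
    using coord_value_inverse[OF m, of a] a by (simp add: U_def soliton_profile_coord g0) (simp add: \<sigma>_def)
  have tU: "tail U x = coord_mass \<sigma> (gd_phase \<sigma> \<xi> x)" for x
    unfolding U_def by (rule profile_square_integral(2)[OF \<sigma>])
  have t0: "tail U 0 = m" using coord_mass_inverse[OF m, of a] by (simp add: tU g0) (simp add: \<sigma>_def)
  have slope: "profile_slope \<sigma> \<xi> x + branch_slope (tail U x) (U x) = 0" for x
  proof -
    have Ux: "U x = coord_value \<sigma> (gd_phase \<sigma> \<xi> x)" unfolding U_def by (rule soliton_profile_coord)
    have "branch_slope (tail U x) (U x) = U x * \<sigma> * sin (gd_phase \<sigma> \<xi> x)"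
      unfolding branch_slope_def tU Ux phase_coord[OF \<sigma> less_imp_le[OF gd_phase_range(1)] gd_phase_range(2)] ..
    thus ?thesis by (simp add: profile_slope_def U_def sin_gd_phase)
  qed
  have "half_energy U (profile_slope \<sigma> \<xi>) = branch_energy (tail U 0) (U 0)"
  proof (rule half_energy_eq)
    show "branch_function U (profile_slope \<sigma> \<xi>)" unfolding U_def by (rule profile_branch_function[OF \<sigma>])
    show "defect U (profile_slope \<sigma> \<xi>) b = 0" for b unfolding defect_def slope by simp
  qed (use t0 m in simp)
  thus ?thesis using that[OF \<sigma>] U0 t0 by (simp add: U_def)
qed

text \<open>
  The flow \<open>u' = - W\<^sub>a\<close>, \<open>m' = - u\<^sup>2\<close> in the coordinates \<open>(\<sigma>, \<theta>)\<close>: the wave number is constant and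
  \<open>artanh (sin \<theta>)\<close>, the argument of the hyperbolic functions, grows linearly. This replaces a uniqueness theorem for
  the differential equation.
\<close>
lemma flow_invariants:
  fixes m u :: "real \<Rightarrow> real"
  assumes xy: "x \<le> y"
    and pos: "\<And>t. t \<in> {x..y} \<Longrightarrow> m t > 0" "\<And>t. t \<in> {x..y} \<Longrightarrow> u t > 0"
    and du: "\<And>t. t \<in> {x..y} \<Longrightarrow> (u has_real_derivative - branch_slope (m t) (u t)) (at t within {x..y})"
    and dm: "\<And>t. t \<in> {x..y} \<Longrightarrow> (m has_real_derivative - (u t)\<^sup>2) (at t within {x..y})"
    and t: "t \<in> {x..y}"
  shows "wavenum (m t) (u t) = wavenum (m x) (u x)"
    and "artanh (sin (phase (m t) (u t))) = artanh (sin (phase (m x) (u x))) + wavenum (m x) (u x) * (t - x) / al"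
proof -
  define k where "k = ln (sqrt (p / 2)) - ln (al * amp) / nu"
  (* the logarithm of the ratio, whose derivative contains the same factor F as that of rho *)
  define L where "L = (\<lambda>s. ln (u s) / al - ln (m s) / nu - k)"
  define \<Theta> where "\<Theta> = (\<lambda>s. rho_inv (exp (L s)))"
  have aa: "al * amp > 0" using al_pos amp_pos by simp
  have R: "ratio (m s) (u s) = exp (L s)" if s: "s \<in> {x..y}" for s
  proof -
    have gen: "y powr (1 / c) = exp (ln y / c)" if "y > 0" for y c :: real using that by (simp add: powr_def)
    have ms: "m s / (al * amp) > 0" using pos(1)[OF s] aa by simp
    have "ratio (m s) (u s) = exp (ln (u s) / al) / (exp (ln (sqrt (p / 2))) * exp (ln (m s / (al * amp)) / nu))"
      unfolding ratio_def abs_of_pos[OF pos(2)[OF s]] gen[OF ms] gen[OF pos(2)[OF s]] exp_ln[OF half_p_pos] ..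
    also have "\<dots> = exp (ln (u s) / al - (ln (sqrt (p / 2)) + ln (m s / (al * amp)) / nu))"
      by (simp only: exp_diff exp_add)
    also have "ln (m s / (al * amp)) = ln (m s) - ln (al * amp)" using pos(1)[OF s] aa by (rule ln_divide_pos)
    also have "ln (u s) / al - (ln (sqrt (p / 2)) + (ln (m s) - ln (al * amp)) / nu) = L s"
      by (simp add: L_def k_def diff_divide_distrib)
    finally show ?thesis .
  qed
  have ph: "phase (m s) (u s) = \<Theta> s" if "s \<in> {x..y}" for s
    unfolding phase_def \<Theta>_def R[OF that] ..
  have \<Theta>_range: "-(pi/2) < \<Theta> s" "\<Theta> s < pi/2" if "s \<in> {x..y}" for s
    using phase_gt[OF pos(1)[OF that], of "u s"] phase_less[of "m s" "u s"] pos(2)[OF that] ph[OF that] by auto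
  define F where "F = (\<lambda>s. cos (\<Theta> s) powr nu / (nu * tail_mass (\<Theta> s)) - sin (\<Theta> s) / cos (\<Theta> s))"
  have d\<Theta>: "(\<Theta> has_real_derivative wavenum (m s) (u s) / al * cos (\<Theta> s)) (at s within {x..y})"
    if s: "s \<in> {x..y}" for s
  proof -
    define \<sigma> where "\<sigma> = wavenum (m s) (u s)"
    have c: "cos (\<Theta> s) > 0" using \<Theta>_range[OF s] by (rule cos_pos')
    have B: "tail_mass (\<Theta> s) > 0" using \<Theta>_range[OF s] by (intro tail_mass_pos) auto
    have F0: "F s > 0" unfolding F_def using phase_factor_pos[OF pos(1)[OF s] pos(2)[OF s]] by (simp add: ph[OF s])
    have dL: "(L has_real_derivative - branch_slope (m s) (u s) / u s / al - - (u s)\<^sup>2 / m s / nu - 0) (at s within {x..y})"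
      unfolding L_def
      by (rule DERIV_cong[OF DERIV_diff[OF DERIV_diff[OF
              DERIV_cdivide[OF DERIV_chain2[OF DERIV_ln_divide[OF pos(2)[OF s]] du[OF s]], of al]
              DERIV_cdivide[OF DERIV_chain2[OF DERIV_ln_divide[OF pos(1)[OF s]] dm[OF s]], of nu]]
            DERIV_const[of k]]]) simp
    have "- branch_slope (m s) (u s) / u s / al - - (u s)\<^sup>2 / m s / nu - 0 = \<sigma> / al * cos (\<Theta> s) * F s"
    proof -
      have "branch_slope (m s) (u s) / u s = \<sigma> * sin (\<Theta> s)"
        using pos(2)[OF s] by (simp add: branch_slope_def \<sigma>_def ph[OF s])
      moreover have "(u s)\<^sup>2 / m s = \<sigma> * (cos (\<Theta> s) powr nu * cos (\<Theta> s)) / (al * tail_mass (\<Theta> s))"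
        unfolding square_mass[OF pos(1)[OF s], of "u s"] ph[OF s] cos_powr_Suc[OF less_imp_le[OF c]] \<sigma>_def[symmetric]
        using pos(1)[OF s] by simp
      ultimately have "- branch_slope (m s) (u s) / u s / al - - (u s)\<^sup>2 / m s / nu - 0
         = - (\<sigma> * sin (\<Theta> s)) / al + \<sigma> * (cos (\<Theta> s) powr nu * cos (\<Theta> s)) / (al * tail_mass (\<Theta> s)) / nu"
        by simp
      also have "\<dots> = \<sigma> / al * cos (\<Theta> s) * F s"
        unfolding F_def using c B al_pos nu_pos by (simp add: field_simps)
      finally show ?thesis .
    qed
    with dL have dL': "(L has_real_derivative \<sigma> / al * cos (\<Theta> s) * F s) (at s within {x..y})" by simp
    have dr: "(rho_inv has_real_derivative 1 / (exp (L s) * F s)) (at (exp (L s)))"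
      using rho_inv_ratio_deriv[OF pos(1)[OF s] pos(2)[OF s]] unfolding ph[OF s] R[OF s] F_def .
    have "(\<Theta> has_real_derivative 1 / (exp (L s) * F s) * (exp (L s) * (\<sigma> / al * cos (\<Theta> s) * F s))) (at s within {x..y})"
      unfolding \<Theta>_def
      by (rule DERIV_chain2[OF dr DERIV_chain2[OF DERIV_exp dL'[unfolded \<Theta>_def]]])
    thus ?thesis using F0 by (simp add: \<sigma>_def)
  qed
  define Q where "Q = (\<lambda>s. ln (m s) - ln (tail_mass (\<Theta> s)))"
  have wn: "wavenum (m s) (u s) = exp ((Q s - ln (al * amp)) / nu)" if s: "s \<in> {x..y}" for s
  proof -
    have B: "tail_mass (\<Theta> s) > 0" using \<Theta>_range[OF s] by (intro tail_mass_pos) auto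
    have "ln (m s / (al * amp * tail_mass (\<Theta> s))) = Q s - ln (al * amp)"
      unfolding Q_def using pos(1)[OF s] B aa by (simp add: ln_divide_pos ln_mult_pos)
    thus ?thesis unfolding wavenum_def ph[OF s] using pos(1)[OF s] B aa al_pos amp_pos by (simp add: powr_def)
  qed
  have "(Q has_real_derivative 0) (at s within {x..y})" if s: "s \<in> {x..y}" for s
  proof -
    define \<sigma> where "\<sigma> = wavenum (m s) (u s)"
    have c: "cos (\<Theta> s) > 0" using \<Theta>_range[OF s] by (rule cos_pos')
    have B: "tail_mass (\<Theta> s) > 0" using \<Theta>_range[OF s] by (intro tail_mass_pos) auto
    have "((\<lambda>s. tail_mass (\<Theta> s)) has_real_derivative - (cos (\<Theta> s) powr nu) * (\<sigma> / al * cos (\<Theta> s))) (at s within {x..y})"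
      unfolding \<sigma>_def by (rule DERIV_chain2[OF tail_mass_deriv[OF \<Theta>_range[OF s]] d\<Theta>[OF s]])
    note dB = this
    have "(Q has_real_derivative 1 / m s * - (u s)\<^sup>2 - 1 / tail_mass (\<Theta> s) * (- (cos (\<Theta> s) powr nu) * (\<sigma> / al * cos (\<Theta> s))))
       (at s within {x..y})"
      unfolding Q_def
      by (rule DERIV_diff[OF DERIV_chain2[OF DERIV_ln_divide[OF pos(1)[OF s]] dm[OF s]]
            DERIV_chain2[OF DERIV_ln_divide[OF B] dB]])
    also have "1 / m s * - (u s)\<^sup>2 - 1 / tail_mass (\<Theta> s) * (- (cos (\<Theta> s) powr nu) * (\<sigma> / al * cos (\<Theta> s))) = 0"
      unfolding square_mass[OF pos(1)[OF s], of "u s"] ph[OF s] cos_powr_Suc[OF less_imp_le[OF c]] \<sigma>_def[symmetric]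
      using pos(1)[OF s] B al_pos by simp
    finally show ?thesis .
  qed
  then obtain q0 where q0: "\<And>s. s \<in> {x..y} \<Longrightarrow> Q s = q0"
    using has_field_derivative_zero_constant[of "{x..y}" Q] by auto
  have x: "x \<in> {x..y}" using xy by simp
  have wc: "wavenum (m s) (u s) = wavenum (m x) (u x)" if "s \<in> {x..y}" for s
    unfolding wn[OF that] wn[OF x] q0[OF that] q0[OF x] ..
  thus "wavenum (m t) (u t) = wavenum (m x) (u x)" using t by blast
  define \<sigma> where "\<sigma> = wavenum (m x) (u x)"
  have "((\<lambda>s. artanh (sin (\<Theta> s)) - \<sigma> * s / al) has_real_derivative 0) (at s within {x..y})" if s: "s \<in> {x..y}" for s
  proof -
    have c: "cos (\<Theta> s) > 0" using \<Theta>_range[OF s] by (rule cos_pos')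
    have "(sin (\<Theta> s))\<^sup>2 < 1" using c by (simp add: sin_squared_eq)
    hence s1: "\<bar>sin (\<Theta> s)\<bar> < 1" by (simp add: abs_square_less_1)
    have dsin: "((\<lambda>s. sin (\<Theta> s)) has_real_derivative cos (\<Theta> s) * (\<sigma> / al * cos (\<Theta> s))) (at s within {x..y})"
      using d\<Theta>[OF s] unfolding wc[OF s] \<sigma>_def[symmetric]
      by (rule DERIV_chain2[where f = sin and g = \<Theta> and x = s, OF DERIV_sin])
    have d1: "((\<lambda>s. artanh (sin (\<Theta> s))) has_real_derivative
       1 / (1 - (sin (\<Theta> s))\<^sup>2) * (cos (\<Theta> s) * (\<sigma> / al * cos (\<Theta> s)))) (at s within {x..y})"
      by (rule DERIV_chain2[where f = artanh and g = "\<lambda>s. sin (\<Theta> s)" and x = s,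
            OF artanh_real_has_field_derivative[OF s1] dsin])
    have d2: "((\<lambda>s. \<sigma> * s / al) has_real_derivative \<sigma> * 1 / al) (at s within {x..y})"
      by (intro DERIV_cdivide DERIV_cmult DERIV_ident)
    have "1 / (1 - (sin (\<Theta> s))\<^sup>2) * (cos (\<Theta> s) * (\<sigma> / al * cos (\<Theta> s))) - \<sigma> * 1 / al = 0"
    proof -
      have cc: "1 - (sin (\<Theta> s))\<^sup>2 = cos (\<Theta> s) * cos (\<Theta> s)"
        using cos_squared_eq[of "\<Theta> s"] by (simp add: power2_eq_square)
      show ?thesis unfolding cc using c by simp
    qed
    with DERIV_diff[OF d1 d2] show ?thesis by simp
  qed
  then obtain c0 where c0: "\<And>s. s \<in> {x..y} \<Longrightarrow> artanh (sin (\<Theta> s)) - \<sigma> * s / al = c0"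
    using has_field_derivative_zero_constant[of "{x..y}" "\<lambda>s. artanh (sin (\<Theta> s)) - \<sigma> * s / al"] by auto
  show "artanh (sin (phase (m t) (u t))) = artanh (sin (phase (m x) (u x))) + wavenum (m x) (u x) * (t - x) / al"
    unfolding ph[OF t] ph[OF x] \<sigma>_def[symmetric] using c0[OF t] c0[OF x]
    by (simp add: right_diff_distrib diff_divide_distrib)
qed

lemma value_from_invariants:
  assumes "m > 0" "a > 0"
  shows "a = sqrt amp * (wavenum m a / cosh (artanh (sin (phase m a)))) powr al"
  using abs_eq[OF assms(1), of a] cosh_artanh_sin(1)[OF phase_gt[OF assms(1)] phase_less, of a] assms by simp

lemma tail_pos_if_nonzero:
  assumes uv: "branch_function u g" and "0 \<le> x" "u x \<noteq> 0"
  shows "tail u x > 0"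
  using tail_zero_imp_zero[OF uv, of x x] tail_nonneg[OF uv, of x] assms by force

context
  fixes u g :: "real \<Rightarrow> real"
  assumes uv: "branch_function u g" and m0: "tail u 0 > 0"
    and opt: "half_energy u g \<le> branch_energy (tail u 0) (u 0)"
begin

text \<open>
  Equality forces the defect to vanish, so \<open>g\<close> equals \<open>- W\<^sub>a\<close> almost everywhere. The latter is
  continuous, so \<open>u\<close> is continuously differentiable.
\<close>
lemma optimal_increment:
  assumes b: "0 \<le> b" "tail u b > 0" and x: "x \<in> {0..b}"
  shows "u x = u 0 - integral {0..x} (\<lambda>t. branch_slope (tail u t) (u t))"
proof -
  define S where "S = (\<lambda>t. branch_slope (tail u t) (u t))"
  have "defect u g b = 0"
    using half_energy_ge[OF uv b] opt defect_nonneg[OF uv, of b] by simp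
  hence z: "(LINT t|lborel. indicator {0..b} t *\<^sub>R (1/2 * (g t + S t)\<^sup>2)) = 0"
    by (simp add: defect_def S_def set_lebesgue_integral_def)
  have "integrable lborel (\<lambda>t. indicator {0..b} t *\<^sub>R (1/2 * (g t + S t)\<^sup>2))"
    using defect_integrable[OF uv b] by (simp add: S_def set_integrable_def)
  from integral_nonneg_eq_0_iff_AE[OF this] z
  have AE: "AE t in lborel. indicator {0..b} t *\<^sub>R (1/2 * (g t + S t)\<^sup>2) = 0"
    by (auto simp: indicator_def)
  have cS: "continuous_on {0..b} S" unfolding S_def by (rule continuous_on_slope[OF uv b(2)])
  have iS: "set_integrable lborel {0..x} S"
    by (intro borel_integrable_atLeastAtMost' continuous_on_subset[OF cS]) (use x in auto)
  have ig: "set_integrable lborel {0..x} g" by (rule L2_halfline_integrable_Icc[OF g_L2[OF uv]]) simp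
  have "u x - u 0 = (LINT t:{0..x}|lborel. g t)"
    using ac_derivD(2)[OF u_ac[OF uv] order_refl, of x] x by simp
  also have "\<dots> = (LINT t:{0..x}|lborel. - S t)"
    unfolding set_lebesgue_integral_def
  proof (rule integral_cong_AE)
    show "(\<lambda>t. indicator {0..x} t *\<^sub>R g t) \<in> borel_measurable lborel"
      using ig unfolding set_integrable_def by (rule borel_measurable_integrable)
    have "(\<lambda>t. indicator {0..x} t *\<^sub>R S t) \<in> borel_measurable lborel"
      using iS unfolding set_integrable_def by (rule borel_measurable_integrable)
    thus "(\<lambda>t. indicator {0..x} t *\<^sub>R - S t) \<in> borel_measurable lborel" by simp
    show "AE t in lborel. indicator {0..x} t *\<^sub>R g t = indicator {0..x} t *\<^sub>R - S t"
      using AE by eventually_elim (use x in \<open>auto simp: indicator_def split: if_splits\<close>)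
  qed
  also have "\<dots> = - integral {0..x} S"
    using set_integral_uminus[OF iS] set_borel_integral_eq_integral(2)[OF iS] by simp
  finally show ?thesis by (simp add: S_def)
qed

lemma optimal_derivs:
  assumes b: "0 \<le> b" "tail u b > 0" and x: "x \<in> {0..b}"
  shows "(u has_real_derivative - branch_slope (tail u x) (u x)) (at x within {0..b})"
    and "(tail u has_real_derivative - (u x)\<^sup>2) (at x within {0..b})"
proof -
  have "((\<lambda>x. u 0 - integral {0..x} (\<lambda>t. branch_slope (tail u t) (u t))) has_real_derivative
     0 - branch_slope (tail u x) (u x)) (at x within {0..b})"
    by (intro DERIV_diff DERIV_const integral_has_real_derivative continuous_on_slope[OF uv b(2)] x)
  hence "(u has_real_derivative 0 - branch_slope (tail u x) (u x)) (at x within {0..b})"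
    unfolding has_real_derivative_iff_has_vector_derivative
    by (rule has_vector_derivative_transform[OF x optimal_increment[OF b], rotated])
  thus "(u has_real_derivative - branch_slope (tail u x) (u x)) (at x within {0..b})" by simp
  have T: "tail u t = tail u 0 - integral {0..t} (\<lambda>t. (u t)\<^sup>2)" if "t \<in> {0..b}" for t
    using that LINT_tail_split[OF u_square[OF uv], of 0 t]
      set_borel_integral_eq_integral(2)[OF Icc_subset_integrable[OF u_square[OF uv] order_refl], of t]
    by (simp add: tail_def)
  have "((\<lambda>x. tail u 0 - integral {0..x} (\<lambda>t. (u t)\<^sup>2)) has_real_derivative 0 - (u x)\<^sup>2) (at x within {0..b})"
    by (intro DERIV_diff DERIV_const integral_has_real_derivative continuous_on_power u_continuous_Icc[OF uv] x) simp
  hence "(tail u has_real_derivative 0 - (u x)\<^sup>2) (at x within {0..b})"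
    unfolding has_real_derivative_iff_has_vector_derivative
    by (rule has_vector_derivative_transform[OF x T, rotated])
  thus "(tail u has_real_derivative - (u x)\<^sup>2) (at x within {0..b})" by simp
qed

text \<open>
  The base point \<open>r\<close> of the soliton may be any point of the interval; the right end point is needed to continue to the
  left.
\<close>
lemma optimal_is_profile_locally:
  assumes x: "0 \<le> x" and y: "tail u y > 0"
    and pos: "\<And>t. t \<in> {x..y} \<Longrightarrow> u t > 0" and r: "r \<in> {x..y}" and t: "t \<in> {x..y}"
  shows "u t = soliton_profile (wavenum (tail u r) (u r)) (artanh (sin (phase (tail u r) (u r)))) (t - r)"
proof -
  have xy: "x \<le> y" using r by simp
  have T: "tail u s > 0" if "s \<in> {x..y}" for s
    using that x by (intro tail_pos_antimono[OF uv _ _ y]) auto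
  have sub: "{x..y} \<subseteq> {0..y}" using x by auto
  have du: "(u has_real_derivative - branch_slope (tail u s) (u s)) (at s within {x..y})"
    and dm: "(tail u has_real_derivative - (u s)\<^sup>2) (at s within {x..y})" if "s \<in> {x..y}" for s
    using that x xy by (auto intro!: DERIV_subset[OF _ sub] optimal_derivs y)
  note inv = flow_invariants[OF xy T pos du dm]
  define \<sigma> where "\<sigma> = wavenum (tail u x) (u x)"
  have w: "wavenum (tail u s) (u s) = \<sigma>" if "s \<in> {x..y}" for s
    unfolding \<sigma>_def by (rule inv(1)) (use that in auto)
  have a: "artanh (sin (phase (tail u s) (u s))) = artanh (sin (phase (tail u x) (u x))) + \<sigma> * (s - x) / al"
    if "s \<in> {x..y}" for s
    unfolding \<sigma>_def by (rule inv(2)) (use that in auto)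
  have e: "artanh (sin (phase (tail u t) (u t))) = artanh (sin (phase (tail u r) (u r))) + \<sigma> * (t - r) / al"
    unfolding a[OF t] a[OF r] by (simp add: right_diff_distrib diff_divide_distrib)
  show ?thesis
    using value_from_invariants[OF T[OF t] pos[OF t]]
    unfolding soliton_profile_def w[OF t] w[OF r] e .
qed

text \<open>
  To the left of a point with positive value the function is a soliton as long as it is positive, and a soliton
  has no zeros.
\<close>
lemma optimal_pos_backwards:
  assumes x1: "0 \<le> x1" "u x1 > 0"
  shows "u 0 > 0"
proof (rule ccontr)
  assume neg: "\<not> u 0 > 0"
  define S where "S = {0..x1} \<inter> u -` {..0}"
  define z where "z = Sup S"
  have cl: "closed S" unfolding S_def
    by (rule continuous_closed_preimage[OF u_continuous_Icc[OF uv order_refl]]) auto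
  have ne: "0 \<in> S" using neg x1 by (simp add: S_def)
  have bd: "bdd_above S" unfolding S_def by (rule bdd_above_Int1) simp
  have zS: "z \<in> S" unfolding z_def using ne by (intro closed_contains_Sup bd cl) auto
  hence z: "0 \<le> z" "z \<le> x1" "u z \<le> 0" by (auto simp: S_def)
  have zx: "z < x1" using z x1 by (cases "z = x1") auto
  have pos: "u t > 0" if "z < t" "t \<le> x1" for t
  proof (rule ccontr)
    assume "\<not> u t > 0"
    hence "t \<in> S" using that z by (simp add: S_def)
    hence "t \<le> z" unfolding z_def using bd by (rule cSup_upper)
    thus False using that by simp
  qed
  define \<sigma> where "\<sigma> = wavenum (tail u x1) (u x1)"
  define \<xi> where "\<xi> = artanh (sin (phase (tail u x1) (u x1)))"
  have T1: "tail u x1 > 0" by (rule tail_pos_if_nonzero[OF uv]) (use x1 in auto)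
  have \<sigma>: "\<sigma> > 0" unfolding \<sigma>_def using T1 by (rule wavenum_pos)
  have eq: "u t - soliton_profile \<sigma> \<xi> (t - x1) = 0" if "t \<in> {z<..x1}" for t
  proof -
    have "u t = soliton_profile \<sigma> \<xi> (t - x1)" unfolding \<sigma>_def \<xi>_def
    proof (rule optimal_is_profile_locally[where x = t and y = x1])
      show "0 \<le> t" using z(1) that by simp
      show "u s > 0" if "s \<in> {t..x1}" for s using pos[of s] that \<open>t \<in> {z<..x1}\<close> by simp
    qed (use that T1 in auto)
    thus ?thesis by simp
  qed
  have clo: "closure {z<..x1} = {z..x1}" using zx by (rule closure_greaterThanAtMost)
  have "u z - soliton_profile \<sigma> \<xi> (z - x1) = 0"
  proof (rule continuous_constant_on_closure[where S = "{z<..x1}" and f = "\<lambda>t. u t - soliton_profile \<sigma> \<xi> (t - x1)"])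
    show "continuous_on (closure {z<..x1}) (\<lambda>t. u t - soliton_profile \<sigma> \<xi> (t - x1))"
      unfolding clo
      by (intro continuous_on_diff u_continuous_Icc[OF uv z(1)]
          continuous_on_compose2[OF continuous_on_soliton_profile[OF \<sigma>, of UNIV]] continuous_on_id continuous_on_const) auto
    show "z \<in> closure {z<..x1}" unfolding clo using zx by simp
  qed (rule eq)
  thus False using z(3) soliton_profile_pos[OF \<sigma>, of \<xi> "z - x1"] by linarith
qed

text \<open>
  The same continuation argument to the right, up to the first zero.
\<close>
lemma optimal_is_profile:
  assumes u0: "u 0 > 0" and x: "0 \<le> x"
  shows "u x = soliton_profile (wavenum (tail u 0) (u 0)) (artanh (sin (phase (tail u 0) (u 0)))) x"
proof -
  define P where "P = soliton_profile (wavenum (tail u 0) (u 0)) (artanh (sin (phase (tail u 0) (u 0))))"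
  have \<sigma>: "wavenum (tail u 0) (u 0) > 0" using m0 by (rule wavenum_pos)
  have formula: "u y = P y" if "0 \<le> y" "\<And>t. t \<in> {0..y} \<Longrightarrow> u t > 0" for y
  proof -
    have "tail u y > 0" by (rule tail_pos_if_nonzero[OF uv]) (use that(1) that(2)[of y] in auto)
    from optimal_is_profile_locally[OF order_refl this that(2), of 0 y] that(1) show ?thesis by (simp add: P_def)
  qed
  have pos: "u y > 0" if "0 \<le> y" for y
  proof (rule ccontr)
    assume neg: "\<not> u y > 0"
    define S where "S = {0..y} \<inter> u -` {..0}"
    define z where "z = Inf S"
    have cl: "closed S" unfolding S_def
      by (rule continuous_closed_preimage[OF u_continuous_Icc[OF uv order_refl]]) auto
    have ne: "y \<in> S" using neg that by (simp add: S_def)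
    have bd: "bdd_below S" unfolding S_def by (rule bdd_below_Int1) simp
    have zS: "z \<in> S" unfolding z_def using ne by (intro closed_contains_Inf bd cl) auto
    hence z: "0 \<le> z" "z \<le> y" "u z \<le> 0" by (auto simp: S_def)
    have z0: "0 < z" using z u0 by (cases "z = 0") auto
    have before: "u t > 0" if "0 \<le> t" "t < z" for t
    proof (rule ccontr)
      assume "\<not> u t > 0"
      hence "t \<in> S" using that z by (simp add: S_def)
      hence "z \<le> t" unfolding z_def using bd by (rule cInf_lower)
      thus False using that by simp
    qed
    have clo: "closure {0..<z} = {0..z}" using z0 by (rule closure_atLeastLessThan)
    have "u z - P z = 0"
    proof (rule continuous_constant_on_closure[where S = "{0..<z}" and f = "\<lambda>t. u t - P t"])
      show "continuous_on (closure {0..<z}) (\<lambda>t. u t - P t)"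
        unfolding clo P_def
        by (intro continuous_on_diff u_continuous_Icc[OF uv] continuous_on_soliton_profile \<sigma>) simp
      show "z \<in> closure {0..<z}" unfolding clo using z0 by simp
      show "u t - P t = 0" if "t \<in> {0..<z}" for t
        using formula[of t] before that by simp
    qed
    thus False using z(3) soliton_profile_pos[OF \<sigma>, of "artanh (sin (phase (tail u 0) (u 0)))" z]
      unfolding P_def by linarith
  qed
  show ?thesis using formula[OF x] pos by (simp add: P_def)
qed

end

lemma branch_function_minus:
  assumes "branch_function u g"
  shows "branch_function (\<lambda>x. - u x) (\<lambda>x. - g x)"
proof -
  have i: "set_integrable lborel {x..y} g" if "0 \<le> x" for x y
    using ac_derivD(1)[OF u_ac[OF assms] that] .
  have "- u y - - u x = (LINT t:{x..y}|lborel. - g t)" if "0 \<le> x" "x \<le> y" for x y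
    using ac_derivD(2)[OF u_ac[OF assms] that] set_integral_uminus[OF i[OF that(1)], of y] by simp
  moreover have "set_integrable lborel {0..b} (\<lambda>x. - g x)" for b
    using set_integrable_mult_right[of "-1" lborel "{0..b}" g] i[OF order_refl, of b] by simp
  ultimately have "ac_deriv (\<lambda>x. - u x) (\<lambda>x. - g x)" unfolding ac_deriv_def by blast
  thus ?thesis using u_continuous[OF assms] u_L2[OF assms] g_L2[OF assms]
    unfolding branch_function_def L2_halfline_def set_borel_measurable_def
    by (auto intro!: continuous_on_minus)
qed

lemma tail_minus: "tail (\<lambda>x. - u x) = tail u" by (simp add: tail_def fun_eq_iff)

lemma half_energy_minus: "half_energy (\<lambda>x. - u x) (\<lambda>x. - g x) = half_energy u g"
  by (simp add: half_energy_def)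

text \<open>
  Unless its sign is reversed, an optimal function is positive somewhere and therefore a soliton from there to both sides. In
  particular it does not vanish at the vertex.
\<close>
lemma equality_case:
  assumes uv: "branch_function u g" and m0: "tail u 0 > 0"
    and opt: "half_energy u g \<le> branch_energy (tail u 0) (u 0)"
  shows "u 0 \<noteq> 0"
    and "0 \<le> x \<Longrightarrow> u x = sgn (u 0) * soliton_profile (wavenum (tail u 0) (u 0)) (artanh (sin (phase (tail u 0) (u 0)))) x"
proof -
  note uv' = branch_function_minus[OF uv]
  have m0': "tail (\<lambda>x. - u x) 0 > 0" using m0 by (simp add: tail_minus)
  have opt': "half_energy (\<lambda>x. - u x) (\<lambda>x. - g x) \<le> branch_energy (tail (\<lambda>x. - u x) 0) (- u 0)"
    using opt by (simp add: half_energy_minus tail_minus)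
  have "\<exists>x1\<ge>0. u x1 \<noteq> 0"
  proof (rule ccontr)
    assume "\<not> (\<exists>x1\<ge>0. u x1 \<noteq> 0)"
    hence z: "indicator {0..} t *\<^sub>R (u t)\<^sup>2 = 0" for t by (auto simp: indicator_def)
    have "tail u 0 = 0" unfolding tail_def set_lebesgue_integral_def z by simp
    thus False using m0 by simp
  qed
  then obtain x1 where x1: "x1 \<ge> 0" "u x1 \<noteq> 0" by blast
  show nz: "u 0 \<noteq> 0"
  proof (cases "u x1 > 0")
    case True
    thus ?thesis using optimal_pos_backwards[OF uv m0 opt x1(1)] by simp
  next
    case False
    thus ?thesis using optimal_pos_backwards[OF uv' m0' opt' x1(1)] x1 by simp
  qed
  assume x: "0 \<le> x"
  show "u x = sgn (u 0) * soliton_profile (wavenum (tail u 0) (u 0)) (artanh (sin (phase (tail u 0) (u 0)))) x"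
  proof (cases "u 0 > 0")
    case True
    thus ?thesis using optimal_is_profile[OF uv m0 opt True x] by simp
  next
    case False
    hence n: "- u 0 > 0" using nz by simp
    show ?thesis using optimal_is_profile[OF uv' m0' opt' n x] n by (simp add: tail_minus)
  qed
qed

lemma soliton_profile_decreasing:
  assumes \<sigma>: "\<sigma> > 0" and \<xi>: "\<xi> \<ge> 0" and xy: "0 \<le> x" "x < y"
  shows "soliton_profile \<sigma> \<xi> y < soliton_profile \<sigma> \<xi> x"
proof -
  have "\<xi> + \<sigma> * x / al < \<xi> + \<sigma> * y / al" using \<sigma> xy al_pos by (simp add: divide_strict_right_mono)
  moreover have "0 \<le> \<xi> + \<sigma> * x / al" using \<sigma> \<xi> xy al_pos by simp
  ultimately have "cosh (\<xi> + \<sigma> * x / al) < cosh (\<xi> + \<sigma> * y / al)" by (subst cosh_real_nonneg_less_iff) auto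
  hence "\<sigma> / cosh (\<xi> + \<sigma> * y / al) < \<sigma> / cosh (\<xi> + \<sigma> * x / al)"
    using \<sigma> by (intro divide_strict_left_mono) (auto simp: cosh_real_pos)
  hence "(\<sigma> / cosh (\<xi> + \<sigma> * y / al)) powr al < (\<sigma> / cosh (\<xi> + \<sigma> * x / al)) powr al"
    using \<sigma> al_pos by (intro powr_less_mono2) auto
  thus ?thesis using amp_pos by (simp add: soliton_profile_def)
qed

lemma artanh_pos: "0 < s \<Longrightarrow> s < 1 \<Longrightarrow> artanh (s::real) > 0"
  by (simp add: artanh_def field_simps)

end

section \<open>Ground states on the star graph\<close>

text \<open>
  Integration by parts on an interval containing the support of the test function.
\<close>
lemma C1_imp_is_weak_deriv:
  assumes f: "\<And>x. (f has_real_derivative g x) (at x)" and g: "continuous_on UNIV g"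
  shows "is_weak_deriv f g"
  unfolding is_weak_deriv_def
proof (intro allI impI)
  fix \<phi> assume "test_function \<phi>"
  then obtain D a b where D: "\<And>x. (\<phi> has_real_derivative D x) (at x)" and cD: "continuous_on UNIV D"
    and ab: "0 < a" "a \<le> b" and supp: "\<And>x. x \<notin> {a..b} \<Longrightarrow> \<phi> x = 0"
    unfolding test_function_def C1_differentiable_on_def has_real_derivative_iff_has_vector_derivative
    by auto
  have dD: "deriv \<phi> x = D x" for x using D by (rule DERIV_imp_deriv)
  define c where "c = b + 1"
  have D0: "D x = 0" if "x > b" for x
  proof (rule DERIV_unique[OF D])
    show "(\<phi> has_real_derivative 0) (at x)"
      by (rule has_field_derivative_transform_within_open[of "\<lambda>_. 0" 0 x "{b<..}"])
         (use that supp in auto)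
  qed
  have cf: "continuous_on UNIV f"
    by (intro continuous_at_imp_continuous_on ballI DERIV_isCont[OF f])
  have c\<phi>: "continuous_on UNIV \<phi>"
    by (intro continuous_at_imp_continuous_on ballI DERIV_isCont[OF D])
  have i1: "set_integrable lborel {0..c} (\<lambda>x. f x * D x)" and i2: "set_integrable lborel {0..c} (\<lambda>x. g x * \<phi> x)"
    by (intro borel_integrable_atLeastAtMost' continuous_on_mult; rule continuous_on_subset[OF _ subset_UNIV], fact)+
  have "(\<integral>x. indicator {0..c} x *\<^sub>R (f x * D x + g x * \<phi> x) \<partial>lborel) = f c * \<phi> c - f 0 * \<phi> 0"
  proof (rule integral_FTC_atLeastAtMost)
    show "0 \<le> c" using ab by (simp add: c_def)
    show "((\<lambda>x. f x * \<phi> x) has_vector_derivative (f x * D x + g x * \<phi> x)) (at x within {0..c})" for x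
      unfolding has_real_derivative_iff_has_vector_derivative[symmetric]
      by (rule has_field_derivative_at_within, rule DERIV_cong[OF DERIV_mult[OF f D]]) simp
    show "continuous_on {0..c} (\<lambda>x. f x * D x + g x * \<phi> x)"
      by (intro continuous_on_add continuous_on_mult; rule continuous_on_subset[OF _ subset_UNIV], fact)
  qed
  also have "f c * \<phi> c - f 0 * \<phi> 0 = 0" using supp[of c] supp[of 0] ab by (simp add: c_def)
  finally have sum0: "(LINT x:{0..c}|lborel. f x * D x) + (LINT x:{0..c}|lborel. g x * \<phi> x) = 0"
    using set_integral_add(2)[OF i1 i2] by (simp add: set_lebesgue_integral_def)
  have e1: "indicator {0..} x *\<^sub>R (f x * D x) = indicator {0..c} x *\<^sub>R (f x * D x)" for x
    using D0[of x] by (auto simp: indicator_def c_def)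
  have e2: "indicator {0..} x *\<^sub>R (g x * \<phi> x) = indicator {0..c} x *\<^sub>R (g x * \<phi> x)" for x
    using supp[of x] by (auto simp: indicator_def c_def)
  show "(LINT x:{0..}|lborel. f x * deriv \<phi> x) = - (LINT x:{0..}|lborel. g x * \<phi> x)"
    using sum0 unfolding dD set_lebesgue_integral_def e1 e2 by linarith
qed

lemma H1_branch_function:
  assumes u: "continuous_on {0..} u" and h: "H1_halfline u"
  shows "branch_function u (weak_deriv u)"
proof -
  have ex: "\<exists>g. L2_halfline g \<and> is_weak_deriv u g" using h by (simp add: H1_halfline_def)
  from someI_ex[OF ex] have "L2_halfline (weak_deriv u)" "is_weak_deriv u (weak_deriv u)"
    unfolding weak_deriv_def by auto
  thus ?thesis using u h weak_deriv_imp_ac_deriv unfolding branch_function_def H1_halfline_def by blast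
qed

context subcritical
begin

lemma half_energy_cong:
  assumes "branch_function u g" "branch_function u h"
  shows "half_energy u g = half_energy u h"
  unfolding half_energy_def set_lebesgue_integral_def
proof (rule integral_cong_AE)
  show "(\<lambda>t. indicator {0..} t *\<^sub>R (1/2 * (g t)\<^sup>2 - 1/p * \<bar>u t\<bar> powr p)) \<in> borel_measurable lborel"
    using energy_density_integrable[OF assms(1)] unfolding set_integrable_def by (rule borel_measurable_integrable)
  show "(\<lambda>t. indicator {0..} t *\<^sub>R (1/2 * (h t)\<^sup>2 - 1/p * \<bar>u t\<bar> powr p)) \<in> borel_measurable lborel"
    using energy_density_integrable[OF assms(2)] unfolding set_integrable_def by (rule borel_measurable_integrable)
  show "AE t in lborel. indicator {0..} t *\<^sub>R (1/2 * (g t)\<^sup>2 - 1/p * \<bar>u t\<bar> powr p)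
      = indicator {0..} t *\<^sub>R (1/2 * (h t)\<^sup>2 - 1/p * \<bar>u t\<bar> powr p)"
    using ac_deriv_unique_AE[OF u_ac[OF assms(1)] u_ac[OF assms(2)]]
    by eventually_elim (auto simp: indicator_def)
qed

lemma half_energy_split:
  assumes uv: "branch_function u g"
  shows "half_energy u g = 1/2 * (LINT t:{0..}|lborel. (g t)\<^sup>2) - 1/p * (LINT t:{0..}|lborel. \<bar>u t\<bar> powr p)"
proof -
  have i: "set_integrable lborel {0..} (\<lambda>t. 1/2 * (g t)\<^sup>2)" "set_integrable lborel {0..} (\<lambda>t. 1/p * \<bar>u t\<bar> powr p)"
    using g_square[OF uv] powr_p_integrable[OF uv] by (auto intro!: set_integrable_mult_right)
  show ?thesis unfolding half_energy_def set_integral_diff(2)[OF i] by (simp only: set_integral_mult_right)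
qed

lemma profile_H1:
  assumes \<sigma>: "\<sigma> > 0"
  shows "H1_halfline (soliton_profile \<sigma> \<xi>)"
proof -
  have "is_weak_deriv (soliton_profile \<sigma> \<xi>) (profile_slope \<sigma> \<xi>)"
    using soliton_profile_deriv[OF \<sigma>] continuous_on_profile_slope[OF \<sigma>]
    by (intro C1_imp_is_weak_deriv) (auto simp: profile_slope_def)
  thus ?thesis
    using u_L2[OF profile_branch_function[OF \<sigma>]] profile_slope_L2[OF \<sigma>] unfolding H1_halfline_def by blast
qed

lemma branch_energy_realised:
  assumes "m > 0" "a > 0"
  shows "\<exists>U. continuous_on {0..} U \<and> H1_halfline U \<and> U 0 = a \<and> tail U 0 = m \<and>
    half_energy U (weak_deriv U) = branch_energy m a"
proof -
  obtain \<sigma> \<xi> where \<sigma>: "\<sigma> > 0" and U: "soliton_profile \<sigma> \<xi> 0 = a" "tail (soliton_profile \<sigma> \<xi>) 0 = m"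
    "half_energy (soliton_profile \<sigma> \<xi>) (profile_slope \<sigma> \<xi>) = branch_energy m a"
    by (rule branch_energy_attained[OF assms])
  have c: "continuous_on {0..} (soliton_profile \<sigma> \<xi>)" by (rule continuous_on_soliton_profile[OF \<sigma>])
  note h = profile_H1[OF \<sigma>, of \<xi>]
  show ?thesis
    using U c h half_energy_cong[OF H1_branch_function[OF c h] profile_branch_function[OF \<sigma>]]
    by (intro exI[of _ "soliton_profile \<sigma> \<xi>"]) simp
qed

end

context star_graph
begin

lemma N_pos: "0 < N" using N_ge_3 by simp

lemma H1_star_branch:
  assumes "u \<in> H1_star N" "i < N"
  shows "branch_function (u i) (weak_deriv (u i))" and "u i 0 = u 0 0"
proof -
  have "star_continuous N u" "H1_halfline (u i)" using assms by (simp_all add: H1_star_def)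
  moreover from this(1) have "continuous_on {0..} (u i)" "u i 0 = u 0 0"
    using assms(2) N_pos unfolding star_continuous_def by blast+
  ultimately show "branch_function (u i) (weak_deriv (u i))" "u i 0 = u 0 0"
    by (blast intro: H1_branch_function)+
qed

lemma energy_eq:
  assumes u: "u \<in> H1_star N"
  shows "energy N p q u = (\<Sum>i<N. half_energy (u i) (weak_deriv (u i))) - \<bar>u 0 0\<bar> powr q / q"
proof -
  have "(\<Sum>i<N. half_energy (u i) (weak_deriv (u i)))
      = (\<Sum>i<N. 1/2 * (LINT t:{0..}|lborel. (weak_deriv (u i) t)\<^sup>2) - 1/p * (LINT t:{0..}|lborel. \<bar>u i t\<bar> powr p))"
    by (intro sum.cong refl half_energy_split H1_star_branch(1)[OF u]) simp
  thus ?thesis unfolding energy_def star_integral_def by (simp add: sum_subtractf sum_distrib_left)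
qed

lemma H1_star_mass_iff:
  "u \<in> H1_star_mass N \<mu> \<longleftrightarrow> u \<in> H1_star N \<and> (\<Sum>i<N. tail (u i) 0) = \<mu>"
  by (simp add: H1_star_mass_def star_integral_def tail_def)

lemma reduced_energy_realised:
  assumes adm: "admissible \<mu> m a"
  obtains v where "v \<in> H1_star_mass N \<mu>" "energy N p q v = reduced_energy m a"
proof -
  have a: "a > 0" and m: "\<And>i. i < N \<Longrightarrow> m i > 0" and sum: "(\<Sum>i<N. m i) = \<mu>"
    using adm by (auto simp: admissible_def)
  have "\<forall>i\<in>{..<N}. \<exists>U. continuous_on {0..} U \<and> H1_halfline U \<and> U 0 = a \<and> tail U 0 = m i \<and>
    half_energy U (weak_deriv U) = branch_energy (m i) a"
    using branch_energy_realised[OF m a] by blast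
  then obtain v where "\<forall>i\<in>{..<N}. continuous_on {0..} (v i) \<and> H1_halfline (v i) \<and> v i 0 = a \<and> tail (v i) 0 = m i \<and>
    half_energy (v i) (weak_deriv (v i)) = branch_energy (m i) a"
    by (rule bchoice[THEN exE])
  hence v: "continuous_on {0..} (v i)" "H1_halfline (v i)" "v i 0 = a" "tail (v i) 0 = m i"
    "half_energy (v i) (weak_deriv (v i)) = branch_energy (m i) a" if "i < N" for i using that by auto
  have H: "v \<in> H1_star N" unfolding H1_star_def star_continuous_def using v(1-3) by simp
  have "(\<Sum>i<N. tail (v i) 0) = \<mu>" unfolding sum[symmetric] by (rule sum.cong) (auto simp: v)
  hence "v \<in> H1_star_mass N \<mu>" using H by (simp add: H1_star_mass_iff)
  moreover have "(\<Sum>i<N. half_energy (v i) (weak_deriv (v i))) = (\<Sum>i<N. branch_energy (m i) a)"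
    by (rule sum.cong) (auto simp: v)
  hence "energy N p q v = reduced_energy m a"
    unfolding energy_eq[OF H] reduced_energy_def using v(3)[OF N_pos] a by simp
  ultimately show ?thesis by (rule that)
qed

text \<open>
  Each branch is replaced by the soliton piece with the same mass and value.
\<close>
lemma energy_ge_reduced_energy:
  assumes u: "u \<in> H1_star_mass N \<mu>" and nz: "u 0 0 \<noteq> 0"
  shows "admissible \<mu> (\<lambda>i. tail (u i) 0) \<bar>u 0 0\<bar>"
    and "i < N \<Longrightarrow> branch_energy (tail (u i) 0) \<bar>u 0 0\<bar> \<le> half_energy (u i) (weak_deriv (u i))"
    and "reduced_energy (\<lambda>i. tail (u i) 0) \<bar>u 0 0\<bar> \<le> energy N p q u"
proof -
  have H: "u \<in> H1_star N" and M: "(\<Sum>i<N. tail (u i) 0) = \<mu>" using u by (auto simp: H1_star_mass_iff)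
  have pos: "tail (u i) 0 > 0" if "i < N" for i
    using tail_pos_if_nonzero[OF H1_star_branch(1)[OF H that] order_refl] H1_star_branch(2)[OF H that] nz by simp
  have le: "branch_energy (tail (u i) 0) \<bar>u 0 0\<bar> \<le> half_energy (u i) (weak_deriv (u i))" if "i < N" for i
    using half_energy_ge_branch_energy[OF H1_star_branch(1)[OF H that] pos[OF that]] H1_star_branch(2)[OF H that] by simp
  show "admissible \<mu> (\<lambda>i. tail (u i) 0) \<bar>u 0 0\<bar>" using pos M nz by (simp add: admissible_def)
  show "i < N \<Longrightarrow> branch_energy (tail (u i) 0) \<bar>u 0 0\<bar> \<le> half_energy (u i) (weak_deriv (u i))" by (rule le)
  have "(\<Sum>i<N. branch_energy (tail (u i) 0) \<bar>u 0 0\<bar>) \<le> (\<Sum>i<N. half_energy (u i) (weak_deriv (u i)))"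
    by (rule sum_mono) (use le in simp)
  thus "reduced_energy (\<lambda>i. tail (u i) 0) \<bar>u 0 0\<bar> \<le> energy N p q u"
    unfolding energy_eq[OF H] reduced_energy_def by simp
qed

text \<open>
  The value function at value 0 is the energy of a soliton, and one soliton is better than several. Equality is
  impossible since a branch with positive mass that vanishes at the vertex is not optimal.
\<close>
lemma energy_gt_soliton_energy:
  assumes u: "u \<in> H1_star_mass N \<mu>" and z: "u 0 0 = 0" and \<mu>: "\<mu> > 0"
  shows "soliton_energy \<mu> < energy N p q u"
proof -
  have H: "u \<in> H1_star N" and M: "(\<Sum>i<N. tail (u i) 0) = \<mu>" using u by (auto simp: H1_star_mass_iff)
  note br = H1_star_branch(1)[OF H]
  have u0: "u i 0 = 0" if "i < N" for i using H1_star_branch(2)[OF H that] z by simp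
  have nn: "tail (u i) 0 \<ge> 0" if "i < N" for i using tail_nonneg[OF br[OF that]] .
  have gt: "soliton_energy (tail (u i) 0) < half_energy (u i) (weak_deriv (u i))"
    if "i < N" "tail (u i) 0 > 0" for i
    using equality_case(1)[OF br[OF that(1)] that(2)] u0[OF that(1)]
    by (auto simp: soliton_energy_def not_le[symmetric])
  have ge: "soliton_energy (tail (u i) 0) \<le> half_energy (u i) (weak_deriv (u i))" if "i < N" for i
  proof (cases "tail (u i) 0 = 0")
    case True
    thus ?thesis using half_energy_nonneg_if_zero(1)[OF br[OF that] True] by simp
  next
    case False
    thus ?thesis using gt[OF that] nn[OF that] by simp
  qed
  have "\<exists>i<N. tail (u i) 0 > 0"
  proof (rule ccontr)
    assume "\<not> (\<exists>i<N. tail (u i) 0 > 0)"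
    hence "(\<Sum>i<N. tail (u i) 0) \<le> 0" by (intro sum_nonpos) (meson lessThan_iff not_less)
    thus False using M \<mu> by simp
  qed
  then obtain k where k: "k < N" "tail (u k) 0 > 0" by blast
  have "soliton_energy \<mu> \<le> (\<Sum>i<N. soliton_energy (tail (u i) 0))"
    unfolding M[symmetric] by (rule soliton_energy_superadditive) (use nn in auto)
  also have "\<dots> < (\<Sum>i<N. half_energy (u i) (weak_deriv (u i)))"
    by (rule sum_strict_mono_ex1) (use ge gt[OF k] k in auto)
  also have "\<dots> = energy N p q u" unfolding energy_eq[OF H] z by simp
  finally show ?thesis .
qed

lemma ground_state_iff:
  "ground_state N p q \<mu> u \<longleftrightarrow> u \<in> H1_star_mass N \<mu> \<and> (\<forall>v\<in>H1_star_mass N \<mu>. energy N p q u \<le> energy N p q v)"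
proof
  assume g: "ground_state N p q \<mu> u"
  have "ereal (energy N p q u) \<le> ereal (energy N p q v)" if "v \<in> H1_star_mass N \<mu>" for v
    using g that unfolding ground_state_def by (auto intro: INF_lower)
  thus "u \<in> H1_star_mass N \<mu> \<and> (\<forall>v\<in>H1_star_mass N \<mu>. energy N p q u \<le> energy N p q v)"
    using g by (simp add: ground_state_def)
next
  assume "u \<in> H1_star_mass N \<mu> \<and> (\<forall>v\<in>H1_star_mass N \<mu>. energy N p q u \<le> energy N p q v)"
  thus "ground_state N p q \<mu> u"
    unfolding ground_state_def by (auto intro!: antisym INF_greatest INF_lower)
qed

text \<open>
  A function vanishing at the vertex lies strictly above the level of the soliton, which competitors come
  arbitrarily close to.
\<close>
lemma ground_state_minimiser:
  assumes g: "ground_state N p q \<mu> u" and \<mu>: "\<mu> > 0"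
  shows "u 0 0 \<noteq> 0" and "minimiser \<mu> (\<lambda>i. tail (u i) 0) \<bar>u 0 0\<bar>"
    and "energy N p q u = reduced_energy (\<lambda>i. tail (u i) 0) \<bar>u 0 0\<bar>"
proof -
  have u: "u \<in> H1_star_mass N \<mu>" and le: "\<And>v. v \<in> H1_star_mass N \<mu> \<Longrightarrow> energy N p q u \<le> energy N p q v"
    using g by (auto simp: ground_state_iff)
  have le': "energy N p q u \<le> reduced_energy m a" if adm: "admissible \<mu> m a" for m a
  proof -
    obtain v where "v \<in> H1_star_mass N \<mu>" "energy N p q v = reduced_energy m a"
      by (rule reduced_energy_realised[OF adm])
    thus ?thesis using le by fastforce
  qed
  show nz: "u 0 0 \<noteq> 0"
  proof
    assume z: "u 0 0 = 0"
    define \<epsilon> where "\<epsilon> = energy N p q u - soliton_energy \<mu>"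
    have "\<epsilon> > 0" using energy_gt_soliton_energy[OF u z \<mu>] by (simp add: \<epsilon>_def)
    then obtain m a where "admissible \<mu> m a" "reduced_energy m a < soliton_energy \<mu> + \<epsilon>"
      using runaway[OF \<mu>] by blast
    thus False using le'[of m a] by (simp add: \<epsilon>_def)
  qed
  note lower = energy_ge_reduced_energy[OF u nz]
  show "minimiser \<mu> (\<lambda>i. tail (u i) 0) \<bar>u 0 0\<bar>"
    unfolding minimiser_def using lower(1) order_trans[OF lower(3) le'] by blast
  show "energy N p q u = reduced_energy (\<lambda>i. tail (u i) 0) \<bar>u 0 0\<bar>"
    by (rule antisym[OF le'[OF lower(1)] lower(3)])
qed

definition ground_profile :: "real \<Rightarrow> real \<Rightarrow> real \<Rightarrow> real" where
  "ground_profile \<mu> a =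
     soliton_profile (wavenum (\<mu> / real N) a) (artanh (sin (phase (\<mu> / real N) a)))"

text \<open>
  The sums of the energies over the branches agree with the sums of the lower bounds, so that equality holds on each
  branch.
\<close>
lemma ground_state_profile:
  assumes g: "ground_state N p q \<mu> u" and \<mu>: "\<mu> > 0" and i: "i < N" and x: "0 \<le> x"
  shows "u i x = sgn (u 0 0) * ground_profile \<mu> \<bar>u 0 0\<bar> x"
proof -
  note min = ground_state_minimiser[OF g \<mu>]
  have u: "u \<in> H1_star_mass N \<mu>" using g by (simp add: ground_state_iff)
  hence H: "u \<in> H1_star N" by (simp add: H1_star_mass_iff)
  note le = energy_ge_reduced_energy(2)[OF u min(1)]
  have "half_energy (u i) (weak_deriv (u i)) \<le> branch_energy (tail (u i) 0) \<bar>u 0 0\<bar>"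
  proof (rule ccontr)
    assume "\<not> ?thesis"
    hence "(\<Sum>i<N. branch_energy (tail (u i) 0) \<bar>u 0 0\<bar>) < (\<Sum>i<N. half_energy (u i) (weak_deriv (u i)))"
      by (intro sum_strict_mono_ex1) (use le i in \<open>auto simp: not_le\<close>)
    thus False using min(3) unfolding energy_eq[OF H] reduced_energy_def by simp
  qed
  hence opt: "half_energy (u i) (weak_deriv (u i)) \<le> branch_energy (tail (u i) 0) (u i 0)"
    unfolding H1_star_branch(2)[OF H i] branch_energy_abs .
  have pos: "tail (u i) 0 > 0" by (rule minimiser_pos[OF min(2) i])
  have t: "tail (u i) 0 = \<mu> / real N" by (rule minimiser_symmetric(1)[OF min(2) i])
  show ?thesis
    using equality_case(2)[OF H1_star_branch(1)[OF H i] pos opt x]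
    unfolding t H1_star_branch(2)[OF H i] ground_profile_def wavenum_abs phase_abs .
qed

lemma ground_profile_decreasing:
  assumes min: "minimiser \<mu> m a" and xy: "0 \<le> x" "x < y"
  shows "ground_profile \<mu> a y < ground_profile \<mu> a x"
proof -
  have M: "\<mu> / real N > 0" using minimiser_pos[OF min N_pos] minimiser_symmetric(1)[OF min N_pos] by simp
  have ph: "phase (\<mu> / real N) a > 0" by (rule minimiser_symmetric(2)[OF min])
  have s: "sin (phase (\<mu> / real N) a) > 0" using sin_phase_pos_iff[OF M] ph by blast
  have c: "cos (phase (\<mu> / real N) a) > 0" by (rule cos_phase_pos[OF M]) (use minimiser_value_pos[OF min] in simp)
  have "(sin (phase (\<mu> / real N) a))\<^sup>2 < 1" using c by (simp add: sin_squared_eq)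
  hence "sin (phase (\<mu> / real N) a) < 1" using s by (simp add: abs_square_less_1)
  with s have "artanh (sin (phase (\<mu> / real N) a)) > 0" by (rule artanh_pos)
  thus ?thesis unfolding ground_profile_def
    by (intro soliton_profile_decreasing[OF wavenum_pos[OF M] _ xy]) simp
qed

lemma ground_state_exists_iff:
  assumes \<mu>: "\<mu> > 0"
  shows "(\<exists>u. ground_state N p q \<mu> u) \<longleftrightarrow> (\<exists>a>0. symmetric_energy \<mu> a \<le> soliton_energy \<mu>)"
proof -
  have "\<exists>u. ground_state N p q \<mu> u" if min: "minimiser \<mu> m a" for m a
  proof -
    have adm: "admissible \<mu> m a" using min by (simp add: minimiser_def)
    obtain v where v: "v \<in> H1_star_mass N \<mu>" "energy N p q v = reduced_energy m a"
      by (rule reduced_energy_realised[OF adm])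
    have "energy N p q v \<le> energy N p q w" if w: "w \<in> H1_star_mass N \<mu>" for w
    proof (cases "w 0 0 = 0")
      case True
      thus ?thesis using energy_gt_soliton_energy[OF w True \<mu>] minimiser_le_soliton[OF min \<mu>] v(2) by simp
    next
      case False
      note l = energy_ge_reduced_energy[OF w False]
      have "reduced_energy m a \<le> reduced_energy (\<lambda>i. tail (w i) 0) \<bar>w 0 0\<bar>"
        using min l(1) by (simp add: minimiser_def)
      thus ?thesis using l(3) v(2) by simp
    qed
    thus ?thesis using v(1) ground_state_iff by blast
  qed
  hence "(\<exists>u. ground_state N p q \<mu> u) \<longleftrightarrow> (\<exists>m a. minimiser \<mu> m a)"
    using ground_state_minimiser(2)[OF _ \<mu>] by blast
  thus ?thesis unfolding minimiser_iff[OF \<mu>] .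
qed

lemma ground_state_unique:
  assumes \<mu>: "\<mu> > 0" and u: "ground_state N p q \<mu> u" and v: "ground_state N p q \<mu> v"
  shows "eq_up_to_sign N u v"
proof -
  note mu = ground_state_minimiser[OF u \<mu>] and mv = ground_state_minimiser[OF v \<mu>]
  have ab: "\<bar>u 0 0\<bar> = \<bar>v 0 0\<bar>" by (rule minimiser_value_unique[OF mu(2) mv(2)])
  define s where "s = sgn (u 0 0) * sgn (v 0 0)"
  have s: "s \<in> {1, -1}" using mu(1) mv(1) by (auto simp: s_def sgn_if)
  have "v i x = s * u i x" if "i < N" "x \<ge> 0" for i x
    using ground_state_profile[OF u \<mu> that] ground_state_profile[OF v \<mu> that] mu(1)
    by (simp add: ab s_def sgn_if)
  thus ?thesis unfolding eq_up_to_sign_def using s by blast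
qed

lemma ground_state_radial_decreasing:
  assumes \<mu>: "\<mu> > 0" and u: "ground_state N p q \<mu> u"
  shows "\<exists>s\<in>{1, -1}. radial_decreasing N (\<lambda>i x. s * u i x)"
proof -
  note mu = ground_state_minimiser[OF u \<mu>]
  define s where "s = sgn (u 0 0)"
  have s: "s \<in> {1, -1}" using mu(1) by (auto simp: s_def sgn_if)
  have "s * u i x = ground_profile \<mu> \<bar>u 0 0\<bar> x" if "i < N" "x \<ge> 0" for i x
    using ground_state_profile[OF u \<mu> that] mu(1) by (simp add: s_def sgn_if)
  hence "radial_decreasing N (\<lambda>i x. s * u i x)"
    unfolding radial_decreasing_def using ground_profile_decreasing[OF mu(2)] by blast
  thus ?thesis using s by blast
qed

end

theorem theorem1p1:
  fixes N :: nat and p q :: real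
  assumes "N \<ge> 3"
    and "2 < p" "p < 6"
    and "2 < q" "q < 4"
    and "q \<noteq> p / 2 + 1"
  shows "(\<exists>\<mu>c>0.
      (q < p / 2 + 1 \<longrightarrow> (\<forall>\<mu>>0. (\<exists>u. ground_state N p q \<mu> u) \<longleftrightarrow> \<mu> \<le> \<mu>c)) \<and>
      (q > p / 2 + 1 \<longrightarrow> (\<forall>\<mu>>0. (\<exists>u. ground_state N p q \<mu> u) \<longleftrightarrow> \<mu> \<ge> \<mu>c))) \<and>
    (\<forall>\<mu>>0.
      (\<forall>u v. ground_state N p q \<mu> u \<longrightarrow> ground_state N p q \<mu> v \<longrightarrow> eq_up_to_sign N u v) \<and>
      (\<forall>u. ground_state N p q \<mu> u \<longrightarrow>
        (\<exists>s\<in>{1, -1}. radial_decreasing N (\<lambda>i x. s * u i x))))"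
proof -
  interpret star_graph p q N by unfold_locales (use assms in auto)
  obtain \<mu>c where c: "\<mu>c > 0"
    "\<And>\<mu>. q < p / 2 + 1 \<Longrightarrow> \<mu> > 0 \<Longrightarrow> (\<exists>a>0. symmetric_energy \<mu> a \<le> soliton_energy \<mu>) \<longleftrightarrow> \<mu> \<le> \<mu>c"
    "\<And>\<mu>. q > p / 2 + 1 \<Longrightarrow> \<mu> > 0 \<Longrightarrow> (\<exists>a>0. symmetric_energy \<mu> a \<le> soliton_energy \<mu>) \<longleftrightarrow> \<mu> \<ge> \<mu>c"
    by (rule threshold[OF assms(6)]) blast
  have "\<exists>\<mu>c>0.
      (q < p / 2 + 1 \<longrightarrow> (\<forall>\<mu>>0. (\<exists>u. ground_state N p q \<mu> u) \<longleftrightarrow> \<mu> \<le> \<mu>c)) \<and>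
      (q > p / 2 + 1 \<longrightarrow> (\<forall>\<mu>>0. (\<exists>u. ground_state N p q \<mu> u) \<longleftrightarrow> \<mu> \<ge> \<mu>c))"
    using c ground_state_exists_iff by (intro exI[of _ \<mu>c]) simp
  thus ?thesis using ground_state_unique ground_state_radial_decreasing by blast
qed

end
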